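(* Let $X(T,\{\mathcal{F}_v\})$ and $X(T',\{\mathcal{F}'_v\})$ be clusters, with $\mathcal{F}_v=\{\gamma_{v,e}\}_{e\ni v}$ a family of geodesics in $Z_v$ for each vertex $v$ of $T$ and $\mathcal{F}'_v=\{\gamma'_{v,e}\}_{e\ni v}$ a family of geodesics in $Z'_v$ for each vertex $v$ of $T'$. Suppose that for each vertex $v$ of $T$ the pair $(Z_v,\{\gamma_{v,e}\})$ is a marked tree, and that for each vertex $v$ of $T'$ the pair $(Z'_v,\{\gamma'_{v,e}\})$ is a marked tree. Then $X(T,\{\mathcal{F}_v\})$ and $X(T',\{\mathcal{F}'_v\})$ are isometric.
   Context: Asymptotic cones. A non-principal ultrafilter on $\mathbb{N}$ is a finitely additive $\{0,1\}$-valued probability measure $\omega$ on the power set of $\mathbb{N}$ vanishing on finite sets; $\omega\text{-}\lim s_n$ is the unique $s\in[-\infty,+\infty]$ with $\omega(\{n:s_n\in U\})=1$ for each neighborhood $U$ of $s$. Given a metric space $X$, a scaling factor $r=(r_n)$ of positive reals with $\omega\text{-}\lim r_n=+\infty$, and a basepoint $x=(x_n)\in X^{\mathbb{N}}$, the asymptotic cone $Cone_\omega(X,x,r)$ is the set of $(y_n)\in X^{\mathbb{N}}$ with $\omega\text{-}\lim d(x_n,y_n)/r_n<\infty$, modulo $(y_n)\sim(z_n)\iff\omega\text{-}\lim d(y_n,z_n)/r_n=0$, with metric $d([(y_n)],[(z_n)])=\omega\text{-}\lim d(y_n,z_n)/r_n$. For subsets $A_n\subseteq X$, $\omega\text{-}\lim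 A_n=\{[(y_n)]\in Cone_\omega(X,x,r):y_n\in A_n\}$. Relative hyperbolicity. A complete geodesic metric space $X$ is tree-graded with respect to a collection $\mathcal{P}$ of closed geodesic subsets (pieces) covering $X$ if any two different pieces intersect in at most one point, and every simple geodesic triangle in $X$ is contained in one piece. A metric space $X$ is asymptotically tree-graded with respect to a collection $\mathcal{A}$ of subsets if each asymptotic cone of $X$ is tree-graded with respect to the set of non-empty sets of the form $\omega\text{-}\lim A_n$, $(A_n)\in\mathcal{A}^{\mathbb{N}}$, and also $\omega\text{-}\lim A_n\neq\omega\text{-}\lim A'_n$ if both are non-empty and $\omega(\{n:A_n\ne A'_n\})=1$. A finitely generated group $G$ is hyperbolic relative to subgroups $H_1,\dots,H_n$ if (a Cayley graph of) $G$ is asymptotically tree-graded with respect to $\{gH_i\}_{g\in G,\,i=1,\dots,n}$. Marked trees. Let $F_k$ be a free group of rank $k\ge 2$ and $H_1,\dots,H_n$ ($n\ge1$) infinite cyclic subgroups such that $F_k$ is hyperbolic relative to $H_1,\dots,H_n$. A marked tree is a real tree isometric to an asymptotic cone of $F_k$ (with respect to a free generating set), endowed with the corresponding standard tree-graded structure, i.e. the one whose pieces are the non-empty ultralimits of sequences of left cosets of the $H_i$. Saying that $(Z_v,\{\gamma_{v,e}\})$ is a marked tree means that there is such an isometry under which the images of the geodesics $\gamma_{v,e}$ correspond exactly to the pieces, with different edges $e$ corresponding to different pieces. Clusters. Let $Z$ be the (unique up to isometry) complete homogeneous real tree with valency $2^{\aleph_0}$ at each point. Let $T$ be a (non-empty)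 simplicial tree. For each vertex $v$ of $T$ let $Z_v$ be a copy of $Z$, let $Q_v=Z_v\times\mathbb{R}$, and let $\mathcal{F}_v=\{\gamma_{v,e}\}$ be a collection of bi-infinite (arc-length parametrized) geodesics in $Z_v$ indexed by the edges $e$ of $T$ containing $v$. Let $\sim$ be the equivalence relation on the disjoint union $\bigcup_v Q_v$ generated by $(\gamma_{v,e}(t),u)\sim(\gamma_{v',e}(u),t)$ for all edges $e$ with endpoints $v,v'$ and all $t,u\in\mathbb{R}$. Let $\hat X(T,\{\mathcal{F}_v\})$ be $\bigcup_v Q_v/_\sim$ with the natural path metric. The cluster $X(T,\{\mathcal{F}_v\})$ is the metric completion of $\hat X(T,\{\mathcal{F}_v\})$. *)

theory Defs
  imports "HOL-Analysis.Analysis" "HOL-Algebra.Generated_Groups"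
begin

section \<open>Metric spaces\<close>

definition isometry :: "'a metric \<Rightarrow> 'b metric \<Rightarrow> ('a \<Rightarrow> 'b) \<Rightarrow> bool" where
  "isometry X Y f \<longleftrightarrow> bij_betw f (mspace X) (mspace Y) \<and>
     (\<forall>x\<in>mspace X. \<forall>y\<in>mspace X. mdist Y (f x) (f y) = mdist X x y)"

definition isometric :: "'a metric \<Rightarrow> 'b metric \<Rightarrow> bool" where
  "isometric X Y \<longleftrightarrow> (\<exists>f. isometry X Y f)"

definition geodesic_segment :: "'a metric \<Rightarrow> 'a \<Rightarrow> 'a \<Rightarrow> 'a set \<Rightarrow> bool" where
  "geodesic_segment X x y A \<longleftrightarrow>
     (\<exists>g L. 0 \<le> L \<and> g 0 = x \<and> g L = y \<and> g ` {0..L} \<subseteq> mspace X \<and>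
        (\<forall>s\<in>{0..L}. \<forall>t\<in>{0..L}. mdist X (g s) (g t) = \<bar>s - t\<bar>) \<and> A = g ` {0..L})"

definition geodesic_subset :: "'a metric \<Rightarrow> 'a set \<Rightarrow> bool" where
  "geodesic_subset X A \<longleftrightarrow> A \<subseteq> mspace X \<and>
     (\<forall>x\<in>A. \<forall>y\<in>A. \<exists>B\<subseteq>A. geodesic_segment X x y B)"

definition geodesic_space :: "'a metric \<Rightarrow> bool" where
  "geodesic_space X \<longleftrightarrow> geodesic_subset X (mspace X)"

definition bi_infinite_geodesic :: "'a metric \<Rightarrow> (real \<Rightarrow> 'a) \<Rightarrow> bool" where
  "bi_infinite_geodesic X g \<longleftrightarrow> range g \<subseteq> mspace X \<and> (\<forall>s t. mdist X (g s) (g t) = \<bar>s - t\<bar>)"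

definition real_tree :: "'a metric \<Rightarrow> bool" where
  "real_tree X \<longleftrightarrow> mspace X \<noteq> {} \<and> geodesic_space X \<and>
     (\<forall>g h. pathin (mtopology_of X) g \<and> inj_on g {0..1} \<and>
            pathin (mtopology_of X) h \<and> inj_on h {0..1} \<and> g 0 = h 0 \<and> g 1 = h 1
        \<longrightarrow> g ` {0..1} = h ` {0..1})"

definition homogeneous :: "'a metric \<Rightarrow> bool" where
  "homogeneous X \<longleftrightarrow> (\<forall>x\<in>mspace X. \<forall>y\<in>mspace X. \<exists>f. isometry X X f \<and> f x = y)"

text \<open>
  The valency of a real tree at a point is the number of components of the complement of the
  point. There is exactly one isometry class of spaces with the following property, so that it
  says that \<open>X\<close> is a copy of the homogeneous tree of valency continuum.
\<close>

definition continuum_tree :: "'a metric \<Rightarrow> bool" where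
  "continuum_tree X \<longleftrightarrow> real_tree X \<and> mcomplete_of X \<and> homogeneous X \<and>
     (\<forall>x\<in>mspace X. connected_components_of (subtopology (mtopology_of X) (mspace X - {x}))
                      \<approx> (UNIV :: real set))"

text \<open>
  Asymptotic cones and metric completions are both sets of sequences with a pseudometric, in which
  points at distance zero are identified. The value zero outside the carrier is there only
  because the type of metrics requires symmetry and nonnegativity for all arguments.
\<close>

definition zero_rel :: "'a set \<Rightarrow> ('a \<Rightarrow> 'a \<Rightarrow> real) \<Rightarrow> ('a \<times> 'a) set" where
  "zero_rel S D = {(x, y). x \<in> S \<and> y \<in> S \<and> D x y = 0}"

definition metric_quotient :: "'a set \<Rightarrow> ('a \<Rightarrow> 'a \<Rightarrow> real) \<Rightarrow> 'a set metric" where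
  "metric_quotient S D = metric (S // zero_rel S D,
     \<lambda>p q. if p \<in> S // zero_rel S D \<and> q \<in> S // zero_rel S D
           then D (SOME x. x \<in> p) (SOME y. y \<in> q) else 0)"

definition pseudometric_on :: "'a set \<Rightarrow> ('a \<Rightarrow> 'a \<Rightarrow> real) \<Rightarrow> bool" where
  "pseudometric_on S D \<longleftrightarrow> (\<forall>x\<in>S. \<forall>y\<in>S. 0 \<le> D x y \<and> D x y = D y x) \<and> (\<forall>x\<in>S. D x x = 0) \<and>
     (\<forall>x\<in>S. \<forall>y\<in>S. \<forall>z\<in>S. D x z \<le> D x y + D y z)"

lemma pseudometric_onI:
  assumes "\<And>x y. x \<in> S \<Longrightarrow> y \<in> S \<Longrightarrow> 0 \<le> D x y"
    and "\<And>x y. x \<in> S \<Longrightarrow> y \<in> S \<Longrightarrow> D x y = D y x"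
    and "\<And>x. x \<in> S \<Longrightarrow> D x x = 0"
    and "\<And>x y z. x \<in> S \<Longrightarrow> y \<in> S \<Longrightarrow> z \<in> S \<Longrightarrow> D x z \<le> D x y + D y z"
  shows "pseudometric_on S D"
  using assms unfolding pseudometric_on_def by blast

lemma pseudometric_onD:
  assumes "pseudometric_on S D"
  shows "x \<in> S \<Longrightarrow> y \<in> S \<Longrightarrow> 0 \<le> D x y" "x \<in> S \<Longrightarrow> y \<in> S \<Longrightarrow> D x y = D y x"
    "x \<in> S \<Longrightarrow> D x x = 0" "x \<in> S \<Longrightarrow> y \<in> S \<Longrightarrow> z \<in> S \<Longrightarrow> D x z \<le> D x y + D y z"
  using assms unfolding pseudometric_on_def by blast+

lemma equiv_zero_rel:
  assumes "pseudometric_on S D"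
  shows "equiv S (zero_rel S D)"
proof (rule equivI)
  show "zero_rel S D \<subseteq> S \<times> S" by (auto simp: zero_rel_def)
  show "refl_on S (zero_rel S D)"
    using pseudometric_onD[OF assms] by (auto simp: refl_on_def zero_rel_def)
  show "sym (zero_rel S D)"
    using pseudometric_onD(2)[OF assms] by (auto simp: sym_def zero_rel_def)
  show "trans (zero_rel S D)"
  proof (rule transI)
    fix x y z assume "(x, y) \<in> zero_rel S D" "(y, z) \<in> zero_rel S D"
    then have *: "x \<in> S" "y \<in> S" "z \<in> S" "D x y = 0" "D y z = 0" by (auto simp: zero_rel_def)
    then have "D x z \<le> 0" using pseudometric_onD(4)[OF assms, of x y z] by simp
    then show "(x, z) \<in> zero_rel S D"
      using * pseudometric_onD(1)[OF assms, of x z] by (auto simp: zero_rel_def)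
  qed
qed

lemma some_in_quotient:
  assumes "equiv S R" "p \<in> S // R"
  shows "(SOME x. x \<in> p) \<in> S" "(SOME x. x \<in> p) \<in> p" "p = R `` {SOME x. x \<in> p}"
proof -
  from assms obtain a where a: "a \<in> S" "p = R `` {a}" by (auto elim: quotientE)
  then have "a \<in> p" using equiv_class_self[OF assms(1)] by blast
  then show 1: "(SOME x. x \<in> p) \<in> p" by (rule someI)
  then show "(SOME x. x \<in> p) \<in> S" using a assms
    by (meson Union_quotient UnionI assms(1) assms(2) in_quotient_imp_subset subsetD)
  show "p = R `` {SOME x. x \<in> p}" using 1 a assms
    by (metis Image_singleton_iff equiv_class_eq)
qed

lemma Metric_space_quotient:
  assumes "pseudometric_on S D"
  shows "Metric_space (S // zero_rel S D)
     (\<lambda>p q. if p \<in> S // zero_rel S D \<and> q \<in> S // zero_rel S D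
           then D (SOME x. x \<in> p) (SOME y. y \<in> q) else 0)"
    (is "Metric_space ?M ?d")
proof
  note E = equiv_zero_rel[OF assms]
  note P = pseudometric_onD[OF assms]
  note Q = some_in_quotient[OF E]
  fix x y z
  show "0 \<le> ?d x y" using P(1) Q(1) by auto
  show "?d x y = ?d y x" using P(2) Q(1) by auto
  show "?d x z \<le> ?d x y + ?d y z" if "x \<in> ?M" "y \<in> ?M" "z \<in> ?M"
    using that P(4) Q(1) by auto
  show "?d x y = 0 \<longleftrightarrow> x = y" if "x \<in> ?M" "y \<in> ?M"
  proof
    assume "?d x y = 0"
    then have "((SOME a. a \<in> x), (SOME a. a \<in> y)) \<in> zero_rel S D"
      using that Q(1) by (auto simp: zero_rel_def)
    then show "x = y" using equiv_class_eq[OF E] Q(3) that by metis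
  qed (use that P(3) Q(1) in auto)
qed

lemma mspace_metric_quotient:
  "pseudometric_on S D \<Longrightarrow> mspace (metric_quotient S D) = S // zero_rel S D"
  unfolding metric_quotient_def by (rule Metric_space.mspace_metric[OF Metric_space_quotient])

lemma mdist_metric_quotient:
  assumes "pseudometric_on S D" "x \<in> S" "y \<in> S"
  shows "mdist (metric_quotient S D) (zero_rel S D `` {x}) (zero_rel S D `` {y}) = D x y"
proof -
  note E = equiv_zero_rel[OF assms(1)]
  note P = pseudometric_onD[OF assms(1)]
  let ?p = "zero_rel S D `` {x}" and ?q = "zero_rel S D `` {y}"
  have pq: "?p \<in> S // zero_rel S D" "?q \<in> S // zero_rel S D" using assms by (auto intro: quotientI)
  define a b where "a = (SOME a. a \<in> ?p)" and "b = (SOME b. b \<in> ?q)"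
  have "a \<in> ?p" "b \<in> ?q" using some_in_quotient(2)[OF E] pq unfolding a_def b_def by blast+
  then have ab: "a \<in> S" "b \<in> S" "D x a = 0" "D y b = 0" by (auto simp: zero_rel_def)
  have "D a b = D x y"
    using ab assms P(4)[of a x b] P(4)[of x y b] P(4)[of x a y] P(4)[of a b y]
      P(2)[of a x] P(2)[of b y] by auto
  then show ?thesis using pq
    unfolding metric_quotient_def Metric_space.mdist_metric[OF Metric_space_quotient[OF assms(1)]]
    by (simp add: a_def b_def)
qed

definition cauchy_seqs :: "'a set \<Rightarrow> ('a \<Rightarrow> 'a \<Rightarrow> real) \<Rightarrow> (nat \<Rightarrow> 'a) set" where
  "cauchy_seqs M d = {s. range s \<subseteq> M \<and> (\<forall>\<epsilon>>0. \<exists>N. \<forall>m\<ge>N. \<forall>n\<ge>N. d (s m) (s n) < \<epsilon>)}"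

definition completion :: "'a set \<Rightarrow> ('a \<Rightarrow> 'a \<Rightarrow> real) \<Rightarrow> (nat \<Rightarrow> 'a) set metric" where
  "completion M d = metric_quotient (cauchy_seqs M d) (\<lambda>s t. lim (\<lambda>n. d (s n) (t n)))"

lemma cauchy_seqs_dist_tendsto:
  assumes "pseudometric_on M d" "s \<in> cauchy_seqs M d" "t \<in> cauchy_seqs M d"
  shows "(\<lambda>n. d (s n) (t n)) \<longlonglongrightarrow> lim (\<lambda>n. d (s n) (t n))"
proof -
  note P = pseudometric_onD[OF assms(1)]
  have in_M: "s n \<in> M" "t n \<in> M" for n using assms by (auto simp: cauchy_seqs_def)
  have "Cauchy (\<lambda>n. d (s n) (t n))"
  proof (rule metric_CauchyI)
    fix e :: real assume "0 < e"
    then obtain N1 N2 where N: "\<And>m n. m \<ge> N1 \<Longrightarrow> n \<ge> N1 \<Longrightarrow> d (s m) (s n) < e/2"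
      "\<And>m n. m \<ge> N2 \<Longrightarrow> n \<ge> N2 \<Longrightarrow> d (t m) (t n) < e/2"
      using assms unfolding cauchy_seqs_def by (smt (verit) half_gt_zero mem_Collect_eq)
    have "dist (d (s m) (t m)) (d (s n) (t n)) < e" if "m \<ge> max N1 N2" "n \<ge> max N1 N2" for m n
      using that N(1)[of m n] N(2)[of m n] in_M
        P(4)[of "s m" "s n" "t m"] P(4)[of "s n" "t n" "t m"]
        P(4)[of "s n" "s m" "t n"] P(4)[of "s m" "t m" "t n"]
        P(2)[of "s m" "s n"] P(2)[of "t m" "t n"]
      by (auto simp: dist_real_def abs_less_iff)
    then show "\<exists>N. \<forall>m\<ge>N. \<forall>n\<ge>N. dist (d (s m) (t m)) (d (s n) (t n)) < e" by blast
  qed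
  then show ?thesis by (simp add: Cauchy_convergent_iff convergent_LIMSEQ_iff)
qed

lemma pseudometric_on_cauchy_seqs:
  assumes "pseudometric_on M d"
  shows "pseudometric_on (cauchy_seqs M d) (\<lambda>s t. lim (\<lambda>n. d (s n) (t n)))"
proof (rule pseudometric_onI)
  note P = pseudometric_onD[OF assms]
  note T = cauchy_seqs_dist_tendsto[OF assms]
  have in_M: "s n \<in> M" if "s \<in> cauchy_seqs M d" for s n using that by (auto simp: cauchy_seqs_def)
  fix s t assume st: "s \<in> cauchy_seqs M d" "t \<in> cauchy_seqs M d"
  show "0 \<le> lim (\<lambda>n. d (s n) (t n))"
    by (rule LIMSEQ_le_const[OF T[OF st]]) (use P(1) in_M st in auto)
  show "lim (\<lambda>n. d (s n) (t n)) = lim (\<lambda>n. d (t n) (s n))"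
    using P(2) in_M st by metis
  show "lim (\<lambda>n. d (s n) (s n)) = 0" using P(3) in_M st by simp
  fix u assume u: "u \<in> cauchy_seqs M d"
  show "lim (\<lambda>n. d (s n) (u n)) \<le> lim (\<lambda>n. d (s n) (t n)) + lim (\<lambda>n. d (t n) (u n))"
    by (rule LIMSEQ_le[OF T[OF st(1) u] tendsto_add[OF T[OF st] T[OF st(2) u]]])
      (use P(4) in_M st u in auto)
qed


section \<open>Asymptotic cones\<close>

definition nonprincipal_ultrafilter :: "(nat set \<Rightarrow> real) \<Rightarrow> bool" where
  "nonprincipal_ultrafilter \<omega> \<longleftrightarrow> (\<forall>A. \<omega> A \<in> {0, 1}) \<and> \<omega> UNIV = 1 \<and>
     (\<forall>A B. A \<inter> B = {} \<longrightarrow> \<omega> (A \<union> B) = \<omega> A + \<omega> B) \<and> (\<forall>A. finite A \<longrightarrow> \<omega> A = 0)"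

definition ulim :: "(nat set \<Rightarrow> real) \<Rightarrow> (nat \<Rightarrow> ereal) \<Rightarrow> ereal" where
  "ulim \<omega> s = (THE l. \<forall>U. open U \<and> l \<in> U \<longrightarrow> \<omega> {n. s n \<in> U} = 1)"

definition cone_data :: "'a metric \<Rightarrow> (nat set \<Rightarrow> real) \<Rightarrow> (nat \<Rightarrow> 'a) \<Rightarrow> (nat \<Rightarrow> real) \<Rightarrow> bool" where
  "cone_data X \<omega> x r \<longleftrightarrow> nonprincipal_ultrafilter \<omega> \<and> range x \<subseteq> mspace X \<and>
     (\<forall>n. 0 < r n) \<and> ulim \<omega> (\<lambda>n. ereal (r n)) = \<infinity>"

definition cone_seqs ::
    "'a metric \<Rightarrow> (nat set \<Rightarrow> real) \<Rightarrow> (nat \<Rightarrow> 'a) \<Rightarrow> (nat \<Rightarrow> real) \<Rightarrow> (nat \<Rightarrow> 'a) set" where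
  "cone_seqs X \<omega> x r =
     {y. range y \<subseteq> mspace X \<and> ulim \<omega> (\<lambda>n. ereal (mdist X (x n) (y n) / r n)) < \<infinity>}"

definition cone_dist ::
    "'a metric \<Rightarrow> (nat set \<Rightarrow> real) \<Rightarrow> (nat \<Rightarrow> real) \<Rightarrow> (nat \<Rightarrow> 'a) \<Rightarrow> (nat \<Rightarrow> 'a) \<Rightarrow> real" where
  "cone_dist X \<omega> r y z = real_of_ereal (ulim \<omega> (\<lambda>n. ereal (mdist X (y n) (z n) / r n)))"

definition cone ::
    "'a metric \<Rightarrow> (nat set \<Rightarrow> real) \<Rightarrow> (nat \<Rightarrow> 'a) \<Rightarrow> (nat \<Rightarrow> real) \<Rightarrow> (nat \<Rightarrow> 'a) set metric" where
  "cone X \<omega> x r = metric_quotient (cone_seqs X \<omega> x r) (cone_dist X \<omega> r)"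

definition ulim_set ::
    "'a metric \<Rightarrow> (nat set \<Rightarrow> real) \<Rightarrow> (nat \<Rightarrow> 'a) \<Rightarrow> (nat \<Rightarrow> real) \<Rightarrow> (nat \<Rightarrow> 'a set)
       \<Rightarrow> (nat \<Rightarrow> 'a) set set" where
  "ulim_set X \<omega> x r A =
     {zero_rel (cone_seqs X \<omega> x r) (cone_dist X \<omega> r) `` {y} | y.
        y \<in> cone_seqs X \<omega> x r \<and> (\<forall>n. y n \<in> A n)}"

definition cone_pieces ::
    "'a metric \<Rightarrow> (nat set \<Rightarrow> real) \<Rightarrow> (nat \<Rightarrow> 'a) \<Rightarrow> (nat \<Rightarrow> real) \<Rightarrow> 'a set set
       \<Rightarrow> (nat \<Rightarrow> 'a) set set set" where
  "cone_pieces X \<omega> x r \<A> = {ulim_set X \<omega> x r A | A. range A \<subseteq> \<A>} - {{}}"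

lemma ulim_filter:
  assumes "nonprincipal_ultrafilter \<omega>"
  obtains F :: "nat filter" where "F \<noteq> bot" "\<And>P. eventually P F \<longleftrightarrow> \<omega> {n. P n} = 1"
    "\<And>s. (s \<longlongrightarrow> ulim \<omega> s) F"
proof -
  have v: "\<omega> A = 0 \<or> \<omega> A = 1" and u: "\<omega> UNIV = 1" and e: "\<omega> {} = 0"
    and add: "A \<inter> B = {} \<Longrightarrow> \<omega> (A \<union> B) = \<omega> A + \<omega> B" for A B
    using assms by (auto simp: nonprincipal_ultrafilter_def)
  have mono: "\<omega> B = 1" if "\<omega> A = 1" "A \<subseteq> B" for A B
    using add[of A "B - A"] that v[of B] v[of "B - A"] by (auto simp: Un_absorb1)
  have comp: "\<omega> (- A) = 1 - \<omega> A" for A using add[of A "- A"] u by simp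
  have inter: "\<omega> (A \<inter> B) = 1" if "\<omega> A = 1" "\<omega> B = 1" for A B
  proof -
    have "\<omega> B = \<omega> (A \<inter> B) + \<omega> (B - A)" using add[of "A \<inter> B" "B - A"]
      by (metis Diff_disjoint Int_Diff_Un Int_Diff_disjoint Int_commute)
    moreover have "\<omega> (B - A) = 0"
      using mono[of "B - A" "- A"] comp[of A] that v[of "B - A"] by auto
    ultimately show ?thesis using that by simp
  qed
  define F where "F = Abs_filter (\<lambda>P. \<omega> {n. P n} = 1)"
  have ev: "eventually P F \<longleftrightarrow> \<omega> {n. P n} = 1" for P
    unfolding F_def
  proof (rule eventually_Abs_filter, standard)
    show "\<omega> {n. True} = 1" using u by simp
    show "\<omega> {n. P n \<and> Q n} = 1" if "\<omega> {n. P n} = 1" "\<omega> {n. Q n} = 1" for P Q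
      using inter[OF that] by (simp add: Collect_conj_eq)
    show "\<omega> {n. Q n} = 1" if "\<forall>n. P n \<longrightarrow> Q n" "\<omega> {n. P n} = 1" for P Q
      using mono[OF that(2), of "{n. Q n}"] that(1) by auto
  qed
  have nb: "F \<noteq> bot" using ev[of "\<lambda>_. False"] e by (auto simp: trivial_limit_def)
  have ultra: "eventually P F \<or> eventually (\<lambda>n. \<not> P n) F" for P
    using comp[of "{n. P n}"] v[of "{n. P n}"] by (auto simp: ev Collect_neg_eq)
  have lim: "(s \<longlongrightarrow> ulim \<omega> s) F" for s
  proof -
    have "Limsup F s \<le> Liminf F s"
    proof (rule dense_le)
      fix y assume y: "y < Limsup F s"
      then have "\<not> eventually (\<lambda>n. s n \<le> y) F" using Limsup_bounded by (metis leD)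
      then have "eventually (\<lambda>n. \<not> s n \<le> y) F" using ultra by blast
      then have "eventually (\<lambda>n. y \<le> s n) F" by eventually_elim simp
      then show "y \<le> Liminf F s" by (rule Liminf_bounded)
    qed
    then have l: "(s \<longlongrightarrow> Limsup F s) F"
      using Liminf_le_Limsup[OF nb, of s] nb by (intro Liminf_eq_Limsup) auto
    have "ulim \<omega> s = Limsup F s"
      unfolding ulim_def
    proof (rule the_equality)
      show "\<forall>U. open U \<and> Limsup F s \<in> U \<longrightarrow> \<omega> {n. s n \<in> U} = 1"
        using l by (auto simp: tendsto_def ev)
      fix k assume "\<forall>U. open U \<and> k \<in> U \<longrightarrow> \<omega> {n. s n \<in> U} = 1"
      then have "(s \<longlongrightarrow> k) F" by (auto simp: tendsto_def ev)
      then show "k = Limsup F s" using l nb tendsto_unique by blast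
    qed
    then show ?thesis using l by simp
  qed
  show thesis using that[OF nb ev lim] .
qed

lemma cone_dist_tendsto:
  assumes "cone_data X \<omega> x r" "y \<in> cone_seqs X \<omega> x r" "z \<in> cone_seqs X \<omega> x r"
    and F: "F \<noteq> bot" "\<And>s. (s \<longlongrightarrow> ulim \<omega> s) F"
  shows "((\<lambda>n. mdist X (y n) (z n) / r n) \<longlongrightarrow> cone_dist X \<omega> r y z) F"
proof -
  define D where "D = (\<lambda>y z n. ereal (mdist X (y n) (z n) / r n))"
  have in_X: "x n \<in> mspace X" "y n \<in> mspace X" "z n \<in> mspace X" "0 < r n" for n
    using assms by (auto simp: cone_data_def cone_seqs_def)
  have fin: "ulim \<omega> (D x y) < \<infinity>" "ulim \<omega> (D x z) < \<infinity>"
    using assms by (auto simp: cone_seqs_def D_def)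
  have nn: "0 \<le> ulim \<omega> (D u v)" for u v
    using F by (intro tendsto_lowerbound[OF F(2)])
      (auto simp: D_def in_X less_imp_le intro!: always_eventually)
  have "ulim \<omega> (D y z) \<le> ulim \<omega> (D x y) + ulim \<omega> (D x z)"
  proof (rule tendsto_le[OF F(1) _ F(2)])
    show "((\<lambda>n. D x y n + D x z n) \<longlongrightarrow> ulim \<omega> (D x y) + ulim \<omega> (D x z)) F"
      using nn fin by (intro tendsto_add_ereal_general F(2)) (auto simp: less_eq_ereal_def)
    show "eventually (\<lambda>n. D y z n \<le> D x y n + D x z n) F"
      using mdist_triangle[OF in_X(2,1,3)] in_X(4)
      by (intro always_eventually)
        (auto simp: D_def mdist_commute[of X "y _"] add_divide_distrib[symmetric]
          less_imp_le intro!: divide_right_mono)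
  qed
  then have "ulim \<omega> (D y z) < \<infinity>" using fin by (metis ereal_infty_less(1) ereal_plus_eq_PInfty neq_iff ereal_infty_less_eq(1) not_le)
  then have "\<bar>ulim \<omega> (D y z)\<bar> \<noteq> \<infinity>" using nn[of y z] by auto
  then show ?thesis using F(2)[of "D y z"]
    unfolding cone_dist_def D_def by (metis ereal_real lim_ereal)
qed

lemma pseudometric_on_cone_seqs:
  assumes "cone_data X \<omega> x r"
  shows "pseudometric_on (cone_seqs X \<omega> x r) (cone_dist X \<omega> r)"
proof -
  obtain F :: "nat filter" where F: "F \<noteq> bot" "\<And>s. (s \<longlongrightarrow> ulim \<omega> s) F"
    using assms ulim_filter by (metis cone_data_def)
  note T = cone_dist_tendsto[OF assms _ _ F]
  have in_X: "y n \<in> mspace X" if "y \<in> cone_seqs X \<omega> x r" for y n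
    using that by (auto simp: cone_seqs_def)
  have r: "0 < r n" for n using assms by (auto simp: cone_data_def)
  show ?thesis
  proof (rule pseudometric_onI)
    fix y z assume yz: "y \<in> cone_seqs X \<omega> x r" "z \<in> cone_seqs X \<omega> x r"
    show "0 \<le> cone_dist X \<omega> r y z"
      using r by (intro tendsto_lowerbound[OF T[OF yz] _ F(1)])
        (auto simp: less_imp_le intro!: always_eventually)
    show "cone_dist X \<omega> r y z = cone_dist X \<omega> r z y"
      by (simp add: cone_dist_def mdist_commute)
    show "cone_dist X \<omega> r y y = 0"
    proof -
      have "mdist X (y n) (y n) = 0" for n using in_X[OF yz(1)] by simp
      then have "(\<lambda>n. mdist X (y n) (y n) / r n) = (\<lambda>n. 0)" by simp
      then show ?thesis using T[OF yz(1) yz(1)] F(1) by (metis tendsto_const tendsto_unique)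
    qed
    fix w assume w: "w \<in> cone_seqs X \<omega> x r"
    show "cone_dist X \<omega> r y w \<le> cone_dist X \<omega> r y z + cone_dist X \<omega> r z w"
      using mdist_triangle[OF in_X[OF yz(1)] in_X[OF yz(2)] in_X[OF w]] r
      by (intro tendsto_le[OF F(1) tendsto_add[OF T[OF yz] T[OF yz(2) w]] T[OF yz(1) w]])
        (auto simp: add_divide_distrib[symmetric] less_imp_le
          intro!: always_eventually divide_right_mono)
  qed
qed


section \<open>Tree-graded spaces and relatively hyperbolic groups\<close>

text \<open>
  In the last clause the conditions on the intersections say that the concatenation of the three
  geodesics is a simple loop. A simple geodesic bigon is covered by subdividing one of its sides.
\<close>

definition tree_graded :: "'a metric \<Rightarrow> 'a set set \<Rightarrow> bool" where
  "tree_graded X \<P> \<longleftrightarrow> mcomplete_of X \<and> geodesic_space X \<and>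
     (\<forall>P\<in>\<P>. closedin (mtopology_of X) P \<and> geodesic_subset X P) \<and> \<Union>\<P> = mspace X \<and>
     (\<forall>P\<in>\<P>. \<forall>Q\<in>\<P>. P \<noteq> Q \<longrightarrow> (\<forall>x\<in>P \<inter> Q. \<forall>y\<in>P \<inter> Q. x = y)) \<and>
     (\<forall>x y z A B C. geodesic_segment X x y A \<and> geodesic_segment X y z B \<and> geodesic_segment X z x C \<and>
        A \<inter> B = {y} \<and> B \<inter> C = {z} \<and> C \<inter> A = {x} \<longrightarrow> (\<exists>P\<in>\<P>. A \<union> B \<union> C \<subseteq> P))"

definition asymptotically_tree_graded :: "'a metric \<Rightarrow> 'a set set \<Rightarrow> bool" where
  "asymptotically_tree_graded X \<A> \<longleftrightarrow>
     (\<forall>\<omega> x r. cone_data X \<omega> x r \<longrightarrow>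
        tree_graded (cone X \<omega> x r) (cone_pieces X \<omega> x r \<A>) \<and>
        (\<forall>A A'. range A \<subseteq> \<A> \<and> range A' \<subseteq> \<A> \<and>
           ulim_set X \<omega> x r A \<noteq> {} \<and> ulim_set X \<omega> x r A' \<noteq> {} \<and> \<omega> {n. A n \<noteq> A' n} = 1
           \<longrightarrow> ulim_set X \<omega> x r A \<noteq> ulim_set X \<omega> x r A'))"

text \<open>A letter \<open>(s, True)\<close> stands for \<open>s\<close>, and \<open>(s, False)\<close> for the inverse of \<open>s\<close>.\<close>

definition word_eval :: "('g, 'm) monoid_scheme \<Rightarrow> ('g \<times> bool) list \<Rightarrow> 'g" where
  "word_eval G w = foldr (\<lambda>(s, b) g. (if b then s else inv\<^bsub>G\<^esub> s) \<otimes>\<^bsub>G\<^esub> g) w \<one>\<^bsub>G\<^esub>"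

definition word_length :: "('g, 'm) monoid_scheme \<Rightarrow> 'g set \<Rightarrow> 'g \<Rightarrow> nat" where
  "word_length G S g = (LEAST n. \<exists>w. fst ` set w \<subseteq> S \<and> length w = n \<and> word_eval G w = g)"

text \<open>
  The path metric of the Cayley graph (with edges from \<open>g\<close> to \<open>g \<otimes> s\<close>) on its vertex set.
\<close>

definition cayley_metric :: "('g, 'm) monoid_scheme \<Rightarrow> 'g set \<Rightarrow> 'g metric" where
  "cayley_metric G S = metric (carrier G, \<lambda>g h. if g \<in> carrier G \<and> h \<in> carrier G
     then real (word_length G S (inv\<^bsub>G\<^esub> g \<otimes>\<^bsub>G\<^esub> h)) else 0)"

definition peripheral_cosets ::
    "('g, 'm) monoid_scheme \<Rightarrow> nat \<Rightarrow> (nat \<Rightarrow> 'g set) \<Rightarrow> 'g set set" where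
  "peripheral_cosets G n H = {g <#\<^bsub>G\<^esub> H i | g i. g \<in> carrier G \<and> i \<in> {1..n}}"

definition relatively_hyperbolic ::
    "('g, 'm) monoid_scheme \<Rightarrow> nat \<Rightarrow> (nat \<Rightarrow> 'g set) \<Rightarrow> bool" where
  "relatively_hyperbolic G n H \<longleftrightarrow> group G \<and> (\<forall>i\<in>{1..n}. subgroup (H i) G) \<and>
     (\<exists>S. finite S \<and> S \<subseteq> carrier G \<and> generate G S = carrier G \<and>
        asymptotically_tree_graded (cayley_metric G S) (peripheral_cosets G n H))"

definition infinite_cyclic_subgroup :: "('g, 'm) monoid_scheme \<Rightarrow> 'g set \<Rightarrow> bool" where
  "infinite_cyclic_subgroup G H \<longleftrightarrow> infinite H \<and> (\<exists>a\<in>carrier G. H = generate G {a})"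

context group
begin

lemma word_eval_closed:
  "fst ` set w \<subseteq> carrier G \<Longrightarrow> word_eval G w \<in> carrier G"
  by (induction w) (auto simp: word_eval_def)

lemma word_eval_append:
  "fst ` set v \<subseteq> carrier G \<Longrightarrow> fst ` set w \<subseteq> carrier G \<Longrightarrow>
     word_eval G (v @ w) = word_eval G v \<otimes> word_eval G w"
proof (induction v)
  case Nil
  then show ?case using word_eval_closed[of w] by (simp add: word_eval_def)
next
  case (Cons a v)
  then show ?case using word_eval_closed[of v] word_eval_closed[of w]
    by (auto simp: word_eval_def m_assoc split: prod.splits)
qed

lemma word_eval_inverse:
  "fst ` set w \<subseteq> carrier G \<Longrightarrow>
     word_eval G (rev (map (apsnd Not) w)) = inv (word_eval G w)"
proof (induction w)
  case Nil
  then show ?case by (simp add: word_eval_def)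
next
  case (Cons a w)
  obtain s b where a: "a = (s, b)" by (cases a)
  have "fst ` set (rev (map (apsnd Not) w)) \<subseteq> carrier G"
    using Cons.prems by (auto simp: apsnd_def map_prod_def split: prod.splits)
  then have "word_eval G (rev (map (apsnd Not) (a # w))) =
      word_eval G (rev (map (apsnd Not) w)) \<otimes> word_eval G [(s, \<not> b)]"
    using Cons.prems by (simp add: a word_eval_append)
  also have "\<dots> = inv (word_eval G (a # w))"
    using Cons word_eval_closed[of w]
    by (auto simp: a inv_mult_group) (auto simp: word_eval_def inv_mult_group)
  finally show ?case .
qed

lemma word_length_exists:
  assumes "S \<subseteq> carrier G" "g \<in> generate G S"
  shows "\<exists>w. fst ` set w \<subseteq> S \<and> length w = word_length G S g \<and> word_eval G w = g"
proof -
  have "\<exists>w. fst ` set w \<subseteq> S \<and> word_eval G w = g"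
    using assms(2)
  proof induction
    case one
    then show ?case by (intro exI[of _ "[]"]) (simp add: word_eval_def)
  next
    case (incl h)
    then show ?case using assms(1) by (intro exI[of _ "[(h, True)]"]) (auto simp: word_eval_def)
  next
    case (inv h)
    then show ?case using assms(1) by (intro exI[of _ "[(h, False)]"]) (auto simp: word_eval_def)
  next
    case (eng g h)
    then obtain v w where "fst ` set v \<subseteq> S" "word_eval G v = g" "fst ` set w \<subseteq> S" "word_eval G w = h"
      by blast
    then show ?case using assms(1)
      by (intro exI[of _ "v @ w"]) (auto simp: image_Un intro!: word_eval_append)
  qed
  then show ?thesis unfolding word_length_def
    by (intro LeastI_ex[where P = "\<lambda>n. \<exists>w. fst ` set w \<subseteq> S \<and> length w = n \<and> word_eval G w = g"]) blast
qed

lemma word_length_le: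
  "fst ` set w \<subseteq> S \<Longrightarrow> word_length G S (word_eval G w) \<le> length w"
  unfolding word_length_def by (rule Least_le) blast

lemma Metric_space_cayley:
  assumes "S \<subseteq> carrier G" "generate G S = carrier G"
  shows "Metric_space (carrier G) (\<lambda>g h. if g \<in> carrier G \<and> h \<in> carrier G
     then real (word_length G S (inv g \<otimes> h)) else 0)"
proof -
  have w: "\<exists>w. fst ` set w \<subseteq> S \<and> length w = word_length G S g \<and> word_eval G w = g"
    if "g \<in> carrier G" for g
    using word_length_exists[of S g] assms that by simp
  have le: "word_length G S (inv g) \<le> word_length G S g" if g: "g \<in> carrier G" for g
  proof -
    obtain w where w: "fst ` set w \<subseteq> S" "length w = word_length G S g" "word_eval G w = g"
      using w[OF g] by blast
    have "fst ` set (rev (map (apsnd Not) w)) \<subseteq> S"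
      using w(1) by (auto simp: apsnd_def map_prod_def split: prod.splits)
    then show ?thesis using word_length_le[of "rev (map (apsnd Not) w)" S] w assms(1)
      by (simp add: word_eval_inverse)
  qed
  have sym: "word_length G S (inv g \<otimes> h) = word_length G S (inv h \<otimes> g)"
    if "g \<in> carrier G" "h \<in> carrier G" for g h
    using le[of "inv g \<otimes> h"] le[of "inv h \<otimes> g"] that by (auto simp: inv_mult_group)
  have tri: "word_length G S (g \<otimes> h) \<le> word_length G S g + word_length G S h"
    if g: "g \<in> carrier G" and h: "h \<in> carrier G" for g h
  proof -
    obtain v where v: "fst ` set v \<subseteq> S" "length v = word_length G S g" "word_eval G v = g"
      using w[OF g] by blast
    obtain u where u: "fst ` set u \<subseteq> S" "length u = word_length G S h" "word_eval G u = h"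
      using w[OF h] by blast
    from v show ?thesis using word_length_le[of "v @ u" S] assms(1) u
      by (simp add: word_eval_append image_Un)
  qed
  have zero: "word_length G S (inv g \<otimes> h) = 0 \<longleftrightarrow> g = h"
    if "g \<in> carrier G" "h \<in> carrier G" for g h
  proof
    assume "word_length G S (inv g \<otimes> h) = 0"
    then have "inv g \<otimes> h = \<one>" using w[of "inv g \<otimes> h"] that by (auto simp: word_eval_def)
    then have "inv h = inv g" using that by (intro inv_equality) auto
    then have "inv (inv h) = inv (inv g)" by (rule arg_cong)
    then show "g = h" using that by simp
  next
    assume "g = h"
    then show "word_length G S (inv g \<otimes> h) = 0"
      using word_length_le[of "[]" S] that by (simp add: word_eval_def)
  qed
  show ?thesis
  proof
    fix x y z assume xyz: "x \<in> carrier G" "y \<in> carrier G" "z \<in> carrier G"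
    have "inv x \<otimes> z = (inv x \<otimes> y) \<otimes> (inv y \<otimes> z)"
    proof -
      have "y \<otimes> (inv y \<otimes> z) = z" using xyz by (simp add: m_assoc[symmetric])
      then show ?thesis using xyz by (simp add: m_assoc)
    qed
    then show "(if x \<in> carrier G \<and> z \<in> carrier G then real (word_length G S (inv x \<otimes> z)) else 0)
      \<le> (if x \<in> carrier G \<and> y \<in> carrier G then real (word_length G S (inv x \<otimes> y)) else 0) +
        (if y \<in> carrier G \<and> z \<in> carrier G then real (word_length G S (inv y \<otimes> z)) else 0)"
      using tri[of "inv x \<otimes> y" "inv y \<otimes> z"] xyz by simp
  next
    show "(if g \<in> carrier G \<and> h \<in> carrier G then real (word_length G S (inv g \<otimes> h)) else 0)
      = (if h \<in> carrier G \<and> g \<in> carrier G then real (word_length G S (inv h \<otimes> g)) else 0)" for g h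
    proof (cases "g \<in> carrier G \<and> h \<in> carrier G")
      case True
      then have "word_length G S (inv g \<otimes> h) = word_length G S (inv h \<otimes> g)" using sym by blast
      then show ?thesis by simp
    qed auto
  qed (simp_all add: zero)
qed

end


section \<open>Free groups and marked trees\<close>

definition letter_inv :: "'a \<times> bool \<Rightarrow> 'a \<times> bool" where
  "letter_inv = apsnd Not"

definition reduced_word :: "('a \<times> bool) list \<Rightarrow> bool" where
  "reduced_word w \<longleftrightarrow> (\<forall>i. Suc i < length w \<longrightarrow> w ! Suc i \<noteq> letter_inv (w ! i))"

definition cancel_cons :: "'a \<times> bool \<Rightarrow> ('a \<times> bool) list \<Rightarrow> ('a \<times> bool) list" where
  "cancel_cons a w = (if w \<noteq> [] \<and> hd w = letter_inv a then tl w else a # w)"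

definition free_group :: "'a set \<Rightarrow> ('a \<times> bool) list monoid" where
  "free_group A = \<lparr>carrier = {w. fst ` set w \<subseteq> A \<and> reduced_word w},
     monoid.mult = (\<lambda>v w. foldr cancel_cons v w), one = []\<rparr>"

definition free_basis :: "('g, 'm) monoid_scheme \<Rightarrow> 'g set \<Rightarrow> bool" where
  "free_basis G S \<longleftrightarrow> S \<subseteq> carrier G \<and> word_eval G \<in> iso (free_group S) G"

lemma letter_inv_inv [simp]: "letter_inv (letter_inv a) = a"
  by (cases a) (simp add: letter_inv_def)

lemma fst_letter_inv [simp]: "fst (letter_inv a) = fst a"
  by (cases a) (simp add: letter_inv_def)

lemma reduced_word_Nil [simp]: "reduced_word []"
  by (simp add: reduced_word_def)

lemma reduced_word_Cons:
  "reduced_word (a # w) \<longleftrightarrow> reduced_word w \<and> (w \<noteq> [] \<longrightarrow> hd w \<noteq> letter_inv a)"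
proof -
  have "reduced_word (a # w) \<longleftrightarrow>
      (Suc 0 < length (a # w) \<longrightarrow> (a # w) ! Suc 0 \<noteq> letter_inv ((a # w) ! 0)) \<and>
      (\<forall>i. Suc (Suc i) < length (a # w) \<longrightarrow> (a # w) ! Suc (Suc i) \<noteq> letter_inv ((a # w) ! Suc i))"
    unfolding reduced_word_def by (metis not0_implies_Suc)
  then show ?thesis by (cases w) (auto simp: reduced_word_def)
qed

lemma reduced_cancel_cons: "reduced_word w \<Longrightarrow> reduced_word (cancel_cons a w)"
  by (cases w) (auto simp: cancel_cons_def reduced_word_Cons)

lemma set_cancel_cons: "set (cancel_cons a w) \<subseteq> insert a (set w)"
  by (auto simp: cancel_cons_def dest: list.set_sel(2))

lemma cancel_cons_inv: "reduced_word w \<Longrightarrow> cancel_cons (letter_inv a) (cancel_cons a w) = w"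
  by (cases w; cases "tl w") (auto simp: cancel_cons_def reduced_word_Cons)

lemma reduced_foldr: "reduced_word w \<Longrightarrow> reduced_word (foldr cancel_cons v w)"
  by (induction v) (auto intro: reduced_cancel_cons)

lemma set_foldr: "set (foldr cancel_cons v w) \<subseteq> set v \<union> set w"
  by (induction v) (use set_cancel_cons in fastforce)+

lemma fst_set_foldr:
  assumes "fst ` set v \<subseteq> A" "fst ` set w \<subseteq> A"
  shows "fst ` set (foldr cancel_cons v w) \<subseteq> A"
  using image_mono[OF set_foldr[of v w], of fst] assms
  unfolding image_Un by (meson Un_least order_trans)

lemma foldr_cancel_Nil: "reduced_word v \<Longrightarrow> foldr cancel_cons v [] = v"
  by (induction v) (auto simp: reduced_word_Cons cancel_cons_def)

lemma foldr_cancel_cons: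
  assumes "reduced_word w"
  shows "foldr cancel_cons (cancel_cons a v) w = cancel_cons a (foldr cancel_cons v w)"
proof (cases "v \<noteq> [] \<and> hd v = letter_inv a")
  case True
  then obtain u where "v = letter_inv a # u" by (cases v) auto
  then show ?thesis
    using cancel_cons_inv[OF reduced_foldr[OF assms], of "letter_inv a" u] by (simp add: cancel_cons_def)
qed (auto simp: cancel_cons_def)

lemma foldr_cancel_assoc:
  assumes "reduced_word w"
  shows "foldr cancel_cons (foldr cancel_cons u v) w = foldr cancel_cons u (foldr cancel_cons v w)"
  by (induction u) (auto simp: foldr_cancel_cons[OF assms])

lemma foldr_cancel_inverse:
  "reduced_word w \<Longrightarrow> foldr cancel_cons (rev (map letter_inv v)) (foldr cancel_cons v w) = w"
  by (induction v) (auto simp: cancel_cons_inv reduced_foldr)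

lemma group_free_group: "group (free_group A)"
proof (rule groupI)
  fix u v w
  assume u: "u \<in> carrier (free_group A)"
  define u' where "u' = foldr cancel_cons (rev (map letter_inv u)) []"
  have "fst ` set u' \<subseteq> A"
    using u unfolding u'_def by (intro fst_set_foldr) (auto simp: free_group_def)
  moreover have "u' \<otimes>\<^bsub>free_group A\<^esub> u = []"
  proof -
    have "reduced_word u" using u by (simp add: free_group_def)
    then have "u' \<otimes>\<^bsub>free_group A\<^esub> u = foldr cancel_cons (rev (map letter_inv u)) (foldr cancel_cons u [])"
      unfolding u'_def using foldr_cancel_assoc[of u "rev (map letter_inv u)" "[]"]
      by (simp add: free_group_def foldr_cancel_Nil)
    then show ?thesis by (simp add: foldr_cancel_inverse)
  qed
  ultimately show "\<exists>y\<in>carrier (free_group A). y \<otimes>\<^bsub>free_group A\<^esub> u = \<one>\<^bsub>free_group A\<^esub>"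
    by (intro bexI[of _ u']) (auto simp: free_group_def u'_def reduced_foldr)
  assume v: "v \<in> carrier (free_group A)"
  show "u \<otimes>\<^bsub>free_group A\<^esub> v \<in> carrier (free_group A)"
    using u v fst_set_foldr[of u A v] by (auto simp: free_group_def reduced_foldr)
  assume w: "w \<in> carrier (free_group A)"
  show "u \<otimes>\<^bsub>free_group A\<^esub> v \<otimes>\<^bsub>free_group A\<^esub> w = u \<otimes>\<^bsub>free_group A\<^esub> (v \<otimes>\<^bsub>free_group A\<^esub> w)"
    using w by (simp add: free_group_def foldr_cancel_assoc)
qed (auto simp: free_group_def)

text \<open>
  The edges at a vertex are represented by an arbitrary index set \<open>I\<close>. Every free group of rank
  \<open>k\<close> is isomorphic to \<open>free_group {..<k}\<close>, all free bases of which are allowed.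
\<close>

definition marked_tree :: "'z metric \<Rightarrow> 'i set \<Rightarrow> ('i \<Rightarrow> real \<Rightarrow> 'z) \<Rightarrow> bool" where
  "marked_tree Z I \<gamma> \<longleftrightarrow> real_tree Z \<and>
     (\<exists>k\<ge>2. \<exists>n\<ge>1. \<exists>H S \<omega> x r f.
        let G = free_group {..<k :: nat}; X = cayley_metric G S in
        (\<forall>i\<in>{1..n}. infinite_cyclic_subgroup G (H i)) \<and> relatively_hyperbolic G n H \<and>
        free_basis G S \<and> cone_data X \<omega> x r \<and> isometry Z (cone X \<omega> x r) f \<and>
        bij_betw (\<lambda>e. f ` range (\<gamma> e)) I (cone_pieces X \<omega> x r (peripheral_cosets G n H)))"


section \<open>Clusters\<close>

definition simplicial_tree :: "'v set \<Rightarrow> 'v set set \<Rightarrow> bool" where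
  "simplicial_tree V E \<longleftrightarrow> V \<noteq> {} \<and> (\<forall>e\<in>E. e \<subseteq> V \<and> card e = 2) \<and>
     (\<forall>u\<in>V. \<forall>v\<in>V. (u, v) \<in> {(a, b). {a, b} \<in> E}\<^sup>*) \<and>
     (\<nexists>c. 3 \<le> length c \<and> distinct c \<and>
          (\<forall>i. Suc i < length c \<longrightarrow> {c ! i, c ! Suc i} \<in> E) \<and> {last c, hd c} \<in> E)"

definition cluster_data ::
    "'v set \<Rightarrow> 'v set set \<Rightarrow> ('v \<Rightarrow> 'z metric) \<Rightarrow> ('v \<Rightarrow> 'v set \<Rightarrow> real \<Rightarrow> 'z) \<Rightarrow> bool" where
  "cluster_data V E Z \<gamma> \<longleftrightarrow> simplicial_tree V E \<and> (\<forall>v\<in>V. continuum_tree (Z v)) \<and>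
     (\<forall>v\<in>V. \<forall>e\<in>E. v \<in> e \<longrightarrow> bi_infinite_geodesic (Z v) (\<gamma> v e))"

text \<open>The product carries the Euclidean (that is, \<open>\<ell>\<^sup>2\<close>) product metric.\<close>

definition vertex_space :: "('v \<Rightarrow> 'z metric) \<Rightarrow> 'v \<Rightarrow> ('z \<times> real) metric" where
  "vertex_space Z v = prod_metric (Z v) euclidean_metric"

definition cluster_points :: "'v set \<Rightarrow> ('v \<Rightarrow> 'z metric) \<Rightarrow> ('v \<times> 'z \<times> real) set" where
  "cluster_points V Z = (SIGMA v:V. mspace (vertex_space Z v))"

definition flip_gluing ::
    "'v set set \<Rightarrow> ('v \<Rightarrow> 'v set \<Rightarrow> real \<Rightarrow> 'z) \<Rightarrow> (('v \<times> 'z \<times> real) \<times> ('v \<times> 'z \<times> real)) set" where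
  "flip_gluing E \<gamma> =
     {((v, \<gamma> v {v, v'} t, u), (v', \<gamma> v' {v, v'} u, t)) | v v' t u. {v, v'} \<in> E}"

definition cluster_equiv ::
    "'v set \<Rightarrow> 'v set set \<Rightarrow> ('v \<Rightarrow> 'z metric) \<Rightarrow> ('v \<Rightarrow> 'v set \<Rightarrow> real \<Rightarrow> 'z)
       \<Rightarrow> (('v \<times> 'z \<times> real) \<times> ('v \<times> 'z \<times> real)) set" where
  "cluster_equiv V E Z \<gamma> =
     (flip_gluing E \<gamma> \<union> (flip_gluing E \<gamma>)\<inverse>)\<^sup>* \<inter> (cluster_points V Z \<times> cluster_points V Z)"

definition precluster_points ::
    "'v set \<Rightarrow> 'v set set \<Rightarrow> ('v \<Rightarrow> 'z metric) \<Rightarrow> ('v \<Rightarrow> 'v set \<Rightarrow> real \<Rightarrow> 'z)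
       \<Rightarrow> ('v \<times> 'z \<times> real) set set" where
  "precluster_points V E Z \<gamma> = cluster_points V Z // cluster_equiv V E Z \<gamma>"

text \<open>
  \<open>polygonal_length V E Z \<gamma> p q l\<close> says that in the quotient there is a path of length \<open>l\<close>
  from \<open>p\<close> to \<open>q\<close> that is a concatenation of images of geodesic segments of the vertex spaces
  (which are geodesic spaces). The path metric is the infimum of these lengths.
\<close>

inductive polygonal_length ::
    "'v set \<Rightarrow> 'v set set \<Rightarrow> ('v \<Rightarrow> 'z metric) \<Rightarrow> ('v \<Rightarrow> 'v set \<Rightarrow> real \<Rightarrow> 'z)
       \<Rightarrow> ('v \<times> 'z \<times> real) set \<Rightarrow> ('v \<times> 'z \<times> real) set \<Rightarrow> real \<Rightarrow> bool"
  for V E Z \<gamma> where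
  segment: "\<lbrakk>v \<in> V; a \<in> mspace (vertex_space Z v); b \<in> mspace (vertex_space Z v)\<rbrakk> \<Longrightarrow>
     polygonal_length V E Z \<gamma> (cluster_equiv V E Z \<gamma> `` {(v, a)}) (cluster_equiv V E Z \<gamma> `` {(v, b)})
       (mdist (vertex_space Z v) a b)"
| concat: "\<lbrakk>polygonal_length V E Z \<gamma> p q l; polygonal_length V E Z \<gamma> q r m\<rbrakk> \<Longrightarrow>
     polygonal_length V E Z \<gamma> p r (l + m)"

definition precluster_dist ::
    "'v set \<Rightarrow> 'v set set \<Rightarrow> ('v \<Rightarrow> 'z metric) \<Rightarrow> ('v \<Rightarrow> 'v set \<Rightarrow> real \<Rightarrow> 'z)
       \<Rightarrow> ('v \<times> 'z \<times> real) set \<Rightarrow> ('v \<times> 'z \<times> real) set \<Rightarrow> real" where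
  "precluster_dist V E Z \<gamma> p q = Inf {l. polygonal_length V E Z \<gamma> p q l}"

definition cluster ::
    "'v set \<Rightarrow> 'v set set \<Rightarrow> ('v \<Rightarrow> 'z metric) \<Rightarrow> ('v \<Rightarrow> 'v set \<Rightarrow> real \<Rightarrow> 'z)
       \<Rightarrow> (nat \<Rightarrow> ('v \<times> 'z \<times> real) set) set metric" where
  "cluster V E Z \<gamma> = completion (precluster_points V E Z \<gamma>) (precluster_dist V E Z \<gamma>)"

lemma flip_gluing_subset:
  assumes "cluster_data V E Z \<gamma>"
  shows "flip_gluing E \<gamma> \<subseteq> cluster_points V Z \<times> cluster_points V Z"
proof -
  have "\<gamma> v {v, v'} t \<in> mspace (Z v)" "\<gamma> v' {v, v'} t \<in> mspace (Z v')" "v \<in> V" "v' \<in> V"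
    if e: "{v, v'} \<in> E" for v v' t
  proof -
    have "\<forall>e\<in>E. e \<subseteq> V" using assms by (simp add: cluster_data_def simplicial_tree_def)
    then have "{v, v'} \<subseteq> V" using e by (rule bspec)
    then show v: "v \<in> V" "v' \<in> V" by auto
    have "bi_infinite_geodesic (Z w) (\<gamma> w {v, v'})" if "w \<in> {v, v'}" for w
      using assms e v that unfolding cluster_data_def by auto
    then show "\<gamma> v {v, v'} t \<in> mspace (Z v)" "\<gamma> v' {v, v'} t \<in> mspace (Z v')"
      by (auto simp: bi_infinite_geodesic_def)
  qed
  then show ?thesis
    by (auto simp: flip_gluing_def cluster_points_def vertex_space_def)
qed

lemma equiv_cluster_equiv: "equiv (cluster_points V Z) (cluster_equiv V E Z \<gamma>)"
proof (rule equivI)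
  let ?R = "(flip_gluing E \<gamma> \<union> (flip_gluing E \<gamma>)\<inverse>)\<^sup>*"
  have "sym ?R" by (intro sym_rtrancl sym_Un_converse)
  then show "sym (cluster_equiv V E Z \<gamma>)" by (auto simp: cluster_equiv_def sym_def)
  show "trans (cluster_equiv V E Z \<gamma>)"
    unfolding cluster_equiv_def by (rule transI) (auto intro: rtrancl_trans)
qed (auto simp: cluster_equiv_def refl_on_def)

lemma polygonal_length_nonneg: "polygonal_length V E Z \<gamma> p q l \<Longrightarrow> 0 \<le> l"
  by (induction rule: polygonal_length.induct) auto

lemma polygonal_length_sym: "polygonal_length V E Z \<gamma> p q l \<Longrightarrow> polygonal_length V E Z \<gamma> q p l"
proof (induction rule: polygonal_length.induct)
  case (segment v a b)
  then show ?case using polygonal_length.segment[of v V b Z a E \<gamma>] by (simp add: mdist_commute)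
next
  case (concat p q l r m)
  then show ?case using polygonal_length.concat[of V E Z \<gamma> r q m p l] by (simp add: add.commute)
qed

lemma precluster_pointsE:
  assumes "p \<in> precluster_points V E Z \<gamma>"
  obtains v a where "v \<in> V" "a \<in> mspace (vertex_space Z v)"
    "p = cluster_equiv V E Z \<gamma> `` {(v, a)}"
proof -
  obtain c where "c \<in> cluster_points V Z" "p = cluster_equiv V E Z \<gamma> `` {c}"
    using assms unfolding precluster_points_def by (rule quotientE)
  then show thesis using that by (cases c) (auto simp: cluster_points_def)
qed

lemma polygonal_length_exists:
  assumes cd: "cluster_data V E Z \<gamma>"
    and p: "p \<in> precluster_points V E Z \<gamma>" and q: "q \<in> precluster_points V E Z \<gamma>"
  shows "\<exists>l. polygonal_length V E Z \<gamma> p q l"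
proof -
  note eq = equiv_cluster_equiv[of V Z E \<gamma>]
  let ?c = "\<lambda>v a. cluster_equiv V E Z \<gamma> `` {(v, a)}"
  obtain v a where va: "v \<in> V" "a \<in> mspace (vertex_space Z v)" "p = ?c v a"
    using p by (rule precluster_pointsE)
  obtain w b where wb: "w \<in> V" "b \<in> mspace (vertex_space Z w)" "q = ?c w b"
    using q by (rule precluster_pointsE)
  have "(v, w) \<in> {(a, b). {a, b} \<in> E}\<^sup>*"
    using cd va wb by (simp add: cluster_data_def simplicial_tree_def)
  then have "\<forall>b\<in>mspace (vertex_space Z w). \<exists>l. polygonal_length V E Z \<gamma> p (?c w b) l" if "w \<in> V"
    using that
  proof (induction rule: rtrancl_induct)
    case base
    show ?case
      unfolding va(3) by (intro ballI exI) (rule polygonal_length.segment[OF va(1,2)])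
  next
    case (step y z)
    then have yz: "{y, z} \<in> E" by simp
    define g g' where "g = (\<gamma> y {y, z} 0, 0::real)" and "g' = (\<gamma> z {y, z} 0, 0::real)"
    have "((y, g), (z, g')) \<in> flip_gluing E \<gamma>"
      using yz unfolding flip_gluing_def g_def g'_def by blast
    moreover from this have in_P: "(y, g) \<in> cluster_points V Z" "(z, g') \<in> cluster_points V Z"
      using flip_gluing_subset[OF cd] by auto
    ultimately have "((y, g), (z, g')) \<in> cluster_equiv V E Z \<gamma>"
      unfolding cluster_equiv_def by (intro IntI r_into_rtrancl) simp_all
    then have c: "?c y g = ?c z g'" by (rule equiv_class_eq[OF eq])
    have y: "y \<in> V" "g \<in> mspace (vertex_space Z y)" and z: "g' \<in> mspace (vertex_space Z z)"
      using in_P by (auto simp: cluster_points_def)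
    obtain l where l: "polygonal_length V E Z \<gamma> p (?c y g) l" using bspec[OF step.IH[OF y(1)] y(2)] by (rule exE)
    show ?case
    proof
      fix b assume "b \<in> mspace (vertex_space Z z)"
      then have b: "polygonal_length V E Z \<gamma> (?c z g') (?c z b) (mdist (vertex_space Z z) g' b)"
        by (rule polygonal_length.segment[OF step.prems z])
      show "\<exists>l. polygonal_length V E Z \<gamma> p (?c z b) l"
        using polygonal_length.concat[OF l[unfolded c] b] by (rule exI)
    qed
  qed
  from bspec[OF this[OF wb(1)] wb(2)] show ?thesis unfolding wb(3) .
qed

lemma pseudometric_on_precluster:
  assumes "cluster_data V E Z \<gamma>"
  shows "pseudometric_on (precluster_points V E Z \<gamma>) (precluster_dist V E Z \<gamma>)"
proof (rule pseudometric_onI)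
  let ?L = "\<lambda>p q. {l. polygonal_length V E Z \<gamma> p q l}"
  have bdd: "bdd_below (?L p q)" for p q
    by (rule bdd_belowI[of _ 0]) (auto intro: polygonal_length_nonneg)
  fix p q assume pq: "p \<in> precluster_points V E Z \<gamma>" "q \<in> precluster_points V E Z \<gamma>"
  have ne: "?L p q \<noteq> {}" if "p \<in> precluster_points V E Z \<gamma>" "q \<in> precluster_points V E Z \<gamma>" for p q
    using polygonal_length_exists[OF assms that] by simp
  show nn: "0 \<le> precluster_dist V E Z \<gamma> p q"
    unfolding precluster_dist_def using ne[OF pq]
    by (intro cInf_greatest) (auto intro: polygonal_length_nonneg)
  show "precluster_dist V E Z \<gamma> p q = precluster_dist V E Z \<gamma> q p"
    unfolding precluster_dist_def by (rule arg_cong[where f = Inf]) (auto intro: polygonal_length_sym)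
  show "precluster_dist V E Z \<gamma> p p = 0"
  proof -
    obtain v a where va: "v \<in> V" "a \<in> mspace (vertex_space Z v)" "p = cluster_equiv V E Z \<gamma> `` {(v, a)}"
      using pq(1) by (rule precluster_pointsE)
    then have "0 \<in> ?L p p" using polygonal_length.segment[of v V a Z a E \<gamma>]
      by (metis mdist_zero mem_Collect_eq)
    then show ?thesis unfolding precluster_dist_def
      by (intro cInf_eq_minimum) (auto intro: polygonal_length_nonneg)
  qed
  fix r assume r: "r \<in> precluster_points V E Z \<gamma>"
  have *: "precluster_dist V E Z \<gamma> p r \<le> l + m" if "l \<in> ?L p q" "m \<in> ?L q r" for l m
    unfolding precluster_dist_def using that
    by (intro cInf_lower bdd) (auto intro: polygonal_length.concat)
  have "precluster_dist V E Z \<gamma> p r - l \<le> precluster_dist V E Z \<gamma> q r" if "l \<in> ?L p q" for l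
    unfolding precluster_dist_def[of V E Z \<gamma> q r]
    using *[OF that] ne[OF pq(2) r] by (intro cInf_greatest) (auto simp: algebra_simps)
  then have "precluster_dist V E Z \<gamma> p r - precluster_dist V E Z \<gamma> q r \<le> precluster_dist V E Z \<gamma> p q"
    unfolding precluster_dist_def[of V E Z \<gamma> p q]
    using ne[OF pq] by (intro cInf_greatest) (auto simp: algebra_simps)
  then show "precluster_dist V E Z \<gamma> p r \<le> precluster_dist V E Z \<gamma> p q + precluster_dist V E Z \<gamma> q r"
    by simp
qed

end

theory Submission
  imports Defs "HOL-Real_Asymp.Real_Asymp"
begin

text \<open>
  An isometry between the clusters is assembled from isometries between the vertex trees. Since the
  gluing along an edge exchanges the two coordinates, an isomorphism \<open>T \<rightarrow> T'\<close> with isometries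
  \<open>f\<^sub>v\<close> of the vertex trees and isometries \<open>\<rho>\<^sub>v\<close> of the line induces an isometry of the clusters as
  soon as \<open>f\<^sub>v\<close> maps the geodesic of each edge \<open>{v, w}\<close> to the geodesic of the image edge,
  reparametrized by \<open>\<rho>\<^sub>w\<close> (\<open>cluster_isometric\<close>). When one passes from \<open>v\<close> to an
  adjacent vertex \<open>w\<close>, the map \<open>f\<^sub>v\<close> thus determines \<open>\<rho>\<^sub>w\<close>, and \<open>\<rho>\<^sub>v\<close> prescribes \<open>f\<^sub>w\<close> on
  one geodesic. There is no further constraint because \<open>T\<close> has no cycles. The theorem therefore
  reduces to a statement about two marked trees: every isometry from one marked geodesic onto another
  extends to an isometry of the trees that maps marked geodesics to marked geodesics
  (\<open>marked_trees_isometric\<close>).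

  This extension comes from a universal property. Call two points of a marked tree collinear if
  some piece contains both. Along a ray, collinearity of parameters has three evident properties,
  which define a pattern. In a marked tree every pattern is realized at every point by continuum many
  rays that pairwise have only their origin in common (\<open>cone_rays\<close>, \<open>marked_tree_universal\<close>). On
  the other hand there are at most continuum many directions at a point, so at any two points of two
  marked trees the directions of each initial pattern are equally many, up to the identification of
  the two directions of a piece (\<open>units_of_type\<close>). Partial isomorphisms together with bijections of
  the directions at all points of their domains can then be enlarged, across a gap or to a limit
  point, until they are defined everywhere, and the bijections make the result surjective
  (\<open>matching_grow\<close>, \<open>matching_close\<close>, \<open>line_isometry_extends\<close>).

  The rays in the cone of a free group are written down as words. A generator of an infinite cyclic
  subgroup is conjugate to a cyclically reduced word \<open>u\<close>, and cosets of the subgroup are, up to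
  bounded error, lines labelled by powers of \<open>u\<close>. Let \<open>c\<close> be a letter that can be concatenated with
  \<open>u\<close> without cancellation. A long word made of blocks \<open>u\<close> and powers of \<open>c\<close> follows a coset of the
  subgroup wherever only \<open>u\<close> is used (\<open>pattern_in_coset\<close>). Elsewhere isolated blocks \<open>u\<close> at
  growing but negligible distances destroy all bounded periods, so that the word follows no coset of
  any of the cyclic subgroups (\<open>coset_in_pattern\<close>). Freely chosen initial blocks of negligible
  length make the rays diverge at once (\<open>rays_diverge\<close>).
\<close>

section \<open>Real trees and the four-point inequality\<close>

text \<open>
  The inequality says that the larger two of the three sums \<open>d a b + d c e\<close>, \<open>d a c + d b e\<close>,
  \<open>d a e + d b c\<close> agree. It replaces all arguments with arcs in a real tree by linear arithmetic.
\<close>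

locale rtree = Metric_space M d for M :: "'a set" and d +
  assumes geod: "a \<in> M \<Longrightarrow> b \<in> M \<Longrightarrow> 0 \<le> s \<Longrightarrow> s \<le> d a b \<Longrightarrow> \<exists>p\<in>M. d a p = s \<and> d p b = d a b - s"
    and four_point: "a \<in> M \<Longrightarrow> b \<in> M \<Longrightarrow> c \<in> M \<Longrightarrow> e \<in> M \<Longrightarrow>
      d a b + d c e \<le> max (d a c + d b e) (d a e + d b c)"

lemma geodesic_pathin:
  assumes g: "\<forall>s\<in>{0..L}. \<forall>t\<in>{0..L}. mdist X (g s) (g t) = \<bar>s - t\<bar>" "g ` {0..L} \<subseteq> mspace X"
    and s: "0 < s" "s \<le> L"
  shows "pathin (mtopology_of X) (\<lambda>t. g (t * s)) \<and> inj_on (\<lambda>t. g (t * s)) {0..1}"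
proof -
  have in_L: "t * s \<in> {0..L}" if "t \<in> {0..1}" for t
    using that s by (auto intro: order.trans[OF mult_left_le_one_le])
  have dist: "mdist X (g (t * s)) (g (t' * s)) = s * \<bar>t - t'\<bar>" if "t \<in> {0..1}" "t' \<in> {0..1}" for t t'
  proof -
    have "s * \<bar>t - t'\<bar> = \<bar>s * (t - t')\<bar>" using s by (simp add: abs_mult)
    then show ?thesis using g(1) in_L[OF that(1)] in_L[OF that(2)] by (simp add: algebra_simps)
  qed
  have "Lipschitz_continuous_map (submetric euclidean_metric {0..1}) X (\<lambda>t. g (t * s))"
    unfolding Lipschitz_continuous_map_def
  proof (intro conjI exI ballI)
    show "(\<lambda>t. g (t * s)) \<in> mspace (submetric euclidean_metric {0..1}) \<rightarrow> mspace X"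
      using g(2) in_L by auto
    fix x y :: real assume "x \<in> mspace (submetric euclidean_metric {0..1})" "y \<in> mspace (submetric euclidean_metric {0..1})"
    then show "mdist X (g (x * s)) (g (y * s)) \<le> s * mdist (submetric euclidean_metric {0..1}) x y"
      using dist[of x y] by (auto simp: dist_real_def)
  qed
  then have "continuous_map (mtopology_of (submetric euclidean_metric {0..1})) (mtopology_of X) (\<lambda>t. g (t * s))"
    by (rule Lipschitz_continuous_imp_continuous_map)
  then have "pathin (mtopology_of X) (\<lambda>t. g (t * s))"
    by (simp add: pathin_def mtopology_of_submetric)
  moreover have "inj_on (\<lambda>t. g (t * s)) {0..1}"
  proof (rule inj_onI)
    fix t t' assume *: "t \<in> {0..1}" "t' \<in> {0..1}" "g (t * s) = g (t' * s)"
    have "g (t * s) \<in> mspace X" using g(2) in_L *(1) by auto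
    then have "mdist X (g (t * s)) (g (t' * s)) = 0" using *(3) by simp
    then have "s * \<bar>t - t'\<bar> = 0" using dist[OF *(1,2)] by linarith
    then show "t = t'" using s by simp
  qed
  ultimately show ?thesis by simp
qed

text \<open>
  Two geodesics from \<open>w\<close> share an initial segment of some length \<open>c\<close> and never meet again. Running
  the first one backwards and then the second one therefore gives an arc, which by uniqueness of
  arcs is the geodesic between the endpoints.
\<close>

lemma geodesics_fork:
  assumes tree: "real_tree X"
    and g: "\<forall>s\<in>{0..A}. \<forall>t\<in>{0..A}. mdist X (g s) (g t) = \<bar>s - t\<bar>" "g ` {0..A} \<subseteq> mspace X" "0 \<le> A"
    and h: "\<forall>s\<in>{0..B}. \<forall>t\<in>{0..B}. mdist X (h s) (h t) = \<bar>s - t\<bar>" "h ` {0..B} \<subseteq> mspace X" "0 \<le> B"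
    and eq: "g 0 = h 0"
  shows "\<exists>c. 0 \<le> c \<and> c \<le> A \<and> c \<le> B \<and> (\<forall>t. 0 \<le> t \<and> t \<le> A \<and> t \<le> B \<longrightarrow> (g t = h t \<longleftrightarrow> t \<le> c)) \<and>
     mdist X (g A) (h B) = A + B - 2 * c"
proof -
  note uniq = tree[unfolded real_tree_def, THEN conjunct2, THEN conjunct2, rule_format]
  have in_X: "t \<in> {0..A} \<Longrightarrow> g t \<in> mspace X" "t \<in> {0..B} \<Longrightarrow> h t \<in> mspace X" for t
    using g(2) h(2) by auto
  have same_time: "s = t" if "s \<in> {0..A}" "t \<in> {0..B}" "g s = h t" for s t
  proof -
    have "mdist X (g 0) (g s) = s" using g(1,3) that(1) by auto
    moreover have "mdist X (h 0) (h t) = t" using h(1,3) that(2) by auto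
    ultimately show ?thesis using that(3) eq by simp
  qed
  have initial: "g r = h r" if s: "0 \<le> s" "s \<le> A" "s \<le> B" "g s = h s" and r: "0 \<le> r" "r \<le> s" for r s
  proof (cases "s = 0")
    case False
    then have "0 < s" using s by simp
    have "(\<lambda>t. g (t * s)) ` {0..1} = (\<lambda>t. h (t * s)) ` {0..1}"
      using geodesic_pathin[OF g(1,2) \<open>0 < s\<close> s(2)] geodesic_pathin[OF h(1,2) \<open>0 < s\<close> s(3)] s(4) eq
      by (intro uniq) auto
    moreover have "g r = (\<lambda>t. g (t * s)) (r / s)" "r / s \<in> {0..1}" using \<open>0 < s\<close> r by auto
    ultimately obtain t where t: "t \<in> {0..1}" "g r = h (t * s)" by blast
    have "t * s \<in> {0..B}" using t(1) \<open>0 < s\<close> s by (auto intro: order.trans[OF mult_left_le_one_le])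
    then show ?thesis using same_time[of r "t * s"] t(2) s r by auto
  qed (use eq r in auto)
  define S where "S = {t. 0 \<le> t \<and> t \<le> A \<and> t \<le> B \<and> g t = h t}"
  define c where "c = Sup S"
  have "0 \<in> S" using g(3) h(3) eq by (simp add: S_def)
  have bdd: "bdd_above S" by (rule bdd_aboveI[of _ A]) (auto simp: S_def)
  have c: "0 \<le> c" "c \<le> A" "c \<le> B"
    using \<open>0 \<in> S\<close> cSup_upper[OF \<open>0 \<in> S\<close> bdd] by (auto simp: c_def S_def intro!: cSup_least)
  have "g c = h c"
  proof (rule ccontr)
    assume ne: "g c \<noteq> h c"
    define e where "e = mdist X (g c) (h c)"
    have "0 < e" unfolding e_def using ne in_X c by (metis Metric_space.mdist_pos_less Metric_space_mspace_mdist atLeastAtMost_iff)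
    then have "c - e / 2 < Sup S" by (simp add: c_def)
    then obtain t where t: "t \<in> S" "c - e / 2 < t" using \<open>0 \<in> S\<close> less_cSupD by (metis empty_iff)
    have "t \<le> c" unfolding c_def by (rule cSup_upper[OF t(1) bdd])
    have tS: "t \<in> {0..A}" "t \<in> {0..B}" "g t = h t" using t(1) by (auto simp: S_def)
    have "e \<le> mdist X (g c) (g t) + mdist X (h t) (h c)"
      unfolding e_def using mdist_triangle[of "g c" X "g t" "h c"] in_X c tS by auto
    also have "mdist X (g c) (g t) = c - t" using g(1) c tS(1) \<open>t \<le> c\<close> by auto
    also have "mdist X (h t) (h c) = c - t" using h(1) c tS(2) \<open>t \<le> c\<close> by auto
    finally show False using t(2) by simp
  qed
  then have iff: "g t = h t \<longleftrightarrow> t \<le> c" if "0 \<le> t" "t \<le> A" "t \<le> B" for t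
    using initial[of c t] c that cSup_upper[OF _ bdd, of t] by (auto simp: S_def c_def)
  have "mdist X (g A) (h B) = A + B - 2 * c"
  proof (cases "c = A \<or> c = B")
    case True
    then show ?thesis
    proof
      assume "c = A"
      then have "g A = h A" using \<open>g c = h c\<close> by simp
      moreover have "mdist X (h A) (h B) = B - A" using h c g(3) \<open>c = A\<close> by auto
      ultimately show ?thesis using \<open>c = A\<close> by simp
    next
      assume "c = B"
      then have "h B = g B" using \<open>g c = h c\<close> by simp
      moreover have "mdist X (g A) (g B) = A - B" using g c h(3) \<open>c = B\<close> by auto
      ultimately show ?thesis using \<open>c = B\<close> by simp
    qed
  next
    case False
    define L where "L = (A - c) + (B - c)"
    have L: "0 < L" using False c by (auto simp: L_def)
    define k where "k = (\<lambda>\<sigma>. if \<sigma> \<le> A - c then g (A - \<sigma>) else h (c + \<sigma> - (A - c)))"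
    have k1: "k \<sigma> = g (A - \<sigma>)" if "\<sigma> \<le> A - c" for \<sigma> using that by (simp add: k_def)
    have k2: "k \<sigma> = h (c + \<sigma> - (A - c))" if "A - c \<le> \<sigma>" for \<sigma>
      using that \<open>g c = h c\<close> by (cases "\<sigma> = A - c") (auto simp: k_def)
    have k_in: "k \<sigma> \<in> mspace X" if "0 \<le> \<sigma>" "\<sigma> \<le> L" for \<sigma>
      using that c by (cases "\<sigma> \<le> A - c") (auto simp: k_def L_def intro!: in_X)
    have k_mid: "k (A - c) = g c" by (simp add: k_def)
    have d1: "mdist X (k \<sigma>) (k \<tau>) = \<tau> - \<sigma>" if "0 \<le> \<sigma>" "\<sigma> \<le> \<tau>" "\<tau> \<le> A - c" for \<sigma> \<tau>
      using that c g(1) by (simp add: k1)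
    have d2: "mdist X (k \<sigma>) (k \<tau>) = \<tau> - \<sigma>" if "A - c \<le> \<sigma>" "\<sigma> \<le> \<tau>" "\<tau> \<le> L" for \<sigma> \<tau>
      using that c h(1) by (simp add: k2 L_def)
    have lip': "mdist X (k \<sigma>) (k \<tau>) \<le> \<tau> - \<sigma>" if "0 \<le> \<sigma>" "\<sigma> \<le> \<tau>" "\<tau> \<le> L" for \<sigma> \<tau>
    proof (cases "\<tau> \<le> A - c \<or> A - c \<le> \<sigma>")
      case True then show ?thesis using d1 d2 that by fastforce
    next
      case F: False
      have "mdist X (k \<sigma>) (k \<tau>) \<le> mdist X (k \<sigma>) (k (A - c)) + mdist X (k (A - c)) (k \<tau>)"
        using that F c by (intro mdist_triangle k_in) (auto simp: L_def)
      then show ?thesis using d1[of \<sigma> "A - c"] d2[of "A - c" \<tau>] F that by auto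
    qed
    have lip: "mdist X (k \<sigma>) (k \<tau>) \<le> \<bar>\<sigma> - \<tau>\<bar>" if "0 \<le> \<sigma>" "\<sigma> \<le> L" "0 \<le> \<tau>" "\<tau> \<le> L" for \<sigma> \<tau>
      using that lip'[of \<sigma> \<tau>] lip'[of \<tau> \<sigma>] mdist_commute[of X "k \<sigma>" "k \<tau>"] by (cases "\<sigma> \<le> \<tau>") auto
    have inj: "\<sigma> = \<tau>" if "0 \<le> \<sigma>" "\<sigma> \<le> \<tau>" "\<tau> \<le> L" "k \<sigma> = k \<tau>" for \<sigma> \<tau>
    proof (cases "\<tau> \<le> A - c \<or> A - c \<le> \<sigma>")
      case True
      then have "mdist X (k \<sigma>) (k \<tau>) = \<tau> - \<sigma>" using d1 d2 that by blast
      moreover have "mdist X (k \<sigma>) (k \<tau>) = 0" using that k_in[of \<sigma>] by simp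
      ultimately show ?thesis by simp
    next
      case F: False
      then have 1: "g (A - \<sigma>) = h (c + \<tau> - (A - c))" using that by (auto simp: k_def)
      have 2: "A - \<sigma> = c + \<tau> - (A - c)"
        using F that c 1 by (intro same_time) (auto simp: L_def)
      have "A - \<sigma> \<le> c" using iff[of "A - \<sigma>"] 1[folded 2] 2 F that c by (auto simp: L_def)
      then show ?thesis using F by auto
    qed
    have in_L: "t * L \<le> L" "0 \<le> t * L" if "t \<in> {0..1}" for t
      using that L by (auto simp: mult_left_le_one_le)
    have "Lipschitz_continuous_map (submetric euclidean_metric {0..1}) X (\<lambda>t. k (t * L))"
      unfolding Lipschitz_continuous_map_def
    proof (intro conjI exI ballI)
      show "(\<lambda>t. k (t * L)) \<in> mspace (submetric euclidean_metric {0..1}) \<rightarrow> mspace X"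
        using in_L by (auto intro!: k_in)
      fix x y :: real assume xy: "x \<in> mspace (submetric euclidean_metric {0..1})" "y \<in> mspace (submetric euclidean_metric {0..1})"
      then have "mdist X (k (x * L)) (k (y * L)) \<le> \<bar>x * L - y * L\<bar>" using in_L by (intro lip) auto
      also have "\<dots> = \<bar>L * (x - y)\<bar>" by (simp add: algebra_simps)
      also have "\<dots> = L * \<bar>x - y\<bar>" using L by (simp add: abs_mult)
      finally show "mdist X (k (x * L)) (k (y * L)) \<le> L * mdist (submetric euclidean_metric {0..1}) x y"
        using xy by (simp add: dist_real_def)
    qed
    then have "continuous_map (mtopology_of (submetric euclidean_metric {0..1})) (mtopology_of X) (\<lambda>t. k (t * L))"
      by (rule Lipschitz_continuous_imp_continuous_map)
    then have path: "pathin (mtopology_of X) (\<lambda>t. k (t * L))"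
      by (simp add: pathin_def mtopology_of_submetric)
    have inj_k: "inj_on (\<lambda>t. k (t * L)) {0..1}"
    proof (rule inj_onI)
      fix t t' assume t: "t \<in> {0..1}" "t' \<in> {0..1}" "k (t * L) = k (t' * L)"
      note in_L[OF t(1)] in_L[OF t(2)]
      then have "t * L = t' * L"
        using inj[of "t * L" "t' * L"] inj[of "t' * L" "t * L"] t(3) by (metis linear)
      then show "t = t'" using L by simp
    qed
    have ends: "k 0 = g A" "k L = h B" using c \<open>g c = h c\<close> k2[of L] by (auto simp: k_def L_def)
    have "g A \<in> mspace X" "h B \<in> mspace X" using in_X g(3) h(3) by auto
    then obtain S' where "geodesic_segment X (g A) (h B) S'"
      using tree unfolding real_tree_def geodesic_space_def geodesic_subset_def by blast
    then obtain q D where q: "0 \<le> D" "q 0 = g A" "q D = h B" "q ` {0..D} \<subseteq> mspace X"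
      "\<forall>s\<in>{0..D}. \<forall>t\<in>{0..D}. mdist X (q s) (q t) = \<bar>s - t\<bar>" unfolding geodesic_segment_def by blast
    have "mdist X (q 0) (q D) = \<bar>0 - D\<bar>" using q(1,5) by simp
    then have D: "D = mdist X (g A) (h B)" using q(1-3) by simp
    have "g A \<noteq> h B" using inj[of 0 L] L ends by auto
    then have "mdist X (g A) (h B) \<noteq> 0" using in_X g(3) h(3) by simp
    then have "0 < D" using D q(1) by linarith
    have "(\<lambda>t. k (t * L)) ` {0..1} = (\<lambda>t. q (t * D)) ` {0..1}"
      by (rule uniq, intro conjI path inj_k
        geodesic_pathin[OF q(5,4) \<open>0 < D\<close> order.refl, THEN conjunct1]
        geodesic_pathin[OF q(5,4) \<open>0 < D\<close> order.refl, THEN conjunct2]) (simp_all add: ends q(2,3))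
    moreover have "g c = (\<lambda>t. k (t * L)) ((A - c) / L)" using L k_mid by simp
    moreover have "(A - c) / L \<in> {0..1}" using L c by (simp add: L_def)
    ultimately obtain t where t: "t \<in> {0..1}" "g c = q (t * D)" by blast
    have tD: "t * D \<in> {0..D}" using t(1) \<open>0 < D\<close> by (auto simp: mult_left_le_one_le)
    have "mdist X (q 0) (q (t * D)) = \<bar>0 - t * D\<bar>" "mdist X (q (t * D)) (q D) = \<bar>t * D - D\<bar>"
      using q(1,5) tD by simp_all
    then have "mdist X (g A) (g c) + mdist X (g c) (h B) = D" using q(2,3) t(2) tD by simp
    moreover have "mdist X (g A) (g c) = A - c" using g(1,3) c by auto
    moreover have "mdist X (g c) (h B) = B - c" using h(1,3) c \<open>g c = h c\<close> by auto
    ultimately show ?thesis using D by simp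
  qed
  then show ?thesis using c iff by blast
qed

text \<open>
  By \<open>geodesics_fork\<close>, the distance between two points is determined by the length of the common
  initial segment of the geodesics that lead to them from a third point. Of the three common lengths
  given by three geodesics from one point, the smaller two agree, and this is the four-point
  inequality.
\<close>

lemma rtree_real_tree:
  assumes tree: "real_tree X"
  shows "rtree (mspace X) (mdist X)"
proof -
  interpret Metric_space "mspace X" "mdist X" by simp
  have ex: "\<exists>g. (\<forall>s\<in>{0..mdist X a b}. \<forall>t\<in>{0..mdist X a b}. mdist X (g s) (g t) = \<bar>s - t\<bar>) \<and>
      g ` {0..mdist X a b} \<subseteq> mspace X \<and> g 0 = a \<and> g (mdist X a b) = b"
    if ab: "a \<in> mspace X" "b \<in> mspace X" for a b
  proof -
    obtain S' where "geodesic_segment X a b S'"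
      using tree ab unfolding real_tree_def geodesic_space_def geodesic_subset_def by blast
    then obtain q D where q: "0 \<le> D" "q 0 = a" "q D = b" "q ` {0..D} \<subseteq> mspace X"
      "\<forall>s\<in>{0..D}. \<forall>t\<in>{0..D}. mdist X (q s) (q t) = \<bar>s - t\<bar>" unfolding geodesic_segment_def by blast
    have "mdist X (q 0) (q D) = \<bar>0 - D\<bar>" using q(1,5) by simp
    then have "D = mdist X a b" using q by simp
    then show ?thesis using q by blast
  qed
  show ?thesis
  proof
    fix a b and s :: real assume ab: "a \<in> mspace X" "b \<in> mspace X" and s: "0 \<le> s" "s \<le> mdist X a b"
    obtain g where g: "\<forall>s\<in>{0..mdist X a b}. \<forall>t\<in>{0..mdist X a b}. mdist X (g s) (g t) = \<bar>s - t\<bar>"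
      "g ` {0..mdist X a b} \<subseteq> mspace X" "g 0 = a" "g (mdist X a b) = b" using ex[OF ab] by blast
    have "mdist X (g 0) (g s) = s" "mdist X (g s) (g (mdist X a b)) = mdist X a b - s"
      using g(1) s by auto
    then show "\<exists>p\<in>mspace X. mdist X a p = s \<and> mdist X p b = mdist X a b - s"
      using g s by (intro bexI[of _ "g s"]) auto
  next
    fix w y x z assume in_X: "w \<in> mspace X" "y \<in> mspace X" "x \<in> mspace X" "z \<in> mspace X"
    obtain g where g: "\<forall>s\<in>{0..mdist X w x}. \<forall>t\<in>{0..mdist X w x}. mdist X (g s) (g t) = \<bar>s - t\<bar>"
      "g ` {0..mdist X w x} \<subseteq> mspace X" "g 0 = w" "g (mdist X w x) = x" using ex in_X by meson
    obtain h where h: "\<forall>s\<in>{0..mdist X w y}. \<forall>t\<in>{0..mdist X w y}. mdist X (h s) (h t) = \<bar>s - t\<bar>"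
      "h ` {0..mdist X w y} \<subseteq> mspace X" "h 0 = w" "h (mdist X w y) = y" using ex in_X by meson
    obtain k where k: "\<forall>s\<in>{0..mdist X w z}. \<forall>t\<in>{0..mdist X w z}. mdist X (k s) (k t) = \<bar>s - t\<bar>"
      "k ` {0..mdist X w z} \<subseteq> mspace X" "k 0 = w" "k (mdist X w z) = z" using ex in_X by meson
    have eqs: "g 0 = h 0" "h 0 = k 0" "g 0 = k 0" using g(3) h(3) k(3) by simp_all
    from geodesics_fork[OF tree g(1,2) mdist_nonneg h(1,2) mdist_nonneg eqs(1), unfolded g(4) h(4)]
    obtain c where c: "0 \<le> c" "c \<le> mdist X w x" "c \<le> mdist X w y"
      "\<forall>t. 0 \<le> t \<and> t \<le> mdist X w x \<and> t \<le> mdist X w y \<longrightarrow> (g t = h t \<longleftrightarrow> t \<le> c)"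
      "mdist X x y = mdist X w x + mdist X w y - 2 * c" by (elim exE conjE)
    from geodesics_fork[OF tree h(1,2) mdist_nonneg k(1,2) mdist_nonneg eqs(2), unfolded h(4) k(4)]
    obtain c' where c': "0 \<le> c'" "c' \<le> mdist X w y" "c' \<le> mdist X w z"
      "\<forall>t. 0 \<le> t \<and> t \<le> mdist X w y \<and> t \<le> mdist X w z \<longrightarrow> (h t = k t \<longleftrightarrow> t \<le> c')"
      "mdist X y z = mdist X w y + mdist X w z - 2 * c'" by (elim exE conjE)
    from geodesics_fork[OF tree g(1,2) mdist_nonneg k(1,2) mdist_nonneg eqs(3), unfolded g(4) k(4)]
    obtain c'' where c'': "0 \<le> c''" "c'' \<le> mdist X w x" "c'' \<le> mdist X w z"
      "\<forall>t. 0 \<le> t \<and> t \<le> mdist X w x \<and> t \<le> mdist X w z \<longrightarrow> (g t = k t \<longleftrightarrow> t \<le> c'')"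
      "mdist X x z = mdist X w x + mdist X w z - 2 * c''" by (elim exE conjE)
    define t where "t = min c c'"
    have t: "0 \<le> t" "t \<le> c" "t \<le> c'" "t = c \<or> t = c'" using c(1) c'(1) by (auto simp: t_def)
    have "g t = h t" using c(2-4) t by auto
    moreover have "h t = k t" using c'(2-4) t by auto
    ultimately have "t \<le> c''" using c''(4) c(2) c'(3) t by auto
    then show "mdist X w y + mdist X x z \<le> max (mdist X w x + mdist X y z) (mdist X w z + mdist X y x)"
      using t(4) unfolding c(5) c'(5) c''(5) mdist_commute[of X y x] by auto
  qed
qed

context rtree
begin

abbreviation btw :: "'a \<Rightarrow> 'a \<Rightarrow> 'a \<Rightarrow> bool" where
  "btw a p b \<equiv> d a p + d p b = d a b"

lemma four:
  assumes "a \<in> M" "b \<in> M" "c \<in> M" "e \<in> M"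
  shows "d a b + d c e \<le> d a c + d b e \<or> d a b + d c e \<le> d a e + d b c"
  using four_point[OF assms] by (auto simp: max_def split: if_splits)

lemma btw_unique:
  assumes "a \<in> M" "b \<in> M" "p \<in> M" "q \<in> M" "btw a p b" "btw a q b" "d a p = d a q"
  shows "p = q"
proof -
  have "d p q \<le> 0" using four[OF assms(1-4)] commute[of b p] commute[of b q] assms(5-7) by linarith
  then show ?thesis using assms(3,4) nonneg[of p q] zero[of p q] by simp
qed

lemma btw_order:
  assumes "a \<in> M" "b \<in> M" "p \<in> M" "q \<in> M" "btw a p b" "btw a q b" "d a p \<le> d a q"
  shows "btw a p q" "btw p q b"
proof -
  have "d a q \<le> d a p + d p q" using assms by (intro triangle)
  then show "btw a p q" "btw p q b"
    using four[OF assms(1-4)] commute[of b p] commute[of b q] assms(5-7) nonneg[of p q] by linarith+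
qed

lemma btw_trans:
  assumes "a \<in> M" "b \<in> M" "p \<in> M" "q \<in> M" "btw a p q" "btw a q b"
  shows "btw a p b" "btw p q b"
  using triangle[of p q b] triangle[of a p b] assms by linarith+

text \<open>Half of \<open>d a b + d a c - d b c\<close> is the length of the common initial segment of the geodesics
  from \<open>a\<close> to \<open>b\<close> and to \<open>c\<close>.\<close>

definition prod :: "'a \<Rightarrow> 'a \<Rightarrow> 'a \<Rightarrow> real" where
  "prod a b c = (d a b + d a c - d b c) / 2"

lemma prod_le: "a \<in> M \<Longrightarrow> b \<in> M \<Longrightarrow> c \<in> M \<Longrightarrow> prod a b c \<le> d a b" "a \<in> M \<Longrightarrow> b \<in> M \<Longrightarrow> c \<in> M \<Longrightarrow> prod a b c \<le> d a c"
  using triangle[of a b c] triangle[of a c b] commute[of b c] by (auto simp: prod_def)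

text \<open>
  This is the four-point inequality, as the ultrametric property of \<open>prod\<close>.
\<close>

lemma prod_trans:
  assumes "a \<in> M" "b \<in> M" "c \<in> M" "e \<in> M"
  shows "prod a b e \<le> prod a b c \<or> prod a e c \<le> prod a b c"
  using four[of a e b c] assms commute[of e b] by (auto simp: prod_def)

lemma btw_prod:
  assumes "a \<in> M" "b \<in> M" "c \<in> M" "p \<in> M" "btw a p b" "d a p \<le> prod a b c"
  shows "btw a p c"
proof -
  have "d a c \<le> d a p + d p c" using assms by (intro triangle)
  then show ?thesis using four[of a b p c] assms commute[of b p] by (auto simp: prod_def field_simps)
qed

definition same_dir :: "'a \<Rightarrow> 'a \<Rightarrow> 'a \<Rightarrow> bool" where
  "same_dir a b c \<longleftrightarrow> d b c < d a b + d a c"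

lemma same_dir_prod: "same_dir a b c \<longleftrightarrow> 0 < prod a b c"
  by (auto simp: same_dir_def prod_def)

lemma same_dir_refl: "a \<in> M \<Longrightarrow> b \<in> M \<Longrightarrow> a \<noteq> b \<Longrightarrow> same_dir a b b"
  using mdist_pos_eq[of a b] by (simp add: same_dir_def)

lemma same_dir_sym: "same_dir a b c \<Longrightarrow> same_dir a c b"
  using commute[of b c] by (simp add: same_dir_def)

lemma same_dir_trans:
  "a \<in> M \<Longrightarrow> b \<in> M \<Longrightarrow> c \<in> M \<Longrightarrow> e \<in> M \<Longrightarrow> same_dir a b e \<Longrightarrow> same_dir a e c \<Longrightarrow> same_dir a b c"
  using prod_trans[of a b c e] by (auto simp: same_dir_prod)

lemma same_dir_neq: "a \<in> M \<Longrightarrow> b \<in> M \<Longrightarrow> c \<in> M \<Longrightarrow> same_dir a b c \<Longrightarrow> b \<noteq> a \<and> c \<noteq> a"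
  using commute[of a b] by (auto simp: same_dir_def)

lemma not_same_dir:
  assumes "a \<in> M" "b \<in> M" "c \<in> M"
  shows "\<not> same_dir a b c \<longleftrightarrow> btw b a c"
proof -
  note triangle[OF assms(2,1,3)] commute[of a b]
  then show ?thesis unfolding same_dir_def by linarith
qed

lemma btw_same_dir:
  assumes "a \<in> M" "b \<in> M" "p \<in> M" "btw a p b" "p \<noteq> a"
  shows "same_dir a p b"
proof -
  have "0 < d a p" using mdist_pos_less[OF assms(5)[symmetric] assms(1,3)] .
  then show ?thesis using assms(4) unfolding same_dir_def by linarith
qed

definition point :: "'a \<Rightarrow> 'a \<Rightarrow> real \<Rightarrow> 'a" where
  "point a b s = (SOME p. p \<in> M \<and> d a p = s \<and> d p b = d a b - s)"

lemma point:
  assumes "a \<in> M" "b \<in> M" "0 \<le> s" "s \<le> d a b"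
  shows "point a b s \<in> M" "d a (point a b s) = s" "d (point a b s) b = d a b - s"
    "btw a (point a b s) b"
proof -
  have "point a b s \<in> M \<and> d a (point a b s) = s \<and> d (point a b s) b = d a b - s"
    unfolding point_def by (rule someI_ex[OF geod[OF assms, unfolded Bex_def]])
  then show "point a b s \<in> M" "d a (point a b s) = s" "d (point a b s) b = d a b - s"
    "btw a (point a b s) b" by auto
qed

lemma point_eq:
  assumes "a \<in> M" "b \<in> M" "p \<in> M" "btw a p b"
  shows "point a b (d a p) = p"
proof -
  have "d a p \<le> d a b" using assms nonneg[of p b] by linarith
  then show ?thesis
    using point[OF assms(1,2), of "d a p"] assms by (intro btw_unique[of a b]) auto
qed

lemma point_0 [simp]: "a \<in> M \<Longrightarrow> b \<in> M \<Longrightarrow> point a b 0 = a"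
  using point_eq[of a b a] by simp

lemma point_dist:
  assumes "a \<in> M" "b \<in> M" "0 \<le> s" "s \<le> t" "t \<le> d a b"
  shows "d (point a b s) (point a b t) = t - s" "btw a (point a b s) (point a b t)"
    "btw (point a b s) (point a b t) b"
proof -
  have 1: "0 \<le> t" "s \<le> d a b" using assms by auto
  note p = point[OF assms(1,2,3) 1(2)] and q = point[OF assms(1,2) 1(1) assms(5)]
  show "btw a (point a b s) (point a b t)" "btw (point a b s) (point a b t) b"
    using btw_order[OF assms(1,2) p(1) q(1) p(4) q(4)] p(2) q(2) assms(4) by auto
  then show "d (point a b s) (point a b t) = t - s" using p q by linarith
qed

lemma point_agree:
  assumes "a \<in> M" "b \<in> M" "c \<in> M" "0 \<le> s" "s \<le> prod a b c"
  shows "point a b s = point a c s"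
proof -
  have s: "s \<le> d a b" using prod_le(1)[of a b c] assms by linarith
  note p = point[OF assms(1,2,4) s]
  have "btw a (point a b s) c" using p assms by (intro btw_prod[of a b c]) auto
  then show ?thesis using point_eq[of a c "point a b s"] p assms by auto
qed

lemma isometric_ray_point:
  assumes "\<And>s t. 0 \<le> s \<Longrightarrow> 0 \<le> t \<Longrightarrow> d (g s) (g t) = \<bar>s - t\<bar>" "\<And>t. 0 \<le> t \<Longrightarrow> g t \<in> M" "0 \<le> s" "s \<le> t"
  shows "point (g 0) (g t) s = g s"
proof -
  have "d (g 0) (g s) = s" "d (g s) (g t) = t - s" "d (g 0) (g t) = t" using assms(1)[of 0 s] assms(1)[of s t] assms(1)[of 0 t] assms by auto
  then show ?thesis using point_eq[of "g 0" "g t" "g s"] assms by auto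
qed

lemma line_convex:
  assumes g: "\<And>s t. d (g s) (g t) = \<bar>s - t\<bar>" "\<And>t. g t \<in> M" and p: "p \<in> M" "btw (g s) p (g t)"
  shows "p \<in> range (g :: real \<Rightarrow> 'a)"
proof -
  define r where "r = (if s \<le> t then s + d (g s) p else s - d (g s) p)"
  have st: "d (g s) (g t) = \<bar>s - t\<bar>" using g by simp
  have le: "d (g s) p \<le> \<bar>s - t\<bar>" using p(2) nonneg[of p "g t"] st by linarith
  have "d (g s) (g r) = d (g s) p" "btw (g s) (g r) (g t)"
    using le nonneg[of "g s" p] by (auto simp: g(1) r_def)
  then have "p = g r" using p g(2) by (intro btw_unique[of "g s" "g t"]) auto
  then show ?thesis by blast
qed

lemma line_closed:
  assumes g: "\<And>s t. d (g s) (g t) = \<bar>s - t\<bar>" "\<And>t. g t \<in> M" and q: "q \<in> M" "\<And>e. 0 < e \<Longrightarrow> \<exists>t. d (g t) q < e"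
  shows "q \<in> range (g :: real \<Rightarrow> 'a)"
proof -
  have "\<forall>n. \<exists>t. d (g t) q < 1 / Suc n" using q(2) by simp
  then obtain t where t: "\<And>n. d (g (t n)) q < 1 / Suc n" by metis
  have tt: "\<bar>t m - t n\<bar> < 1 / Suc m + 1 / Suc n" for m n
    using triangle[of "g (t m)" q "g (t n)"] g q t[of m] t[of n] commute[of q "g (t n)"] by simp
  have "Cauchy t"
  proof (rule metric_CauchyI)
    fix e :: real assume "0 < e"
    then obtain N where N: "1 / real (Suc N) < e / 2" using nat_approx_posE[of "e / 2"] by (metis half_gt_zero)
    have le: "1 / real (Suc m) \<le> 1 / real (Suc N)" if "m \<ge> N" for m using that by (simp add: frac_le)
    have "dist (t m) (t n) < e" if "m \<ge> N" "n \<ge> N" for m n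
      using tt[of m n] le[OF that(1)] le[OF that(2)] N unfolding dist_real_def by linarith
    then show "\<exists>N. \<forall>m\<ge>N. \<forall>n\<ge>N. dist (t m) (t n) < e" by blast
  qed
  then obtain l where l: "t \<longlonglongrightarrow> l" using Cauchy_convergent_iff convergent_def by blast
  have "(\<lambda>n. \<bar>l - t n\<bar> + 1 / Suc n) \<longlonglongrightarrow> \<bar>l - l\<bar> + 0"
    by (intro tendsto_intros l LIMSEQ_Suc[OF lim_1_over_n, unfolded o_def])
  moreover have "d (g l) q \<le> \<bar>l - t n\<bar> + 1 / Suc n" for n
    using triangle[of "g l" "g (t n)" q] g q t[of n] by (smt (verit))
  ultimately have "d (g l) q \<le> 0" by (intro LIMSEQ_le_const) auto
  then have "g l = q" using g q nonneg[of "g l" q] zero[of "g l" q] by simp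
  then show ?thesis by blast
qed

text \<open>
  The projection of \<open>z\<close> is the last point in \<open>A\<close> on the geodesic to \<open>z\<close> from some point \<open>o'\<close> of
  \<open>A\<close>. The geodesic from \<open>o'\<close> to another point \<open>b\<close> of \<open>A\<close> runs inside \<open>A\<close>, so it leaves the
  geodesic to \<open>z\<close> no later than this point.
\<close>

lemma projection:
  assumes A: "A \<subseteq> M" "A \<noteq> {}" and z: "z \<in> M"
    and convex: "\<And>a b p. a \<in> A \<Longrightarrow> b \<in> A \<Longrightarrow> p \<in> M \<Longrightarrow> btw a p b \<Longrightarrow> p \<in> A"
    and closed: "\<And>q. q \<in> M \<Longrightarrow> (\<And>e. 0 < e \<Longrightarrow> \<exists>p\<in>A. d p q < e) \<Longrightarrow> q \<in> A"
  shows "\<exists>a\<in>A. \<forall>b\<in>A. btw z a b"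
proof -
  obtain o' where o: "o' \<in> A" "o' \<in> M" using A by blast
  define T where "T = {t. 0 \<le> t \<and> t \<le> d o' z \<and> point o' z t \<in> A}"
  have "0 \<in> T" using o z by (simp add: T_def)
  have bdd: "bdd_above T" by (rule bdd_aboveI[of _ "d o' z"]) (auto simp: T_def)
  define s where "s = Sup T"
  have s: "0 \<le> s" "s \<le> d o' z"
    using cSup_upper[OF \<open>0 \<in> T\<close> bdd] \<open>0 \<in> T\<close> by (auto simp: s_def T_def intro!: cSup_least)
  note a = point[OF o(2) z s]
  define a where "a = point o' z s"
  have "a \<in> A"
  proof (rule closed)
    show "a \<in> M" using point[OF o(2) z s] by (simp add: a_def)
    fix e :: real assume "0 < e"
    then have "s - e < Sup T" by (simp add: s_def)
    then obtain t where t: "t \<in> T" "s - e < t" using less_cSupD[of T "s - e"] \<open>0 \<in> T\<close> by blast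
    have "t \<le> s" unfolding s_def by (rule cSup_upper[OF t(1) bdd])
    then have "d (point o' z t) a = s - t" using t(1) s o z by (simp add: a_def T_def point_dist)
    then show "\<exists>p\<in>A. d p a < e" using t by (intro bexI[of _ "point o' z t"]) (auto simp: T_def)
  qed
  moreover have "btw z a b" if b: "b \<in> A" for b
  proof -
    have bM: "b \<in> M" using b A by blast
    have aM: "a \<in> M" "d o' a = s" "d a z = d o' z - s" using a by (auto simp: a_def)
    define m where "m = prod o' z b"
    have m: "0 \<le> m" "m \<le> d o' z" "m \<le> d o' b"
      using prod_le[of o' z b] o z bM triangle[of z o' b] commute[of z o'] by (auto simp: m_def prod_def)
    have "point o' z m = point o' b m" using point_agree[of o' z b m] o z bM m by (simp add: m_def)
    moreover have "point o' b m \<in> A" by (rule convex[OF o(1) b]) (use point[OF o(2) bM m(1,3)] in simp_all)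
    ultimately have "m \<in> T" using m by (simp add: T_def)
    then have "m \<le> s" unfolding s_def by (rule cSup_upper[OF _ bdd])
    moreover have "prod o' a z \<le> prod o' a b \<or> prod o' z b \<le> prod o' a b"
      by (rule prod_trans[OF o(2) aM(1) bM z])
    moreover have "d z b \<le> d z a + d a b" by (rule triangle[OF z aM(1) bM])
    moreover have "d z a = d a z" by (rule commute)
    ultimately show ?thesis using aM m_def by (auto simp: prod_def)
  qed
  ultimately show ?thesis by blast
qed

end

section \<open>Trees covered by lines\<close>

text \<open>
  The argument \<open>p\<close> matters only on \<open>[0, L]\<close>, and two such functions have the same germ iff they
  agree near \<open>0\<close>. This makes germs of geodesics of different lengths comparable.
\<close>

definition germ :: "real \<Rightarrow> (real \<Rightarrow> real \<Rightarrow> bool) \<Rightarrow> (real \<Rightarrow> real \<Rightarrow> bool) set" where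
  "germ L p = {R. \<exists>e>0. e \<le> L \<and> (\<forall>s t. 0 \<le> s \<and> s < t \<and> t \<le> e \<longrightarrow> R s t = p s t)}"

lemma germ_eqI:
  assumes e: "0 < e" "e \<le> L" "e \<le> L'" and agree: "\<And>s t. 0 \<le> s \<Longrightarrow> s < t \<Longrightarrow> t \<le> e \<Longrightarrow> p s t = p' s t"
  shows "germ L p = germ L' p'"
proof -
  have "R \<in> germ L' p'" if "R \<in> germ L p" "e \<le> L'" "\<And>s t. 0 \<le> s \<Longrightarrow> s < t \<Longrightarrow> t \<le> e \<Longrightarrow> p s t = p' s t" for R L p L' p'
  proof -
    obtain e' where e': "e' > 0" "\<And>s t. 0 \<le> s \<Longrightarrow> s < t \<Longrightarrow> t \<le> e' \<Longrightarrow> R s t = p s t"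
      using \<open>R \<in> germ L p\<close> unfolding germ_def by blast
    show ?thesis unfolding germ_def
    proof (intro CollectI exI[of _ "min e e'"] conjI allI impI)
      fix s t assume "0 \<le> s \<and> s < t \<and> t \<le> min e e'"
      then show "R s t = p' s t" using e'(2)[of s t] that(3)[of s t] by simp
    qed (use e e'(1) that(2) in auto)
  qed
  from this[of _ L p L' p'] this[of _ L' p' L p] e agree show ?thesis by blast
qed

lemma germ_eqD:
  assumes "germ L p = germ L' p'" "0 < L"
  shows "\<exists>e>0. e \<le> L \<and> e \<le> L' \<and> (\<forall>s t. 0 \<le> s \<and> s < t \<and> t \<le> e \<longrightarrow> p s t = p' s t)"
proof -
  have "p \<in> germ L p" using assms(2) by (auto simp: germ_def)
  then have "p \<in> germ L' p'" using assms(1) by simp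
  then obtain e where "e > 0" "e \<le> L'" "\<forall>s t. 0 \<le> s \<and> s < t \<and> t \<le> e \<longrightarrow> p s t = p' s t"
    unfolding germ_def by (elim CollectE exE conjE)
  then show ?thesis using assms(2) by (intro exI[of _ "min e L"]) auto
qed

locale piece_tree = rtree +
  fixes \<P> :: "'a set set"
  assumes piece_line: "P \<in> \<P> \<Longrightarrow> \<exists>g. range g = P \<and> P \<subseteq> M \<and> (\<forall>s t :: real. d (g s) (g t) = \<bar>s - t\<bar>)"
    and piece_cover: "a \<in> M \<Longrightarrow> \<exists>P\<in>\<P>. a \<in> P"
    and piece_inter: "P \<in> \<P> \<Longrightarrow> Q \<in> \<P> \<Longrightarrow> a \<in> P \<Longrightarrow> a \<in> Q \<Longrightarrow> b \<in> P \<Longrightarrow> b \<in> Q \<Longrightarrow> a \<noteq> b \<Longrightarrow> P = Q"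
begin

definition col :: "'a \<Rightarrow> 'a \<Rightarrow> bool" where
  "col a b \<longleftrightarrow> (\<exists>P\<in>\<P>. a \<in> P \<and> b \<in> P)"

lemma col_commute: "col a b \<longleftrightarrow> col b a"
  by (auto simp: col_def)

lemma col_refl: "a \<in> M \<Longrightarrow> col a a"
  using piece_cover by (auto simp: col_def)

lemma piece_subset: "P \<in> \<P> \<Longrightarrow> P \<subseteq> M"
  using piece_line by blast

lemma piece_convex:
  assumes "P \<in> \<P>" "a \<in> P" "b \<in> P" "p \<in> M" "btw a p b"
  shows "p \<in> P"
proof -
  obtain g where g: "range g = P" "P \<subseteq> M" "\<And>s t :: real. d (g s) (g t) = \<bar>s - t\<bar>"
    using piece_line[OF assms(1)] by blast
  obtain s t where "a = g s" "b = g t" using assms(2,3) g(1) by blast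
  then show ?thesis using line_convex[of g p s t] g assms by auto
qed

lemma piece_closed:
  assumes "P \<in> \<P>" "q \<in> M" "\<And>e. 0 < e \<Longrightarrow> \<exists>p\<in>P. d p q < e"
  shows "q \<in> P"
proof -
  obtain g where g: "range g = P" "P \<subseteq> M" "\<And>s t :: real. d (g s) (g t) = \<bar>s - t\<bar>"
    using piece_line[OF assms(1)] by blast
  then show ?thesis using line_closed[of g q] assms by blast
qed

definition toward :: "'a set \<Rightarrow> 'a \<Rightarrow> 'a \<Rightarrow> bool" where
  "toward P a b \<longleftrightarrow> P \<in> \<P> \<and> a \<in> P \<and> (\<exists>q\<in>P. same_dir a q b)"

lemma toward_same_dir:
  assumes "a \<in> M" "b \<in> M" "c \<in> M" "same_dir a b c" "toward P a b"
  shows "toward P a c"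
proof -
  obtain q where q: "q \<in> P" "same_dir a q b" "P \<in> \<P>" "a \<in> P" using assms(5) by (auto simp: toward_def)
  then have "same_dir a q c" using same_dir_trans[of a q c b] assms piece_subset by blast
  then show ?thesis using q by (auto simp: toward_def)
qed

lemma toward_initial:
  assumes "a \<in> M" "b \<in> M" "toward P a b"
  shows "\<exists>e>0. e \<le> d a b \<and> (\<forall>s. 0 \<le> s \<and> s \<le> e \<longrightarrow> point a b s \<in> P)"
proof -
  obtain q where q: "q \<in> P" "same_dir a q b" "P \<in> \<P>" "a \<in> P" using assms(3) by (auto simp: toward_def)
  have qM: "q \<in> M" using q piece_subset by blast
  have "point a b s \<in> P" if "0 \<le> s" "s \<le> prod a q b" for s
  proof -
    have "s \<le> d a q" using prod_le(1)[OF assms(1) qM assms(2)] that by simp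
    then have "point a q s \<in> P" 
      using point[OF assms(1) qM that(1)] by (intro piece_convex[OF q(3,4,1)]) auto
    then show ?thesis using point_agree[OF assms(1) qM assms(2) that] by simp
  qed
  then show ?thesis using q(2) prod_le(2)[OF assms(1) qM assms(2)] by (auto simp: same_dir_prod)
qed

lemma towardI:
  assumes "a \<in> M" "b \<in> M" "P \<in> \<P>" "a \<in> P" "0 < s" "s \<le> d a b" "point a b s \<in> P"
  shows "toward P a b"
proof -
  have "point a b s \<noteq> a" using point(2)[of a b s] assms by auto
  then have "same_dir a (point a b s) b" using point[of a b s] assms by (intro btw_same_dir) auto
  then show ?thesis using assms by (auto simp: toward_def)
qed

lemma toward_unique:
  assumes "a \<in> M" "b \<in> M" "toward P a b" "toward Q a b"
  shows "P = Q"
proof -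
  obtain e where e: "e > 0" "e \<le> d a b" "\<And>s. 0 \<le> s \<Longrightarrow> s \<le> e \<Longrightarrow> point a b s \<in> P"
    using toward_initial[OF assms(1-3)] by blast
  obtain e' where e': "e' > 0" "e' \<le> d a b" "\<And>s. 0 \<le> s \<Longrightarrow> s \<le> e' \<Longrightarrow> point a b s \<in> Q"
    using toward_initial[OF assms(1,2,4)] by blast
  define s where "s = min e e'"
  have s: "0 < s" "s \<le> e" "s \<le> e'" using e e' by (auto simp: s_def)
  have "point a b s \<noteq> a" using point(2)[of a b s] assms s e by auto
  moreover have "point a b s \<in> P" "point a b s \<in> Q" using e(3) e'(3) s by auto
  ultimately show ?thesis using assms(3,4) piece_inter[of P Q a "point a b s"] by (auto simp: toward_def)
qed

text \<open>
  A partial isomorphism that is defined at \<open>a\<close> and along one half of a piece through \<open>a\<close> leaves no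
  choice for the other half. This is why both directions of a piece form a single unit, whereas any
  other direction is a unit by itself.
\<close>

definition unit :: "'a \<Rightarrow> 'a \<Rightarrow> 'a set" where
  "unit a b = (if \<exists>P. toward P a b then THE P. toward P a b else {c \<in> M. same_dir a b c})"

definition units :: "'a \<Rightarrow> 'a set set" where
  "units a = unit a ` (M - {a})"

definition type_at :: "'a \<Rightarrow> 'a \<Rightarrow> (real \<Rightarrow> real \<Rightarrow> bool) set" where
  "type_at a b = germ (d a b) (\<lambda>s t. col (point a b s) (point a b t))"

lemma unit_toward:
  assumes "a \<in> M" "b \<in> M" "toward P a b"
  shows "unit a b = P"
proof -
  have "(THE P. toward P a b) = P"
    using assms(3) by (rule the_equality) (rule toward_unique[OF assms(1,2) _ assms(3)])
  moreover have "\<exists>P. toward P a b" using assms(3) by (rule exI)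
  ultimately show ?thesis unfolding unit_def by simp
qed

lemma unit_same_dir:
  assumes "a \<in> M" "b \<in> M" "c \<in> M" "same_dir a b c"
  shows "unit a b = unit a c"
proof (cases "\<exists>P. toward P a b")
  case True
  then obtain P where "toward P a b" by blast
  then show ?thesis using toward_same_dir[OF assms] unit_toward assms(1-3) by metis
next
  case False
  then have F: "\<not> (\<exists>P. toward P a c)"
    using toward_same_dir[OF assms(1,3,2) same_dir_sym[OF assms(4)]] by blast
  have "same_dir a b e \<longleftrightarrow> same_dir a c e" if "e \<in> M" for e
    using that assms same_dir_sym same_dir_trans by meson
  then have "{e \<in> M. same_dir a b e} = {e \<in> M. same_dir a c e}" by blast
  then show ?thesis using False F by (simp add: unit_def)
qed

lemma unit_eq_iff:
  assumes "a \<in> M" "b \<in> M" "c \<in> M" "b \<noteq> a" "c \<noteq> a"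
  shows "unit a b = unit a c \<longleftrightarrow> same_dir a b c \<or> (\<exists>P. toward P a b \<and> toward P a c)"
proof
  assume eq: "unit a b = unit a c"
  have *: "\<not> unit a x = unit a y" if "toward P a x" "\<not> (\<exists>Q. toward Q a y)" "x \<in> M" "y \<in> M" for P x y
  proof -
    have "unit a x = P" "a \<in> P" using unit_toward that assms(1) by (auto simp: toward_def)
    moreover have "a \<notin> unit a y" using that commute[of a y] assms(1) by (auto simp: unit_def same_dir_def)
    ultimately show ?thesis by auto
  qed
  show "same_dir a b c \<or> (\<exists>P. toward P a b \<and> toward P a c)"
  proof (cases "\<exists>P. toward P a b")
    case True
    then obtain P where P: "toward P a b" by blast
    then obtain Q where Q: "toward Q a c" using *[OF P _ assms(2,3)] eq by blast
    have "P = Q" using P Q unit_toward eq assms by metis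
    then show ?thesis using P Q by blast
  next
    case False
    then have "\<not> (\<exists>P. toward P a c)" using *[of _ c b] eq assms(2,3) by metis
    then have "{e \<in> M. same_dir a b e} = {e \<in> M. same_dir a c e}" using False eq by (simp add: unit_def)
    moreover have "same_dir a c c" using same_dir_refl assms by auto
    ultimately show ?thesis using assms(3) by blast
  qed
next
  assume "same_dir a b c \<or> (\<exists>P. toward P a b \<and> toward P a c)"
  then show "unit a b = unit a c" using unit_same_dir unit_toward assms by metis
qed

lemma unit_eq_iff_col:
  assumes "a \<in> M" "b \<in> M" "c \<in> M" "b \<noteq> a" "c \<noteq> a"
  shows "unit a b = unit a c \<longleftrightarrow>
    same_dir a b c \<or> (\<exists>e>0. e \<le> d a b \<and> e \<le> d a c \<and> col (point a b e) (point a c e))"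
proof (cases "same_dir a b c")
  case True then show ?thesis using unit_same_dir assms by auto
next
  case False
  have "(\<exists>P. toward P a b \<and> toward P a c) \<longleftrightarrow>
      (\<exists>e>0. e \<le> d a b \<and> e \<le> d a c \<and> col (point a b e) (point a c e))" (is "?L \<longleftrightarrow> ?R")
  proof
    assume ?L
    then obtain P where P: "toward P a b" "toward P a c" by blast
    obtain e where e: "e > 0" "e \<le> d a b" "\<And>s. 0 \<le> s \<Longrightarrow> s \<le> e \<Longrightarrow> point a b s \<in> P"
      using toward_initial[OF assms(1,2) P(1)] by blast
    obtain e' where e': "e' > 0" "e' \<le> d a c" "\<And>s. 0 \<le> s \<Longrightarrow> s \<le> e' \<Longrightarrow> point a c s \<in> P"
      using toward_initial[OF assms(1,3) P(2)] by blast
    have "point a b (min e e') \<in> P" "point a c (min e e') \<in> P" using e e' by auto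
    then have "col (point a b (min e e')) (point a c (min e e'))" using P(1) by (auto simp: col_def toward_def)
    then show ?R using e(1,2) e'(1,2) by (intro exI[of _ "min e e'"]) auto
  next
    assume ?R
    then obtain e P where e: "e > 0" "e \<le> d a b" "e \<le> d a c" and P: "P \<in> \<P>" "point a b e \<in> P" "point a c e \<in> P"
      by (auto simp: col_def)
    have e0: "0 \<le> e" using e by simp
    note p = point[OF assms(1,2) e0 e(2)] and q = point[OF assms(1,3) e0 e(3)]
    have bc: "btw b a c" using False not_same_dir[OF assms(1-3)] by simp
    have "d b c \<le> d b (point a b e) + d (point a b e) (point a c e) + d (point a c e) c"
      using triangle[of b "point a b e" c] triangle[of "point a b e" "point a c e" c] assms p q by linarith
    moreover have "d (point a b e) (point a c e) \<le> d (point a b e) a + d a (point a c e)"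
      by (rule triangle[OF p(1) assms(1) q(1)])
    ultimately have "btw (point a b e) a (point a c e)"
      using p q bc commute[of a b] commute[of b "point a b e"] commute[of a "point a b e"] by linarith
    then have "a \<in> P" by (rule piece_convex[OF P assms(1)])
    then show ?L using towardI[OF assms(1,2) P(1) _ e(1,2) P(2)] towardI[OF assms(1,3) P(1) _ e(1,3) P(3)] by blast
  qed
  then show ?thesis using unit_eq_iff[OF assms] False by blast
qed

lemma type_at_cong:
  assumes "a \<in> M" "b \<in> M" "c \<in> M" "b \<noteq> a" "c \<noteq> a" "unit a b = unit a c"
  shows "type_at a b = type_at a c"
proof -
  from unit_eq_iff[OF assms(1-5)] assms(6)
  consider "same_dir a b c" | P where "toward P a b" "toward P a c" by blast
  then show ?thesis
  proof cases
    case 1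
    then show ?thesis unfolding type_at_def
      using prod_le[OF assms(1-3)] point_agree[OF assms(1-3)]
      by (intro germ_eqI[of "prod a b c"]) (auto simp: same_dir_prod)
  next
    case 2
    obtain e where e: "e > 0" "e \<le> d a b" "\<And>s. 0 \<le> s \<Longrightarrow> s \<le> e \<Longrightarrow> point a b s \<in> P"
      using toward_initial[OF assms(1,2) 2(1)] by blast
    obtain e' where e': "e' > 0" "e' \<le> d a c" "\<And>s. 0 \<le> s \<Longrightarrow> s \<le> e' \<Longrightarrow> point a c s \<in> P"
      using toward_initial[OF assms(1,3) 2(2)] by blast
    have P: "P \<in> \<P>" using 2 by (simp add: toward_def)
    show ?thesis unfolding type_at_def
    proof (rule germ_eqI[of "min e e'"])
      fix s t :: real assume st: "0 \<le> s" "s < t" "t \<le> min e e'"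
      have "col (point a b s) (point a b t)" unfolding col_def by (rule bexI[OF _ P]) (use e(3) st in auto)
      moreover have "col (point a c s) (point a c t)" unfolding col_def by (rule bexI[OF _ P]) (use e'(3) st in auto)
      ultimately show "col (point a b s) (point a b t) = col (point a c s) (point a c t)" by simp
    qed (use e e' in auto)
  qed
qed

end

section \<open>Universal trees\<close>

text \<open>
  These are the properties of collinearity along a geodesic ray: pieces are convex, two of them share
  at most one point, and they are closed.
\<close>

definition pattern :: "(real \<Rightarrow> real \<Rightarrow> bool) \<Rightarrow> bool" where
  "pattern R \<longleftrightarrow>
     (\<forall>s t s' t'. R s t \<and> s \<le> s' \<and> s' < t' \<and> t' \<le> t \<longrightarrow> R s' t') \<and>
     (\<forall>s t s' t'. R s t \<and> R s' t' \<and> s \<le> s' \<and> s' < t \<and> t \<le> t' \<longrightarrow> R s t') \<and>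
     (\<forall>s t. s < t \<and> (\<forall>e>0. 2 * e < t - s \<longrightarrow> R (s + e) (t - e)) \<longrightarrow> R s t)"

text \<open>
  Every pattern occurs at every point, and does so on continuum many rays that pairwise meet only at
  their origin. Conversely there are no more than continuum many directions at a point. These two
  bounds determine the number of directions of each type.
\<close>

locale universal_tree = piece_tree +
  assumes nonempty: "M \<noteq> {}"
    and complete: mcomplete
    and valency: "a \<in> M \<Longrightarrow> (\<lambda>b. {c \<in> M. same_dir a b c}) ` (M - {a}) \<lesssim> (UNIV :: real set)"
    and rays: "x \<in> M \<Longrightarrow> pattern R \<Longrightarrow> \<exists>g :: (nat \<Rightarrow> bool) \<Rightarrow> real \<Rightarrow> 'a.
      (\<forall>f. g f 0 = x \<and> (\<forall>t\<ge>0. g f t \<in> M) \<and> (\<forall>s\<ge>0. \<forall>t\<ge>0. d (g f s) (g f t) = \<bar>s - t\<bar>) \<and>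
           (\<forall>s t. 0 \<le> s \<and> s < t \<longrightarrow> (col (g f s) (g f t) \<longleftrightarrow> R s t))) \<and>
      (\<forall>f f' s s'. f \<noteq> f' \<and> 0 < s \<and> 0 < s' \<longrightarrow> g f s \<noteq> g f' s')"

context piece_tree
begin

lemma col_through:
  assumes "a \<in> M" "b \<in> M" "c \<in> M" "b \<noteq> a" "c \<noteq> a" "btw b a c"
  shows "col b c \<longleftrightarrow> col b a \<and> col a c \<and> unit a b = unit a c"
proof
  assume "col b c"
  then obtain P where P: "P \<in> \<P>" "b \<in> P" "c \<in> P" by (auto simp: col_def)
  then have aP: "a \<in> P" by (rule piece_convex[OF _ _ _ assms(1,6)])
  have "toward P a b" "toward P a c"
    using P aP same_dir_refl assms(1-5) unfolding toward_def by metis+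
  then have "unit a b = P" "unit a c = P" using unit_toward assms(1-3) by auto
  then show "col b a \<and> col a c \<and> unit a b = unit a c" using P aP by (auto simp: col_def)
next
  assume *: "col b a \<and> col a c \<and> unit a b = unit a c"
  then obtain P Q where PQ: "P \<in> \<P>" "b \<in> P" "a \<in> P" "Q \<in> \<P>" "a \<in> Q" "c \<in> Q" by (auto simp: col_def)
  have "toward P a b" "toward Q a c"
    using PQ same_dir_refl assms(1-5) unfolding toward_def by metis+
  then have "P = Q" using unit_toward assms(1-3) * by metis
  then show "col b c" using PQ by (auto simp: col_def)
qed

lemma toward_opposite:
  assumes "a \<in> M" "b \<in> M" "toward P a b"
  shows "\<exists>c\<in>P. toward P a c \<and> \<not> same_dir a b c \<and> c \<noteq> a"
proof -
  obtain q where q: "q \<in> P" "same_dir a q b" "P \<in> \<P>" "a \<in> P" using assms(3) by (auto simp: toward_def)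
  obtain g where g: "range g = P" "P \<subseteq> M" "\<And>s t :: real. d (g s) (g t) = \<bar>s - t\<bar>"
    using piece_line[OF q(3)] by blast
  obtain t0 t1 where t: "a = g t0" "q = g t1" using q g(1) by blast
  have qM: "q \<in> M" using q(1) g(2) by blast
  have ne: "q \<noteq> a" using same_dir_neq[OF assms(1) qM assms(2) q(2)] by simp
  define c where "c = g (2 * t0 - t1)"
  have cP: "c \<in> P" using g(1) by (auto simp: c_def)
  then have cM: "c \<in> M" using g(2) by blast
  have dist: "d a q = \<bar>t0 - t1\<bar>" "d a c = \<bar>t0 - t1\<bar>" "d q c = 2 * \<bar>t0 - t1\<bar>"
    unfolding t c_def g(3) by (simp_all add: abs_if)
  have "t0 \<noteq> t1" using ne unfolding t by blast
  then have "d a c \<noteq> 0" unfolding dist by simp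
  then have ca: "c \<noteq> a" using mdist_zero[OF assms(1)] by blast
  have "\<not> same_dir a q c" unfolding same_dir_def dist by simp
  then have "\<not> same_dir a b c" using same_dir_trans[OF assms(1) qM cM assms(2) q(2)] by blast
  moreover have "toward P a c" unfolding toward_def
    using q(3,4) cP same_dir_refl[OF assms(1) cM ca[symmetric]] by blast
  ultimately show ?thesis using cP ca by blast
qed

lemma line_two_sides:
  assumes "a \<in> M" "x \<in> M" "y \<in> M" "z \<in> M" "toward P a x" "toward P a y" "toward P a z"
  shows "same_dir a x y \<or> same_dir a y z \<or> same_dir a x z"
proof -
  obtain p q r where pqr: "p \<in> P" "same_dir a p x" "q \<in> P" "same_dir a q y" "r \<in> P" "same_dir a r z" "P \<in> \<P>" "a \<in> P"
    using assms(5-7) by (auto simp: toward_def)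
  obtain g where g: "range g = P" "P \<subseteq> M" "\<And>s t :: real. d (g s) (g t) = \<bar>s - t\<bar>"
    using piece_line[OF pqr(7)] by blast
  obtain t0 t1 t2 t3 where t: "a = g t0" "p = g t1" "q = g t2" "r = g t3" using pqr g(1) by blast
  have M: "p \<in> M" "q \<in> M" "r \<in> M" using pqr g(2) by auto
  have "p \<noteq> a" "q \<noteq> a" "r \<noteq> a"
    using same_dir_neq[OF assms(1) M(1) assms(2) pqr(2)] same_dir_neq[OF assms(1) M(2) assms(3) pqr(4)]
      same_dir_neq[OF assms(1) M(3) assms(4) pqr(6)] by auto
  then have ne: "t1 \<noteq> t0" "t2 \<noteq> t0" "t3 \<noteq> t0" using t by auto
  have "same_dir a p q \<or> same_dir a q r \<or> same_dir a p r"
    using ne unfolding t same_dir_def g(3) by linarith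
  then show ?thesis
    using same_dir_trans[OF assms(1)] same_dir_sym pqr(2,4,6) M assms(2-4) by meson
qed

text \<open>
  Collinearity with \<open>b\<close> passes to the limit: the points of the geodesic close to \<open>p\<close> all lie in the
  piece that contains \<open>b\<close> and the midpoint, and pieces are closed.
\<close>

lemma col_limit:
  assumes "b \<in> M" "p \<in> M" "b \<noteq> p"
  shows "col b p \<longleftrightarrow> (\<forall>s. 0 < s \<and> s < d b p \<longrightarrow> col b (point b p s))"
proof
  assume "col b p"
  then obtain P where P: "P \<in> \<P>" "b \<in> P" "p \<in> P" by (auto simp: col_def)
  show "\<forall>s. 0 < s \<and> s < d b p \<longrightarrow> col b (point b p s)"
  proof (intro allI impI)
    fix s assume s: "0 < s \<and> s < d b p"
    have "point b p s \<in> P" using point[OF assms(1,2), of s] s by (intro piece_convex[OF P]) auto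
    then show "col b (point b p s)" using P by (auto simp: col_def)
  qed
next
  assume *: "\<forall>s. 0 < s \<and> s < d b p \<longrightarrow> col b (point b p s)"
  have D: "0 < d b p" using assms mdist_pos_less by blast
  define h where "h = d b p / 2"
  have h: "0 < h" "h < d b p" using D by (auto simp: h_def)
  obtain P where P: "P \<in> \<P>" "b \<in> P" "point b p h \<in> P" using * h by (auto simp: col_def)
  have all: "point b p s \<in> P" if s: "h \<le> s" "s < d b p" for s
  proof -
    have s0: "0 \<le> s" "s \<le> d b p" "0 < s" using s h by auto
    obtain Q where Q: "Q \<in> \<P>" "b \<in> Q" "point b p s \<in> Q" using * s s0 by (auto simp: col_def)
    note pt = point_dist[OF assms(1,2), of h s]
    have "point b p h \<in> Q"
      using point(1)[OF assms(1,2), of h] pt h s by (intro piece_convex[OF Q]) auto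
    moreover have "point b p h \<noteq> b" using point(2)[OF assms(1,2), of h] h assms by auto
    ultimately have "P = Q" using piece_inter[OF P(1) Q(1), of b "point b p h"] P Q by auto
    then show ?thesis using Q by simp
  qed
  have "p \<in> P"
  proof (rule piece_closed[OF P(1) assms(2)])
    fix e :: real assume "0 < e"
    define s where "s = max h (d b p - e / 2)"
    have s: "h \<le> s" "s < d b p" "d b p - s < e" using h \<open>0 < e\<close> by (auto simp: s_def)
    then show "\<exists>q\<in>P. d q p < e"
      using all[OF s(1,2)] point(3)[OF assms(1,2), of s] h by (intro bexI[of _ "point b p s"]) auto
  qed
  then show "col b p" using P by (auto simp: col_def)
qed

text \<open>
  The parameters outside the segment are declared to be unrelated, so that a segment gives a pattern
  on all of \<open>\<real>\<close>.
\<close>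

lemma pattern_segment:
  assumes "a \<in> M" "b \<in> M"
  shows "pattern (\<lambda>s t. 0 \<le> s \<and> s < t \<and> t \<le> d a b \<and> col (point a b s) (point a b t))"
    (is "pattern ?R")
proof -
  define g where "g = point a b"
  have gM: "g s \<in> M" if "0 \<le> s" "s \<le> d a b" for s using point(1)[OF assms that] by (simp add: g_def)
  have gd: "d (g s) (g t) = t - s" if "0 \<le> s" "s \<le> t" "t \<le> d a b" for s t
    using point_dist(1)[OF assms that] by (simp add: g_def)
  have conv: "g s' \<in> P" if "P \<in> \<P>" "g s \<in> P" "g t \<in> P" "0 \<le> s" "s \<le> s'" "s' \<le> t" "t \<le> d a b" for s t s' P
    using that gd[of s s'] gd[of s' t] gd[of s t] gM[of s'] by (intro piece_convex[OF that(1-3)]) auto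
  have ne: "g s \<noteq> g t" if "0 \<le> s" "s < t" "t \<le> d a b" for s t
    using gd[of s t] gM[of s] that by auto
  show ?thesis unfolding pattern_def g_def[symmetric]
  proof (intro conjI allI impI; (elim conjE)?)
    fix s t s' t' assume *: "col (g s) (g t)" "s \<le> s'" "s' < t'" "t' \<le> t" "0 \<le> s" "t \<le> d a b"
    then show "0 \<le> s'" "t' \<le> d a b" "s' < t'" by auto
    obtain P where P: "P \<in> \<P>" "g s \<in> P" "g t \<in> P" using * by (auto simp: col_def)
    have "g s' \<in> P" "g t' \<in> P" using conv[OF P, of s'] conv[OF P, of t'] * by auto
    then show "col (g s') (g t')" using P by (auto simp: col_def)
  next
    fix s t s' t' assume *: "col (g s) (g t)" "col (g s') (g t')" "s \<le> s'" "s' < t" "t \<le> t'" "0 \<le> s" "t' \<le> d a b"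
    then show "0 \<le> s" "s < t'" "t' \<le> d a b" by auto
    obtain P where P: "P \<in> \<P>" "g s \<in> P" "g t \<in> P" using * by (auto simp: col_def)
    obtain Q where Q: "Q \<in> \<P>" "g s' \<in> Q" "g t' \<in> Q" using * by (auto simp: col_def)
    have "g s' \<in> P" using conv[OF P, of s'] * by auto
    moreover have "g t \<in> Q" using conv[OF Q, of t] * by auto
    ultimately have "P = Q" using piece_inter[OF P(1) Q(1), of "g s'" "g t"] ne[of s' t] P Q * by auto
    then show "col (g s) (g t')" using P Q by (auto simp: col_def)
  next
    fix s t :: real
    assume st: "s < t" and all: "\<forall>e>0. 2 * e < t - s \<longrightarrow> 0 \<le> s + e \<and> s + e < t - e \<and> t - e \<le> d a b \<and> col (g (s + e)) (g (t - e))"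
    show s0: "0 \<le> s"
    proof (rule ccontr)
      assume "\<not> 0 \<le> s"
      define e where "e = min ((t - s) / 3) (- s / 2)"
      have e1: "e \<le> (t - s) / 3" unfolding e_def by (rule min.cobounded1)
      have e2: "e \<le> - s / 2" unfolding e_def by (rule min.cobounded2)
      have e3: "0 < e" using st \<open>\<not> 0 \<le> s\<close> by (simp add: e_def)
      have e: "0 < e" "2 * e < t - s" "s + e < 0" using e1 e2 e3 st \<open>\<not> 0 \<le> s\<close> by simp_all
      then have "0 \<le> s + e" using all by blast
      then show False using e(3) by linarith
    qed
    show t0: "t \<le> d a b"
    proof (rule ccontr)
      assume "\<not> t \<le> d a b"
      define e where "e = min ((t - s) / 3) ((t - d a b) / 2)"
      have e1: "e \<le> (t - s) / 3" unfolding e_def by (rule min.cobounded1)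
      have e2: "e \<le> (t - d a b) / 2" unfolding e_def by (rule min.cobounded2)
      have e3: "0 < e" using st \<open>\<not> t \<le> d a b\<close> by (simp add: e_def)
      have e: "0 < e" "2 * e < t - s" "d a b < t - e" using e1 e2 e3 st \<open>\<not> t \<le> d a b\<close> by simp_all
      then have "t - e \<le> d a b" using all by blast
      then show False using e(3) by linarith
    qed
    show "s < t" by fact
    define h where "h = (t - s) / 4"
    have h: "0 < h" "2 * h < t - s" using st by (auto simp: h_def)
    obtain P where P: "P \<in> \<P>" "g (s + h) \<in> P" "g (t - h) \<in> P" using all h by (auto simp: col_def)
    have near: "g (s + e) \<in> P \<and> g (t - e) \<in> P" if e: "0 < e" "e \<le> h" for e
    proof -
      obtain Q where Q: "Q \<in> \<P>" "g (s + e) \<in> Q" "g (t - e) \<in> Q" using all e h by (auto simp: col_def)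
      have "g (s + h) \<in> Q" using conv[OF Q, of "s + h"] e h s0 t0 by auto
      moreover have "g (t - h) \<in> Q" using conv[OF Q, of "t - h"] e h s0 t0 by auto
      moreover have "g (s + h) \<noteq> g (t - h)" using ne[of "s + h" "t - h"] h s0 t0 by auto
      ultimately have "P = Q" using piece_inter[OF P(1) Q(1), of "g (s + h)" "g (t - h)"] P by auto
      then show ?thesis using Q by simp
    qed
    have "g s \<in> P"
    proof (rule piece_closed[OF P(1)])
      show "g s \<in> M" using gM s0 t0 st by auto
      fix e :: real assume "0 < e"
      define u where "u = min h (e / 2)"
      have u: "0 < u" "u \<le> h" "u < e" using h \<open>0 < e\<close> by (auto simp: u_def)
      have "d (g (s + u)) (g s) = u" using gd[of s "s + u"] commute[of "g s"] u h s0 t0 by auto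
      then show "\<exists>p\<in>P. d p (g s) < e" using near[OF u(1,2)] u(3) by (intro bexI[of _ "g (s + u)"]) auto
    qed
    moreover have "g t \<in> P"
    proof (rule piece_closed[OF P(1)])
      show "g t \<in> M" using gM s0 t0 st by auto
      fix e :: real assume "0 < e"
      define u where "u = min h (e / 2)"
      have u: "0 < u" "u \<le> h" "u < e" using h \<open>0 < e\<close> by (auto simp: u_def)
      have "d (g (t - u)) (g t) = u" using gd[of "t - u" t] u h s0 t0 by auto
      then show "\<exists>p\<in>P. d p (g t) < e" using near[OF u(1,2)] u(3) by (intro bexI[of _ "g (t - u)"]) auto
    qed
    ultimately show "col (g s) (g t)" using P by (auto simp: col_def)
  qed
qed

definition unit_type :: "'a \<Rightarrow> 'a set \<Rightarrow> (real \<Rightarrow> real \<Rightarrow> bool) set" where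
  "unit_type a U = type_at a (SOME b. b \<in> M \<and> b \<noteq> a \<and> unit a b = U)"

lemma unit_type_unit:
  assumes "a \<in> M" "b \<in> M" "b \<noteq> a"
  shows "unit_type a (unit a b) = type_at a b"
proof -
  define c where "c = (SOME c. c \<in> M \<and> c \<noteq> a \<and> unit a c = unit a b)"
  have "c \<in> M \<and> c \<noteq> a \<and> unit a c = unit a b"
    unfolding c_def by (rule someI[of _ b]) (use assms in simp)
  then show ?thesis
    using type_at_cong[of a c b] assms by (simp add: unit_type_def c_def[symmetric])
qed

lemma unit_in_units: "b \<in> M \<Longrightarrow> b \<noteq> a \<Longrightarrow> unit a b \<in> units a"
  by (simp add: units_def)

lemma unit_type_pattern:
  assumes "a \<in> M" "U \<in> units a"
  shows "\<exists>L>0. \<exists>R. pattern R \<and> unit_type a U = germ L R"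
proof -
  obtain b where b: "b \<in> M" "b \<noteq> a" "U = unit a b" using assms(2) by (auto simp: units_def)
  have L: "0 < d a b" using mdist_pos_less[OF b(2)[symmetric] assms(1) b(1)] .
  have "type_at a b = germ (d a b) (\<lambda>s t. 0 \<le> s \<and> s < t \<and> t \<le> d a b \<and> col (point a b s) (point a b t))"
    unfolding type_at_def by (rule germ_eqI[OF L]) auto
  then show ?thesis
    using L pattern_segment[OF assms(1) b(1)] unit_type_unit[OF assms(1) b(1,2)] b(3) by auto
qed

end

lemma lepoll_image_finite_fibers:
  assumes "infinite A" "\<And>y. finite {x \<in> A. f x = y}"
  shows "A \<lesssim> f ` A"
proof -
  have inf: "infinite (f ` A)"
  proof
    assume "finite (f ` A)"
    moreover have "A = (\<Union>y\<in>f ` A. {x \<in> A. f x = y})" by auto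
    ultimately show False using assms by (metis (no_types, lifting) finite_UN_I)
  qed
  have conv: "X \<lesssim> Y \<longleftrightarrow> (card_of X, card_of Y) \<in> ordLeq" for X :: "'c set" and Y :: "'e set"
    by (simp add: lepoll_def card_of_ordLeq)
  have "(card_of (\<Union>y\<in>f ` A. {x \<in> A. f x = y}), card_of (f ` A)) \<in> ordLeq"
  proof (rule card_of_UNION_ordLeq_infinite[OF inf], unfold conv[symmetric])
    show "f ` A \<lesssim> f ` A" by (rule lepoll_refl)
    show "\<forall>y\<in>f ` A. {x \<in> A. f x = y} \<lesssim> f ` A" using finite_lepoll_infinite[OF inf assms(2)] by blast
  qed
  moreover have "(\<Union>y\<in>f ` A. {x \<in> A. f x = y}) = A" by auto
  ultimately have "(card_of A, card_of (f ` A)) \<in> ordLeq" by simp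
  then show ?thesis by (simp add: lepoll_def card_of_ordLeq)
qed

lemma sequences_eqpoll_reals: "(UNIV :: (nat \<Rightarrow> bool) set) \<approx> (UNIV :: real set)"
proof -
  have "bij_betw (Collect :: (nat \<Rightarrow> bool) \<Rightarrow> nat set) UNIV UNIV"
    by (rule bij_betw_byWitness[of _ "\<lambda>A x. x \<in> A"]) auto
  then have "(UNIV :: (nat \<Rightarrow> bool) set) \<approx> (UNIV :: nat set set)" by (auto simp: eqpoll_def)
  then show ?thesis using nat_sets_eqpoll_reals by (rule eqpoll_trans)
qed

lemma finite_if_no_three:
  assumes "\<And>x y z. x \<in> A \<Longrightarrow> y \<in> A \<Longrightarrow> z \<in> A \<Longrightarrow> x = y \<or> y = z \<or> x = z"
  shows "finite A"
proof (rule ccontr)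
  assume "infinite A"
  then obtain B where B: "B \<subseteq> A" "card B = 3" "finite B" using infinite_arbitrarily_large by metis
  then obtain x y z where "B = {x, y, z}" "x \<noteq> y" "y \<noteq> z" "x \<noteq> z" by (auto simp: card_3_iff)
  then show False using assms[of x y z] B(1) by auto
qed

text \<open>
  By the valency bound there are at most continuum many units. A germ that occurs anywhere occurs
  continuum many times, since it is realized by a family of rays that pairwise have only their
  origin in common, and a unit contains at most two of these.
\<close>

lemma (in universal_tree) units_of_type:
  assumes a: "a \<in> M" and L: "0 < L" and R: "pattern R"
  shows "{U \<in> units a. unit_type a U = germ L R} \<approx> (UNIV :: real set)"
proof (rule lepoll_antisym)
  define D where "D b = {c \<in> M. same_dir a b c}" for b
  define rep where "rep U = (SOME b. b \<in> M \<and> b \<noteq> a \<and> unit a b = U)" for U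
  have rep: "rep U \<in> M \<and> rep U \<noteq> a \<and> unit a (rep U) = U" if "U \<in> units a" for U
    unfolding rep_def by (rule someI_ex) (use that in \<open>auto simp: units_def\<close>)
  have "inj_on (\<lambda>U. D (rep U)) (units a)"
  proof (rule inj_onI)
    fix U W assume U: "U \<in> units a" and W: "W \<in> units a" and eq: "D (rep U) = D (rep W)"
    have "rep W \<in> D (rep W)" using rep[OF W] same_dir_refl[OF a] by (auto simp: D_def)
    then have "same_dir a (rep U) (rep W)" unfolding eq[symmetric] by (simp add: D_def)
    then have "unit a (rep U) = unit a (rep W)" using unit_same_dir a rep[OF U] rep[OF W] by blast
    then show "U = W" using rep[OF U] rep[OF W] by simp
  qed
  then have "units a \<lesssim> D ` (M - {a})"
    unfolding lepoll_def using rep by (intro exI[of _ "\<lambda>U. D (rep U)"]) blast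
  also have "D ` (M - {a}) \<lesssim> (UNIV :: real set)" using valency[OF a] by (simp add: D_def[abs_def])
  finally have "units a \<lesssim> (UNIV :: real set)" .
  then show "{U \<in> units a. unit_type a U = germ L R} \<lesssim> (UNIV :: real set)"
    by (rule lepoll_trans[OF subset_imp_lepoll, rotated]) auto
next
  from rays[OF a R] obtain g :: "(nat \<Rightarrow> bool) \<Rightarrow> real \<Rightarrow> 'a" where
    G: "(\<forall>f. g f 0 = a \<and> (\<forall>t\<ge>0. g f t \<in> M) \<and> (\<forall>s\<ge>0. \<forall>t\<ge>0. d (g f s) (g f t) = \<bar>s - t\<bar>) \<and>
           (\<forall>s t. 0 \<le> s \<and> s < t \<longrightarrow> (col (g f s) (g f t) \<longleftrightarrow> R s t))) \<and>
      (\<forall>f f' s s'. f \<noteq> f' \<and> 0 < s \<and> 0 < s' \<longrightarrow> g f s \<noteq> g f' s')" by (rule exE)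
  note G1 = G[THEN conjunct1, rule_format]
  have g0: "g f 0 = a" for f using G1[of f] by (rule conjunct1)
  have gM: "g f t \<in> M" if "0 \<le> t" for f t
    using G1[of f, THEN conjunct2, THEN conjunct1] that by blast
  have gd: "d (g f s) (g f t) = \<bar>s - t\<bar>" if "0 \<le> s" "0 \<le> t" for f s t
    using G1[of f, THEN conjunct2, THEN conjunct2, THEN conjunct1] that by blast
  have gc: "col (g f s) (g f t) \<longleftrightarrow> R s t" if "0 \<le> s" "s < t" for f s t
    using G1[of f, THEN conjunct2, THEN conjunct2, THEN conjunct2] that by blast
  have ge: "g f s \<noteq> g f' s'" if "f \<noteq> f'" "0 < s" "0 < s'" for f f' s s'
    using G[THEN conjunct2] that by blast
  define x where "x f = g f L" for f
  have dx: "d a (x f) = L" for f using gd[of 0 L f] g0 L by (simp add: x_def)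
  have x: "x f \<in> M" "x f \<noteq> a" for f using gM[of L f] dx[of f] L a by (auto simp: x_def)
  have pt: "point a (x f) s = g f s" if "0 \<le> s" "s \<le> L" for f s
    using isometric_ray_point[of "g f" s L] gd gM that g0 by (simp add: x_def)
  have ty: "unit_type a (unit a (x f)) = germ L R" for f
    unfolding unit_type_unit[OF a x] type_at_def dx
    by (rule germ_eqI[OF L]) (simp_all add: pt gc)
  have nd: "\<not> same_dir a (x f) (x f')" if "f \<noteq> f'" for f f'
  proof
    assume "same_dir a (x f) (x f')"
    then have p: "0 < prod a (x f) (x f')" by (simp add: same_dir_prod)
    have le: "prod a (x f) (x f') \<le> L" using prod_le(1)[OF a x(1) x(1), of f f'] dx by simp
    have "point a (x f) (prod a (x f) (x f')) = point a (x f') (prod a (x f) (x f'))"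
      using p by (intro point_agree a x) auto
    then show False using ge[OF that p p] pt p le by auto
  qed
  have fib: "finite {f \<in> UNIV. unit a (x f) = U}" for U
  proof (rule finite_if_no_three)
    fix f f' f'' assume "f \<in> {f \<in> UNIV. unit a (x f) = U}" "f' \<in> {f \<in> UNIV. unit a (x f) = U}" "f'' \<in> {f \<in> UNIV. unit a (x f) = U}"
    then have u: "unit a (x f) = U" "unit a (x f') = U" "unit a (x f'') = U" by auto
    show "f = f' \<or> f' = f'' \<or> f = f''"
    proof (rule ccontr)
      assume "\<not> ?thesis"
      then have n: "f \<noteq> f'" "f' \<noteq> f''" "f \<noteq> f''" by auto
      obtain P where P: "toward P a (x f)" "toward P a (x f')"
        using unit_eq_iff[OF a x(1) x(1) x(2) x(2), of f f'] u nd[OF n(1)] by auto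
      obtain Q where Q: "toward Q a (x f)" "toward Q a (x f'')"
        using unit_eq_iff[OF a x(1) x(1) x(2) x(2), of f f''] u nd[OF n(3)] by auto
      have "P = Q" using toward_unique[OF a x(1) P(1) Q(1)] .
      then show False using line_two_sides[OF a x(1) x(1) x(1) P] Q(2) nd n by blast
    qed
  qed
  have "infinite (UNIV :: (nat \<Rightarrow> bool) set)"
    using sequences_eqpoll_reals eqpoll_finite_iff infinite_UNIV_char_0 by metis
  then have "(UNIV :: (nat \<Rightarrow> bool) set) \<lesssim> (\<lambda>f. unit a (x f)) ` UNIV"
    using fib by (rule lepoll_image_finite_fibers)
  also have "(\<lambda>f. unit a (x f)) ` UNIV \<lesssim> {U \<in> units a. unit_type a U = germ L R}"
    by (rule subset_imp_lepoll) (use ty x in \<open>auto intro: unit_in_units\<close>)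
  finally show "(UNIV :: real set) \<lesssim> {U \<in> units a. unit_type a U = germ L R}"
    using sequences_eqpoll_reals by (meson eqpoll_sym lepoll_trans1)
qed

section \<open>Extending partial isomorphisms\<close>

lemma eqpoll_Diff_finite:
  assumes "infinite A" "finite F"
  shows "A - F \<approx> A"
  using assms(2)
proof induction
  case (insert x F)
  show ?case
  proof (cases "x \<in> A - F")
    case True
    have "infinite (A - insert x F)" using assms(1) insert by (simp add: Diff_infinite_finite)
    then have "insert x (A - insert x F) \<approx> A - insert x F" by (rule infinite_insert_eqpoll)
    moreover have "insert x (A - insert x F) = A - F" using True by auto
    ultimately show ?thesis using insert.IH by (metis eqpoll_sym eqpoll_trans)
  next
    case False
    then have "A - insert x F = A - F" by auto
    then show ?thesis using insert.IH by simp
  qed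
qed simp

text \<open>
  Removing a finite set does not change the cardinality of an infinite set of elements of one type, so
  the remaining elements of each type can be matched independently.
\<close>

lemma typed_bijection_extends:
  assumes F: "F \<subseteq> A \<times> B" "finite F"
    and F_type: "\<And>x y. (x, y) \<in> F \<Longrightarrow> tB y = tA x"
    and F_inj: "\<And>x y x' y'. (x, y) \<in> F \<Longrightarrow> (x', y') \<in> F \<Longrightarrow> x = x' \<longleftrightarrow> y = y'"
    and fibers: "\<And>t. {x \<in> A. tA x = t} \<approx> {y \<in> B. tB y = t}"
    and big: "\<And>t. infinite {x \<in> A. tA x = t} \<or> {x \<in> A. tA x = t} = {}"
  shows "\<exists>\<beta>. bij_betw \<beta> A B \<and> (\<forall>x\<in>A. tB (\<beta> x) = tA x) \<and> (\<forall>(x, y)\<in>F. \<beta> x = y)"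
proof -
  have "{x \<in> A. tA x = t} - Domain F \<approx> {y \<in> B. tB y = t} - Range F" for t
  proof (cases "{x \<in> A. tA x = t} = {}")
    case True
    then have "{y \<in> B. tB y = t} = {}" using fibers[of t] by (metis eqpoll_empty_iff_empty eqpoll_sym)
    then have "{y \<in> B. tB y = t} - Range F = {}" by blast
    moreover have "{x \<in> A. tA x = t} - Domain F = {}" using True by blast
    ultimately show ?thesis by (simp only: eqpoll_empty_iff_empty)
  next
    case False
    then have inf1: "infinite {x \<in> A. tA x = t}" using big[of t] by blast
    have inf: "infinite {x \<in> A. tA x = t}" "infinite {y \<in> B. tB y = t}"
      using inf1 eqpoll_finite_iff[OF fibers[of t]] by (blast, blast)
    have "finite (Domain F)" "finite (Range F)" using F(2) by (auto simp: finite_Domain finite_Range)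
    then show ?thesis
      using eqpoll_Diff_finite[OF inf(1)] eqpoll_Diff_finite[OF inf(2)] fibers[of t]
      by (meson eqpoll_sym eqpoll_trans)
  qed
  then obtain h where h: "\<And>t. bij_betw (h t) ({x \<in> A. tA x = t} - Domain F) ({y \<in> B. tB y = t} - Range F)"
    unfolding eqpoll_def by metis
  define \<beta> where "\<beta> x = (if x \<in> Domain F then SOME y. (x, y) \<in> F else h (tA x) x)" for x
  have b1: "(x, \<beta> x) \<in> F" if "x \<in> Domain F" for x
    using that by (auto simp: \<beta>_def intro: someI)
  have b1': "\<beta> x = y" if "(x, y) \<in> F" for x y
    using b1[of x] F_inj[OF that, of x "\<beta> x"] that by auto
  have b2: "\<beta> x \<in> {y \<in> B. tB y = tA x} - Range F" if "x \<in> A" "x \<notin> Domain F" for x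
    using bij_betwE[OF h[of "tA x"]] that by (auto simp: \<beta>_def)
  have inj: "inj_on \<beta> A"
  proof (rule inj_onI)
    fix x x' assume x: "x \<in> A" "x' \<in> A" "\<beta> x = \<beta> x'"
    show "x = x'"
    proof (cases "x \<in> Domain F")
      case True
      then have "x' \<in> Domain F" using b1[of x] b2[of x'] x by (auto simp: Range_iff)
      then show ?thesis using b1[OF True] b1[of x'] F_inj x(3) by metis
    next
      case False
      then have x': "x' \<notin> Domain F" using b1[of x'] b2[of x] x by (auto simp: Range_iff)
      have "tA x = tA x'" using b2[OF x(1) False] b2[OF x(2) x'] x(3) by auto
      then show ?thesis using x False x' bij_betw_imp_inj_on[OF h[of "tA x"]] by (auto simp: \<beta>_def inj_on_def)
    qed
  qed
  have surj: "\<beta> ` A = B"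
  proof
    show "\<beta> ` A \<subseteq> B" using b1 b2 F(1) by blast
    show "B \<subseteq> \<beta> ` A"
    proof
      fix y assume y: "y \<in> B"
      show "y \<in> \<beta> ` A"
      proof (cases "y \<in> Range F")
        case True
        then obtain x where "(x, y) \<in> F" by blast
        then show ?thesis using b1' F(1) by blast
      next
        case False
        then have "y \<in> h (tB y) ` ({x \<in> A. tA x = tB y} - Domain F)"
          using h[of "tB y"] y by (simp add: bij_betw_def)
        then obtain x where x: "y = h (tB y) x" "x \<in> A" "tA x = tB y" "x \<notin> Domain F" by blast
        then have "y = \<beta> x" by (simp add: \<beta>_def)
        then show ?thesis using x(2) by (rule image_eqI)
      qed
    qed
  qed
  have "tB (\<beta> x) = tA x" if "x \<in> A" for x
    using b1[of x] b2[of x] F_type that by (cases "x \<in> Domain F") auto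
  then show ?thesis using inj surj b1' by (intro exI[of _ \<beta>]) (auto simp: bij_betw_def)
qed

locale two_trees = A: universal_tree M d \<P> + B: universal_tree M' d' \<P>'
  for M :: "'a set" and d \<P> and M' :: "'b set" and d' \<P>'
begin

definition piso :: "('a \<times> 'b) set \<Rightarrow> bool" where
  "piso K \<longleftrightarrow> K \<subseteq> M \<times> M' \<and>
     (\<forall>a a' b b'. (a, a') \<in> K \<and> (b, b') \<in> K \<longrightarrow> d' a' b' = d a b \<and> (B.col a' b' \<longleftrightarrow> A.col a b)) \<and>
     (\<forall>a b p. a \<in> Domain K \<and> b \<in> Domain K \<and> p \<in> M \<and> A.btw a p b \<longrightarrow> p \<in> Domain K)"

lemma pisoD:
  assumes "piso K"
  shows "(a, a') \<in> K \<Longrightarrow> a \<in> M" "(a, a') \<in> K \<Longrightarrow> a' \<in> M'"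
    "(a, a') \<in> K \<Longrightarrow> (b, b') \<in> K \<Longrightarrow> d' a' b' = d a b"
    "(a, a') \<in> K \<Longrightarrow> (b, b') \<in> K \<Longrightarrow> B.col a' b' \<longleftrightarrow> A.col a b"
    "a \<in> Domain K \<Longrightarrow> b \<in> Domain K \<Longrightarrow> p \<in> M \<Longrightarrow> A.btw a p b \<Longrightarrow> p \<in> Domain K"
  using assms unfolding piso_def by blast+

lemma piso_eq_iff: "piso K \<Longrightarrow> (a, a') \<in> K \<Longrightarrow> (b, b') \<in> K \<Longrightarrow> a' = b' \<longleftrightarrow> a = b"
  using pisoD(1-3)[of K] A.zero[of a b] B.zero[of a' b'] by metis

lemma piso_same_dir:
  "piso K \<Longrightarrow> (a, a') \<in> K \<Longrightarrow> (b, b') \<in> K \<Longrightarrow> (c, c') \<in> K \<Longrightarrow> B.same_dir a' b' c' \<longleftrightarrow> A.same_dir a b c"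
  using pisoD(3)[of K] by (simp add: A.same_dir_def B.same_dir_def)

lemma piso_point:
  assumes K: "piso K" and ab: "(a, a') \<in> K" "(b, b') \<in> K" and s: "0 \<le> s" "s \<le> d a b"
  shows "(A.point a b s, B.point a' b' s) \<in> K"
proof -
  note M = pisoD(1)[OF K ab(1)] pisoD(1)[OF K ab(2)] pisoD(2)[OF K ab(1)] pisoD(2)[OF K ab(2)]
  note p = A.point[OF M(1,2) s]
  have "A.point a b s \<in> Domain K" 
    by (rule pisoD(5)[OF K _ _ p(1,4)]) (use ab in blast)+
  then obtain q where q: "(A.point a b s, q) \<in> K" by blast
  have "d' a' q = s" "d' q b' = d a b - s" "d' a' b' = d a b"
    using pisoD(3)[OF K ab(1) q] pisoD(3)[OF K q ab(2)] pisoD(3)[OF K ab] p by auto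
  then have "B.point a' b' s = q"
    using B.point_eq[OF M(3,4) pisoD(2)[OF K q]] by auto
  then show ?thesis using q by simp
qed

lemma piso_type:
  assumes K: "piso K" and ab: "(a, a') \<in> K" "(b, b') \<in> K"
  shows "B.type_at a' b' = A.type_at a b"
proof (cases "0 < d a b")
  case True
  then show ?thesis
    unfolding A.type_at_def B.type_at_def pisoD(3)[OF K ab]
    using pisoD(4)[OF K piso_point[OF K ab] piso_point[OF K ab]]
    by (intro germ_eqI[of "d a b"]) auto
next
  case False
  then show ?thesis
    unfolding A.type_at_def B.type_at_def pisoD(3)[OF K ab] by (auto simp: germ_def)
qed

lemma piso_unit:
  assumes K: "piso K" and abc: "(a, a') \<in> K" "(b, b') \<in> K" "(c, c') \<in> K" and ne: "b \<noteq> a" "c \<noteq> a"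
  shows "B.unit a' b' = B.unit a' c' \<longleftrightarrow> A.unit a b = A.unit a c"
proof -
  note M = pisoD(1)[OF K abc(1)] pisoD(1)[OF K abc(2)] pisoD(1)[OF K abc(3)]
  note M' = pisoD(2)[OF K abc(1)] pisoD(2)[OF K abc(2)] pisoD(2)[OF K abc(3)]
  have ne': "b' \<noteq> a'" "c' \<noteq> a'"
    using piso_eq_iff[OF K abc(1,2)] piso_eq_iff[OF K abc(1,3)] ne by auto
  have "B.col (B.point a' b' e) (B.point a' c' e) \<longleftrightarrow> A.col (A.point a b e) (A.point a c e)"
    if "0 < e" "e \<le> d a b" "e \<le> d a c" for e
    using that by (intro pisoD(4)[OF K] piso_point[OF K] abc) auto
  then show ?thesis
    unfolding A.unit_eq_iff_col[OF M ne] B.unit_eq_iff_col[OF M' ne'] piso_same_dir[OF K abc]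
      pisoD(3)[OF K abc(1,2)] pisoD(3)[OF K abc(1,3)] by blast
qed

text \<open>
  A matching is a partial isomorphism together with, at each point of its domain, a bijection
  between all units at the point and all units at its image that is compatible with the partial
  isomorphism and preserves types. The bijections promise that a unit which has not been reached yet
  still has an unused counterpart. They make matchings stable under unions of chains.
\<close>

definition base :: "('a \<times> 'b \<times> 'a set \<times> 'b set) set \<Rightarrow> ('a \<times> 'b) set" where
  "base N = {(a, a'). \<exists>U U'. (a, a', U, U') \<in> N}"

definition fiber :: "('a \<times> 'b \<times> 'a set \<times> 'b set) set \<Rightarrow> 'a \<Rightarrow> 'b \<Rightarrow> ('a set \<times> 'b set) set" where
  "fiber N a a' = {(U, U'). (a, a', U, U') \<in> N}"

definition unit_bijection :: "'a \<Rightarrow> 'b \<Rightarrow> ('a set \<times> 'b set) set \<Rightarrow> bool" where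
  "unit_bijection a a' G \<longleftrightarrow> (\<exists>\<beta>. bij_betw \<beta> (A.units a) (B.units a') \<and>
     (\<forall>U\<in>A.units a. B.unit_type a' (\<beta> U) = A.unit_type a U) \<and> G = {(U, \<beta> U) | U. U \<in> A.units a})"

definition matching :: "('a \<times> 'b \<times> 'a set \<times> 'b set) set \<Rightarrow> bool" where
  "matching N \<longleftrightarrow> piso (base N) \<and> (\<forall>a a'. (a, a') \<in> base N \<longrightarrow> unit_bijection a a' (fiber N a a')) \<and>
     (\<forall>a a' b b'. (a, a') \<in> base N \<and> (b, b') \<in> base N \<and> b \<noteq> a \<longrightarrow>
        (a, a', A.unit a b, B.unit a' b') \<in> N)"

lemma unit_bijectionD:
  assumes "unit_bijection a a' G"
  shows "(U, U') \<in> G \<Longrightarrow> U \<in> A.units a" "(U, U') \<in> G \<Longrightarrow> U' \<in> B.units a'"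
    "(U, U') \<in> G \<Longrightarrow> B.unit_type a' U' = A.unit_type a U"
    "(U, U') \<in> G \<Longrightarrow> (W, W') \<in> G \<Longrightarrow> U' = W' \<longleftrightarrow> U = W"
    "U \<in> A.units a \<Longrightarrow> \<exists>U'. (U, U') \<in> G" "U' \<in> B.units a' \<Longrightarrow> \<exists>U. (U, U') \<in> G"
proof -
  obtain \<beta> where b: "bij_betw \<beta> (A.units a) (B.units a')"
     "\<forall>U\<in>A.units a. B.unit_type a' (\<beta> U) = A.unit_type a U" "G = {(U, \<beta> U) | U. U \<in> A.units a}"
    using assms unfolding unit_bijection_def by blast
  show "(U, U') \<in> G \<Longrightarrow> U \<in> A.units a" "(U, U') \<in> G \<Longrightarrow> B.unit_type a' U' = A.unit_type a U"
    "U \<in> A.units a \<Longrightarrow> \<exists>U'. (U, U') \<in> G" using b(2,3) by auto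
  show "(U, U') \<in> G \<Longrightarrow> U' \<in> B.units a'" using b(1,3) bij_betwE by fastforce
  show "(U, U') \<in> G \<Longrightarrow> (W, W') \<in> G \<Longrightarrow> U' = W' \<longleftrightarrow> U = W"
    using b(1,3) unfolding bij_betw_def inj_on_def by blast
  show "U' \<in> B.units a' \<Longrightarrow> \<exists>U. (U, U') \<in> G" using b(1,3) unfolding bij_betw_def by blast
qed

lemma unit_bijection_subset:
  assumes "unit_bijection a a' G" "unit_bijection a a' H" "G \<subseteq> H"
  shows "G = H"
  using unit_bijectionD(1,4,5)[OF assms(1)] unit_bijectionD(1,4)[OF assms(2)] assms(3) by fast

lemma units_nonempty:
  assumes "a \<in> M" shows "A.units a \<noteq> {}"
proof -
  obtain P where P: "P \<in> \<P>" "a \<in> P" using A.piece_cover assms by blast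
  obtain g where g: "range g = P" "P \<subseteq> M" "\<And>s t :: real. d (g s) (g t) = \<bar>s - t\<bar>"
    using A.piece_line[OF P(1)] by blast
  have "d (g 0) (g 1) = 1" using g(3) by simp
  moreover have "g 0 \<in> M" "g 1 \<in> M" using g by auto
  ultimately have "g 0 \<noteq> g 1" by auto
  then obtain b where "b \<in> M" "b \<noteq> a" using \<open>g 0 \<in> M\<close> \<open>g 1 \<in> M\<close> by metis
  then show ?thesis by (auto simp: A.units_def)
qed

lemma unit_types_eqpoll:
  assumes "a \<in> M" "a' \<in> M'"
  shows "{U \<in> A.units a. A.unit_type a U = t} \<approx> {U \<in> B.units a'. B.unit_type a' U = t}"
    "infinite {U \<in> A.units a. A.unit_type a U = t} \<or> {U \<in> A.units a. A.unit_type a U = t} = {}"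
proof -
  have *: "{U \<in> A.units a. A.unit_type a U = t} \<approx> (UNIV :: real set) \<and> {U \<in> B.units a'. B.unit_type a' U = t} \<approx> (UNIV :: real set)"
    if "{U \<in> A.units a. A.unit_type a U = t} \<noteq> {} \<or> {U \<in> B.units a'. B.unit_type a' U = t} \<noteq> {}"
  proof -
    have "\<exists>L>0. \<exists>R. pattern R \<and> t = germ L R"
      using that A.unit_type_pattern[OF assms(1)] B.unit_type_pattern[OF assms(2)] by blast
    then show ?thesis using A.units_of_type[OF assms(1)] B.units_of_type[OF assms(2)] by blast
  qed
  show "{U \<in> A.units a. A.unit_type a U = t} \<approx> {U \<in> B.units a'. B.unit_type a' U = t}"
  proof (cases "{U \<in> A.units a. A.unit_type a U = t} = {} \<and> {U \<in> B.units a'. B.unit_type a' U = t} = {}")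
    case False
    then show ?thesis using * by (meson eqpoll_sym eqpoll_trans)
  next
    case True
    then show ?thesis by (simp only: eqpoll_empty_iff_empty)
  qed
  have "infinite {U \<in> A.units a. A.unit_type a U = t}" if "{U \<in> A.units a. A.unit_type a U = t} \<approx> (UNIV :: real set)"
    using that eqpoll_finite_iff infinite_UNIV_char_0 by blast
  then show "infinite {U \<in> A.units a. A.unit_type a U = t} \<or> {U \<in> A.units a. A.unit_type a U = t} = {}"
    using * by blast
qed

text \<open>
  Only finitely many units are prescribed by \<open>K\<close>, hence the prescription extends to all units. This
  is where finiteness of the number of units reached at a new point enters.
\<close>

lemma unit_bijection_exists:
  assumes K: "piso K" and a: "(a, a') \<in> K" and fin: "finite (A.unit a ` (Domain K - {a}))"
  shows "\<exists>G. unit_bijection a a' G \<and> (\<forall>b b'. (b, b') \<in> K \<and> b \<noteq> a \<longrightarrow> (A.unit a b, B.unit a' b') \<in> G)"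
proof -
  define F where "F = {(A.unit a b, B.unit a' b') | b b'. (b, b') \<in> K \<and> b \<noteq> a}"
  note M = pisoD(1)[OF K] pisoD(2)[OF K]
  have inj: "U = W \<longleftrightarrow> U' = W'" if UU: "(U, U') \<in> F" and WW: "(W, W') \<in> F" for U U' W W'
  proof -
    obtain b b' where b: "(b, b') \<in> K" "b \<noteq> a" "U = A.unit a b" "U' = B.unit a' b'" using UU by (auto simp: F_def)
    obtain c c' where c: "(c, c') \<in> K" "c \<noteq> a" "W = A.unit a c" "W' = B.unit a' c'" using WW by (auto simp: F_def)
    show ?thesis unfolding b(3,4) c(3,4) using piso_unit[OF K a b(1) c(1) b(2) c(2)] by blast
  qed
  have "Domain F \<subseteq> A.unit a ` (Domain K - {a})" by (auto simp: F_def)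
  then have finD: "finite (Domain F)" using fin finite_subset by blast
  have "inj_on fst F" using inj by (auto simp: inj_on_def)
  moreover have "fst ` F = Domain F" by (auto simp: fst_eq_Domain)
  ultimately have "finite F" using finD finite_imageD by metis
  moreover have "F \<subseteq> A.units a \<times> B.units a'"
  proof -
    have "b' \<noteq> a'" if "(b, b') \<in> K" "b \<noteq> a" for b b' using piso_eq_iff[OF K a that(1)] that(2) by blast
    then show ?thesis using M unfolding F_def by (auto intro!: A.unit_in_units B.unit_in_units)
  qed
  moreover have "B.unit_type a' U' = A.unit_type a U" if UU: "(U, U') \<in> F" for U U'
  proof -
    obtain b b' where b: "(b, b') \<in> K" "b \<noteq> a" "U = A.unit a b" "U' = B.unit a' b'" using UU by (auto simp: F_def)
    then have "b' \<noteq> a'" using piso_eq_iff[OF K a] by auto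
    then show ?thesis using b piso_type[OF K a b(1)] A.unit_type_unit B.unit_type_unit M(1)[OF a] M(2)[OF a] M(1)[OF b(1)] M(2)[OF b(1)]
      by simp
  qed
  ultimately obtain \<beta> where "bij_betw \<beta> (A.units a) (B.units a')"
    "\<forall>U\<in>A.units a. B.unit_type a' (\<beta> U) = A.unit_type a U" "\<forall>(U, U')\<in>F. \<beta> U = U'"
    using typed_bijection_extends[of F "A.units a" "B.units a'" "B.unit_type a'" "A.unit_type a"] inj
      unit_types_eqpoll[OF M(1)[OF a] M(2)[OF a]] by blast
  then have b: "bij_betw \<beta> (A.units a) (B.units a')"
    "\<forall>U\<in>A.units a. B.unit_type a' (\<beta> U) = A.unit_type a U" "\<And>U U'. (U, U') \<in> F \<Longrightarrow> \<beta> U = U'" by blast+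
  have "(A.unit a b, B.unit a' b') \<in> {(U, \<beta> U) | U. U \<in> A.units a}" if bb: "(b, b') \<in> K" "b \<noteq> a" for b b'
  proof -
    have "(A.unit a b, B.unit a' b') \<in> F" using bb unfolding F_def by blast
    then have "\<beta> (A.unit a b) = B.unit a' b'" "A.unit a b \<in> A.units a"
      using b(3) \<open>F \<subseteq> A.units a \<times> B.units a'\<close> by blast+
    then show ?thesis by (intro CollectI exI[of _ "A.unit a b"]) simp
  qed
  moreover have "unit_bijection a a' {(U, \<beta> U) | U. U \<in> A.units a}"
    unfolding unit_bijection_def using b(1,2) by blast
  ultimately show ?thesis by blast
qed

lemma matching_extend:
  assumes N: "matching N" and K: "piso K" "base N \<subseteq> K"
    and new: "\<And>a a'. (a, a') \<in> K \<Longrightarrow> (a, a') \<notin> base N \<Longrightarrow> finite (A.unit a ` (Domain K - {a}))"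
    and old: "\<And>a a' b b'. (a, a') \<in> base N \<Longrightarrow> (b, b') \<in> K \<Longrightarrow> (b, b') \<notin> base N \<Longrightarrow> b \<noteq> a \<Longrightarrow>
      (a, a', A.unit a b, B.unit a' b') \<in> N"
  shows "\<exists>N'. matching N' \<and> N \<subseteq> N' \<and> base N' = K"
proof -
  have "\<forall>a a'. \<exists>G. (a, a') \<in> K - base N \<longrightarrow> unit_bijection a a' G \<and>
      (\<forall>b b'. (b, b') \<in> K \<and> b \<noteq> a \<longrightarrow> (A.unit a b, B.unit a' b') \<in> G)"
    using unit_bijection_exists[OF K(1)] new by (metis Diff_iff)
  then obtain G where G: "\<And>a a'. (a, a') \<in> K - base N \<Longrightarrow> unit_bijection a a' (G a a')"
    "\<And>a a' b b'. (a, a') \<in> K - base N \<Longrightarrow> (b, b') \<in> K \<Longrightarrow> b \<noteq> a \<Longrightarrow> (A.unit a b, B.unit a' b') \<in> G a a'"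
    by metis
  define C where "C = K - base N"
  define N' where "N' = N \<union> {(a, a', U, U') | a a' U U'. (a, a') \<in> C \<and> (U, U') \<in> G a a'}"
  have ne: "\<exists>U U'. (U, U') \<in> G a a'" if aC: "(a, a') \<in> C" for a a'
  proof -
    have "(a, a') \<in> K - base N" using aC by (simp add: C_def)
    note b = unit_bijectionD(5)[OF G(1)[OF this]]
    have "a \<in> M" using \<open>(a, a') \<in> K - base N\<close> pisoD(1)[OF K(1)] by blast
    then obtain U where "U \<in> A.units a" using units_nonempty by blast
    then show ?thesis using b by blast
  qed
  have "base N' = base N \<union> C"
  proof (intro equalityI subsetI)
    fix x assume "x \<in> base N'"
    then show "x \<in> base N \<union> C" by (auto simp: N'_def base_def)
  next
    fix x assume x: "x \<in> base N \<union> C"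
    obtain a a' where xa: "x = (a, a')" by (cases x)
    have "\<exists>U U'. (a, a', U, U') \<in> N'"
    proof (cases "(a, a') \<in> C")
      case True
      then show ?thesis using ne[OF True] by (auto simp: N'_def)
    next
      case False
      then show ?thesis using x xa by (auto simp: N'_def base_def)
    qed
    then show "x \<in> base N'" by (simp add: base_def xa)
  qed
  then have base': "base N' = K" using K(2) by (auto simp: C_def)
  have fib_old: "fiber N' a a' = fiber N a a'" if "(a, a') \<in> base N" for a a'
    using that by (auto simp: N'_def fiber_def C_def)
  have fib_new: "fiber N' a a' = G a a'" if "(a, a') \<in> K - base N" for a a'
  proof -
    have "(a, a', U, U') \<notin> N" for U U' using that by (auto simp: base_def)
    then show ?thesis using that by (auto simp: N'_def fiber_def C_def)
  qed
  have "unit_bijection a a' (fiber N' a a')" if "(a, a') \<in> K" for a a'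
    using fib_old[of a a'] fib_new[of a a'] G(1)[of a a'] N that unfolding matching_def by (cases "(a, a') \<in> base N") auto
  moreover have "(a, a', A.unit a b, B.unit a' b') \<in> N'" if "(a, a') \<in> K" "(b, b') \<in> K" "b \<noteq> a" for a a' b b'
  proof (cases "(a, a') \<in> base N")
    case True
    then have "(a, a', A.unit a b, B.unit a' b') \<in> N"
      using old[of a a' b b'] that N unfolding matching_def by blast
    then show ?thesis by (simp add: N'_def)
  next
    case False
    then show ?thesis using G(2)[of a a' b b'] that by (auto simp: N'_def C_def)
  qed
  ultimately have "matching N'" unfolding matching_def base' using K(1) by blast
  then show ?thesis using base' by (auto simp: N'_def)
qed

lemma matchingD:
  assumes "matching N"
  shows "piso (base N)"
    "(a, a') \<in> base N \<Longrightarrow> unit_bijection a a' (fiber N a a')"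
    "(a, a') \<in> base N \<Longrightarrow> (b, b') \<in> base N \<Longrightarrow> b \<noteq> a \<Longrightarrow> (A.unit a b, B.unit a' b') \<in> fiber N a a'"
  using assms unfolding matching_def fiber_def by auto

lemma matching_unit_iff:
  assumes "matching N" "(a, a') \<in> base N" "(U, U') \<in> fiber N a a'" "(W, W') \<in> fiber N a a'"
  shows "U' = W' \<longleftrightarrow> U = W"
  using unit_bijectionD(4)[OF matchingD(2)[OF assms(1,2)] assms(3,4)] .

text \<open>
  Away from the image there is a geodesic at \<open>a'\<close> that continues the partial isomorphism in the
  same way as the geodesic from \<open>a\<close> to \<open>z\<close>. If the unit is a piece one of whose halves has been
  used already, the geodesic has to run along the other half.
\<close>

lemma unused_geodesic:
  assumes N: "matching N" and a: "(a, a') \<in> base N" and z: "z \<in> M" "z \<noteq> a"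
    and fresh: "\<And>b. b \<in> Domain (base N) \<Longrightarrow> \<not> A.same_dir a b z"
  shows "\<exists>w\<in>M'. w \<noteq> a' \<and> (A.unit a z, B.unit a' w) \<in> fiber N a a' \<and>
     B.type_at a' w = A.type_at a z \<and> (\<forall>b'\<in>Range (base N). \<not> B.same_dir a' b' w)"
proof -
  note K = matchingD(1)[OF N]
  note U = matchingD(2)[OF N a]
  have aM: "a \<in> M" and aM': "a' \<in> M'" using pisoD(1,2)[OF K a] by auto
  obtain U' where U': "(A.unit a z, U') \<in> fiber N a a'"
    using unit_bijectionD(5)[OF U A.unit_in_units[OF z]] by blast
  obtain w where w: "w \<in> M'" "w \<noteq> a'" "U' = B.unit a' w"
    using unit_bijectionD(2)[OF U U'] by (auto simp: B.units_def)
  have type: "B.type_at a' v = A.type_at a z" if "v \<in> M'" "v \<noteq> a'" "B.unit a' v = U'" for v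
    using unit_bijectionD(3)[OF U U'] B.unit_type_unit[OF aM' that(1,2)] A.unit_type_unit[OF aM z] that(3) by simp
  show ?thesis
  proof (cases "\<exists>b'\<in>Range (base N). B.same_dir a' b' w")
    case False
    then show ?thesis using w U' type[OF w(1,2)] by blast
  next
    case True
    then obtain b b' where b: "(b, b') \<in> base N" "B.same_dir a' b' w" by blast
    have bM: "b \<in> M" "b' \<in> M'" using pisoD(1,2)[OF K b(1)] by auto
    have ba: "b' \<noteq> a'" "b \<noteq> a"
      using B.same_dir_neq[OF aM' bM(2) w(1) b(2)] piso_eq_iff[OF K b(1) a] by blast+
    have same_unit: "A.unit a c = A.unit a z" if "(c, c') \<in> base N" "c \<noteq> a" "B.unit a' c' = U'" for c c'
      using matching_unit_iff[OF N a matchingD(3)[OF N a that(1,2)] U'] that(3) by blast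
    have "B.unit a' b' = U'" using B.unit_same_dir[OF aM' bM(2) w(1) b(2)] w(3) by simp
    then have "A.unit a b = A.unit a z" by (rule same_unit[OF b(1) ba(2)])
    moreover have "\<not> A.same_dir a b z" using fresh b(1) by blast
    ultimately obtain P where P: "A.toward P a b" "A.toward P a z"
      using A.unit_eq_iff[OF aM bM(1) z(1) ba(2) z(2)] by blast
    obtain e where e: "e > 0" "e \<le> d a z" "\<And>s t. 0 \<le> s \<Longrightarrow> s < t \<Longrightarrow> t \<le> e \<Longrightarrow>
        A.col (A.point a z s) (A.point a z t) = B.col (B.point a' w s) (B.point a' w t)" "e \<le> d' a' w"
      using germ_eqD[OF type[OF w(1,2) w(3)[symmetric], symmetric, unfolded A.type_at_def B.type_at_def]
        A.mdist_pos_less[OF z(2)[symmetric] aM z(1)]] by blast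
    obtain e' where e': "e' > 0" "e' \<le> d a z" "\<And>s. 0 \<le> s \<Longrightarrow> s \<le> e' \<Longrightarrow> A.point a z s \<in> P"
      using A.toward_initial[OF aM z(1) P(2)] by blast
    have PP: "P \<in> \<P>" "a \<in> P" using P(1) by (auto simp: A.toward_def)
    define m where "m = min e e'"
    have m: "0 < m" "m \<le> e" "m \<le> e'" using e(1) e'(1) by (auto simp: m_def)
    have "A.col (A.point a z 0) (A.point a z m)"
      using e'(3)[of 0] e'(3)[of m] m PP(1) unfolding A.col_def by (intro bexI[of _ P]) auto
    then have "B.col (B.point a' w 0) (B.point a' w m)" using e(3)[of 0 m] m by simp
    then obtain P' where P': "P' \<in> \<P>'" "a' \<in> P'" "B.point a' w m \<in> P'"
      using aM' w(1) by (auto simp: B.col_def)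
    have toward': "B.toward P' a' w"
      by (rule B.towardI[OF aM' w(1) P'(1,2) m(1) _ P'(3)]) (use m e in auto)
    obtain v where v: "v \<in> P'" "B.toward P' a' v" "\<not> B.same_dir a' w v" "v \<noteq> a'"
      using B.toward_opposite[OF aM' w(1) toward'] by blast
    have vM: "v \<in> M'" using v(1) B.piece_subset[OF P'(1)] by blast
    have unit_v: "B.unit a' v = U'"
      using B.unit_toward[OF aM' vM v(2)] B.unit_toward[OF aM' w(1) toward'] w(3) by simp
    have "\<not> B.same_dir a' c' v" if "(c, c') \<in> base N" for c c'
    proof
      assume cv: "B.same_dir a' c' v"
      have cM: "c \<in> M" "c' \<in> M'" using pisoD(1,2)[OF K that] by auto
      have ca: "c' \<noteq> a'" "c \<noteq> a"
        using B.same_dir_neq[OF aM' cM(2) vM cv] piso_eq_iff[OF K that a] by blast+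
      have "B.unit a' c' = U'" using B.unit_same_dir[OF aM' cM(2) vM cv] unit_v by simp
      then have "A.unit a c = A.unit a z" by (rule same_unit[OF that ca(2)])
      moreover have nc: "\<not> A.same_dir a c z" using fresh that by blast
      ultimately obtain Q where Q: "A.toward Q a c" "A.toward Q a z"
        using A.unit_eq_iff[OF aM cM(1) z(1) ca(2) z(2)] by blast
      have "P = Q" using A.toward_unique[OF aM z(1) P(2) Q(2)] .
      then have "A.same_dir a b c"
        using A.line_two_sides[OF aM bM(1) cM(1) z(1) P(1) _ P(2)] Q(1) nc \<open>\<not> A.same_dir a b z\<close> by blast
      then have "B.same_dir a' b' c'" using piso_same_dir[OF K a b(1) that] by simp
      then have "B.same_dir a' w c'"
        using B.same_dir_trans[OF aM' w(1) cM(2) bM(2) B.same_dir_sym[OF b(2)]] by blast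
      then have "B.same_dir a' w v" by (rule B.same_dir_trans[OF aM' w(1) vM cM(2) _ cv])
      then show False using v(3) by blast
    qed
    then show ?thesis using vM v(4) unit_v U' type[OF vM v(4) unit_v] by blast
  qed
qed

text \<open>
  Let \<open>a\<close> be the projection of \<open>z\<close> to the domain. The promised counterpart of the unit of \<open>z\<close> at
  \<open>a\<close> is the unit of a geodesic with the same germ, so a short initial segment of the geodesic from
  \<open>a\<close> to \<open>z\<close> can be added to the partial isomorphism. At a new point the enlarged domain reaches
  at most two units, back to \<open>a\<close> and onwards.
\<close>

lemma matching_grow:
  assumes N: "matching N" and a: "(a, a') \<in> base N" and z: "z \<in> M" "z \<notin> Domain (base N)"
    and proj: "\<And>b. b \<in> Domain (base N) \<Longrightarrow> A.btw z a b"
  shows "\<exists>N'. matching N' \<and> N \<subseteq> N' \<and> N' \<noteq> N"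
proof -
  note K = matchingD(1)[OF N]
  define K0 where "K0 = base N"
  note K = K[folded K0_def]
  have a0: "(a, a') \<in> K0" using a by (simp add: K0_def)
  have aM: "a \<in> M" and aM': "a' \<in> M'" using pisoD(1,2)[OF K a0] by auto
  have za: "z \<noteq> a" using a z(2) by blast
  have fresh: "\<not> A.same_dir a b z" if "b \<in> Domain K0" for b
  proof -
    have bM: "b \<in> M" using that pisoD(1)[OF K] by blast
    have "A.btw b a z" using proj[folded K0_def, OF that] A.commute[of a b] A.commute[of a z] A.commute[of b z] by linarith
    then show ?thesis using A.not_same_dir[OF aM bM z(1)] by blast
  qed
  obtain w where w: "w \<in> M'" "w \<noteq> a'" "(A.unit a z, B.unit a' w) \<in> fiber N a a'"
     "B.type_at a' w = A.type_at a z" "\<And>b'. b' \<in> Range K0 \<Longrightarrow> \<not> B.same_dir a' b' w"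
    using unused_geodesic[OF N a z(1) za] fresh unfolding K0_def by blast
  obtain e where e: "e > 0" "e \<le> d a z" "e \<le> d' a' w"
    "\<And>s t. 0 \<le> s \<Longrightarrow> s < t \<Longrightarrow> t \<le> e \<Longrightarrow>
        A.col (A.point a z s) (A.point a z t) = B.col (B.point a' w s) (B.point a' w t)"
    using germ_eqD[OF w(4)[symmetric, unfolded A.type_at_def B.type_at_def]
      A.mdist_pos_less[OF za[symmetric] aM z(1)]] by blast
  define g where "g = A.point a z"
  define g' where "g' = B.point a' w"
  have g0: "g 0 = a" "g' 0 = a'" using aM aM' z w by (simp_all add: g_def g'_def)
  have gM: "g s \<in> M" "g' s \<in> M'" "d a (g s) = s" "d' a' (g' s) = s" "A.btw a (g s) z" "B.btw a' (g' s) w"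
    if "0 \<le> s" "s \<le> e" for s
  proof -
    have "s \<le> d a z" "s \<le> d' a' w" using that e by auto
    then show "g s \<in> M" "g' s \<in> M'" "d a (g s) = s" "d' a' (g' s) = s" "A.btw a (g s) z" "B.btw a' (g' s) w"
      using A.point[OF aM z(1) that(1)] B.point[OF aM' w(1) that(1)] by (simp_all add: g_def g'_def)
  qed
  have gg: "d (g s) (g t) = \<bar>s - t\<bar>" "d' (g' s) (g' t) = \<bar>s - t\<bar>" if "0 \<le> s" "s \<le> e" "0 \<le> t" "t \<le> e" for s t
  proof -
    have *: "d (g s) (g t) = t - s \<and> d' (g' s) (g' t) = t - s" if "0 \<le> s" "s \<le> t" "t \<le> e" for s t
    proof -
      have "t \<le> d a z" "t \<le> d' a' w" using that e by auto
      then show ?thesis using A.point_dist(1)[OF aM z(1) that(1,2)] B.point_dist(1)[OF aM' w(1) that(1,2)]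
        by (simp add: g_def g'_def)
    qed
    then show "d (g s) (g t) = \<bar>s - t\<bar>" "d' (g' s) (g' t) = \<bar>s - t\<bar>"
      using *[of s t] *[of t s] that A.commute[of "g s" "g t"] B.commute[of "g' s" "g' t"]
      by (cases "s \<le> t"; simp)+
  qed
  have g_ne: "g s \<noteq> a" "g' s \<noteq> a'" if "0 < s" "s \<le> e" for s
    using gM(3,4)[of s] that aM aM' by auto
  have colg: "B.col (g' s) (g' t) \<longleftrightarrow> A.col (g s) (g t)" if "0 \<le> s" "s \<le> e" "0 \<le> t" "t \<le> e" for s t
    using e(4)[of s t] e(4)[of t s] that A.col_refl[OF gM(1)[of s]] B.col_refl[OF gM(2)[of s]]
      A.col_commute[of "g s" "g t"] B.col_commute[of "g' s" "g' t"]
    unfolding g_def[symmetric] g'_def[symmetric] by (cases s t rule: linorder_cases) auto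
  have dir: "A.same_dir a (g s) z" "B.same_dir a' (g' s) w" if "0 < s" "s \<le> e" for s
    using gM[of s] that g_ne[OF that] by (auto intro!: A.btw_same_dir B.btw_same_dir aM aM' z(1) w(1))
  have old_new: "A.btw b a (g s)" "B.btw b' a' (g' s)" if b: "(b, b') \<in> K0" and s: "0 \<le> s" "s \<le> e" for b b' s
  proof -
    have bM: "b \<in> M" "b' \<in> M'" using pisoD(1,2)[OF K b] by auto
    have "\<not> A.same_dir a b (g s) \<and> \<not> B.same_dir a' b' (g' s)"
    proof (cases "s = 0")
      case True
      then show ?thesis using g0 aM aM' bM A.same_dir_neq B.same_dir_neq by blast
    next
      case False
      then have "0 < s" using s by simp
      note ds = dir[OF \<open>0 < s\<close> s(2)] and gs = gM(1,2)[OF s]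
      show ?thesis
        using A.same_dir_trans[OF aM bM(1) z(1) gs(1) _ ds(1)] B.same_dir_trans[OF aM' bM(2) w(1) gs(2) _ ds(2)]
          fresh w(5) b by blast
    qed
    then show "A.btw b a (g s)" "B.btw b' a' (g' s)"
      using A.not_same_dir[OF aM bM(1) gM(1)[OF s]] B.not_same_dir[OF aM' bM(2) gM(2)[OF s]] by auto
  qed
  \<comment> \<open>The germs agree up to \<open>e\<close>, so this segment can be added.\<close>
  define K1 where "K1 = K0 \<union> {(g s, g' s) | s. 0 \<le> s \<and> s \<le> e}"
  have unit_g: "A.unit a (g s) = A.unit a z" "B.unit a' (g' s) = B.unit a' w" if "0 < s" "s \<le> e" for s
    using A.unit_same_dir[OF aM _ z(1) dir(1)[OF that]] B.unit_same_dir[OF aM' _ w(1) dir(2)[OF that]] gM(1,2)[of s] that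
    by auto
  have mixed_dist: "d' b' (g' s) = d b (g s)" if b: "(b, b') \<in> K0" and s: "0 \<le> s" "s \<le> e" for b b' s
    using old_new[OF b s] gM(3,4)[OF s] pisoD(3)[OF K b a0] by linarith
  have mixed_col: "B.col b' (g' s) \<longleftrightarrow> A.col b (g s)" if b: "(b, b') \<in> K0" and s: "0 \<le> s" "s \<le> e" for b b' s
  proof (cases "s = 0 \<or> b = a")
    case True
    then show ?thesis
    proof
      assume "s = 0"
      then show ?thesis using g0 pisoD(4)[OF K b a0] by simp
    next
      assume "b = a"
      then have "b' = a'" using piso_eq_iff[OF K b a0] by simp
      then show ?thesis using colg[of 0 s] s e(1) g0 \<open>b = a\<close> by simp
    qed
  next
    case False
    then have s': "0 < s" "s \<le> e" and ba: "b \<noteq> a" using s by auto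
    have ba': "b' \<noteq> a'" using piso_eq_iff[OF K b a0] ba by simp
    have bM: "b \<in> M" "b' \<in> M'" using pisoD(1,2)[OF K b] by auto
    have "B.unit a' b' = B.unit a' w \<longleftrightarrow> A.unit a b = A.unit a z"
      by (rule matching_unit_iff[OF N a matchingD(3)[OF N a b[unfolded K0_def] ba] w(3)])
    then show ?thesis
      unfolding A.col_through[OF aM bM(1) gM(1)[OF s] ba g_ne(1)[OF s'] old_new(1)[OF b s]]
        B.col_through[OF aM' bM(2) gM(2)[OF s] ba' g_ne(2)[OF s'] old_new(2)[OF b s]] unit_g[OF s']
      using pisoD(4)[OF K b a0] colg[of 0 s] s e(1) g0 by simp
  qed
  have "x \<in> Domain K1 \<longleftrightarrow> x \<in> Domain K0 \<or> (\<exists>s. 0 \<le> s \<and> s \<le> e \<and> x = g s)" for x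
    unfolding K1_def Domain_iff by blast
  then have "x \<in> Domain K1 \<longleftrightarrow> x \<in> Domain K0 \<union> g ` {0..e}" for x
    by (simp add: image_iff Bex_def conj_assoc)
  then have dom: "Domain K1 = Domain K0 \<union> g ` {0..e}" by blast
  have seg: "p \<in> g ` {0..s}" if "p \<in> M" "A.btw a p (g s)" "0 \<le> s" "s \<le> e" for p s
  proof -
    have "A.btw a p z" by (rule A.btw_trans(1)[OF aM z(1) that(1) gM(1)[OF that(3,4)] that(2) gM(5)[OF that(3,4)]])
    then have eq: "p = g (d a p)" using A.point_eq[OF aM z(1) that(1)] by (simp add: g_def)
    have "d a p + d p (g s) = s" using that(2) gM(3)[OF that(3,4)] by simp
    then have "d a p \<in> {0..s}" using A.nonneg[of a p] A.nonneg[of p "g s"] unfolding atLeastAtMost_iff by linarith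
    then show ?thesis by (rule image_eqI[where f = g and x = "d a p", OF eq])
  qed
  have convex: "p \<in> Domain K1" if x: "x \<in> Domain K1" and y: "y \<in> Domain K1" and p: "p \<in> M" "A.btw x p y" for x y p
  proof -
    have mix: "p \<in> Domain K1" if b: "(b, b') \<in> K0" and s: "0 \<le> s" "s \<le> e" and p: "p \<in> M" "A.btw b p (g s)" for b b' s p
    proof (cases "d b p \<le> d b a")
      case True
      have bM: "b \<in> M" using pisoD(1)[OF K b] .
      have "A.btw b p a" using A.btw_order(1)[OF bM gM(1)[OF s] p(1) aM p(2) old_new(1)[OF b s] True] .
      then have "p \<in> Domain K0" using pisoD(5)[OF K _ _ p(1)] b a0 by blast
      then show ?thesis by (simp add: dom)
    next
      case False
      have bM: "b \<in> M" using pisoD(1)[OF K b] .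
      have "A.btw a p (g s)" using A.btw_order(2)[OF bM gM(1)[OF s] aM p(1) old_new(1)[OF b s] p(2)] False by simp
      then show ?thesis using seg[OF p(1) _ s] s(2) unfolding dom by auto
    qed
    have D: "u \<in> Domain K0 \<or> (\<exists>s. u = g s \<and> 0 \<le> s \<and> s \<le> e)" if "u \<in> Domain K1" for u
      using that unfolding dom by auto
    have flip: "A.btw y p x" using p(2) A.commute[of x p] A.commute[of p y] A.commute[of x y] by linarith
    consider "x \<in> Domain K0" "y \<in> Domain K0" | s where "x \<in> Domain K0" "y = g s" "0 \<le> s" "s \<le> e"
      | s where "y \<in> Domain K0" "x = g s" "0 \<le> s" "s \<le> e"
      | s t where "x = g s" "0 \<le> s" "s \<le> e" "y = g t" "0 \<le> t" "t \<le> e"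
      using D[OF x] D[OF y] by blast
    then show ?thesis
    proof cases
      case 1
      then show ?thesis using pisoD(5)[OF K _ _ p] by (simp add: dom)
    next
      case 2
      then show ?thesis using mix p by blast
    next
      case 3
      then show ?thesis using mix flip p(1) by blast
    next
      case 4
      have *: "p \<in> Domain K1" if "0 \<le> s" "s \<le> t" "t \<le> e" "A.btw (g s) p (g t)" for s t
      proof -
        have st: "0 \<le> t" "s \<le> e" using that by auto
        have "A.btw a (g s) (g t)" using gM(3)[OF that(1) st(2)] gM(3)[OF st(1) that(3)] gg(1)[OF that(1) st(2) st(1) that(3)] that(2) by simp
        then have "A.btw a p (g t)"
          using that(4) A.triangle[OF aM gM(1)[OF that(1) st(2)] p(1)] A.triangle[OF aM p(1) gM(1)[OF st(1) that(3)]] by linarith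
        then show ?thesis using seg[OF p(1) _ st(1) that(3)] that(3) unfolding dom by auto
      qed
      show ?thesis using *[of s t] *[of t s] 4 p(2) flip by (cases "s \<le> t") auto
    qed
  qed
  have K1: "piso K1"
    unfolding piso_def
  proof (intro conjI allI impI; (elim conjE)?)
    show "K1 \<subseteq> M \<times> M'" using pisoD(1,2)[OF K] gM(1,2) by (auto simp: K1_def)
    fix x x' y y' assume xy: "(x, x') \<in> K1" "(y, y') \<in> K1"
    consider "(x, x') \<in> K0" "(y, y') \<in> K0" | s where "(x, x') \<in> K0" "y = g s" "y' = g' s" "0 \<le> s" "s \<le> e"
      | s where "(y, y') \<in> K0" "x = g s" "x' = g' s" "0 \<le> s" "s \<le> e"
      | s t where "x = g s" "x' = g' s" "0 \<le> s" "s \<le> e" "y = g t" "y' = g' t" "0 \<le> t" "t \<le> e"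
      using xy unfolding K1_def by blast
    then have "d' x' y' = d x y \<and> (B.col x' y' \<longleftrightarrow> A.col x y)"
    proof cases
      case 1 then show ?thesis using pisoD(3,4)[OF K] by blast
    next
      case 2 then show ?thesis using mixed_dist mixed_col by simp
    next
      case 3 then show ?thesis
        using mixed_dist[OF 3(1,4,5)] mixed_col[OF 3(1,4,5)] A.commute[of x y] B.commute[of x' y']
          A.col_commute[of x y] B.col_commute[of x' y'] by simp
    next
      case 4 then show ?thesis using gg colg by simp
    qed
    then show "d' x' y' = d x y" "B.col x' y' \<longleftrightarrow> A.col x y" by auto
  next
    fix x y p assume "x \<in> Domain K1" "y \<in> Domain K1" "p \<in> M" "A.btw x p y"
    then show "p \<in> Domain K1" by (rule convex)
  qed
  have new: "finite (A.unit q ` (Domain K1 - {q}))" if q: "(q, q') \<in> K1" "(q, q') \<notin> base N" for q q'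
  proof -
    obtain s where s: "q = g s" "q' = g' s" "0 \<le> s" "s \<le> e" using q unfolding K1_def K0_def by blast
    have "s \<noteq> 0" using q(2) a s g0 by auto
    then have s0: "0 < s" using s by simp
    have qM: "q \<in> M" "q \<noteq> a" using gM(1)[of s] g_ne(1)[of s] s s0 by auto
    \<comment> \<open>From an interior point of the new segment, every point of the domain is seen through \<open>a\<close> or
        through the other end.\<close>
    have "A.unit q b = A.unit q a \<or> A.unit q b = A.unit q (g e)" if b: "b \<in> Domain K1" "b \<noteq> q" for b
    proof -
      from b(1) consider "b \<in> Domain K0" | t where "b = g t" "0 \<le> t" "t \<le> e" by (auto simp: dom)
      then show ?thesis
      proof cases
        case 1
        then obtain b' where b': "(b, b') \<in> K0" by blast
        have bM: "b \<in> M" using pisoD(1)[OF K b'] .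
        have "A.btw q a b" using old_new(1)[OF b' s(3,4), folded s(1)] A.commute[of b a] A.commute[of a q] A.commute[of b q] by linarith
        then have "A.same_dir q a b" using qM by (intro A.btw_same_dir[OF qM(1) bM aM]) auto
        then show ?thesis using A.unit_same_dir[OF qM(1) aM bM] by simp
      next
        case t: 2
        have tM: "g t \<in> M" "g e \<in> M" using gM(1)[of t] gM(1)[of e] t e(1) by auto
        show ?thesis
        proof (cases "t < s")
          case True
          have "A.btw q (g t) a"
            using gg(1)[of s t] gM(3)[of t] gM(3)[of s] A.commute[of "g t" a] A.commute[of "g s" a] s t True by simp
          then have "A.same_dir q (g t) a" using b(2) t(1) by (intro A.btw_same_dir[OF qM(1) aM tM(1)]) auto
          then show ?thesis using A.unit_same_dir[OF qM(1) tM(1) aM] t(1) by simp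
        next
          case False
          have "A.btw q (g t) (g e)" using gg(1)[of s t] gg(1)[of t e] gg(1)[of s e] s t False e(1) by simp
          then have "A.same_dir q (g t) (g e)" using b(2) t(1) by (intro A.btw_same_dir[OF qM(1) tM(2) tM(1)]) auto
          then show ?thesis using A.unit_same_dir[OF qM(1) tM] t(1) by simp
        qed
      qed
    qed
    then have "A.unit q ` (Domain K1 - {q}) \<subseteq> {A.unit q a, A.unit q (g e)}" by blast
    then show ?thesis by (rule finite_subset) simp
  qed
  have old: "(c, c', A.unit c b, B.unit c' b') \<in> N"
    if c: "(c, c') \<in> base N" and b: "(b, b') \<in> K1" "(b, b') \<notin> base N" "b \<noteq> c" for c c' b b'
  proof -
    obtain s where s: "b = g s" "b' = g' s" "0 \<le> s" "s \<le> e" using b unfolding K1_def K0_def by blast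
    have "s \<noteq> 0" using b(2) a s g0 by auto
    then have s0: "0 < s" using s by simp
    have c0: "(c, c') \<in> K0" using c by (simp add: K0_def)
    have cM: "c \<in> M" "c' \<in> M'" using pisoD(1,2)[OF K c0] by auto
    show ?thesis
    proof (cases "c = a")
      case True
      then have "c' = a'" using piso_eq_iff[OF K c0 a0] by simp
      then show ?thesis using True w(3) unit_g[OF s0 s(4)] s by (simp add: fiber_def)
    next
      case False
      then have ca: "a \<noteq> c" "a' \<noteq> c'" using piso_eq_iff[OF K c0 a0] by auto
      have "A.same_dir c a b" "B.same_dir c' a' b'"
        using old_new[OF c0 s(3,4)] ca gM(1,2)[OF s(3,4)] s(1,2)
        by (auto intro!: A.btw_same_dir B.btw_same_dir cM aM aM')
      then have "A.unit c a = A.unit c b" "B.unit c' a' = B.unit c' b'"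
        using A.unit_same_dir[OF cM(1) aM] B.unit_same_dir[OF cM(2) aM'] gM(1,2)[OF s(3,4)] s(1,2) by auto
      then show ?thesis using matchingD(3)[OF N c a ca(1)] by (simp add: fiber_def)
    qed
  qed
  have sub: "base N \<subseteq> K1" by (auto simp: K1_def K0_def)
  have "\<exists>N'. matching N' \<and> N \<subseteq> N' \<and> base N' = K1"
    by (rule matching_extend[OF N K1 sub]) (rule new old; assumption)+
  then obtain N' where N': "matching N'" "N \<subseteq> N'" "base N' = K1" by blast
  have "(g e, g' e) \<in> K1" using e(1) by (auto simp: K1_def)
  moreover have "(g e, g' e) \<notin> base N"
  proof
    assume "(g e, g' e) \<in> base N"
    then have "\<not> A.same_dir a (g e) z" using fresh by (auto simp: K0_def)
    then show False using dir(1)[of e] e(1) by simp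
  qed
  ultimately have "N' \<noteq> N" using N'(3) by auto
  then show ?thesis using N' by blast
qed

text \<open>
  A limit point \<open>p\<close> of the domain is sent to the limit \<open>p'\<close> of the images, which exists by
  completeness. Collinearity with \<open>p\<close> is determined by collinearity with the points before \<open>p\<close> by
  \<open>col_limit\<close>. From \<open>p\<close> the domain is seen in one direction only, since the domain is convex and
  does not contain \<open>p\<close>.
\<close>

lemma matching_close:
  assumes N: "matching N" and p: "p \<in> M" "p \<notin> Domain (base N)"
    and lim: "\<And>e. 0 < e \<Longrightarrow> \<exists>x\<in>Domain (base N). d x p < e"
  shows "\<exists>N'. matching N' \<and> N \<subseteq> N' \<and> N' \<noteq> N"
proof -
  define K0 where "K0 = base N"
  note K = matchingD(1)[OF N, folded K0_def]
  note KM = pisoD(1)[OF K] and KM' = pisoD(2)[OF K] and Kd = pisoD(3)[OF K]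
  have "\<forall>n. \<exists>x x'. (x, x') \<in> K0 \<and> d x p < 1 / Suc n"
  proof
    fix n :: nat
    show "\<exists>x x'. (x, x') \<in> K0 \<and> d x p < 1 / Suc n" using lim[of "1 / Suc n"] by (auto simp: K0_def)
  qed
  then obtain x x' where x: "\<And>n. (x n, x' n) \<in> K0" "\<And>n. d (x n) p < 1 / Suc n" by metis
  have small: "\<exists>N. \<forall>n\<ge>N. 1 / real (Suc n) < e" if e: "0 < e" for e
  proof -
    obtain N where "1 / real (Suc N) < e" using nat_approx_posE[OF e] by metis
    moreover have "1 / real (Suc n) \<le> 1 / real (Suc N)" if "n \<ge> N" for n using that by (simp add: frac_le)
    ultimately show ?thesis by (intro exI[of _ N]) (meson le_less_trans)
  qed
  have dxx: "d (x m) (x n) < 1 / Suc m + 1 / Suc n" for m n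
    using A.triangle[OF KM[OF x(1)[of m]] p(1) KM[OF x(1)[of n]]] x(2)[of m] x(2)[of n] A.commute[of p "x n"] by linarith
  have "B.MCauchy x'"
    unfolding B.MCauchy_def
  proof (intro conjI allI impI)
    show "range x' \<subseteq> M'" using KM' x(1) by blast
    fix e :: real assume "0 < e"
    then obtain k where k: "\<forall>n\<ge>k. 1 / real (Suc n) < e / 2" using small[of "e / 2"] by auto
    have "d' (x' m) (x' n) < e" if "k \<le> m" "k \<le> n" for m n
      using Kd[OF x(1) x(1), of m n] dxx[of m n] k[rule_format, OF that(1)] k[rule_format, OF that(2)] by linarith
    then show "\<exists>k. \<forall>m n. k \<le> m \<longrightarrow> k \<le> n \<longrightarrow> d' (x' m) (x' n) < e" by blast
  qed
  then obtain p' where p': "limitin B.mtopology x' p' sequentially" using B.complete B.mcomplete_def by blast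
  have pM': "p' \<in> M'" using p' B.limitin_mspace by blast
  have dp: "d' b' p' = d b p" if b: "(b, b') \<in> K0" for b b'
  proof -
    have "\<bar>d' b' p' - d b p\<bar> \<le> e" if e: "0 < e" for e
    proof -
      obtain k where k: "\<And>n. k \<le> n \<Longrightarrow> 1 / real (Suc n) < e / 2" using small[of "e / 2"] e by auto
      obtain l where l: "\<And>n. l \<le> n \<Longrightarrow> d' (x' n) p' < e / 2"
        using p' e unfolding B.limitin_metric eventually_sequentially by (metis half_gt_zero)
      define n where "n = max k l"
      have n: "d (x n) p < e / 2" "d' (x' n) p' < e / 2" using k[of n] l[of n] x(2)[of n] by (auto simp: n_def)
      note t1 = A.triangle[OF KM[OF b] KM[OF x(1)[of n]] p(1)] A.triangle[OF KM[OF b] p(1) KM[OF x(1)[of n]]]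
      note t2 = B.triangle[OF KM'[OF b] KM'[OF x(1)[of n]] pM'] B.triangle[OF KM'[OF b] pM' KM'[OF x(1)[of n]]]
      show ?thesis
        using t1 t2 n Kd[OF b x(1)[of n]] A.commute[of p "x n"] B.commute[of p' "x' n"] by linarith
    qed
    then have "\<bar>d' b' p' - d b p\<bar> \<le> 0" by (rule field_le_epsilon[of _ 0, simplified])
    then show ?thesis by simp
  qed
  have half_open: "q \<in> Domain K0" if b: "(b, b') \<in> K0" and q: "q \<in> M" "A.btw b q p" "q \<noteq> p" for b b' q
  proof -
    have "0 < d q p" using A.mdist_pos_less[OF q(3,1) p(1)] .
    then obtain y y' where y: "(y, y') \<in> K0" "d y p < d q p"
      using lim[OF \<open>0 < d q p\<close>] unfolding K0_def by blast
    note bM = KM[OF b] and yM = KM[OF y(1)]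
    have "d b q \<le> A.prod b p y"
      using A.triangle[OF bM yM p(1)] q(2) y(2) A.commute[of p y] unfolding A.prod_def by simp
    then have "A.btw b q y" by (rule A.btw_prod[OF bM p(1) yM q(1,2)])
    then show ?thesis using pisoD(5)[OF K _ _ q(1)] b y(1) by blast
  qed
  have ne: "b \<noteq> p" if "(b, b') \<in> K0" for b b' using that p(2) by (auto simp: K0_def)
  have ne': "b' \<noteq> p'" if b: "(b, b') \<in> K0" for b b'
  proof -
    have "d' b' p' \<noteq> 0" using dp[OF b] A.mdist_pos_less[OF ne[OF b] KM[OF b] p(1)] by simp
    then show ?thesis using KM'[OF b] by auto
  qed
  have pt: "(A.point b p s, B.point b' p' s) \<in> K0" if b: "(b, b') \<in> K0" and s: "0 \<le> s" "s < d b p" for b b' s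
  proof -
    have s': "s \<le> d b p" using s by simp
    note q = A.point[OF KM[OF b] p(1) s(1) s']
    have "A.point b p s \<noteq> p" using q(3) s(2) p(1) by auto
    then obtain q' where q': "(A.point b p s, q') \<in> K0" using half_open[OF b q(1,4)] by blast
    have "B.point b' p' (d' b' q') = q'"
      by (rule B.point_eq[OF KM'[OF b] pM' KM'[OF q']]) (use Kd[OF b q'] dp[OF b] dp[OF q'] q in linarith)
    moreover have "d' b' q' = s" using Kd[OF b q'] q(2) by simp
    ultimately show ?thesis using q' by simp
  qed
  have colp: "B.col b' p' \<longleftrightarrow> A.col b p" if b: "(b, b') \<in> K0" for b b'
  proof -
    have "B.col b' (B.point b' p' s) \<longleftrightarrow> A.col b (A.point b p s)" if "0 < s" "s < d b p" for s
      using pisoD(4)[OF K b pt[OF b]] that by simp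
    then show ?thesis
      unfolding A.col_limit[OF KM[OF b] p(1) ne[OF b]] B.col_limit[OF KM'[OF b] pM' ne'[OF b]] dp[OF b] by blast
  qed
  define K1 where "K1 = insert (p, p') K0"
  have dom: "Domain K1 = insert p (Domain K0)" by (auto simp: K1_def)
  have one_dir: "A.same_dir p b c" if b: "(b, b') \<in> K0" and c: "(c, c') \<in> K0" for b b' c c'
  proof (rule ccontr)
    assume "\<not> ?thesis"
    then have "A.btw b p c" using A.not_same_dir[OF p(1) KM[OF b] KM[OF c]] by blast
    then have "p \<in> Domain K0" using pisoD(5)[OF K _ _ p(1)] b c by blast
    then show False using p(2) by (simp add: K0_def)
  qed
  have K1: "piso K1"
    unfolding piso_def
  proof (intro conjI allI impI; (elim conjE)?)
    show "K1 \<subseteq> M \<times> M'" using KM KM' p(1) pM' by (auto simp: K1_def)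
    fix y y' z z' assume yz: "(y, y') \<in> K1" "(z, z') \<in> K1"
    then consider "(y, y') \<in> K0" "(z, z') \<in> K0" | "(y, y') \<in> K0" "z = p" "z' = p'"
      | "(z, z') \<in> K0" "y = p" "y' = p'" | "y = p" "y' = p'" "z = p" "z' = p'" unfolding K1_def by blast
    then have "d' y' z' = d y z \<and> (B.col y' z' \<longleftrightarrow> A.col y z)"
    proof cases
      case 1 then show ?thesis using pisoD(3,4)[OF K] by blast
    next
      case 2 then show ?thesis using dp colp by simp
    next
      case 3 then show ?thesis
        using dp[OF 3(1)] colp[OF 3(1)] A.commute[of y z] B.commute[of y' z'] A.col_commute[of y z] B.col_commute[of y' z'] by simp
    next
      case 4 then show ?thesis using A.col_refl[OF p(1)] B.col_refl[OF pM'] p(1) pM' by simp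
    qed
    then show "d' y' z' = d y z" "B.col y' z' \<longleftrightarrow> A.col y z" by auto
  next
    fix y z q assume yz: "y \<in> Domain K1" "z \<in> Domain K1" and q: "q \<in> M" "A.btw y q z"
    show "q \<in> Domain K1"
    proof (cases "q = p")
      case False
      have flip: "A.btw z q y" using q(2) A.commute[of y q] A.commute[of q z] A.commute[of y z] by linarith
      consider "y \<in> Domain K0" "z \<in> Domain K0" | "y \<in> Domain K0" "z = p" | "z \<in> Domain K0" "y = p" | "y = p" "z = p"
        using yz unfolding dom by blast
      then have "q \<in> Domain K0"
      proof cases
        case 1 then show ?thesis using pisoD(5)[OF K _ _ q] by blast
      next
        case 2 then show ?thesis using half_open q False by blast
      next
        case 3 then show ?thesis using half_open[of z _ q] q(1) flip False by blast
      next
        case 4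
        then have "d p q + d q p = d p p" using q(2) by simp
        then have "d p q = 0" using A.mdist_zero[OF p(1)] A.nonneg[of p q] A.nonneg[of q p] by linarith
        then show ?thesis using False A.zero[OF p(1) q(1)] by simp
      qed
      then show ?thesis by (simp add: dom)
    qed (simp add: dom)
  qed
  have new: "finite (A.unit q ` (Domain K1 - {q}))" if "(q, q') \<in> K1" "(q, q') \<notin> base N" for q q'
  proof -
    have q: "q = p" using that by (auto simp: K1_def K0_def)
    have "A.unit p b = A.unit p (x 0)" if "b \<in> Domain K1 - {p}" for b
    proof -
      obtain b' where b: "(b, b') \<in> K0" using \<open>b \<in> Domain K1 - {p}\<close> by (auto simp: dom)
      show ?thesis by (rule A.unit_same_dir[OF p(1) KM[OF b] KM[OF x(1)] one_dir[OF b x(1)]])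
    qed
    then have "A.unit q ` (Domain K1 - {q}) \<subseteq> {A.unit p (x 0)}" unfolding q by blast
    then show ?thesis by (rule finite_subset) simp
  qed
  have old: "(c, c', A.unit c b, B.unit c' b') \<in> N"
    if c: "(c, c') \<in> base N" and b: "(b, b') \<in> K1" "(b, b') \<notin> base N" "b \<noteq> c" for c c' b b'
  proof -
    have bp: "b = p" "b' = p'" using b by (auto simp: K1_def K0_def)
    have c0: "(c, c') \<in> K0" using c by (simp add: K0_def)
    note cM = KM[OF c0] KM'[OF c0]
    define s where "s = d c p / 2"
    have s: "0 < s" "s < d c p" using A.mdist_pos_less[OF ne[OF c0] cM(1) p(1)] by (auto simp: s_def)
    have s': "0 \<le> s" "s \<le> d c p" "s \<le> d' c' p'" using s dp[OF c0] by auto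
    note q = pt[OF c0 s'(1) s(2)]
    note pq = A.point[OF cM(1) p(1) s'(1,2)] and pq' = B.point[OF cM(2) pM' s'(1,3)]
    have qc: "A.point c p s \<noteq> c" "B.point c' p' s \<noteq> c'" using pq(2) pq'(2) s(1) cM by auto
    have "A.unit c (A.point c p s) = A.unit c p"
      by (rule A.unit_same_dir[OF cM(1) pq(1) p(1) A.btw_same_dir[OF cM(1) p(1) pq(1,4) qc(1)]])
    moreover have "B.unit c' (B.point c' p' s) = B.unit c' p'"
      by (rule B.unit_same_dir[OF cM(2) pq'(1) pM' B.btw_same_dir[OF cM(2) pM' pq'(1,4) qc(2)]])
    ultimately show ?thesis
      using matchingD(3)[OF N c q[unfolded K0_def] qc(1)] by (simp add: fiber_def bp)
  qed
  have sub: "base N \<subseteq> K1" by (auto simp: K1_def K0_def)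
  have "\<exists>N'. matching N' \<and> N \<subseteq> N' \<and> base N' = K1"
    by (rule matching_extend[OF N K1 sub]) (rule new old; assumption)+
  then obtain N' where N': "matching N'" "N \<subseteq> N'" "base N' = K1" by blast
  have "(p, p') \<in> base N'" "(p, p') \<notin> base N" using N'(3) p(2) by (auto simp: K1_def)
  then show ?thesis using N' by blast
qed

text \<open>
  Along a line that is a piece, all other points of the line lie in one and the same unit, namely the
  line itself. So there is only one prescribed value at each point.
\<close>

lemma matching_line:
  assumes P: "P \<in> \<P>" "P' \<in> \<P>'" and g: "range g = P" "\<And>s t :: real. d (g s) (g t) = \<bar>s - t\<bar>"
    and g': "range g' = P'" "\<And>s t. d' (g' s) (g' t) = \<bar>s - t\<bar>"
  shows "\<exists>N. matching N \<and> base N = {(g t, g' t) | t. True}"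
proof -
  define K where "K = {(g t, g' t) | t. True}"
  have gM: "g t \<in> M" "g t \<in> P" "g' t \<in> M'" "g' t \<in> P'" for t
    using A.piece_subset[OF P(1)] B.piece_subset[OF P(2)] g(1) g'(1) by auto
  have K: "piso K"
    unfolding piso_def
  proof (intro conjI allI impI; (elim conjE)?)
    show "K \<subseteq> M \<times> M'" using gM by (auto simp: K_def)
    fix a a' b b' assume "(a, a') \<in> K" "(b, b') \<in> K"
    then obtain s t where st: "a = g s" "a' = g' s" "b = g t" "b' = g' t" unfolding K_def by blast
    show "d' a' b' = d a b" unfolding st g g' ..
    show "B.col a' b' \<longleftrightarrow> A.col a b" unfolding st A.col_def B.col_def using gM P by blast
  next
    fix a b p assume *: "a \<in> Domain K" "b \<in> Domain K" "p \<in> M" "A.btw a p b"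
    then have "a \<in> P" "b \<in> P" using gM by (auto simp: K_def)
    then have "p \<in> P" by (rule A.piece_convex[OF P(1) _ _ *(3,4)])
    then show "p \<in> Domain K" using g(1) by (auto simp: K_def)
  qed
  have base0: "base {} = {}" by (simp add: base_def)
  have m0: "matching {}" by (simp add: matching_def base0 piso_def)
  have fin: "finite (A.unit a ` (Domain K - {a}))" if "(a, a') \<in> K" for a a'
  proof -
    have aP: "a \<in> P" "a \<in> M" using that gM by (auto simp: K_def)
    have "A.unit a b = P" if "b \<in> Domain K - {a}" for b
    proof -
      have b: "b \<in> P" "b \<in> M" "a \<noteq> b" using that gM by (auto simp: K_def)
      show ?thesis by (rule A.unit_toward[OF aP(2) b(2)])
        (use A.same_dir_refl[OF aP(2) b(2,3)] P(1) aP(1) b(1) in \<open>auto simp: A.toward_def\<close>)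
    qed
    then have "A.unit a ` (Domain K - {a}) \<subseteq> {P}" by blast
    then show ?thesis by (rule finite_subset) simp
  qed
  show ?thesis
    using matching_extend[OF m0 K] fin unfolding base0 K_def[symmetric] by blast
qed

lemma matching_chain:
  assumes C: "\<C> \<noteq> {}" "subset.chain {N. matching N} \<C>"
  shows "matching (\<Union>\<C>)"
proof -
  have m: "matching N" if "N \<in> \<C>" for N using C that by (auto simp: subset.chain_def)
  have comp: "N \<subseteq> N' \<or> N' \<subseteq> N" if "N \<in> \<C>" "N' \<in> \<C>" for N N'
    using C that unfolding subset.chain_def by blast
  have b: "(a, a') \<in> base (\<Union>\<C>) \<longleftrightarrow> (\<exists>N\<in>\<C>. (a, a') \<in> base N)" for a a' by (auto simp: base_def)
  have mono: "base N \<subseteq> base N'" if "N \<subseteq> N'" for N N' using that by (auto simp: base_def)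
  have two: "\<exists>N\<in>\<C>. x \<in> base N \<and> y \<in> base N" if xy: "x \<in> base (\<Union>\<C>)" "y \<in> base (\<Union>\<C>)" for x y
  proof -
    obtain N N' where "N \<in> \<C>" "x \<in> base N" "N' \<in> \<C>" "y \<in> base N'"
      using xy b by (metis surj_pair)
    then show ?thesis using comp[of N N'] mono by blast
  qed
  have dom: "a \<in> Domain (base (\<Union>\<C>)) \<longleftrightarrow> (\<exists>N\<in>\<C>. a \<in> Domain (base N))" for a
    using b by (auto simp: Domain_iff)
  have "piso (base (\<Union>\<C>))"
    unfolding piso_def
  proof (intro conjI allI impI; (elim conjE)?)
    show "base (\<Union>\<C>) \<subseteq> M \<times> M'"
    proof
      fix x assume "x \<in> base (\<Union>\<C>)"
      then obtain N where "N \<in> \<C>" "x \<in> base N" using two by blast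
      then show "x \<in> M \<times> M'" using pisoD(1,2)[OF matchingD(1)[OF m]] by (cases x) blast
    qed
    fix y y' z z' assume "(y, y') \<in> base (\<Union>\<C>)" "(z, z') \<in> base (\<Union>\<C>)"
    then obtain N where N: "N \<in> \<C>" "(y, y') \<in> base N" "(z, z') \<in> base N" using two by blast
    show "d' y' z' = d y z" "B.col y' z' \<longleftrightarrow> A.col y z"
      using pisoD(3,4)[OF matchingD(1)[OF m[OF N(1)]] N(2,3)] .
  next
    fix y z p assume *: "y \<in> Domain (base (\<Union>\<C>))" "z \<in> Domain (base (\<Union>\<C>))" "p \<in> M" "A.btw y p z"
    then obtain y' z' where "(y, y') \<in> base (\<Union>\<C>)" "(z, z') \<in> base (\<Union>\<C>)" by blast
    then obtain N where N: "N \<in> \<C>" "(y, y') \<in> base N" "(z, z') \<in> base N" using two by blast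
    have "p \<in> Domain (base N)" by (rule pisoD(5)[OF matchingD(1)[OF m[OF N(1)]] _ _ *(3,4)]) (use N in blast)+
    then show "p \<in> Domain (base (\<Union>\<C>))" using dom N(1) by blast
  qed
  moreover have "unit_bijection a a' (fiber (\<Union>\<C>) a a')" if "(a, a') \<in> base (\<Union>\<C>)" for a a'
  proof -
    obtain N where N: "N \<in> \<C>" "(a, a') \<in> base N" using \<open>(a, a') \<in> base (\<Union>\<C>)\<close> b by blast
    have "fiber N' a a' \<subseteq> fiber N a a'" if N': "N' \<in> \<C>" for N'
    proof (cases "N' \<subseteq> N")
      case True then show ?thesis by (auto simp: fiber_def)
    next
      case False
      then have sub: "N \<subseteq> N'" using comp[OF N(1) N'] by blast
      then have "fiber N a a' \<subseteq> fiber N' a a'" by (auto simp: fiber_def)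
      moreover have "(a, a') \<in> base N'" using mono[OF sub] N(2) by blast
      ultimately have "fiber N a a' = fiber N' a a'"
        using unit_bijection_subset matchingD(2)[OF m[OF N(1)] N(2)] matchingD(2)[OF m[OF N']] by blast
      then show ?thesis by simp
    qed
    then have "fiber (\<Union>\<C>) a a' = fiber N a a'" using N(1) unfolding fiber_def by blast
    then show ?thesis using matchingD(2)[OF m[OF N(1)] N(2)] by simp
  qed
  moreover have "(a, a', A.unit a b, B.unit a' b') \<in> \<Union>\<C>"
    if ab: "(a, a') \<in> base (\<Union>\<C>)" "(b, b') \<in> base (\<Union>\<C>)" "b \<noteq> a" for a a' b b'
  proof -
    obtain N where N: "N \<in> \<C>" "(a, a') \<in> base N" "(b, b') \<in> base N" using two[OF ab(1,2)] by blast
    then show ?thesis using matchingD(3)[OF m[OF N(1)] N(2,3) ab(3)] by (auto simp: fiber_def)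
  qed
  ultimately show ?thesis unfolding matching_def by blast
qed

text \<open>
  A maximal matching is everywhere defined: its domain is convex, and closed by \<open>matching_close\<close>, so
  that a point outside would have a projection and \<open>matching_grow\<close> would apply. It is surjective
  because the unit of a point outside the range, seen from its projection, is matched to a unit of
  the domain. The points of this unit are mapped into the same unit of the image, in a direction other
  than the missing one. Then the unit is a piece, and both of its directions at the projection are
  attained already.
\<close>

theorem line_isometry_extends:
  assumes P: "P \<in> \<P>" "P' \<in> \<P>'" and g: "range g = P" "\<And>s t :: real. d (g s) (g t) = \<bar>s - t\<bar>"
    and g': "range g' = P'" "\<And>s t. d' (g' s) (g' t) = \<bar>s - t\<bar>"
  shows "\<exists>f. bij_betw f M M' \<and> (\<forall>a\<in>M. \<forall>b\<in>M. d' (f a) (f b) = d a b) \<and>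
     (\<forall>a\<in>M. \<forall>b\<in>M. B.col (f a) (f b) \<longleftrightarrow> A.col a b) \<and> (\<forall>t. f (g t) = g' t)"
proof -
  obtain N0 where N0: "matching N0" "base N0 = {(g t, g' t) | t. True}"
    using matching_line[OF assms] by blast
  define L where "L = {(g t, g' t) | t. True}"
  define \<A> where "\<A> = {N. matching N \<and> L \<subseteq> base N}"
  have "N0 \<in> \<A>" using N0 by (simp add: \<A>_def L_def)
  have "\<exists>N\<in>\<A>. \<forall>X\<in>\<A>. N \<subseteq> X \<longrightarrow> X = N"
  proof (rule subset_Zorn_nonempty)
    show "\<A> \<noteq> {}" using \<open>N0 \<in> \<A>\<close> by blast
    fix \<C> assume C: "\<C> \<noteq> {}" "subset.chain \<A> \<C>"
    then have "\<C> \<subseteq> \<A>" "subset.chain {N. matching N} \<C>" by (auto simp: subset.chain_def \<A>_def)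
    moreover from this obtain N where "N \<in> \<C>" "L \<subseteq> base N" using C(1) by (auto simp: \<A>_def)
    moreover from this have "base N \<subseteq> base (\<Union>\<C>)" by (auto simp: base_def)
    ultimately show "\<Union>\<C> \<in> \<A>" using matching_chain[OF C(1)] by (auto simp: \<A>_def)
  qed
  then obtain N where N: "matching N" "L \<subseteq> base N" and maximal: "\<And>X. X \<in> \<A> \<Longrightarrow> N \<subseteq> X \<Longrightarrow> X = N"
    by (auto simp: \<A>_def)
  have stuck: "X = N" if "matching X" "N \<subseteq> X" for X
  proof -
    have "base N \<subseteq> base X" using that(2) by (auto simp: base_def)
    then show ?thesis using maximal[of X] that N(2) by (auto simp: \<A>_def)
  qed
  define K where "K = base N"
  note K = matchingD(1)[OF N(1), folded K_def]
  note KM = pisoD(1)[OF K] and KM' = pisoD(2)[OF K] and Kd = pisoD(3)[OF K] and Kc = pisoD(4)[OF K]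
  have o: "(g 0, g' 0) \<in> K" using N(2) by (auto simp: K_def L_def)
  have closed: "q \<in> Domain K" if "q \<in> M" "\<And>e. 0 < e \<Longrightarrow> \<exists>p\<in>Domain K. d p q < e" for q
    using matching_close[OF N(1) that(1)] that(2) stuck unfolding K_def by blast
  have total: "z \<in> Domain K" if z: "z \<in> M" for z
  proof (rule ccontr)
    assume nz: "z \<notin> Domain K"
    have "\<exists>a\<in>Domain K. \<forall>b\<in>Domain K. A.btw z a b"
    proof (rule A.projection[OF _ _ z])
      show "Domain K \<subseteq> M" using KM by blast
      show "Domain K \<noteq> {}" using o by blast
      show "p \<in> Domain K" if "a \<in> Domain K" "b \<in> Domain K" "p \<in> M" "A.btw a p b" for a b p
        using pisoD(5)[OF K that] .
    qed (rule closed)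
    then obtain a a' where "(a, a') \<in> K" "\<And>b. b \<in> Domain K \<Longrightarrow> A.btw z a b" by blast
    then show False using matching_grow[OF N(1) _ z] nz stuck unfolding K_def by blast
  qed
  have onto: "z' \<in> Range K" if z': "z' \<in> M'" for z'
  proof (rule ccontr)
    assume nz: "z' \<notin> Range K"
    have "\<exists>a'\<in>Range K. \<forall>b'\<in>Range K. B.btw z' a' b'"
    proof (rule B.projection[OF _ _ z'])
      show "Range K \<subseteq> M'" using KM' by blast
      show "Range K \<noteq> {}" using o by blast
    next
      fix a' b' p' assume ab': "a' \<in> Range K" "b' \<in> Range K" and p': "p' \<in> M'" "B.btw a' p' b'"
      obtain a b where ab: "(a, a') \<in> K" "(b, b') \<in> K" using ab' by blast
      have s: "0 \<le> d' a' p'" "d' a' p' \<le> d a b" using p'(2) B.nonneg[of p' b'] B.nonneg[of a' p'] Kd[OF ab] by linarith+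
      have "(A.point a b (d' a' p'), B.point a' b' (d' a' p')) \<in> K" by (rule piso_point[OF K ab s])
      then show "p' \<in> Range K" using B.point_eq[OF KM'[OF ab(1)] KM'[OF ab(2)] p'] by auto
    next
      fix q' assume q': "q' \<in> M'" and lim: "\<And>e. 0 < e \<Longrightarrow> \<exists>p'\<in>Range K. d' p' q' < e"
      have "\<forall>n. \<exists>x x'. (x, x') \<in> K \<and> d' x' q' < 1 / Suc n"
      proof
        fix n :: nat
        show "\<exists>x x'. (x, x') \<in> K \<and> d' x' q' < 1 / Suc n" using lim[of "1 / Suc n"] by auto
      qed
      then obtain x x' where x: "\<And>n. (x n, x' n) \<in> K" "\<And>n. d' (x' n) q' < 1 / Suc n" by metis
      have small: "\<exists>k. \<forall>n\<ge>k. 1 / real (Suc n) < e" if e: "0 < e" for e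
      proof -
        obtain k where "1 / real (Suc k) < e" using nat_approx_posE[OF e] by metis
        moreover have "1 / real (Suc n) \<le> 1 / real (Suc k)" if "n \<ge> k" for n using that by (simp add: frac_le)
        ultimately show ?thesis by (intro exI[of _ k]) (meson le_less_trans)
      qed
      have dxx: "d (x m) (x n) < 1 / Suc m + 1 / Suc n" for m n
        using B.triangle[OF KM'[OF x(1)[of m]] q' KM'[OF x(1)[of n]]] x(2)[of m] x(2)[of n]
          B.commute[of q' "x' n"] Kd[OF x(1) x(1), of m n] by linarith
      have "A.MCauchy x"
        unfolding A.MCauchy_def
      proof (intro conjI allI impI)
        show "range x \<subseteq> M" using KM x(1) by blast
        fix e :: real assume "0 < e"
        then obtain k where k: "\<forall>n\<ge>k. 1 / real (Suc n) < e / 2" using small[of "e / 2"] by auto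
        have "d (x m) (x n) < e" if "k \<le> m" "k \<le> n" for m n
          using dxx[of m n] k[rule_format, OF that(1)] k[rule_format, OF that(2)] by linarith
        then show "\<exists>k. \<forall>m n. k \<le> m \<longrightarrow> k \<le> n \<longrightarrow> d (x m) (x n) < e" by blast
      qed
      then obtain p where p: "limitin A.mtopology x p sequentially" using A.complete A.mcomplete_def by blast
      have "p \<in> M" using p A.limitin_mspace by blast
      then obtain p' where p': "(p, p') \<in> K" using total by blast
      have "d' p' q' \<le> e" if e: "0 < e" for e
      proof -
        obtain k where k: "\<And>n. k \<le> n \<Longrightarrow> 1 / real (Suc n) < e / 2" using small[of "e / 2"] e by auto
        obtain l where l: "\<And>n. l \<le> n \<Longrightarrow> d (x n) p < e / 2"
          using p e unfolding A.limitin_metric eventually_sequentially by (metis half_gt_zero)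
        define n where "n = max k l"
        have "d' (x' n) q' < e / 2" "d (x n) p < e / 2" using k[of n] l[of n] x(2)[of n] by (auto simp: n_def)
        then show ?thesis
          using B.triangle[OF KM'[OF p'] KM'[OF x(1)[of n]] q'] Kd[OF p' x(1)[of n]] A.commute[of p "x n"] by linarith
      qed
      then have "d' p' q' \<le> 0" by (rule field_le_epsilon[of _ 0, simplified])
      then have "p' = q'" using B.nonneg[of p' q'] B.zero[OF KM'[OF p'] q'] by simp
      then show "q' \<in> Range K" using p' by blast
    qed
    then obtain a a' where a: "(a, a') \<in> K" and proj: "\<And>b'. b' \<in> Range K \<Longrightarrow> B.btw z' a' b'" by blast
    note aM = KM[OF a] KM'[OF a]
    have za: "z' \<noteq> a'" using nz a by blast
    have far: "\<not> B.same_dir a' b' z'" if "(b, b') \<in> K" for b b'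
    proof -
      have "B.btw z' a' b'" using proj that by blast
      then have "B.btw b' a' z'" using B.commute[of z' a'] B.commute[of a' b'] B.commute[of z' b'] by linarith
      then show ?thesis using B.not_same_dir[OF aM(2) KM'[OF that] z'] by blast
    qed
    note U = matchingD(2)[OF N(1) a[unfolded K_def]]
    \<comment> \<open>The unit of \<open>z'\<close> has a partner \<open>W\<close>, and \<open>b\<close> is a point in the direction of \<open>W\<close>. Its image is in
        the unit of \<open>z'\<close> but not in its direction, so this unit is a piece \<open>Q\<close>.\<close>
    obtain W where W: "(W, B.unit a' z') \<in> fiber N a a'"
      using unit_bijectionD(6)[OF U B.unit_in_units[OF z' za]] by blast
    obtain b where b: "b \<in> M" "b \<noteq> a" "W = A.unit a b"
      using unit_bijectionD(1)[OF U W] by (auto simp: A.units_def)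
    obtain b' where b': "(b, b') \<in> K" using total[OF b(1)] by blast
    have ba': "b' \<noteq> a'" using piso_eq_iff[OF K b' a] b(2) by blast
    note bM' = KM'[OF b']
    have "B.unit a' b' = B.unit a' z'"
      using matching_unit_iff[OF N(1) a[unfolded K_def] matchingD(3)[OF N(1) a[unfolded K_def] b'[unfolded K_def] b(2)] W] b(3) by blast
    then obtain Q where Q: "B.toward Q a' b'" "B.toward Q a' z'"
      using B.unit_eq_iff[OF aM(2) bM' z' ba' za] far[OF b'] by blast
    obtain e where e: "e > 0" "e \<le> d' a' b'" "\<And>s. 0 \<le> s \<Longrightarrow> s \<le> e \<Longrightarrow> B.point a' b' s \<in> Q"
      using B.toward_initial[OF aM(2) bM' Q(1)] by blast
    define c where "c = A.point a b e"
    define c' where "c' = B.point a' b' e"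
    have e': "0 \<le> e" "e \<le> d a b" using e(1,2) Kd[OF a b'] by auto
    have c: "(c, c') \<in> K" unfolding c_def c'_def by (rule piso_point[OF K a b' e'])
    have cQ: "c' \<in> Q" "a' \<in> Q" "Q \<in> \<P>'" using e Q(1) by (auto simp: c'_def B.toward_def)
    have ca: "c \<noteq> a" using A.point(2)[OF aM(1) b(1) e'] e(1) aM(1) by (auto simp: c_def)
    have ca': "c' \<noteq> a'" using piso_eq_iff[OF K c a] ca by blast
    have cb: "B.same_dir a' c' b'" using ca' B.point(1,4)[OF aM(2) bM' e'(1) e(2)]
      by (intro B.btw_same_dir[OF aM(2) bM']) (simp_all add: c'_def)
    \<comment> \<open>The piece \<open>R\<close> corresponds to \<open>Q\<close>. A point \<open>x\<close> on the half of \<open>R\<close> opposite to \<open>b\<close> is mapped to the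
        half of \<open>Q\<close> that contains the direction of \<open>z'\<close>.\<close>
    obtain R where R: "R \<in> \<P>" "a \<in> R" "c \<in> R"
      using Kc[OF a c] cQ unfolding A.col_def B.col_def by blast
    have "A.toward R a c" using R A.same_dir_refl[OF aM(1) KM[OF c] ca[symmetric]] by (auto simp: A.toward_def)
    then obtain x where x: "x \<in> R" "A.toward R a x" "\<not> A.same_dir a c x" "x \<noteq> a"
      using A.toward_opposite[OF aM(1) KM[OF c]] by blast
    have xM: "x \<in> M" using x(1) A.piece_subset[OF R(1)] by blast
    obtain x' where x': "(x, x') \<in> K" using total[OF xM] by blast
    have xa': "x' \<noteq> a'" using piso_eq_iff[OF K x' a] x(4) by blast
    have cx': "\<not> B.same_dir a' c' x'" using x(3) piso_same_dir[OF K a c x'] by blast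
    have "B.col c' x'" using Kc[OF c x'] R x(1) by (auto simp: A.col_def)
    then obtain S where S: "S \<in> \<P>'" "c' \<in> S" "x' \<in> S" by (auto simp: B.col_def)
    have "B.btw c' a' x'" using B.not_same_dir[OF aM(2) KM'[OF c] KM'[OF x']] cx' by blast
    then have "a' \<in> S" using B.piece_convex[OF S aM(2)] by blast
    then have "S = Q" using B.piece_inter[OF S(1) cQ(3), of a' c'] S cQ ca' by blast
    then have "B.toward Q a' x'" using S cQ(2) B.same_dir_refl[OF aM(2) KM'[OF x'] xa'[symmetric]] by (auto simp: B.toward_def)
    moreover have "\<not> B.same_dir a' b' x'"
      using cx' B.same_dir_trans[OF aM(2) KM'[OF c] KM'[OF x'] bM' cb] by blast
    ultimately show False
      using B.line_two_sides[OF aM(2) bM' KM'[OF x'] z' Q(1) _ Q(2)] far[OF b'] far[OF x'] by blast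
  qed
  define f where "f a = (SOME a'. (a, a') \<in> K)" for a
  have f: "(a, f a) \<in> K" if "a \<in> M" for a unfolding f_def using total[OF that] by (auto intro: someI)
  have f_eq: "f a = a'" if "(a, a') \<in> K" for a a' using piso_eq_iff[OF K f[OF KM[OF that]] that] by simp
  have "bij_betw f M M'"
  proof (rule bij_betw_imageI)
    show "inj_on f M" using f piso_eq_iff[OF K] by (metis inj_onI)
    show "f ` M = M'"
    proof
      show "f ` M \<subseteq> M'" using f KM' by blast
      show "M' \<subseteq> f ` M" using onto f_eq KM by blast
    qed
  qed
  moreover have "f (g t) = g' t" for t using N(2) by (intro f_eq) (auto simp: K_def L_def)
  ultimately show ?thesis using f Kd Kc by (intro exI[of _ f]) simp
qed

end

section \<open>Reduced words\<close>

abbreviation word_mult :: "('a \<times> bool) list \<Rightarrow> ('a \<times> bool) list \<Rightarrow> ('a \<times> bool) list" where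
  "word_mult v w \<equiv> foldr cancel_cons v w"

definition word_inv :: "('a \<times> bool) list \<Rightarrow> ('a \<times> bool) list" where
  "word_inv w = rev (map letter_inv w)"

lemma letter_inv_neq: "letter_inv a \<noteq> a"
  by (cases a) (simp add: letter_inv_def)

lemma letter_inv_eq_iff [simp]: "letter_inv a = letter_inv b \<longleftrightarrow> a = b"
  by (metis letter_inv_inv)

lemma reduced_word_append:
  "reduced_word (v @ w) \<longleftrightarrow> reduced_word v \<and> reduced_word w \<and>
     (v \<noteq> [] \<and> w \<noteq> [] \<longrightarrow> hd w \<noteq> letter_inv (last v))"
  by (induction v) (auto simp: reduced_word_Cons)

lemma length_word_inv [simp]: "length (word_inv w) = length w"
  by (simp add: word_inv_def)

lemma word_inv_append: "word_inv (v @ w) = word_inv w @ word_inv v"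
  by (simp add: word_inv_def)

lemma fst_set_word_inv [simp]: "fst ` set (word_inv w) = fst ` set w"
  by (force simp: word_inv_def)

lemma reduced_word_inv: "reduced_word w \<Longrightarrow> reduced_word (word_inv w)"
proof (induction w)
  case (Cons a w)
  then show ?case
    by (cases w) (auto simp: word_inv_def reduced_word_append reduced_word_Cons)
qed (simp add: word_inv_def)

lemma word_mult_append:
  assumes "reduced_word (v @ w)"
  shows "word_mult v w = v @ w"
  using foldr_cancel_Nil[OF assms] foldr_cancel_Nil[of w] assms by (simp add: reduced_word_append)

lemma word_mult_left:
  "\<exists>i x. word_mult \<alpha> w = x @ drop i w \<and> i + length x \<le> length \<alpha>"
proof (induction \<alpha>)
  case (Cons a \<alpha>)
  then obtain i x where ix: "word_mult \<alpha> w = x @ drop i w" "i + length x \<le> length \<alpha>" by blast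
  show ?case
  proof (cases "x @ drop i w \<noteq> [] \<and> hd (x @ drop i w) = letter_inv a")
    case True
    show ?thesis
    proof (cases x)
      case Nil
      then have "word_mult (a # \<alpha>) w = [] @ drop (Suc i) w"
        using True ix by (simp add: cancel_cons_def tl_drop drop_Suc)
      then show ?thesis using ix Nil by (intro exI[of _ "Suc i"] exI[of _ "[]"]) auto
    next
      case (Cons b y)
      then have "word_mult (a # \<alpha>) w = y @ drop i w" using True ix by (simp add: cancel_cons_def)
      then show ?thesis using ix Cons by (intro exI[of _ i] exI[of _ y]) auto
    qed
  next
    case False
    then have "word_mult (a # \<alpha>) w = (a # x) @ drop i w"
      using ix unfolding cancel_cons_def by auto
    then show ?thesis using ix by (intro exI[of _ i] exI[of _ "a # x"]) auto
  qed
qed (intro exI[of _ 0] exI[of _ "[]"], simp)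

lemma word_mult_snoc:
  "reduced_word w \<Longrightarrow> word_mult w [c] = (if w \<noteq> [] \<and> last w = letter_inv c then butlast w else w @ [c])"
proof (induction w)
  case (Cons a w)
  then show ?case
    by (cases w) (auto simp: cancel_cons_def reduced_word_Cons)
qed simp

text \<open>
  Cancellation is performed from the left by \<open>word_mult\<close>. On the right the letters of \<open>\<gamma>\<close> have to be
  absorbed one after the other.
\<close>

lemma word_mult_right:
  assumes "reduced_word w"
  shows "\<exists>j x. word_mult w (word_mult \<gamma> []) = take j w @ x \<and> length x \<le> length \<gamma>"
proof (induction \<gamma> rule: rev_induct)
  case Nil
  then show ?case using assms by (intro exI[of _ "length w"] exI[of _ "[]"]) (simp add: foldr_cancel_Nil)
next
  case (snoc c \<gamma>)
  then obtain j x where jx: "word_mult w (word_mult \<gamma> []) = take j w @ x" "length x \<le> length \<gamma>" by blast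
  have red: "reduced_word (take j w @ x)" using jx(1) reduced_foldr[of "word_mult \<gamma> []" w]
    by (metis reduced_foldr reduced_word_Nil)
  have "word_mult w (word_mult (\<gamma> @ [c]) []) = word_mult w (word_mult (word_mult \<gamma> []) [c])"
    using foldr_cancel_assoc[of "[c]" \<gamma> "[]"] by (simp add: cancel_cons_def reduced_word_Cons)
  also have "\<dots> = word_mult (take j w @ x) [c]"
    using foldr_cancel_assoc[of "[c]" w "word_mult \<gamma> []"] jx(1) by (simp add: reduced_word_Cons)
  also have "\<dots> = (if take j w @ x \<noteq> [] \<and> last (take j w @ x) = letter_inv c
      then butlast (take j w @ x) else (take j w @ x) @ [c])" by (rule word_mult_snoc[OF red])
  finally have eq: "word_mult w (word_mult (\<gamma> @ [c]) []) = \<dots>" .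
  show ?case
  proof (cases "take j w @ x \<noteq> [] \<and> last (take j w @ x) = letter_inv c")
    case True
    show ?thesis
    proof (cases "x = []")
      case x: True
      have "butlast (take j w) = take (min j (length w) - 1) w"
        by (cases "j \<le> length w") (auto simp: butlast_take butlast_conv_take)
      then have "word_mult w (word_mult (\<gamma> @ [c]) []) = take (min j (length w) - 1) w @ []"
        using eq True x by simp
      then show ?thesis 
        by (intro exI[of _ "min j (length w) - 1"] exI[of _ "[]"] conjI) (assumption | simp)+
    next
      case False
      then show ?thesis using eq True jx(2) by (intro exI[of _ j] exI[of _ "butlast x"]) (auto simp: butlast_append)
    qed
  next
    case False
    then show ?thesis using eq jx(2) by (intro exI[of _ j] exI[of _ "x @ [c]"]) auto
  qed
qed

text \<open>A product differs from its middle factor only near both ends.\<close>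

lemma word_mult_middle:
  assumes "reduced_word \<beta>" "length \<alpha> \<le> K" "length \<gamma> \<le> K"
  shows "\<exists>x m y \<beta>1 \<beta>2. word_mult \<alpha> (word_mult \<beta> (word_mult \<gamma> [])) = x @ m @ y \<and> length x \<le> K \<and> length y \<le> K \<and> \<beta> = \<beta>1 @ m @ \<beta>2"
proof -
  obtain j y where y: "word_mult \<beta> (word_mult \<gamma> []) = take j \<beta> @ y" "length y \<le> length \<gamma>"
    using word_mult_right[OF assms(1)] by blast
  obtain i x where x: "word_mult \<alpha> (take j \<beta> @ y) = x @ drop i (take j \<beta> @ y)" "i + length x \<le> length \<alpha>"
    using word_mult_left by blast
  have "\<beta> = take i (take j \<beta>) @ drop i (take j \<beta>) @ drop j \<beta>"
    by (metis append.assoc append_take_drop_id)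
  moreover have "word_mult \<alpha> (word_mult \<beta> (word_mult \<gamma> [])) = x @ drop i (take j \<beta>) @ drop (i - length (take j \<beta>)) y"
    using x y by simp
  ultimately show ?thesis using x(2) y(2) assms(2,3)
    by (intro exI[of _ x] exI[of _ "drop i (take j \<beta>)"] exI[of _ "drop (i - length (take j \<beta>)) y"]
      exI[of _ "take i (take j \<beta>)"] exI[of _ "drop j \<beta>"] conjI) (assumption | simp)+
qed

text \<open>
  Two words that differ at position \<open>i\<close> have at most \<open>i\<close> letters in common at the beginning, and only
  those cancel in the quotient.
\<close>

lemma length_word_mult_diverging:
  assumes "reduced_word v" "reduced_word w" "i < length v" "i < length w" "v ! i \<noteq> w ! i"
  shows "length v + length w \<le> length (word_mult (word_inv v) w) + 2 * i"
  using assms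
proof (induction i arbitrary: v w)
  case 0
  then obtain a v' b w' where *: "v = a # v'" "w = b # w'" "a \<noteq> b" by (cases v; cases w) auto
  then have "reduced_word (word_inv v @ w)"
    using 0 reduced_word_inv[of v] unfolding reduced_word_append by (auto simp: word_inv_def)
  then show ?case using word_mult_append[of "word_inv v" w] by simp
next
  case (Suc i)
  then obtain a v' b w' where *: "v = a # v'" "w = b # w'" by (cases v; cases w) auto
  show ?case
  proof (cases "a = b")
    case True
    have red: "reduced_word v'" "reduced_word w'" using Suc.prems * by (auto simp: reduced_word_Cons)
    have "word_mult (word_inv v) w = word_mult (word_inv v') (cancel_cons (letter_inv a) (cancel_cons a w'))"
      using True * Suc.prems(2) by (auto simp: word_inv_def cancel_cons_def reduced_word_Cons)
    then have "word_mult (word_inv v) w = word_mult (word_inv v') w'" 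
      using cancel_cons_inv[OF red(2), of a] by simp
    then show ?thesis using Suc.IH[OF red] Suc.prems * by auto
  next
    case False
    then have "reduced_word (word_inv v @ w)"
      using Suc.prems reduced_word_inv[of v] * unfolding reduced_word_append by (auto simp: word_inv_def)
    then show ?thesis using word_mult_append[of "word_inv v" w] by simp
  qed
qed

lemma cyclically_reduced_core:
  assumes "reduced_word w" "w \<noteq> []"
  shows "\<exists>p u. w = p @ u @ word_inv p \<and> u \<noteq> [] \<and> hd u \<noteq> letter_inv (last u)"
  using assms
proof (induction "length w" arbitrary: w rule: less_induct)
  case less
  show ?case
  proof (cases "hd w = letter_inv (last w)")
    case False
    then show ?thesis using less by (intro exI[of _ "[]"] exI[of _ w]) (auto simp: word_inv_def)
  next
    case True
    obtain a v where v: "w = a # v" using less by (cases w) auto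
    then have "v \<noteq> []" using True letter_inv_neq[of a] by auto
    then obtain v' b where v': "v = v' @ [b]" by (cases v rule: rev_cases) auto
    have b: "b = letter_inv a" using True v v' by simp
    then have "v' \<noteq> []" using less(2) v v' by (auto simp: reduced_word_Cons)
    moreover have "reduced_word v'" using less(2) v v' by (auto simp: reduced_word_Cons reduced_word_append)
    ultimately obtain p u where "v' = p @ u @ word_inv p" "u \<noteq> []" "hd u \<noteq> letter_inv (last u)"
      using less(1)[of v'] v v' by auto
    then show ?thesis using v v' b by (intro exI[of _ "a # p"] exI[of _ u]) (auto simp: word_inv_def)
  qed
qed

lemma reduced_word_concat:
  assumes "\<And>b. b \<in> set bs \<Longrightarrow> reduced_word b \<and> b \<noteq> []"
    and "\<And>b b'. b \<in> set bs \<Longrightarrow> b' \<in> set bs \<Longrightarrow> hd b' \<noteq> letter_inv (last b)"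
  shows "reduced_word (concat bs)"
  using assms
proof (induction bs)
  case (Cons b bs)
  have "hd (concat bs) = hd (hd bs)" if "concat bs \<noteq> []"
    using that Cons.prems(1) by (cases bs) auto
  moreover have "hd bs \<in> set bs" if "concat bs \<noteq> []" using that by (cases bs) auto
  moreover have "reduced_word (concat bs)" using Cons by auto
  ultimately show ?case using Cons.prems by (auto simp: reduced_word_append)
qed simp

definition periodic :: "nat \<Rightarrow> 'b list \<Rightarrow> bool" where
  "periodic p w \<longleftrightarrow> (\<forall>i. i + p < length w \<longrightarrow> w ! (i + p) = w ! i)"

lemma periodic_factor: "periodic p (x @ m @ y) \<Longrightarrow> periodic p m"
  unfolding periodic_def
proof (intro allI impI)
  fix i assume *: "\<forall>i. i + p < length (x @ m @ y) \<longrightarrow> (x @ m @ y) ! (i + p) = (x @ m @ y) ! i" "i + p < length m"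
  have "(x @ m @ y) ! ((length x + i) + p) = (x @ m @ y) ! (length x + i)" using * by auto
  then show "m ! (i + p) = m ! i" using *(2) by (simp add: nth_append add.assoc)
qed

lemma periodic_mod:
  assumes "periodic p w" "i < length w"
  shows "w ! i = w ! (i mod p)"
  using assms(2)
proof (induction i rule: less_induct)
  case (less i)
  show ?case
  proof (cases "i < p \<or> p = 0")
    case False
    then have "w ! i = w ! (i - p)" using assms(1) less(2) unfolding periodic_def
      by (metis le_add_diff_inverse2 not_less)
    also have "\<dots> = w ! ((i - p) mod p)" using less False by auto
    also have "(i - p) mod p = i mod p" using False by (simp add: le_mod_geq)
    finally show ?thesis .
  qed auto
qed

text \<open>
  A run of equal letters of length at least \<open>p\<close> meets every residue class modulo \<open>p\<close>.
\<close>

lemma periodic_run: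
  assumes "periodic p (x @ replicate m c @ y)" "0 < p" "p \<le> m"
  shows "set (x @ replicate m c @ y) \<subseteq> {c}"
proof
  fix b assume "b \<in> set (x @ replicate m c @ y)"
  then obtain i where i: "i < length (x @ replicate m c @ y)" "b = (x @ replicate m c @ y) ! i"
    by (metis in_set_conv_nth)
  define j where "j = (i + (p - 1) * length x) mod p"
  have j: "j < p" using assms(2) by (simp add: j_def)
  have "(length x + j) mod p = (length x + (i + (p - 1) * length x)) mod p"
    unfolding j_def by (simp add: mod_add_right_eq)
  also have "length x + (i + (p - 1) * length x) = i + p * length x"
    using assms(2) by (cases p) auto
  finally have "(length x + j) mod p = i mod p" by simp
  moreover have "(x @ replicate m c @ y) ! (length x + j) = c"
    using j assms(3) by (simp add: nth_append)
  ultimately have "b = c"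
    using periodic_mod[OF assms(1) i(1)] periodic_mod[OF assms(1), of "length x + j"] i(2) j assms(3) by simp
  then show "b \<in> {c}" by simp
qed

lemma periodic_replicate: "periodic (length u) (concat (replicate n u))"
proof (induction n)
  case (Suc n)
  show ?case unfolding periodic_def
  proof (intro allI impI)
    fix i assume i: "i + length u < length (concat (replicate (Suc n) u))"
    have eq: "concat (replicate (Suc n) u) = u @ concat (replicate n u)" by simp
    have i': "i < length (concat (replicate n u))" using i by simp
    have "concat (replicate (Suc n) u) ! (i + length u) = concat (replicate n u) ! i"
      unfolding eq by (simp add: nth_append)
    also have "\<dots> = concat (replicate (Suc n) u) ! i"
    proof (cases "i < length u")
      case True
      then show ?thesis using i' by (cases n) (auto simp: nth_append)
    next
      case False
      then have "concat (replicate n u) ! i = concat (replicate n u) ! (i - length u)"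
        using Suc.IH i' unfolding periodic_def by (metis le_add_diff_inverse2 not_less)
      then show ?thesis unfolding eq using False by (simp add: nth_append)
    qed
    finally show "concat (replicate (Suc n) u) ! (i + length u) = concat (replicate (Suc n) u) ! i" .
  qed
qed (simp add: periodic_def)

section \<open>Free bases\<close>

locale free_basis_group = group G for G (structure) +
  fixes S :: "'a set"
  assumes basis: "free_basis G S"
begin

lemma S_closed: "S \<subseteq> carrier G"
  using basis by (simp add: free_basis_def)

lemma eval_mult:
  assumes "reduced_word v" "reduced_word w" "fst ` set v \<subseteq> S" "fst ` set w \<subseteq> S"
  shows "word_eval G (word_mult v w) = word_eval G v \<otimes> word_eval G w"
  using basis assms unfolding free_basis_def iso_def hom_def free_group_def by auto

lemma eval_inj:
  assumes "reduced_word v" "reduced_word w" "fst ` set v \<subseteq> S" "fst ` set w \<subseteq> S" "word_eval G v = word_eval G w"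
  shows "v = w"
proof -
  have "inj_on (word_eval G) (carrier (free_group S))"
    using basis unfolding free_basis_def iso_def by (auto simp: bij_betw_def)
  then show ?thesis using assms by (auto simp: inj_on_def free_group_def)
qed

lemma eval_surj:
  assumes "g \<in> carrier G"
  shows "\<exists>w. reduced_word w \<and> fst ` set w \<subseteq> S \<and> word_eval G w = g"
proof -
  have "word_eval G ` carrier (free_group S) = carrier G"
    using basis unfolding free_basis_def iso_def by (auto simp: bij_betw_def)
  then show ?thesis using assms by (auto simp: free_group_def image_iff) (metis (no_types, lifting) imageE mem_Collect_eq)
qed

lemma eval_closed: "fst ` set w \<subseteq> S \<Longrightarrow> word_eval G w \<in> carrier G"
  using word_eval_closed S_closed by blast

lemma eval_inv:
  assumes "fst ` set w \<subseteq> S"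
  shows "word_eval G (word_inv w) = inv (word_eval G w)"
  using word_eval_inverse[of w] assms S_closed by (auto simp: word_inv_def letter_inv_def)

lemma eval_Nil [simp]: "word_eval G [] = \<one>"
  by (simp add: word_eval_def)

lemma eval_reduce:
  "fst ` set w \<subseteq> S \<Longrightarrow> word_eval G (word_mult w []) = word_eval G w"
proof (induction w)
  case (Cons a w)
  have w: "fst ` set w \<subseteq> S" "fst ` set [a] \<subseteq> S" using Cons.prems by auto
  have "fst ` set (word_mult w []) \<subseteq> S" using fst_set_foldr[of w S "[]"] w by simp
  then have "word_eval G (word_mult [a] (word_mult w [])) = word_eval G [a] \<otimes> word_eval G w"
    using eval_mult[of "[a]" "word_mult w []"] w Cons.IH by (simp add: reduced_foldr reduced_word_Cons)
  also have "\<dots> = word_eval G ([a] @ w)"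
    by (rule word_eval_append[symmetric]) (use w S_closed in auto)
  finally show ?case by simp
qed simp

lemma length_reduce: "length (word_mult w []) \<le> length w"
proof (induction w)
  case (Cons a w)
  then show ?case by (auto simp: cancel_cons_def)
qed simp

lemma generate_S: "generate G S = carrier G"
proof
  show "generate G S \<subseteq> carrier G" using generate_incl[OF S_closed] .
  have "word_eval G w \<in> generate G S" if "fst ` set w \<subseteq> S" for w
    using that
  proof (induction w)
    case (Cons a w)
    obtain s b where a: "a = (s, b)" by (cases a)
    then have "(if b then s else inv s) \<in> generate G S" using Cons.prems by (auto intro: generate.intros)
    then show ?case using Cons by (auto simp: word_eval_def a intro: generate.eng)
  qed (simp add: generate.one)
  then show "carrier G \<subseteq> generate G S" using eval_surj by blast
qed

lemma word_length_eval:
  assumes "reduced_word w" "fst ` set w \<subseteq> S"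
  shows "word_length G S (word_eval G w) = length w"
proof (rule antisym)
  show "word_length G S (word_eval G w) \<le> length w" by (rule word_length_le[OF assms(2)])
  have "word_eval G w \<in> generate G S" using eval_closed[OF assms(2)] generate_S by simp
  then obtain v where v: "fst ` set v \<subseteq> S" "length v = word_length G S (word_eval G w)" "word_eval G v = word_eval G w"
    using word_length_exists[OF S_closed] by blast
  have "word_mult v [] = w"
    using v eval_reduce[OF v(1)] fst_set_foldr[of v S "[]"] assms
    by (intro eval_inj) (auto simp: reduced_foldr)
  then show "length w \<le> word_length G S (word_eval G w)" using length_reduce[of v] v(2) by simp
qed

lemma cayley: "mspace (cayley_metric G S) = carrier G"
    "mdist (cayley_metric G S) g h = (if g \<in> carrier G \<and> h \<in> carrier G then real (word_length G S (inv g \<otimes> h)) else 0)"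
  unfolding cayley_metric_def
  using Metric_space.mspace_metric[OF Metric_space_cayley[OF S_closed generate_S]]
    Metric_space.mdist_metric[OF Metric_space_cayley[OF S_closed generate_S]] by simp_all

lemma cayley_dist:
  assumes "g \<in> carrier G" "reduced_word v" "fst ` set v \<subseteq> S" "reduced_word w" "fst ` set w \<subseteq> S"
  shows "mdist (cayley_metric G S) (g \<otimes> word_eval G v) (g \<otimes> word_eval G w) = length (word_mult (word_inv v) w)"
proof -
  note cl = eval_closed[OF assms(3)] eval_closed[OF assms(5)] assms(1)
  have "inv (g \<otimes> word_eval G v) \<otimes> (g \<otimes> word_eval G w) = inv (word_eval G v) \<otimes> word_eval G w"
    using cl by (simp add: inv_mult_group m_assoc[symmetric]) (simp add: m_assoc)
  also have "\<dots> = word_eval G (word_mult (word_inv v) w)"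
    using assms by (simp add: eval_mult reduced_word_inv eval_inv)
  finally have "inv (g \<otimes> word_eval G v) \<otimes> (g \<otimes> word_eval G w) = \<dots>" .
  moreover have "word_length G S (word_eval G (word_mult (word_inv v) w)) = length (word_mult (word_inv v) w)"
    using assms fst_set_foldr[of "word_inv v" S w] by (intro word_length_eval) (auto simp: reduced_foldr)
  ultimately show ?thesis using cl by (simp add: cayley)
qed

text \<open>
  The letters that occur in the members of \<open>T\<close> already generate the group. By freeness no further
  element of \<open>S\<close> is a product of them.
\<close>

lemma finite_basis:
  assumes "finite T" "T \<subseteq> carrier G" "generate G T = carrier G"
  shows "finite S"
proof -
  have "\<forall>t\<in>T. \<exists>w. reduced_word w \<and> fst ` set w \<subseteq> S \<and> word_eval G w = t"
    using eval_surj assms(2) by blast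
  then obtain f where f: "\<And>t. t \<in> T \<Longrightarrow> reduced_word (f t) \<and> fst ` set (f t) \<subseteq> S \<and> word_eval G (f t) = t" by metis
  define S1 where "S1 = (\<Union>t\<in>T. fst ` set (f t))"
  have "finite S1" using assms(1) by (simp add: S1_def)
  have S1: "S1 \<subseteq> S" using f by (auto simp: S1_def)
  have "T \<subseteq> generate G S1"
  proof
    fix t assume t: "t \<in> T"
    have "word_eval G w \<in> generate G S1" if "fst ` set w \<subseteq> S1" for w
      using that
    proof (induction w)
      case (Cons a w)
      obtain s b where a: "a = (s, b)" by (cases a)
      then have "(if b then s else inv s) \<in> generate G S1" using Cons.prems by (auto intro: generate.intros)
      then show ?case using Cons by (auto simp: word_eval_def a intro: generate.eng)
    qed (simp add: generate.one)
    moreover have "fst ` set (f t) \<subseteq> S1" using t by (auto simp: S1_def)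
    ultimately show "t \<in> generate G S1" using f[OF t] by metis
  qed
  then have gen: "carrier G \<subseteq> generate G S1"
    using assms(3) generate_subgroup_incl[OF _ generate_is_subgroup] S1 S_closed by (metis order_trans)
  have "S \<subseteq> S1"
  proof
    fix s assume s: "s \<in> S"
    have "s \<in> generate G S1" using gen s S_closed by blast
    then obtain v where v: "fst ` set v \<subseteq> S1" "word_eval G v = s"
      using word_length_exists[of S1 s] S1 S_closed by blast
    have "word_eval G [(s, True)] = s" using s S_closed by (auto simp: word_eval_def)
    then have "word_mult v [] = [(s, True)]"
      using v eval_reduce[of v] S1 s fst_set_foldr[of v S "[]"]
      by (intro eval_inj) (auto simp: reduced_foldr reduced_word_Cons)
    then show "s \<in> S1" using fst_set_foldr[of v S1 "[]"] v(1) by simp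
  qed
  then show ?thesis using \<open>finite S1\<close> finite_subset by blast
qed

end

section \<open>Words in two blocks\<close>

text \<open>
  The conditions on \<open>c\<close> say that \<open>u\<close> and powers of \<open>c\<close> can be concatenated in any order without
  cancellation, and that \<open>u\<close> is not itself a power of \<open>c\<close>.
\<close>

locale block_words =
  fixes u :: "('a \<times> bool) list" and c :: "'a \<times> bool"
  assumes u: "u \<noteq> []" "reduced_word u" "hd u \<noteq> letter_inv (last u)"
    and c: "c \<noteq> letter_inv (hd u)" "c \<noteq> letter_inv (last u)" "\<not> set u \<subseteq> {c}"
begin

text \<open>
  Both blocks have the same length, so that positions in the word do not depend on the choice of
  blocks.
\<close>

definition block :: "bool \<Rightarrow> ('a \<times> bool) list" where
  "block b = (if b then u else replicate (length u) c)"

definition segment :: "(nat \<Rightarrow> bool) \<Rightarrow> nat \<Rightarrow> nat \<Rightarrow> ('a \<times> bool) list" where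
  "segment B i j = concat (map (\<lambda>q. block (B q)) [i..<j])"

lemma length_u: "0 < length u"
  using u by simp

lemma length_block [simp]: "length (block b) = length u"
  by (simp add: block_def)

lemma segment_append: "i \<le> j \<Longrightarrow> j \<le> k \<Longrightarrow> segment B i k = segment B i j @ segment B j k"
  using upt_add_eq_append[of i j "k - j"] by (simp add: segment_def)

lemma segment_single: "segment B i (Suc i) = block (B i)"
  by (simp add: segment_def)

lemma length_segment [simp]: "length (segment B i j) = length u * (j - i)"
proof (induction j)
  case (Suc j)
  show ?case
  proof (cases "i \<le> j")
    case True
    then show ?thesis using Suc segment_append[of i j "Suc j" B]
      by (simp add: segment_single Suc_diff_le)
  qed (simp add: segment_def)
qed (simp add: segment_def)

lemma reduced_replicate: "reduced_word (replicate m a)"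
  by (induction m) (auto simp: reduced_word_Cons letter_inv_neq[symmetric] split: nat.splits)

lemma reduced_segment: "reduced_word (segment B i j)"
  unfolding segment_def
proof (rule reduced_word_concat)
  have b: "hd (block b) = (if b then hd u else c)" "last (block b) = (if b then last u else c)" for b
    using u(1) by (auto simp: block_def)
  fix w w' assume "w \<in> set (map (\<lambda>q. block (B q)) [i..<j])"
  then obtain q where w: "w = block q" by auto
  show "reduced_word w \<and> w \<noteq> []"
    using u reduced_replicate[of "length u" c] by (simp add: w block_def)
  assume "w' \<in> set (map (\<lambda>q. block (B q)) [i..<j])"
  then obtain q' where w': "w' = block q'" by auto
  have "hd u \<noteq> letter_inv c" using c(1) letter_inv_inv[of "hd u"] letter_inv_inv[of c] by metis
  then show "hd w' \<noteq> letter_inv (last w)"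
    using u(3) c(2) letter_inv_neq[of c] by (auto simp: w w' b split: if_splits)
qed

lemma segment_const:
  assumes "\<And>q. i \<le> q \<Longrightarrow> q < j \<Longrightarrow> B q = b"
  shows "segment B i j = concat (replicate (j - i) (block b))"
proof -
  have "map (\<lambda>q. block (B q)) [i..<j] = map (\<lambda>q. block b) [i..<j]" using assms by auto
  then show ?thesis by (simp add: segment_def map_replicate_const)
qed

lemma set_segment: "set (segment B i j) \<subseteq> insert c (set u)"
  by (auto simp: segment_def block_def split: if_splits)

lemma concat_replicate_letter: "concat (replicate m (replicate l a)) = replicate (m * l) a"
  by (induction m) (auto simp: replicate_add)

lemma segments_diverge:
  assumes "B i \<noteq> B' i" "i < j" "i < j'"
  shows "length u * j + length u * j' \<le>
    length (word_mult (word_inv (segment B 0 j)) (segment B' 0 j')) + 2 * length u * (i + 1)"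
proof -
  have "set (replicate (length u) c) \<subseteq> {c}" by auto
  then have "u \<noteq> replicate (length u) c" using c(3) by metis
  then have "block (B i) \<noteq> block (B' i)" using assms(1) by (cases "B i"; cases "B' i") (auto simp: block_def)
  then obtain q where q: "q < length u" "block (B i) ! q \<noteq> block (B' i) ! q"
    by (metis length_block nth_equalityI)
  have nth: "segment B 0 j ! (length u * i + q) = block (B i) ! q" if "i < j" for B j
  proof -
    have "segment B 0 j = segment B 0 i @ block (B i) @ segment B (Suc i) j"
      using that segment_append[of 0 i j B] segment_append[of i "Suc i" j B] by (simp add: segment_single)
    then show ?thesis using q(1) by (simp add: nth_append)
  qed
  have less: "length u * i + q < length u * j" if "i < j" for j
  proof -
    have "length u * i + q < length u * (i + 1)" using q(1) by simp
    also have "\<dots> \<le> length u * j" using that by (intro mult_left_mono) auto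
    finally show ?thesis .
  qed
  have "length (segment B 0 j) + length (segment B' 0 j') \<le>
      length (word_mult (word_inv (segment B 0 j)) (segment B' 0 j')) + 2 * (length u * i + q)"
    by (rule length_word_mult_diverging[OF reduced_segment reduced_segment])
      (use less[OF assms(2)] less[OF assms(3)] nth[OF assms(2)] nth[OF assms(3)] q(2) in auto)
  moreover have "2 * (length u * i + q) \<le> 2 * length u * (i + 1)" using q(1) by simp
  ultimately show ?thesis by simp
qed

text \<open>
  The power of \<open>c\<close> in the gap is at least as long as the period, so a periodic word would consist of \<open>c\<close> only.
\<close>

lemma gap_not_periodic:
  assumes "B i" "\<And>q. i < q \<Longrightarrow> q < i + k \<Longrightarrow> \<not> B q" "0 < p" "p < k" "periodic p (x @ segment B i (i + k) @ y)"
  shows False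
proof -
  have "segment B i (i + k) = segment B i (Suc i) @ segment B (Suc i) (i + k)"
    using assms(4) by (intro segment_append) auto
  also have "segment B (Suc i) (i + k) = concat (replicate (k - 1) (block False))"
    using segment_const[of "Suc i" "i + k" B False] assms(2) by auto
  also have "\<dots> = replicate ((k - 1) * length u) c" by (simp add: block_def concat_replicate_letter)
  also have "segment B i (Suc i) = u" using assms(1) by (simp add: segment_single block_def)
  finally have eq: "segment B i (i + k) = u @ replicate ((k - 1) * length u) c" .
  have "p \<le> (k - 1) * 1" using assms(4) by simp
  also have "\<dots> \<le> (k - 1) * length u" using length_u by (intro mult_left_mono) (simp_all add: Suc_leI)
  finally have "set ((x @ u) @ replicate ((k - 1) * length u) c @ y) \<subseteq> {c}"
    using periodic_run[of p "x @ u" "(k - 1) * length u" c y] assms(3,5) by (simp add: eq)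
  then show False using c(3) by auto
qed

end

lemma append_middle_factor:
  assumes "x @ m @ y = a @ b @ c" "length x \<le> length a" "length y \<le> length c"
  shows "\<exists>z1 z2. m = z1 @ b @ z2"
proof -
  have a: "a = x @ drop (length x) a"
    using assms(1,2) by (metis append_eq_conv_conj append_take_drop_id take_append take_all_iff append_Nil2 diff_is_0_eq take0)
  then have 1: "m @ y = drop (length x) a @ b @ c" using assms(1) by (metis append.assoc same_append_eq)
  then have "m @ y = (drop (length x) a @ b @ take (length c - length y) c) @ drop (length c - length y) c" by simp
  moreover have "length y = length (drop (length c - length y) c)" using assms(3) by simp
  ultimately have "m = drop (length x) a @ b @ take (length c - length y) c" using append_eq_append_conv by blast
  then show ?thesis by blast
qed

text \<open>
  Away from its ends, a factor of short period meets marked indices only: an unmarked index is part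
  of a stretch of \<open>2 k\<close> unmarked indices, and within it an isolated block \<open>u\<close> is followed by a long
  power of \<open>c\<close>.
\<close>

lemma (in block_words) periodic_marked:
  fixes k K p :: nat
  assumes B: "\<And>i. k \<le> i \<Longrightarrow> B i \<longleftrightarrow> marked i \<or> k dvd i"
    and fill: "\<And>i i' j. marked i \<Longrightarrow> marked i' \<Longrightarrow> i \<le> j \<Longrightarrow> j \<le> i' \<Longrightarrow> i' < i + 6 * k \<Longrightarrow> marked j"
    and factor: "segment B a b = x @ m @ y" "length x \<le> K" "length y \<le> K"
    and p: "periodic p m" "0 < p" "p < k"
    and j: "a + K + 4 * k \<le> j" "j + 4 * k + K \<le> b"
  shows "marked j"
proof (rule ccontr)
  assume nj: "\<not> marked j"
  have k: "0 < k" using p by simp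
  \<comment> \<open>Marked indices within \<open>3 k\<close> before \<open>j\<close> and within \<open>2 k\<close> after it would force \<open>j\<close> to be
      marked, so there is a stretch of \<open>2 k\<close> unmarked indices on one side of \<open>j\<close>.\<close>
  have "\<exists>s. j + 1 \<le> s + 2 * k \<and> s \<le> j \<and> (\<forall>q. s \<le> q \<and> q < s + 2 * k \<longrightarrow> \<not> marked q)"
  proof (cases "\<exists>i. j < i + 3 * k \<and> i \<le> j \<and> marked i")
    case True
    then obtain i where i: "j < i + 3 * k" "i \<le> j" "marked i" by blast
    have "\<not> marked q" if "j \<le> q" "q < j + 2 * k" for q
      using fill[of i q j] i nj that by auto
    then show ?thesis using k by (intro exI[of _ j]) auto
  next
    case False
    then show ?thesis using j k by (intro exI[of _ "j + 1 - 2 * k"]) auto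
  qed
  then obtain s where s: "j + 1 \<le> s + 2 * k" "s \<le> j" "\<And>q. s \<le> q \<Longrightarrow> q < s + 2 * k \<Longrightarrow> \<not> marked q" by blast
  \<comment> \<open>The first multiple of \<open>k\<close> in the stretch is followed by \<open>k - 1\<close> indices with blocks \<open>c\<close>.\<close>
  define i where "i = ((s + k - 1) div k) * k"
  have "(s + k - 1) mod k < k" using k by simp
  moreover have "i + (s + k - 1) mod k = s + k - 1" unfolding i_def by simp
  ultimately have "s \<le> i" "i < s + k" using k by linarith+
  moreover have "k dvd i" by (simp add: i_def)
  ultimately have i: "s \<le> i" "i < s + k" "k dvd i" by blast+
  have between: "\<not> k dvd q" if "i < q" "q < i + k" for q
  proof
    assume "k dvd q"
    then have "k dvd q - i" using i(3) by (rule dvd_diff_nat)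
    then show False using that nat_dvd_not_less[of "q - i" k] by auto
  qed
  have large: "k \<le> i" "a + K \<le> i" "i + k + K \<le> b" using s i j by auto
  have "B i" using B[OF large(1)] i(3) by simp
  moreover have "\<not> B q" if "i < q" "q < i + k" for q
    using B[of q] between[OF that] s(3)[of q] i large that by auto
  moreover have "\<exists>z1 z2. m = z1 @ segment B i (i + k) @ z2"
  proof (rule append_middle_factor)
    have "segment B a b = segment B a i @ segment B i b" using large by (intro segment_append) auto
    also have "segment B i b = segment B i (i + k) @ segment B (i + k) b" using large by (intro segment_append) auto
    finally show "x @ m @ y = segment B a i @ segment B i (i + k) @ segment B (i + k) b" using factor(1) by simp
    have ge: "q \<le> length u * q" for q using length_u by (cases "length u") auto
    have "K \<le> i - a" "K \<le> b - (i + k)" using large by arith+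
    then have "length x \<le> length u * (i - a)" "length y \<le> length u * (b - (i + k))"
      using ge[of "i - a"] ge[of "b - (i + k)"] factor(2,3) by linarith+
    then show "length x \<le> length (segment B a i)" "length y \<le> length (segment B (i + k) b)"
      unfolding length_segment .
  qed
  ultimately show False using gap_not_periodic[of B i k p] p by metis
qed

section \<open>Cyclic subgroups of free groups\<close>

lemma concat_replicate_inv:
  fixes u :: "('x \<times> bool) list"
  shows "word_inv (concat (replicate m u)) = concat (replicate m (word_inv u))"
proof -
  have comm: "concat (replicate m v) @ v = v @ concat (replicate m v)" for m and v :: "('x \<times> bool) list"
    by (induction m) auto
  show ?thesis
  proof (induction m)
    case (Suc m)
    have "word_inv (concat (replicate (Suc m) u)) = word_inv (concat (replicate m u)) @ word_inv u"
      by (simp add: word_inv_append)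
    also have "\<dots> = word_inv u @ concat (replicate m (word_inv u))" unfolding Suc by (rule comm)
    finally show ?case by simp
  qed (simp add: word_inv_def)
qed

context free_basis_group
begin

lemma eval_append:
  "fst ` set v \<subseteq> S \<Longrightarrow> fst ` set w \<subseteq> S \<Longrightarrow> word_eval G (v @ w) = word_eval G v \<otimes> word_eval G w"
  by (rule word_eval_append) (use S_closed in blast)+

lemma eval_mult_reduced:
  assumes "fst ` set v \<subseteq> S" "fst ` set w \<subseteq> S" "reduced_word w"
  shows "word_eval G (word_mult v w) = word_eval G v \<otimes> word_eval G w"
proof -
  have "fst ` set (word_mult v []) \<subseteq> S" using fst_set_foldr[of v S "[]"] assms(1) by simp
  then have "word_eval G (word_mult (word_mult v []) w) = word_eval G (word_mult v []) \<otimes> word_eval G w"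
    using assms by (intro eval_mult) (auto simp: reduced_foldr)
  then show ?thesis using foldr_cancel_assoc[OF assms(3), of v "[]"] eval_reduce[OF assms(1)] by simp
qed

lemma fst_set_concat_replicate: "fst ` set u \<subseteq> S \<Longrightarrow> fst ` set (concat (replicate m u)) \<subseteq> S"
  by (induction m) (auto simp: image_Un)

text \<open>
  Here \<open>u\<close> is the cyclically reduced core of a generator. Its powers are reduced as written, so
  elements of \<open>H\<close> correspond to periodic words between bounded words.
\<close>

lemma infinite_cyclic_core:
  assumes "infinite_cyclic_subgroup G H"
  shows "\<exists>p u. fst ` set p \<subseteq> S \<and> fst ` set u \<subseteq> S \<and> reduced_word u \<and> u \<noteq> [] \<and> hd u \<noteq> letter_inv (last u) \<and>
    H = {word_eval G p \<otimes> word_eval G (concat (replicate m v)) \<otimes> inv (word_eval G p) | m v. v \<in> {u, word_inv u}}"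
proof -
  obtain a where a: "a \<in> carrier G" "H = generate G {a}" "infinite H"
    using assms by (auto simp: infinite_cyclic_subgroup_def)
  obtain w where w: "reduced_word w" "fst ` set w \<subseteq> S" "word_eval G w = a" using eval_surj[OF a(1)] by blast
  have pow: "H = {a [^] (k :: int) | k. k \<in> UNIV}" using generate_pow[OF a(1)] a(2) by simp
  have "w \<noteq> []"
  proof
    assume "w = []"
    then have "a = \<one>" using w by simp
    then have "H = {\<one>}" unfolding pow by auto
    then show False using a(3) by simp
  qed
  then obtain p u where pu: "w = p @ u @ word_inv p" "u \<noteq> []" "hd u \<noteq> letter_inv (last u)"
    using cyclically_reduced_core[OF w(1)] by blast
  have S: "fst ` set p \<subseteq> S" "fst ` set u \<subseteq> S" using w(2) pu(1) by auto
  have red: "reduced_word u" using w(1) pu(1) by (simp add: reduced_word_append)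
  define P U where "P = word_eval G p" and "U = word_eval G u"
  have PU: "P \<in> carrier G" "U \<in> carrier G" using eval_closed S by (auto simp: P_def U_def)
  have a_eq: "a = P \<otimes> U \<otimes> inv P"
    using w(3) S eval_append[of p "u @ word_inv p"] eval_append[of u "word_inv p"] eval_inv[OF S(1)] PU
    by (simp add: pu(1) image_Un P_def U_def m_assoc)
  have powU: "word_eval G (concat (replicate m u)) = U [^] m" for m :: nat
  proof (induction m)
    case (Suc m)
    have "word_eval G (concat (replicate (Suc m) u)) = U \<otimes> U [^] m"
      using Suc eval_append[OF S(2) fst_set_concat_replicate[OF S(2), of m]] by (simp add: U_def)
    also have "\<dots> = U [^] Suc m" using PU(2) by (metis nat_pow_Suc2)
    finally show ?case .
  qed (simp add: nat_pow_0)
  have conj: "a [^] m = P \<otimes> U [^] m \<otimes> inv P" for m :: nat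
  proof (induction m)
    case (Suc m)
    have "a [^] Suc m = (P \<otimes> U [^] m \<otimes> inv P) \<otimes> (P \<otimes> U \<otimes> inv P)" using Suc a_eq by simp
    also have "\<dots> = P \<otimes> (U [^] m \<otimes> ((inv P \<otimes> P) \<otimes> (U \<otimes> inv P)))"
      using PU by (simp only: m_assoc m_closed inv_closed nat_pow_closed)
    also have "\<dots> = P \<otimes> U [^] Suc m \<otimes> inv P" using PU by (simp add: m_assoc)
    finally show ?case .
  qed (use PU in simp)
  have pos: "word_eval G p \<otimes> word_eval G (concat (replicate m u)) \<otimes> inv (word_eval G p) = a [^] int m" for m
    using conj[of m] powU[of m] by (simp add: int_pow_int P_def)
  have neg: "word_eval G p \<otimes> word_eval G (concat (replicate m (word_inv u))) \<otimes> inv (word_eval G p) = a [^] (- int m)" for m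
  proof -
    have "word_eval G (concat (replicate m (word_inv u))) = inv (U [^] m)"
      using eval_inv[OF fst_set_concat_replicate[OF S(2), of m]] powU[of m] by (simp add: concat_replicate_inv)
    then have "word_eval G p \<otimes> word_eval G (concat (replicate m (word_inv u))) \<otimes> inv (word_eval G p) = P \<otimes> (inv (U [^] m) \<otimes> inv P)"
      using PU by (simp add: P_def m_assoc)
    also have "\<dots> = inv (P \<otimes> U [^] m \<otimes> inv P)" using PU by (simp add: inv_mult_group m_assoc)
    also have "\<dots> = a [^] (- int m)" using conj[of m] a(1) by (simp add: int_pow_neg int_pow_int)
    finally show ?thesis .
  qed
  have "H = {word_eval G p \<otimes> word_eval G (concat (replicate m v)) \<otimes> inv (word_eval G p) | m v. v \<in> {u, word_inv u}}" (is "_ = ?R")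
  proof
    show "H \<subseteq> ?R"
    proof
      fix h assume "h \<in> H"
      then obtain k :: int where k: "h = a [^] k" using pow by blast
      show "h \<in> ?R"
      proof (cases "k \<ge> 0")
        case True
        then have "h = a [^] int (nat k)" using k by simp
        then have "h = word_eval G p \<otimes> word_eval G (concat (replicate (nat k) u)) \<otimes> inv (word_eval G p)" using pos by simp
        then show ?thesis by blast
      next
        case False
        then have "h = a [^] (- int (nat (- k)))" using k by simp
        then have "h = word_eval G p \<otimes> word_eval G (concat (replicate (nat (- k)) (word_inv u))) \<otimes> inv (word_eval G p)" using neg by simp
        then show ?thesis by blast
      qed
    qed
    show "?R \<subseteq> H" using pos neg unfolding pow by auto
  qed
  then show ?thesis using S red pu(2,3) by blast
qed

text \<open>
  If \<open>u\<close> is a power of one letter, then any letter of the other generator will do. Otherwise only the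
  two inverses have to be avoided, and there are three candidates.
\<close>

lemma free_letter:
  assumes "s \<in> S" "t \<in> S" "s \<noteq> t" "u \<noteq> []"
  shows "\<exists>c. fst c \<in> S \<and> c \<noteq> letter_inv (hd u) \<and> c \<noteq> letter_inv (last u) \<and> \<not> set u \<subseteq> {c}"
proof (cases "\<exists>a. set u \<subseteq> {a}")
  case True
  then obtain a where a: "set u \<subseteq> {a}" by blast
  then have 1: "hd u = a" "last u = a"
    using subsetD[OF a hd_in_set[OF assms(4)]] subsetD[OF a last_in_set[OF assms(4)]] by simp_all
  define c where "c = (if fst a = s then (t, True) else (s, True))"
  have "fst c \<noteq> fst a" "fst c \<in> S" using assms(1-3) by (auto simp: c_def)
  moreover have "c \<noteq> letter_inv a"
  proof
    assume "c = letter_inv a"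
    then have "fst c = fst a" by simp
    then show False using \<open>fst c \<noteq> fst a\<close> by simp
  qed
  moreover have "c \<noteq> a" using \<open>fst c \<noteq> fst a\<close> by blast
  moreover have "a \<in> set u" using hd_in_set[OF assms(4)] 1 by metis
  ultimately show ?thesis unfolding 1 by (intro exI[of _ c] conjI) (assumption | blast)+
next
  case False
  have "\<exists>c\<in>{(s, True), (s, False), (t, True)}. c \<noteq> X \<and> c \<noteq> Y" for X Y
    by (cases X; cases Y) (use assms(3) in auto)
  from this[of "letter_inv (hd u)" "letter_inv (last u)"] obtain c where
    "c \<in> {(s, True), (s, False), (t, True)}" "c \<noteq> letter_inv (hd u)" "c \<noteq> letter_inv (last u)" by (elim bexE conjE)
  moreover from this(1) have "fst c \<in> S" using assms(1,2) by (elim insertE) simp_all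
  moreover have "\<not> set u \<subseteq> {c}" using False by blast
  ultimately show ?thesis by (intro exI[of _ c] conjI)
qed

end

section \<open>Rays in asymptotic cones of free groups\<close>

locale cone_group = free_basis_group +
  fixes \<omega> :: "nat set \<Rightarrow> real" and x r
  assumes cone_data: "cone_data (cayley_metric G S) \<omega> x r"
begin

abbreviation "dG \<equiv> mdist (cayley_metric G S)"
abbreviation "seqs \<equiv> cone_seqs (cayley_metric G S) \<omega> x r"
abbreviation "cdist \<equiv> cone_dist (cayley_metric G S) \<omega> r"
abbreviation "cls y \<equiv> zero_rel seqs cdist `` {y}"

text \<open>
  Ultralimits become ordinary limits along this filter.
\<close>

definition \<F> :: "nat filter" where
  "\<F> = (SOME F. F \<noteq> bot \<and> (\<forall>s. (s \<longlongrightarrow> ulim \<omega> s) F))"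

lemma \<F>: "\<F> \<noteq> bot" "(s \<longlongrightarrow> ulim \<omega> s) \<F>"
proof -
  have "nonprincipal_ultrafilter \<omega>" using cone_data by (simp add: cone_data_def)
  then have "\<exists>F :: nat filter. F \<noteq> bot \<and> (\<forall>s. (s \<longlongrightarrow> ulim \<omega> s) F)"
    by (rule ulim_filter) blast
  from someI_ex[OF this] show "\<F> \<noteq> bot" "(s \<longlongrightarrow> ulim \<omega> s) \<F>" by (simp_all add: \<F>_def)
qed

lemma r_pos: "0 < r n"
  using cone_data by (simp add: cone_data_def)

lemma r_at_top: "filterlim r at_top \<F>"
  using \<F>(2)[of "\<lambda>n. ereal (r n)"] cone_data by (simp add: cone_data_def tendsto_PInfty_eq_at_top)

lemma tendsto_const_over_r: "((\<lambda>n. a / r n) \<longlongrightarrow> 0) \<F>"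
  by (rule filterlim_compose[OF _ r_at_top]) real_asymp

lemma seqs_closed: "y \<in> seqs \<Longrightarrow> y n \<in> carrier G"
  by (auto simp: cone_seqs_def cayley)

lemma pseudometric: "pseudometric_on seqs cdist"
  by (rule pseudometric_on_cone_seqs[OF cone_data])

lemma dist_tendsto: "y \<in> seqs \<Longrightarrow> z \<in> seqs \<Longrightarrow> ((\<lambda>n. dG (y n) (z n) / r n) \<longlongrightarrow> cdist y z) \<F>"
  by (rule cone_dist_tendsto[OF cone_data _ _ \<F>])

lemma cdist_eqI: "y \<in> seqs \<Longrightarrow> z \<in> seqs \<Longrightarrow> ((\<lambda>n. dG (y n) (z n) / r n) \<longlongrightarrow> l) \<F> \<Longrightarrow> cdist y z = l"
  using dist_tendsto \<F>(1) tendsto_unique by blast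

lemma triangle_G: "a \<in> carrier G \<Longrightarrow> b \<in> carrier G \<Longrightarrow> c \<in> carrier G \<Longrightarrow> dG a c \<le> dG a b + dG b c"
  using mdist_triangle[of a "cayley_metric G S" b c] by (simp add: cayley)

lemma x_in_seqs: "x \<in> seqs"
proof -
  have xG: "x n \<in> mspace (cayley_metric G S)" for n using cone_data by (auto simp: cone_data_def)
  have "(\<lambda>n. ereal (dG (x n) (x n) / r n)) = (\<lambda>n. 0)"
  proof
    fix n
    have "dG (x n) (x n) = 0" using xG by simp
    then show "ereal (dG (x n) (x n) / r n) = 0" by simp
  qed
  then have "ulim \<omega> (\<lambda>n. ereal (dG (x n) (x n) / r n)) = 0"
    using \<F>(2)[of "\<lambda>n. 0 :: ereal"] \<F>(1) by (metis tendsto_const tendsto_unique)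
  then show ?thesis using xG by (auto simp: cone_seqs_def)
qed

lemma seqsI:
  assumes z: "z \<in> seqs" and y: "\<And>n. y n \<in> carrier G" and l: "((\<lambda>n. dG (z n) (y n) / r n) \<longlongrightarrow> l) \<F>"
  shows "y \<in> seqs"
proof -
  have "((\<lambda>n. dG (x n) (z n) / r n + dG (z n) (y n) / r n) \<longlongrightarrow> cdist x z + l) \<F>"
    by (intro tendsto_add dist_tendsto x_in_seqs z l)
  then have "((\<lambda>n. ereal (dG (x n) (z n) / r n + dG (z n) (y n) / r n)) \<longlongrightarrow> ereal (cdist x z + l)) \<F>" by simp
  moreover have "eventually (\<lambda>n. ereal (dG (x n) (y n) / r n) \<le> ereal (dG (x n) (z n) / r n + dG (z n) (y n) / r n)) \<F>"
    using triangle_G[OF seqs_closed[OF x_in_seqs] seqs_closed[OF z] y] r_pos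
    by (intro always_eventually allI) (simp add: add_divide_distrib[symmetric] divide_right_mono less_imp_le)
  ultimately have "ulim \<omega> (\<lambda>n. ereal (dG (x n) (y n) / r n)) \<le> ereal (cdist x z + l)"
    by (rule tendsto_le[OF \<F>(1) _ \<F>(2)])
  also have "\<dots> < \<infinity>" by simp
  finally show ?thesis using y by (auto simp: cone_seqs_def cayley)
qed

lemma cls_eq_iff: "y \<in> seqs \<Longrightarrow> z \<in> seqs \<Longrightarrow> cls y = cls z \<longleftrightarrow> cdist y z = 0"
  using eq_equiv_class_iff[OF equiv_zero_rel[OF pseudometric], of y z] by (simp add: zero_rel_def)

text \<open>Moving a sequence by a distance that is negligible compared to \<open>r\<close> does not change its class.\<close>

lemma cls_near:
  assumes z: "z \<in> seqs" and y: "\<And>n. y n \<in> carrier G"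
    and bound: "eventually (\<lambda>n. dG (z n) (y n) \<le> e n) \<F>" and e: "((\<lambda>n. e n / r n) \<longlongrightarrow> 0) \<F>"
  shows "y \<in> seqs" "cls y = cls z"
proof -
  have lim: "((\<lambda>n. dG (z n) (y n) / r n) \<longlongrightarrow> 0) \<F>"
  proof (rule tendsto_sandwich[OF _ _ tendsto_const e])
    show "eventually (\<lambda>n. 0 \<le> dG (z n) (y n) / r n) \<F>" using r_pos by (intro always_eventually allI) (simp add: less_imp_le)
    show "eventually (\<lambda>n. dG (z n) (y n) / r n \<le> e n / r n) \<F>"
      using bound by eventually_elim (use r_pos in \<open>simp add: divide_right_mono less_imp_le\<close>)
  qed
  show *: "y \<in> seqs" by (rule seqsI[OF z y lim])
  have "cdist z y = 0" by (rule cdist_eqI[OF z * lim])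
  then show "cls y = cls z" using cls_eq_iff[OF z *] by simp
qed

end

locale cone_ray = cone_group G S \<omega> x r + block_words u c
  for G :: "('a, 'm) monoid_scheme" (structure) and S \<omega> x r and u :: "('a \<times> bool) list" and c +
  fixes y0 R
  assumes y0: "y0 \<in> seqs" and R: "pattern R" and letters: "fst ` set u \<subseteq> S" "fst c \<in> S"
begin

text \<open>
  The marked indices of the word at stage \<open>n\<close> are those whose distance from the complement of the
  pattern is at least \<open>margin n\<close>. Everywhere else, isolated blocks at the multiples of \<open>width n\<close>
  prevent periodicity. The first \<open>width n\<close> blocks are free to encode a sequence. The width tends to
  infinity, but it is negligible compared to \<open>r\<close>.
\<close>

definition width :: "nat \<Rightarrow> nat" where
  "width n = Suc (nat \<lfloor>sqrt (r n)\<rfloor>)"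

definition mesh :: "nat \<Rightarrow> real" where
  "mesh n = length u / r n"

definition margin :: "nat \<Rightarrow> real" where
  "margin n = 3 * width n * mesh n"

definition marked :: "nat \<Rightarrow> nat \<Rightarrow> bool" where
  "marked n i \<longleftrightarrow> R (i * mesh n - margin n) (i * mesh n + margin n)"

definition blocks :: "(nat \<Rightarrow> bool) \<Rightarrow> nat \<Rightarrow> nat \<Rightarrow> bool" where
  "blocks f n i \<longleftrightarrow> (if i < width n then f i else marked n i \<or> width n dvd i)"

definition index :: "real \<Rightarrow> nat \<Rightarrow> nat" where
  "index t n = nat \<lfloor>t / mesh n\<rfloor>"

definition vertex :: "(nat \<Rightarrow> bool) \<Rightarrow> nat \<Rightarrow> nat \<Rightarrow> 'a" where
  "vertex f n j = y0 n \<otimes> word_eval G (segment (blocks f n) 0 j)"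

definition ray :: "(nat \<Rightarrow> bool) \<Rightarrow> real \<Rightarrow> nat \<Rightarrow> 'a" where
  "ray f t n = vertex f n (index t n)"

lemma mesh_pos: "0 < mesh n"
  using r_pos length_u by (simp add: mesh_def)

lemma width_pos: "0 < width n"
  by (simp add: width_def)

lemma margin_pos: "0 < margin n"
  using mesh_pos width_pos by (simp add: margin_def)

lemma mesh_tendsto: "(mesh \<longlongrightarrow> 0) \<F>"
  using tendsto_const_over_r[of "length u"] by (simp add: mesh_def[abs_def])

lemma width_tendsto: "((\<lambda>n. width n * mesh n) \<longlongrightarrow> 0) \<F>"
proof (rule tendsto_sandwich[OF _ _ tendsto_const])
  show "((\<lambda>n. (1 + sqrt (r n)) / r n * length u) \<longlongrightarrow> 0) \<F>"
    by (rule filterlim_compose[OF _ r_at_top]) real_asymp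
  show "eventually (\<lambda>n. 0 \<le> width n * mesh n) \<F>" using mesh_pos by (intro always_eventually allI) (simp add: less_imp_le)
  show "eventually (\<lambda>n. width n * mesh n \<le> (1 + sqrt (r n)) / r n * length u) \<F>"
  proof (intro always_eventually allI)
    fix n
    have "real (width n) \<le> 1 + sqrt (r n)" using r_pos[of n] by (simp add: width_def)
    then have "width n * mesh n \<le> (1 + sqrt (r n)) * mesh n" using mesh_pos[of n] by (intro mult_right_mono) auto
    then show "width n * mesh n \<le> (1 + sqrt (r n)) / r n * length u" by (simp add: mesh_def)
  qed
qed

lemma width_at_top: "eventually (\<lambda>n. N < width n) \<F>"
proof -
  have "eventually (\<lambda>n. (real N)\<^sup>2 \<le> r n) \<F>" using r_at_top by (simp add: filterlim_at_top)
  then show ?thesis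
  proof eventually_elim
    case (elim n)
    then have "real N \<le> sqrt (r n)" by (simp add: real_le_rsqrt)
    then show ?case by (simp add: width_def le_nat_floor less_Suc_eq_le)
  qed
qed

lemma index_bounds:
  assumes "0 \<le> t"
  shows "index t n * mesh n \<le> t" "t < (index t n + 1) * mesh n"
proof -
  have "0 \<le> t / mesh n" using assms mesh_pos[of n] by simp
  then have "real (index t n) \<le> t / mesh n" "t / mesh n < real (index t n) + 1"
    unfolding index_def by linarith+
  then show "index t n * mesh n \<le> t" "t < (index t n + 1) * mesh n"
    using mesh_pos[of n] by (simp_all add: field_simps)
qed

lemma index_tendsto: "0 \<le> t \<Longrightarrow> ((\<lambda>n. index t n * mesh n) \<longlongrightarrow> t) \<F>"
proof (rule tendsto_sandwich[of "\<lambda>n. t - mesh n" _ _ "\<lambda>n. t"])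
  assume t: "0 \<le> t"
  show "eventually (\<lambda>n. t - mesh n \<le> index t n * mesh n) \<F>"
    using index_bounds(2)[OF t] by (intro always_eventually allI) (simp add: algebra_simps less_imp_le)
  show "eventually (\<lambda>n. index t n * mesh n \<le> t) \<F>" using index_bounds(1)[OF t] by simp
  show "((\<lambda>n. t - mesh n) \<longlongrightarrow> t) \<F>" using tendsto_diff[OF tendsto_const mesh_tendsto, of t] by simp
qed simp

lemma letters_segment: "fst ` set (segment B i j) \<subseteq> S"
  using set_segment[of B i j] letters by auto

lemma vertex_closed: "vertex f n j \<in> carrier G"
  using seqs_closed[OF y0] eval_closed[OF letters_segment] by (simp add: vertex_def)

lemma vertex_append:
  assumes "i \<le> j"
  shows "vertex f n j = vertex f n i \<otimes> word_eval G (segment (blocks f n) i j)"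
proof -
  have "segment (blocks f n) 0 j = segment (blocks f n) 0 i @ segment (blocks f n) i j"
    using assms by (intro segment_append) auto
  then show ?thesis
    using eval_append[OF letters_segment letters_segment] seqs_closed[OF y0] eval_closed[OF letters_segment]
    by (simp add: vertex_def m_assoc)
qed

lemma dG_mult:
  assumes "g \<in> carrier G" "h \<in> carrier G"
  shows "dG g (g \<otimes> h) = word_length G S h"
proof -
  have "inv g \<otimes> (g \<otimes> h) = h" using assms by (simp add: m_assoc[symmetric])
  then show ?thesis using assms by (simp add: cayley)
qed

lemma vertex_dist: "dG (vertex f n i) (vertex f n j) = length u * \<bar>real i - real j\<bar>"
proof -
  have *: "dG (vertex f n i) (vertex f n j) = length u * (real j - real i)" if "i \<le> j" for i j
  proof -
    have "dG (vertex f n i) (vertex f n j) = word_length G S (word_eval G (segment (blocks f n) i j))"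
      unfolding vertex_append[OF that] using vertex_closed eval_closed[OF letters_segment] by (rule dG_mult)
    also have "\<dots> = length u * (j - i)"
      using word_length_eval[OF reduced_segment letters_segment] by simp
    finally show ?thesis using that by (simp add: of_nat_diff)
  qed
  show ?thesis
  proof (cases "i \<le> j")
    case True
    then show ?thesis using *[OF True] by (simp add: abs_if)
  next
    case False
    then show ?thesis using *[of j i] mdist_commute[of "cayley_metric G S" "vertex f n i"] by (simp add: abs_if)
  qed
qed

lemma length_over_r: "real (length u) * a / r n = a * mesh n"
  by (simp add: mesh_def)

lemma ray_0: "ray f 0 = y0"
proof
  fix n show "ray f 0 n = y0 n" using seqs_closed[OF y0, of n] by (simp add: ray_def index_def vertex_def segment_def)
qed

lemma ray_dist_tendsto:
  assumes "0 \<le> s" "0 \<le> t"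
  shows "((\<lambda>n. dG (ray f s n) (ray f t n) / r n) \<longlongrightarrow> \<bar>s - t\<bar>) \<F>"
proof -
  have "dG (ray f s n) (ray f t n) / r n = \<bar>index s n * mesh n - index t n * mesh n\<bar>" for n
  proof -
    have "dG (ray f s n) (ray f t n) / r n = \<bar>real (index s n) - real (index t n)\<bar> * mesh n"
      unfolding ray_def vertex_dist by (rule length_over_r)
    also have "\<dots> = \<bar>(real (index s n) - real (index t n)) * mesh n\<bar>" using mesh_pos[of n] by (simp add: abs_mult)
    finally show ?thesis by (simp add: left_diff_distrib)
  qed
  then show ?thesis using tendsto_rabs[OF tendsto_diff[OF index_tendsto[OF assms(1)] index_tendsto[OF assms(2)]]] by simp
qed

lemma ray_closed: "ray f t n \<in> carrier G"
  by (simp add: ray_def vertex_closed)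

lemma ray_in_seqs: "0 \<le> t \<Longrightarrow> ray f t \<in> seqs"
  using seqsI[OF y0 ray_closed] ray_dist_tendsto[of 0 t f] by (simp add: ray_0)

lemma ray_dist: "0 \<le> s \<Longrightarrow> 0 \<le> t \<Longrightarrow> cdist (ray f s) (ray f t) = \<bar>s - t\<bar>"
  by (intro cdist_eqI ray_in_seqs ray_dist_tendsto)

text \<open>
  If \<open>f\<close> and \<open>f'\<close> differ at \<open>i\<close>, then the words of the two rays part after at most \<open>i + 1\<close> blocks as
  soon as \<open>width n\<close> exceeds \<open>i\<close>. In the limit the rays have only the origin in common.
\<close>

lemma rays_diverge:
  assumes "f \<noteq> f'" "0 < s" "0 < t"
  shows "cls (ray f s) \<noteq> cls (ray f' t)"
proof
  assume eq: "cls (ray f s) = cls (ray f' t)"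
  obtain i where i: "f i \<noteq> f' i" using assms(1) by blast
  have st: "0 \<le> s" "0 \<le> t" using assms by auto
  note in_s = ray_in_seqs[OF st(1), of f] ray_in_seqs[OF st(2), of f']
  have zero: "cdist (ray f s) (ray f' t) = 0" using cls_eq_iff[OF in_s] eq by simp
  have "s + t - 2 * (real i + 1) * 0 \<le> cdist (ray f s) (ray f' t)"
  proof (rule tendsto_le[OF \<F>(1) dist_tendsto[OF in_s]])
    show "((\<lambda>n. index s n * mesh n + index t n * mesh n - 2 * (real i + 1) * mesh n) \<longlongrightarrow> s + t - 2 * (real i + 1) * 0) \<F>"
      by (intro tendsto_intros index_tendsto st mesh_tendsto)
    have big: "eventually (\<lambda>n. i < index v n) \<F>" if "0 < v" for v
    proof -
      have "((\<lambda>n. (real i + 1) * mesh n) \<longlongrightarrow> (real i + 1) * 0) \<F>" by (intro tendsto_intros mesh_tendsto)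
      then have "eventually (\<lambda>n. (real i + 1) * mesh n < v) \<F>" using that by (intro order_tendstoD(2)) auto
      then show ?thesis
      proof eventually_elim
        case (elim n)
        have "v < (real (index v n) + 1) * mesh n" using index_bounds(2)[of v n] that by (simp add: add.commute)
        then have "(real i + 1) * mesh n < (real (index v n) + 1) * mesh n" using elim by linarith
        then show ?case using mesh_pos[of n] by simp
      qed
    qed
    show "eventually (\<lambda>n. index s n * mesh n + index t n * mesh n - 2 * (real i + 1) * mesh n \<le> dG (ray f s n) (ray f' t n) / r n) \<F>"
      using big[OF assms(2)] big[OF assms(3)] width_at_top[of i]
    proof eventually_elim
      case (elim n)
      let ?v = "segment (blocks f n) 0 (index s n)" and ?w = "segment (blocks f' n) 0 (index t n)"
      have "blocks f n i \<noteq> blocks f' n i" using i elim(3) by (simp add: blocks_def)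
      then have "length u * index s n + length u * index t n \<le> length (word_mult (word_inv ?v) ?w) + 2 * length u * (i + 1)"
        by (rule segments_diverge) (use elim in auto)
      then have "real (length u * index s n + length u * index t n) \<le> real (length (word_mult (word_inv ?v) ?w) + 2 * length u * (i + 1))"
        by (rule of_nat_mono)
      moreover have "dG (ray f s n) (ray f' t n) = length (word_mult (word_inv ?v) ?w)"
        unfolding ray_def vertex_def
        by (rule cayley_dist[OF seqs_closed[OF y0] reduced_segment letters_segment reduced_segment letters_segment])
      ultimately have "length u * (real (index s n) + index t n - 2 * (real i + 1)) \<le> dG (ray f s n) (ray f' t n)"
        by (simp add: algebra_simps)
      then have "length u * (real (index s n) + index t n - 2 * (real i + 1)) / r n \<le> dG (ray f s n) (ray f' t n) / r n"
        using r_pos[of n] by (intro divide_right_mono) auto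
      then show ?case unfolding length_over_r by (simp add: algebra_simps)
    qed
  qed
  then show False using zero assms by simp
qed

lemma pattern_convex: "R s t \<Longrightarrow> s \<le> s' \<Longrightarrow> s' < t' \<Longrightarrow> t' \<le> t \<Longrightarrow> R s' t'"
  using R unfolding pattern_def by blast

lemma pattern_glue: "R s t \<Longrightarrow> R s' t' \<Longrightarrow> s \<le> s' \<Longrightarrow> s' < t \<Longrightarrow> t \<le> t' \<Longrightarrow> R s t'"
  using R unfolding pattern_def by blast

lemma pattern_closed: "s < t \<Longrightarrow> (\<And>e. 0 < e \<Longrightarrow> 2 * e < t - s \<Longrightarrow> R (s + e) (t - e)) \<Longrightarrow> R s t"
  using R unfolding pattern_def by blast

lemma index_gap:
  assumes "0 \<le> s" "s < t"
    and K: "((\<lambda>n. real (K n) * mesh n) \<longlongrightarrow> 0) \<F>"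
  shows "eventually (\<lambda>n. index s n + K n < index t n) \<F>"
proof -
  have "((\<lambda>n. index t n * mesh n - index s n * mesh n - K n * mesh n) \<longlongrightarrow> t - s - 0) \<F>"
    using assms by (intro tendsto_diff index_tendsto K) auto
  then have "eventually (\<lambda>n. 0 < index t n * mesh n - index s n * mesh n - K n * mesh n) \<F>"
    using assms(2) by (intro order_tendstoD(1)) auto
  then show ?thesis
  proof eventually_elim
    case (elim n)
    then have "(real (index s n) + real (K n)) * mesh n < real (index t n) * mesh n" by (simp add: algebra_simps)
    then have "real (index s n) + real (K n) < real (index t n)" using mesh_pos[of n] by simp
    then show ?case by linarith
  qed
qed

lemma width_multiple_tendsto: "((\<lambda>n. real (a * width n + b) * mesh n) \<longlongrightarrow> 0) \<F>"
proof -
  have "((\<lambda>n. real a * (width n * mesh n) + real b * mesh n) \<longlongrightarrow> real a * 0 + real b * 0) \<F>"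
    by (intro tendsto_intros width_tendsto mesh_tendsto)
  then show ?thesis by (simp add: algebra_simps)
qed

text \<open>
  Between \<open>s\<close> and \<open>t\<close> all indices are marked, apart from about \<open>3 * width n\<close> of them at either end.
  There the word is a power of \<open>u\<close> and stays close to a single coset.
\<close>

lemma pattern_in_coset:
  assumes st: "0 \<le> s" "s < t" "R s t" and q: "q \<in> carrier G"
    and \<A>: "\<And>g. g \<in> carrier G \<Longrightarrow> \<exists>A\<in>\<A>. \<forall>m. g \<otimes> word_eval G (concat (replicate m u)) \<otimes> q \<in> A"
  shows "\<exists>A. range A \<subseteq> \<A> \<and> cls (ray f s) \<in> ulim_set (cayley_metric G S) \<omega> x r A \<and>
     cls (ray f t) \<in> ulim_set (cayley_metric G S) \<omega> x r A"
proof -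
  \<comment> \<open>The additional block absorbs the rounding in \<open>index\<close>.\<close>
  define w where "w n = 3 * width n + 1" for n
  define i0 where "i0 n = index s n + w n" for n
  define i1 where "i1 n = index t n - w n" for n
  define a where "a n = vertex f n (i0 n) \<otimes> q" for n
  \<comment> \<open>The second case occurs only for a negligible set of \<open>n\<close>. It keeps \<open>b n\<close> in the coset of \<open>a n\<close>.\<close>
  define b where "b n = (if i0 n \<le> i1 n then vertex f n (i1 n) \<otimes> q else a n)" for n
  have "\<forall>n. \<exists>A\<in>\<A>. \<forall>m. vertex f n (i0 n) \<otimes> word_eval G (concat (replicate m u)) \<otimes> q \<in> A"
    using \<A>[OF vertex_closed] by blast
  then obtain A where A: "\<And>n. A n \<in> \<A>" "\<And>n m. vertex f n (i0 n) \<otimes> word_eval G (concat (replicate m u)) \<otimes> q \<in> A n"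
    by metis
  have t: "0 \<le> t" using st by simp
  have aG: "a n \<in> carrier G" for n using vertex_closed q by (simp add: a_def)
  have bG: "b n \<in> carrier G" for n using vertex_closed q aG by (simp add: b_def)
  have aA: "a n \<in> A n" for n using A(2)[of n 0] vertex_closed by (simp add: a_def)
  have bA: "b n \<in> A n" for n
  proof (cases "i0 n \<le> i1 n")
    case True
    have "blocks f n j" if j: "i0 n \<le> j" "j < i1 n" for j
    proof -
      have "(real (index s n) + 1 + 3 * width n) * mesh n \<le> j * mesh n"
        using j(1) mesh_pos[of n] by (intro mult_right_mono) (auto simp: i0_def w_def)
      then have "s \<le> j * mesh n - margin n"
        using index_bounds(2)[OF st(1), of n] by (simp add: margin_def algebra_simps)
      moreover have "(real j + 3 * width n) * mesh n \<le> index t n * mesh n"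
        using j(2) mesh_pos[of n] by (intro mult_right_mono) (auto simp: i1_def w_def)
      then have "j * mesh n + margin n \<le> t"
        using index_bounds(1)[OF t, of n] by (simp add: margin_def algebra_simps)
      ultimately have "marked n j" unfolding marked_def using margin_pos[of n] by (intro pattern_convex[OF st(3)]) auto
      then show ?thesis using j(1) by (simp add: blocks_def i0_def w_def)
    qed
    then have "segment (blocks f n) (i0 n) (i1 n) = concat (replicate (i1 n - i0 n) u)"
      using segment_const[of "i0 n" "i1 n" "blocks f n" True] by (simp add: block_def)
    then show ?thesis using A(2)[of n "i1 n - i0 n"] True vertex_append[OF True, of f n] by (simp add: b_def)
  qed (use aA in \<open>simp add: b_def\<close>)
  define C where "C = real (word_length G S q)"
  have err: "((\<lambda>n. (length u * real (w n) + C) / r n) \<longlongrightarrow> 0) \<F>"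
  proof -
    have "((\<lambda>n. real (3 * width n + 1) * mesh n + C / r n) \<longlongrightarrow> 0 + 0) \<F>"
      by (intro tendsto_add width_multiple_tendsto tendsto_const_over_r)
    moreover have "(length u * real (w n) + C) / r n = real (3 * width n + 1) * mesh n + C / r n" for n
      by (simp only: add_divide_distrib length_over_r w_def)
    ultimately show ?thesis by simp
  qed
  have near: "dG (vertex f n i) (vertex f n j \<otimes> q) \<le> length u * real (w n) + C" if "\<bar>real i - real j\<bar> \<le> w n" for i j n
  proof -
    have "dG (vertex f n i) (vertex f n j \<otimes> q) \<le> dG (vertex f n i) (vertex f n j) + dG (vertex f n j) (vertex f n j \<otimes> q)"
      using vertex_closed q by (intro triangle_G) auto
    also have "\<dots> = length u * \<bar>real i - real j\<bar> + C" by (simp add: vertex_dist dG_mult[OF vertex_closed q] C_def)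
    also have "\<dots> \<le> length u * real (w n) + C" using that by (intro add_right_mono mult_left_mono) auto
    finally show ?thesis .
  qed
  have "eventually (\<lambda>n. dG (ray f s n) (a n) \<le> length u * real (w n) + C) \<F>"
    unfolding ray_def a_def by (intro always_eventually allI near) (simp add: i0_def)
  note as = cls_near[OF ray_in_seqs[OF st(1)] aG this err]
  have "eventually (\<lambda>n. index s n + (6 * width n + 2) < index t n) \<F>"
    by (rule index_gap[OF st(1,2) width_multiple_tendsto])
  then have "eventually (\<lambda>n. dG (ray f t n) (b n) \<le> length u * real (w n) + C) \<F>"
  proof eventually_elim
    case (elim n)
    then have le: "i0 n \<le> i1 n" "w n \<le> index t n" by (auto simp: i0_def i1_def w_def)
    then have "dG (ray f t n) (vertex f n (i1 n) \<otimes> q) \<le> length u * real (w n) + C"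
      unfolding ray_def by (intro near) (simp add: i1_def of_nat_diff)
    then show ?case using le(1) by (simp add: b_def)
  qed
  note bs = cls_near[OF ray_in_seqs[OF t] bG this err]
  have "cls a \<in> ulim_set (cayley_metric G S) \<omega> x r A" "cls b \<in> ulim_set (cayley_metric G S) \<omega> x r A"
    using as(1) bs(1) aA bA by (auto simp: ulim_set_def)
  then show ?thesis using A(1) as(2) bs(2) by (intro exI[of _ A]) auto
qed

text \<open>
  The intervals of radius \<open>margin n\<close> around \<open>i\<close> and \<open>i'\<close> overlap. This is the reason for the factor
  three in \<open>margin\<close>, as \<open>periodic_marked\<close> needs to fill gaps of up to \<open>6 * width n\<close> indices.
\<close>

lemma marked_fill:
  assumes "marked n i" "marked n i'" "i \<le> j" "j \<le> i'" "i' < i + 6 * width n"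
  shows "marked n j"
proof -
  have "real i' * mesh n < (real i + 6 * width n) * mesh n" using assms(5) mesh_pos[of n] by (intro mult_strict_right_mono) auto
  then have 1: "i' * mesh n - margin n < i * mesh n + margin n" by (simp add: margin_def algebra_simps)
  have 2: "i * mesh n \<le> j * mesh n" "j * mesh n \<le> i' * mesh n" using assms(3,4) mesh_pos[of n] by (auto intro!: mult_right_mono)
  have "R (i * mesh n - margin n) (i' * mesh n + margin n)"
    by (rule pattern_glue[OF assms(1,2)[unfolded marked_def]]) (use 1 2 in linarith)+
  then show ?thesis unfolding marked_def by (rule pattern_convex) (use 2 margin_pos[of n] in auto)
qed

lemma marked_run:
  fixes i j :: nat
  assumes "i \<le> j" "\<And>q. i \<le> q \<Longrightarrow> q \<le> j \<Longrightarrow> marked n q"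
  shows "R (i * mesh n - margin n) (j * mesh n + margin n)"
  using assms
proof (induction j rule: dec_induct)
  case base
  then show ?case by (simp add: marked_def)
next
  case (step j)
  have 1: "mesh n < 2 * margin n"
  proof -
    have "1 * mesh n \<le> real (width n) * mesh n" using width_pos[of n] mesh_pos[of n] by (intro mult_right_mono) auto
    then show ?thesis using mesh_pos[of n] by (simp add: margin_def)
  qed
  have 2: "i * mesh n \<le> Suc j * mesh n" using step(1) mesh_pos[of n] by (intro mult_right_mono) auto
  have ih: "R (i * mesh n - margin n) (j * mesh n + margin n)" by (rule step.IH) (use step.prems in auto)
  have mk: "marked n (Suc j)" using step.prems[of "Suc j"] step.hyps(1) by simp
  have 3: "Suc j * mesh n = j * mesh n + mesh n" by (simp add: algebra_simps)
  show ?case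
    by (rule pattern_glue[OF ih mk[unfolded marked_def]]) (use 1 2 3 mesh_pos[of n] in linarith)+
qed

text \<open>
  If the two points lie in the limit of cosets, then the word between them equals, up to a negligible
  part at both ends, a factor of a word of bounded period. By \<open>periodic_marked\<close> all indices between
  \<open>s + e\<close> and \<open>t - e\<close> are marked. The intervals of the pattern around adjacent indices overlap, so
  they combine to give \<open>R (s + e) (t - e)\<close>, and the pattern is closed.
\<close>

lemma coset_in_pattern:
  assumes st: "0 \<le> s" "s < t" and A: "range A \<subseteq> \<A>"
    and sA: "cls (ray f s) \<in> ulim_set (cayley_metric G S) \<omega> x r A"
    and tA: "cls (ray f t) \<in> ulim_set (cayley_metric G S) \<omega> x r A"
    and \<A>: "\<And>A g h. A \<in> \<A> \<Longrightarrow> g \<in> A \<Longrightarrow> h \<in> A \<Longrightarrow> \<exists>\<alpha> \<beta> \<gamma> p. fst ` set \<alpha> \<subseteq> S \<and> fst ` set \<beta> \<subseteq> S \<and> fst ` set \<gamma> \<subseteq> S \<and>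
       length \<alpha> \<le> C \<and> length \<gamma> \<le> C \<and> reduced_word \<beta> \<and> periodic p \<beta> \<and> 0 < p \<and> p \<le> C \<and>
       inv g \<otimes> h = word_eval G \<alpha> \<otimes> word_eval G \<beta> \<otimes> word_eval G \<gamma>"
  shows "R s t"
proof (rule pattern_closed[OF st(2)])
  fix e :: real assume e: "0 < e" "2 * e < t - s"
  have t: "0 \<le> t" using st by simp
  obtain a where a: "cls (ray f s) = cls a" "a \<in> seqs" "\<And>n. a n \<in> A n" using sA by (auto simp: ulim_set_def)
  obtain b where b: "cls (ray f t) = cls b" "b \<in> seqs" "\<And>n. b n \<in> A n" using tA by (auto simp: ulim_set_def)
  have aG: "a n \<in> carrier G" "b n \<in> carrier G" for n using a(2) b(2) seqs_closed by auto
  have "\<forall>n. \<exists>w. reduced_word w \<and> fst ` set w \<subseteq> S \<and> word_eval G w = inv (ray f s n) \<otimes> a n"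
    using eval_surj aG ray_closed by simp
  then obtain v where v: "\<And>n. reduced_word (v n)" "\<And>n. fst ` set (v n) \<subseteq> S" "\<And>n. word_eval G (v n) = inv (ray f s n) \<otimes> a n" by metis
  have "\<forall>n. \<exists>w. reduced_word w \<and> fst ` set w \<subseteq> S \<and> word_eval G w = inv (b n) \<otimes> ray f t n"
    using eval_surj aG ray_closed by simp
  then obtain w where w: "\<And>n. reduced_word (w n)" "\<And>n. fst ` set (w n) \<subseteq> S" "\<And>n. word_eval G (w n) = inv (b n) \<otimes> ray f t n" by metis
  have len_v: "dG (ray f s n) (a n) = length (v n)" for n
    using word_length_eval[OF v(1,2), of n] aG ray_closed by (simp add: cayley v(3))
  have len_w: "dG (ray f t n) (b n) = length (w n)" for n
  proof -
    have "dG (b n) (ray f t n) = length (w n)"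
      using word_length_eval[OF w(1,2), of n] aG ray_closed by (simp add: cayley w(3))
    then show ?thesis by (metis mdist_commute)
  qed
  \<comment> \<open>The word between the two points of the ray is \<open>v n\<close>, a word coming from the coset, and \<open>w n\<close>. The
      number \<open>K n\<close> bounds the part affected by cancellation.\<close>
  define K where "K n = length (v n) + length (w n) + C" for n
  have "cdist (ray f s) a = 0" "cdist (ray f t) b = 0"
    using a b cls_eq_iff[OF ray_in_seqs[OF st(1)]] cls_eq_iff[OF ray_in_seqs[OF t]] by auto
  then have lims: "((\<lambda>n. length (v n) / r n) \<longlongrightarrow> 0) \<F>" "((\<lambda>n. length (w n) / r n) \<longlongrightarrow> 0) \<F>"
    using dist_tendsto[OF ray_in_seqs[OF st(1), of f] a(2)] dist_tendsto[OF ray_in_seqs[OF t, of f] b(2)] by (simp_all add: len_v len_w)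
  have K: "((\<lambda>n. real (K n + (4 * width n + 2)) * mesh n) \<longlongrightarrow> 0) \<F>"
  proof -
    have "((\<lambda>n. (length (v n) / r n + length (w n) / r n + C / r n) * length u + real (4 * width n + 2) * mesh n) \<longlongrightarrow> (0 + 0 + 0) * real (length u) + 0) \<F>"
      by (intro tendsto_intros lims tendsto_const_over_r width_multiple_tendsto)
    then show ?thesis by (simp add: K_def mesh_def add_divide_distrib algebra_simps)
  qed
  have "eventually (\<lambda>n. C < width n \<and> index s n + (K n + (4 * width n + 2)) < index (s + e) n \<and>
      index (t - e) n + (K n + (4 * width n + 2)) < index t n) \<F>"
    using st e by (intro eventually_conj width_at_top index_gap K) auto
  then obtain n where n: "C < width n" "index s n + (K n + (4 * width n + 2)) < index (s + e) n"
      "index (t - e) n + (K n + (4 * width n + 2)) < index t n"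
    using \<F>(1) by (metis (mono_tags, lifting) eventually_happens')
  have "A n \<in> \<A>" using A by blast
  from \<A>[OF this a(3) b(3)] obtain \<alpha> \<beta> \<gamma> p where h: "fst ` set \<alpha> \<subseteq> S" "fst ` set \<beta> \<subseteq> S" "fst ` set \<gamma> \<subseteq> S"
      "length \<alpha> \<le> C" "length \<gamma> \<le> C" "reduced_word \<beta>" "periodic p \<beta>" "0 < p" "p \<le> C"
      "inv (a n) \<otimes> b n = word_eval G \<alpha> \<otimes> word_eval G \<beta> \<otimes> word_eval G \<gamma>"
    by (elim exE conjE)
  have "0 \<le> t - e" "s + e \<le> t - e" using st e by auto
  then have order: "index (s + e) n \<le> index (t - e) n"
    using mesh_pos[of n] by (simp add: index_def nat_mono floor_mono divide_right_mono)
  have le: "index s n \<le> index t n" using n order by simp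
  define \<alpha>' where "\<alpha>' = v n @ \<alpha>"
  define \<gamma>' where "\<gamma>' = \<gamma> @ w n"
  have S': "fst ` set \<alpha>' \<subseteq> S" "fst ` set \<gamma>' \<subseteq> S" 
    unfolding \<alpha>'_def \<gamma>'_def set_append image_Un using v(2)[of n] w(2)[of n] h(1,3) by simp_all
  have S'': "fst ` set (word_mult \<gamma>' []) \<subseteq> S" "fst ` set (word_mult \<beta> (word_mult \<gamma>' [])) \<subseteq> S"
    using fst_set_foldr[of \<gamma>' S "[]"] fst_set_foldr[of \<beta> S "word_mult \<gamma>' []"] S' h(2) by auto
  have red: "reduced_word (word_mult \<gamma>' [])" "reduced_word (word_mult \<beta> (word_mult \<gamma>' []))"
    by (simp_all add: reduced_foldr)
  have "word_eval G (segment (blocks f n) (index s n) (index t n)) = inv (ray f s n) \<otimes> ray f t n"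
    using vertex_append[OF le, of f n] vertex_closed eval_closed[OF letters_segment]
    by (simp add: ray_def m_assoc[symmetric])
  also have "\<dots> = (inv (ray f s n) \<otimes> a n) \<otimes> ((inv (a n) \<otimes> b n) \<otimes> (inv (b n) \<otimes> ray f t n))"
  proof -
    have "a n \<otimes> (inv (a n) \<otimes> z) = z" if "z \<in> carrier G" for z
      using aG that by (simp add: m_assoc[symmetric])
    moreover have "b n \<otimes> (inv (b n) \<otimes> z) = z" if "z \<in> carrier G" for z
      using aG that by (simp add: m_assoc[symmetric])
    ultimately show ?thesis using aG ray_closed by (simp add: m_assoc)
  qed
  also have "\<dots> = (word_eval G (v n) \<otimes> word_eval G \<alpha>) \<otimes> (word_eval G \<beta> \<otimes> (word_eval G \<gamma> \<otimes> word_eval G (w n)))"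
    using eval_closed v(2) w(2) h(1-3) by (simp add: h(10) v(3)[symmetric] w(3)[symmetric] m_assoc)
  also have "\<dots> = word_eval G \<alpha>' \<otimes> (word_eval G \<beta> \<otimes> word_eval G \<gamma>')"
    using eval_append v(2) w(2) h(1,3) by (simp add: \<alpha>'_def \<gamma>'_def)
  also have "\<dots> = word_eval G (word_mult \<alpha>' (word_mult \<beta> (word_mult \<gamma>' [])))"
    using eval_mult_reduced[OF S'(1) S''(2) red(2)] eval_mult_reduced[OF h(2) S''(1) red(1)] eval_reduce[OF S'(2)] by simp
  finally have seg: "segment (blocks f n) (index s n) (index t n) = word_mult \<alpha>' (word_mult \<beta> (word_mult \<gamma>' []))"
    by (intro eval_inj reduced_segment letters_segment) (use fst_set_foldr[OF S'(1) S''(2)] in \<open>auto simp: reduced_foldr\<close>)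
  have "length \<alpha>' \<le> K n" "length \<gamma>' \<le> K n" using h(4,5) by (auto simp: \<alpha>'_def \<gamma>'_def K_def)
  then obtain xx m yy \<beta>1 \<beta>2 where f: "segment (blocks f n) (index s n) (index t n) = xx @ m @ yy"
      "length xx \<le> K n" "length yy \<le> K n" "\<beta> = \<beta>1 @ m @ \<beta>2"
    using word_mult_middle[OF h(6), of \<alpha>' "K n" \<gamma>'] unfolding seg by blast
  have per: "periodic p m" using h(7) unfolding f(4) by (rule periodic_factor)
  have mark: "marked n j" if "index (s + e) n \<le> j" "j \<le> index (t - e) n + 1" for j
  proof (rule periodic_marked[OF _ _ f(1-3) per h(8)])
    show "blocks f n i \<longleftrightarrow> marked n i \<or> width n dvd i" if "width n \<le> i" for i using that by (simp add: blocks_def)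
    show "p < width n" using h(9) n(1) by simp
    show "index s n + K n + 4 * width n \<le> j" "j + 4 * width n + K n \<le> index t n" using that n by auto
  qed (rule marked_fill)
  have "R (index (s + e) n * mesh n - margin n) ((index (t - e) n + 1) * mesh n + margin n)"
    using marked_run[of "index (s + e) n" "index (t - e) n + 1" n] mark order by simp
  then show "R (s + e) (t - e)"
  proof (rule pattern_convex)
    show "index (s + e) n * mesh n - margin n \<le> s + e" using index_bounds(1)[of "s + e" n] st e margin_pos[of n] by simp
    show "s + e < t - e" using e by simp
    show "t - e \<le> real (index (t - e) n + 1) * mesh n + margin n"
      using index_bounds(2)[OF \<open>0 \<le> t - e\<close>, of n] margin_pos[of n] by simp
  qed
qed

end

section \<open>Marked trees are universal\<close>

context cone_group
begin

lemma mspace_cone: "mspace (cone (cayley_metric G S) \<omega> x r) = {cls y | y. y \<in> seqs}"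
  unfolding cone_def mspace_metric_quotient[OF pseudometric] quotient_def by blast

lemma mdist_cone: "y \<in> seqs \<Longrightarrow> z \<in> seqs \<Longrightarrow> mdist (cone (cayley_metric G S) \<omega> x r) (cls y) (cls z) = cdist y z"
  unfolding cone_def by (rule mdist_metric_quotient[OF pseudometric])

text \<open>
  The word \<open>u\<close> is taken from the first subgroup, and this subgroup realizes the collinear pairs. All
  other pairs have to be kept apart by every one of the subgroups, whose cores have lengths
  bounded by a common constant \<open>C\<close>.
\<close>

theorem cone_rays:
  assumes st: "s \<in> S" "t \<in> S" "s \<noteq> t" and n: "1 \<le> n"
    and H: "\<And>i. i \<in> {1..n} \<Longrightarrow> infinite_cyclic_subgroup G (H i)"
    and p: "p \<in> mspace (cone (cayley_metric G S) \<omega> x r)" and R: "pattern R"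
  shows "\<exists>g. (\<forall>f :: nat \<Rightarrow> bool. g f 0 = p \<and> (\<forall>t\<ge>0. g f t \<in> mspace (cone (cayley_metric G S) \<omega> x r)) \<and>
       (\<forall>s\<ge>0. \<forall>t\<ge>0. mdist (cone (cayley_metric G S) \<omega> x r) (g f s) (g f t) = \<bar>s - t\<bar>) \<and>
       (\<forall>s t. 0 \<le> s \<and> s < t \<longrightarrow>
         ((\<exists>Q\<in>cone_pieces (cayley_metric G S) \<omega> x r (peripheral_cosets G n H). g f s \<in> Q \<and> g f t \<in> Q) \<longleftrightarrow> R s t))) \<and>
     (\<forall>f f' s s'. f \<noteq> f' \<and> 0 < s \<and> 0 < s' \<longrightarrow> g f s \<noteq> g f' s')"
proof -
  obtain y0 where yp: "y0 \<in> seqs" "p = cls y0" using p unfolding mspace_cone by blast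
  define K where "K i q u \<longleftrightarrow> fst ` set q \<subseteq> S \<and> fst ` set u \<subseteq> S \<and> reduced_word u \<and> u \<noteq> [] \<and> hd u \<noteq> letter_inv (last u) \<and>
    H i = {word_eval G q \<otimes> word_eval G (concat (replicate m v)) \<otimes> inv (word_eval G q) | m v. v \<in> {u, word_inv u}}" for i q u
  have "\<exists>q u. K i q u" if "i \<in> {1..n}" for i
    unfolding K_def by (rule infinite_cyclic_core[OF H[OF that]])
  then have "\<exists>q u. \<forall>i\<in>{1..n}. K i (q i) (u i)" by metis
  then obtain q u where "\<And>i. i \<in> {1..n} \<Longrightarrow> K i (q i) (u i)" by blast
  note core = this[unfolded K_def]
  have one: "1 \<in> {1..n}" using n by simp
  have coreD: "fst ` set (q i) \<subseteq> S" "fst ` set (u i) \<subseteq> S" "reduced_word (u i)" "u i \<noteq> []"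
    "hd (u i) \<noteq> letter_inv (last (u i))"
    "H i = {word_eval G (q i) \<otimes> word_eval G (concat (replicate m v)) \<otimes> inv (word_eval G (q i)) | m v. v \<in> {u i, word_inv (u i)}}"
    if "i \<in> {1..n}" for i
    using core[OF that] by - (elim conjE, assumption)+
  note core1 = coreD[OF one]
  from free_letter[OF st core1(4)] obtain c where
    c: "fst c \<in> S" "c \<noteq> letter_inv (hd (u 1))" "c \<noteq> letter_inv (last (u 1))" "\<not> set (u 1) \<subseteq> {c}"
    by (elim exE conjE)
  interpret cone_ray G S \<omega> x r "u 1" c y0 R
    by unfold_locales (fact core1 c yp(1) R)+
  let ?X = "cayley_metric G S" and ?\<A> = "peripheral_cosets G n H"
  define C where "C = (\<Sum>i\<in>{1..n}. length (q i) + length (u i))"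
  have C: "length (q i) + length (u i) \<le> C" if "i \<in> {1..n}" for i
    unfolding C_def by (rule member_le_sum) (use that in auto)
  define Q where "Q = word_eval G (q 1)"
  have Q: "Q \<in> carrier G" using eval_closed[OF core1(1)] by (simp add: Q_def)
  have up: "\<exists>A\<in>?\<A>. \<forall>m. g \<otimes> word_eval G (concat (replicate m (u 1))) \<otimes> inv Q \<in> A" if g: "g \<in> carrier G" for g
  proof (intro bexI allI)
    show "(g \<otimes> inv Q) <# H 1 \<in> ?\<A>" unfolding peripheral_cosets_def using g Q one by blast
    fix m
    define U where "U = word_eval G (concat (replicate m (u 1)))"
    have U: "U \<in> carrier G" using eval_closed[OF fst_set_concat_replicate[OF core1(2)]] by (simp add: U_def)
    have "Q \<otimes> U \<otimes> inv Q \<in> H 1" unfolding core1(6) Q_def U_def by blast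
    moreover have "g \<otimes> U \<otimes> inv Q = (g \<otimes> inv Q) \<otimes> (Q \<otimes> U \<otimes> inv Q)"
    proof -
      have "inv Q \<otimes> (Q \<otimes> (U \<otimes> inv Q)) = U \<otimes> inv Q" using Q U by (simp add: m_assoc[symmetric])
      then show ?thesis using g Q U by (simp add: m_assoc)
    qed
    ultimately show "g \<otimes> U \<otimes> inv Q \<in> (g \<otimes> inv Q) <# H 1" unfolding l_coset_def by blast
  qed
  have down: "\<exists>\<alpha> \<beta> \<gamma> p. fst ` set \<alpha> \<subseteq> S \<and> fst ` set \<beta> \<subseteq> S \<and> fst ` set \<gamma> \<subseteq> S \<and>
       length \<alpha> \<le> C \<and> length \<gamma> \<le> C \<and> reduced_word \<beta> \<and> periodic p \<beta> \<and> 0 < p \<and> p \<le> C \<and>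
       inv g \<otimes> h = word_eval G \<alpha> \<otimes> word_eval G \<beta> \<otimes> word_eval G \<gamma>"
    if A: "A \<in> ?\<A>" "g \<in> A" "h \<in> A" for A g h
  proof -
    obtain b i where b: "A = b <# H i" "b \<in> carrier G" "i \<in> {1..n}"
      using A(1) unfolding peripheral_cosets_def by blast
    obtain h1 h2 where h: "h1 \<in> H i" "h2 \<in> H i" "g = b \<otimes> h1" "h = b \<otimes> h2"
      using A(2,3) unfolding b(1) l_coset_def by blast
    from H[OF b(3), unfolded infinite_cyclic_subgroup_def]
    obtain a where a: "a \<in> carrier G" "H i = generate G {a}" by (elim conjE bexE)
    have sub: "subgroup (H i) G" unfolding a(2) by (rule generate_is_subgroup) (use a(1) in simp)
    note hc = subgroup.mem_carrier[OF sub h(1)] subgroup.mem_carrier[OF sub h(2)]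
    have "inv g \<otimes> h = inv h1 \<otimes> h2"
    proof -
      have "inv b \<otimes> (b \<otimes> h2) = h2" using b(2) hc by (simp add: m_assoc[symmetric])
      then show ?thesis using b(2) hc by (simp add: h(3,4) inv_mult_group m_assoc)
    qed
    moreover have "inv h1 \<otimes> h2 \<in> H i" using sub h(1,2) by (simp add: subgroup.m_closed subgroup.m_inv_closed)
    ultimately have "inv g \<otimes> h \<in> H i" by simp
    from this[unfolded coreD(6)[OF b(3)]]
    obtain m v where mv: "inv g \<otimes> h = word_eval G (q i) \<otimes> word_eval G (concat (replicate m v)) \<otimes> inv (word_eval G (q i))"
        "v \<in> {u i, word_inv (u i)}" by (elim CollectE exE conjE)
    note ci = coreD(1-5)[OF b(3)]
    have "u i \<noteq> [] \<and> word_inv (u i) \<noteq> []" using ci by (simp add: word_inv_def)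
    moreover have "reduced_word (word_inv (u i))" using ci by (simp add: reduced_word_inv)
    moreover have "hd (word_inv (u i)) \<noteq> letter_inv (last (word_inv (u i)))"
    proof -
      have "hd (word_inv (u i)) = letter_inv (last (u i))" "last (word_inv (u i)) = letter_inv (hd (u i))"
        using ci(4) by (simp_all add: word_inv_def hd_rev last_rev hd_map last_map)
      then show ?thesis using ci(5) letter_inv_inv[of "hd (u i)"] by metis
    qed
    moreover have "length (word_inv (u i)) = length (u i)" by simp
    moreover have "fst ` set (word_inv (u i)) \<subseteq> S" unfolding fst_set_word_inv by (rule ci(2))
    ultimately have v: "v \<noteq> []" "reduced_word v" "hd v \<noteq> letter_inv (last v)" "length v = length (u i)"
        "fst ` set v \<subseteq> S"
      using mv(2) ci(2-5) by (elim insertE emptyE; simp only: simp_thms)+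
    have red: "reduced_word (concat (replicate m v))" by (rule reduced_word_concat) (use v in auto)
    have inv: "word_eval G (word_inv (q i)) = inv (word_eval G (q i))" by (rule eval_inv[OF ci(1)])
    have qS: "fst ` set (word_inv (q i)) \<subseteq> S" unfolding fst_set_word_inv by (rule ci(1))
    show ?thesis
    proof (intro exI conjI)
      show "fst ` set (q i) \<subseteq> S" by (rule ci(1))
      show "fst ` set (concat (replicate m v)) \<subseteq> S" by (rule fst_set_concat_replicate[OF v(5)])
      show "fst ` set (word_inv (q i)) \<subseteq> S" by (rule qS)
      show "length (q i) \<le> C" "length (word_inv (q i)) \<le> C" using C[OF b(3)] by simp_all
      show "reduced_word (concat (replicate m v))" by (rule red)
      show "periodic (length v) (concat (replicate m v))" by (rule periodic_replicate)
      show "0 < length v" using v(1) by simp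
      show "length v \<le> C" using C[OF b(3)] v(4) by simp
      show "inv g \<otimes> h = word_eval G (q i) \<otimes> word_eval G (concat (replicate m v)) \<otimes> word_eval G (word_inv (q i))"
        using mv(1) inv by simp
    qed
  qed
  define g where "g f t = cls (ray f t)" for f t
  have g0: "g f 0 = p" for f unfolding g_def ray_0 by (rule yp(2)[symmetric])
  have gin: "g f t \<in> mspace (cone ?X \<omega> x r)" if "0 \<le> t" for f t
    unfolding mspace_cone g_def using ray_in_seqs[OF that] by blast
  have gd: "mdist (cone ?X \<omega> x r) (g f s) (g f t) = \<bar>s - t\<bar>" if "0 \<le> s" "0 \<le> t" for f s t
    unfolding g_def mdist_cone[OF ray_in_seqs[OF that(1)] ray_in_seqs[OF that(2)]] by (rule ray_dist[OF that])
  have gR: "(\<exists>Q\<in>cone_pieces ?X \<omega> x r ?\<A>. g f s \<in> Q \<and> g f t \<in> Q) \<longleftrightarrow> R s t" if t: "0 \<le> s" "s < t" for f s t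
  proof
    assume "\<exists>Q\<in>cone_pieces ?X \<omega> x r ?\<A>. g f s \<in> Q \<and> g f t \<in> Q"
    then obtain A where A: "range A \<subseteq> ?\<A>" "g f s \<in> ulim_set ?X \<omega> x r A" "g f t \<in> ulim_set ?X \<omega> x r A"
      unfolding cone_pieces_def by blast
    show "R s t" by (rule coset_in_pattern[OF t A(1) A(2)[unfolded g_def] A(3)[unfolded g_def] down])
  next
    assume "R s t"
    then obtain A where A: "range A \<subseteq> ?\<A>" "g f s \<in> ulim_set ?X \<omega> x r A" "g f t \<in> ulim_set ?X \<omega> x r A"
      using pattern_in_coset[OF t _ inv_closed[OF Q] up] unfolding g_def by blast
    then have "ulim_set ?X \<omega> x r A \<in> cone_pieces ?X \<omega> x r ?\<A>" unfolding cone_pieces_def by blast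
    then show "\<exists>Q\<in>cone_pieces ?X \<omega> x r ?\<A>. g f s \<in> Q \<and> g f t \<in> Q" using A(2,3) by blast
  qed
  have gne: "g f s \<noteq> g f' s'" if "f \<noteq> f'" "0 < s" "0 < s'" for f f' s s'
    unfolding g_def by (rule rays_diverge[OF that])
  show ?thesis
  proof (intro exI[of _ g] conjI allI impI)
    show "g f 0 = p" for f by (rule g0)
    show "g f t \<in> mspace (cone ?X \<omega> x r)" if "0 \<le> t" for f t by (rule gin[OF that])
    show "mdist (cone ?X \<omega> x r) (g f s) (g f t) = \<bar>s - t\<bar>" if "0 \<le> s" "0 \<le> t" for f s t by (rule gd[OF that])
    show "(\<exists>Q\<in>cone_pieces ?X \<omega> x r ?\<A>. g f s \<in> Q \<and> g f t \<in> Q) \<longleftrightarrow> R s t" if "0 \<le> s \<and> s < t" for f s t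
      by (rule gR[OF conjunct1[OF that] conjunct2[OF that]])
    show "g f s \<noteq> g f' s'" if "f \<noteq> f' \<and> 0 < s \<and> 0 < s'" for f f' s s'
      by (rule gne[OF conjunct1[OF that] conjunct1[OF conjunct2[OF that]] conjunct2[OF conjunct2[OF that]]])
  qed
qed

end

lemma (in group) word_length_bilipschitz:
  assumes S: "finite S" "S \<subseteq> carrier G" "generate G S = carrier G"
    and T: "T \<subseteq> carrier G" "generate G T = carrier G"
  shows "\<exists>C\<ge>0. \<forall>g\<in>carrier G. \<forall>h\<in>carrier G. mdist (cayley_metric G T) g h \<le> C * mdist (cayley_metric G S) g h"
proof -
  interpret T: Metric_space "carrier G" "\<lambda>g h. if g \<in> carrier G \<and> h \<in> carrier G then real (word_length G T (inv g \<otimes> h)) else 0"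
    by (rule Metric_space_cayley[OF T])
  have dT: "mdist (cayley_metric G T) g h = real (word_length G T (inv g \<otimes> h))" if "g \<in> carrier G" "h \<in> carrier G" for g h
    using that unfolding cayley_metric_def T.mdist_metric by simp
  have dS: "mdist (cayley_metric G S) g h = real (word_length G S (inv g \<otimes> h))" if "g \<in> carrier G" "h \<in> carrier G" for g h
    using that unfolding cayley_metric_def Metric_space.mdist_metric[OF Metric_space_cayley[OF S(2,3)]] by simp
  define C where "C = (\<Sum>s\<in>S. word_length G T s)"
  have C: "word_length G T s \<le> C" if "s \<in> S" for s
    unfolding C_def by (rule member_le_sum) (use S(1) that in auto)
  have sub: "word_length G T (g \<otimes> h) \<le> word_length G T g + word_length G T h" if "g \<in> carrier G" "h \<in> carrier G" for g h
  proof -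
    have "inv g \<otimes> (g \<otimes> h) = h" using that by (simp add: m_assoc[symmetric])
    then show ?thesis using T.triangle[of \<one> g "g \<otimes> h"] that by simp
  qed
  have inv: "word_length G T (inv g) = word_length G T g" if "g \<in> carrier G" for g
    using T.commute[of \<one> g] that by simp
  have zero: "word_length G T \<one> = 0" using T.zero[of \<one> \<one>] by simp
  have "word_length G T (word_eval G w) \<le> C * length w" if "fst ` set w \<subseteq> S" for w
    using that
  proof (induction w)
    case Nil
    then show ?case using zero by (simp add: word_eval_def)
  next
    case (Cons a w)
    obtain s b where a: "a = (s, b)" by (cases a)
    have s: "s \<in> S" "s \<in> carrier G" using Cons.prems S(2) a by auto
    have w: "word_eval G w \<in> carrier G" using Cons.prems S(2) by (intro word_eval_closed) auto
    have "word_eval G (a # w) = (if b then s else inv s) \<otimes> word_eval G w" by (simp add: word_eval_def a)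
    then have "word_length G T (word_eval G (a # w)) \<le> word_length G T (if b then s else inv s) + word_length G T (word_eval G w)"
      using sub[OF _ w] s(2) by simp
    also have "\<dots> \<le> C + C * length w" using C[OF s(1)] inv[OF s(2)] Cons by (intro add_mono) auto
    finally show ?case by simp
  qed
  then have "word_length G T g \<le> C * word_length G S g" if "g \<in> carrier G" for g
    using word_length_exists[OF S(2), of g] S(3) that by metis
  then have "mdist (cayley_metric G T) g h \<le> real C * mdist (cayley_metric G S) g h" if "g \<in> carrier G" "h \<in> carrier G" for g h
    unfolding dT[OF that] dS[OF that] using that by (metis inv_closed m_closed of_nat_le_iff of_nat_mult)
  then show ?thesis by (intro exI[of _ "real C"]) simp
qed

lemma cone_seqs_mono:
  assumes \<omega>: "nonprincipal_ultrafilter \<omega>" and X: "mspace X = mspace Y" and x: "range x \<subseteq> mspace X" and r: "\<And>n. 0 < r n"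
    and C: "0 \<le> C" "\<And>a b. a \<in> mspace X \<Longrightarrow> b \<in> mspace X \<Longrightarrow> mdist Y a b \<le> C * mdist X a b"
  shows "cone_seqs X \<omega> x r \<subseteq> cone_seqs Y \<omega> x r"
proof
  fix y assume y: "y \<in> cone_seqs X \<omega> x r"
  obtain F :: "nat filter" where F: "F \<noteq> bot" "\<And>s. (s \<longlongrightarrow> ulim \<omega> s) F"
    using \<omega> by (rule ulim_filter) blast
  have yX: "y n \<in> mspace X" "x n \<in> mspace X" for n using y x by (auto simp: cone_seqs_def)
  have "ulim \<omega> (\<lambda>n. ereal (mdist X (x n) (y n) / r n)) < \<infinity>" using y by (simp add: cone_seqs_def)
  then obtain K :: real where K: "ulim \<omega> (\<lambda>n. ereal (mdist X (x n) (y n) / r n)) < ereal K"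
    using ereal_dense2 by blast
  have "eventually (\<lambda>n. ereal (mdist X (x n) (y n) / r n) < ereal K) F" by (rule order_tendstoD(2)[OF F(2) K])
  then have "eventually (\<lambda>n. ereal (mdist Y (x n) (y n) / r n) \<le> ereal (C * K)) F"
  proof eventually_elim
    case (elim n)
    have "mdist Y (x n) (y n) / r n \<le> C * mdist X (x n) (y n) / r n"
      using C(2)[OF yX(2,1)] r[of n] by (intro divide_right_mono) auto
    also have "\<dots> = C * (mdist X (x n) (y n) / r n)" by simp
    also have "\<dots> \<le> C * K" using elim C(1) by (intro mult_left_mono) auto
    finally show ?case by simp
  qed
  then have "ulim \<omega> (\<lambda>n. ereal (mdist Y (x n) (y n) / r n)) \<le> ereal (C * K)"
    by (rule tendsto_upperbound[OF F(2) _ F(1)])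
  also have "\<dots> < \<infinity>" by simp
  finally show "y \<in> cone_seqs Y \<omega> x r" using y X by (auto simp: cone_seqs_def)
qed

lemma cone_dist_zero_mono:
  assumes data: "cone_data X \<omega> x r" "cone_data Y \<omega> x r" and X: "mspace X = mspace Y"
    and yz: "y \<in> cone_seqs X \<omega> x r" "z \<in> cone_seqs X \<omega> x r" "y \<in> cone_seqs Y \<omega> x r" "z \<in> cone_seqs Y \<omega> x r"
    and C: "\<And>a b. a \<in> mspace X \<Longrightarrow> b \<in> mspace X \<Longrightarrow> mdist Y a b \<le> C * mdist X a b"
    and 0: "cone_dist X \<omega> r y z = 0"
  shows "cone_dist Y \<omega> r y z = 0"
proof -
  obtain F :: "nat filter" where F: "F \<noteq> bot" "\<And>s. (s \<longlongrightarrow> ulim \<omega> s) F"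
    using data(1) unfolding cone_data_def by (metis ulim_filter)
  have yX: "y n \<in> mspace X" "z n \<in> mspace X" for n using yz by (auto simp: cone_seqs_def)
  have r: "0 < r n" for n using data(1) by (simp add: cone_data_def)
  have "cone_dist Y \<omega> r y z \<le> C * cone_dist X \<omega> r y z"
  proof (rule tendsto_le[OF F(1) _ cone_dist_tendsto[OF data(2) yz(3,4) F]])
    show "((\<lambda>n. C * (mdist X (y n) (z n) / r n)) \<longlongrightarrow> C * cone_dist X \<omega> r y z) F"
      by (intro tendsto_mult_left cone_dist_tendsto[OF data(1) yz(1,2) F])
    show "eventually (\<lambda>n. mdist Y (y n) (z n) / r n \<le> C * (mdist X (y n) (z n) / r n)) F"
    proof (intro always_eventually allI)
      fix n show "mdist Y (y n) (z n) / r n \<le> C * (mdist X (y n) (z n) / r n)"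
        using divide_right_mono[OF C[OF yX], of "r n" n] r[of n] by simp
    qed
  qed
  then have "cone_dist Y \<omega> r y z \<le> 0" using 0 by simp
  moreover have "0 \<le> cone_dist Y \<omega> r y z" using pseudometric_onD(1)[OF pseudometric_on_cone_seqs[OF data(2)] yz(3,4)] .
  ultimately show ?thesis by simp
qed

text \<open>
  Passing to another finite generating set multiplies distances by bounded factors. This changes
  the metric of a cone, but neither its points nor the limits of sequences of subsets.
\<close>

lemma cone_bilipschitz:
  assumes data: "cone_data X \<omega> x r" and X: "mspace X = mspace Y"
    and C: "0 \<le> C" "\<And>a b. a \<in> mspace X \<Longrightarrow> b \<in> mspace X \<Longrightarrow> mdist Y a b \<le> C * mdist X a b"
    and D: "0 \<le> D" "\<And>a b. a \<in> mspace X \<Longrightarrow> b \<in> mspace X \<Longrightarrow> mdist X a b \<le> D * mdist Y a b"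
  shows "cone_data Y \<omega> x r" "mspace (cone Y \<omega> x r) = mspace (cone X \<omega> x r)"
    "cone_pieces Y \<omega> x r \<A> = cone_pieces X \<omega> x r \<A>"
proof -
  show data': "cone_data Y \<omega> x r" using data X by (simp add: cone_data_def)
  have w: "nonprincipal_ultrafilter \<omega>" "range x \<subseteq> mspace X" "range x \<subseteq> mspace Y" "\<And>n. 0 < r n"
    using data X by (auto simp: cone_data_def)
  have seqs: "cone_seqs X \<omega> x r = cone_seqs Y \<omega> x r"
  proof
    show "cone_seqs X \<omega> x r \<subseteq> cone_seqs Y \<omega> x r" by (rule cone_seqs_mono[OF w(1) X w(2,4) C])
    show "cone_seqs Y \<omega> x r \<subseteq> cone_seqs X \<omega> x r" by (rule cone_seqs_mono[OF w(1) X[symmetric] w(3,4) D[unfolded X]])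
  qed
  have "cone_dist X \<omega> r y z = 0 \<longleftrightarrow> cone_dist Y \<omega> r y z = 0" if "y \<in> cone_seqs X \<omega> x r" "z \<in> cone_seqs X \<omega> x r" for y z
    using cone_dist_zero_mono[OF data data' X that that[unfolded seqs] C(2)]
      cone_dist_zero_mono[OF data' data X[symmetric] that[unfolded seqs] that D(2)[unfolded X]] by blast
  then have rel: "zero_rel (cone_seqs Y \<omega> x r) (cone_dist Y \<omega> r) = zero_rel (cone_seqs X \<omega> x r) (cone_dist X \<omega> r)"
    unfolding zero_rel_def seqs[symmetric] by blast
  show "mspace (cone Y \<omega> x r) = mspace (cone X \<omega> x r)"
  proof -
    note mX = mspace_metric_quotient[OF pseudometric_on_cone_seqs[OF data], folded cone_def]
    note mY = mspace_metric_quotient[OF pseudometric_on_cone_seqs[OF data'], folded cone_def]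
    show ?thesis unfolding mX mY rel seqs ..
  qed
  show "cone_pieces Y \<omega> x r \<A> = cone_pieces X \<omega> x r \<A>"
    unfolding cone_pieces_def ulim_set_def rel seqs ..
qed

lemma (in free_basis_group) rank_two:
  assumes "a \<in> carrier G" "b \<in> carrier G" "a \<otimes> b \<noteq> b \<otimes> a"
  shows "\<exists>s\<in>S. \<exists>t\<in>S. s \<noteq> t"
proof (rule ccontr)
  assume no: "\<not> ?thesis"
  have "\<exists>s\<in>carrier G. S \<subseteq> {s}"
  proof (cases "S = {}")
    case False
    then obtain s where "s \<in> S" by blast
    then show ?thesis using no S_closed by blast
  qed blast
  then obtain s where s: "s \<in> carrier G" "S \<subseteq> {s}" by blast
  have "carrier G \<subseteq> generate G {s}" using mono_generate[OF s(2)] generate_S by simp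
  then have "a \<in> {s [^] (k :: int) | k. k \<in> UNIV}" "b \<in> {s [^] (k :: int) | k. k \<in> UNIV}"
    unfolding generate_pow[OF s(1), symmetric] using assms(1,2) by - (erule subsetD, assumption)+
  then obtain i j :: int where "a = s [^] i" "b = s [^] j" by (elim CollectE exE conjE)
  then have "a \<otimes> b = s [^] (i + j)" "b \<otimes> a = s [^] (j + i)" using int_pow_mult[OF s(1)] by simp_all
  then show False using assms(3) by (simp add: add.commute)
qed

text \<open>
  Each direction is open in the punctured tree, because \<open>d b c < d a b\<close> implies that \<open>b\<close> and \<open>c\<close>
  have the same direction. So different directions lie in different components.
\<close>

lemma (in rtree) directions_lepoll_components:
  assumes a: "a \<in> M"
  shows "(\<lambda>b. {c \<in> M. same_dir a b c}) ` (M - {a}) \<lesssim> connected_components_of (subtopology mtopology (M - {a}))"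
proof -
  let ?X = "subtopology mtopology (M - {a})"
  define D where "D b = {c \<in> M. same_dir a b c}" for b
  have top: "topspace ?X = M - {a}" by auto
  have open_near: "openin ?X U" if U: "U \<subseteq> M - {a}" "\<And>b c. b \<in> U \<Longrightarrow> c \<in> M \<Longrightarrow> same_dir a b c \<Longrightarrow> c \<in> U" for U
  proof -
    have "openin mtopology U" unfolding openin_mtopology
    proof (intro conjI allI impI)
      show "U \<subseteq> M" using U by blast
      fix b assume b: "b \<in> U"
      have bM: "b \<in> M" "a \<noteq> b" using b U(1) by auto
      have "mball b (d a b) \<subseteq> U"
      proof
        fix c assume "c \<in> mball b (d a b)"
        then have c: "c \<in> M" "d b c < d a b" by auto
        have "same_dir a b c" unfolding same_dir_def using c(2) nonneg[of a c] by linarith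
        then show "c \<in> U" using U(2)[OF b c(1)] by blast
      qed
      then show "\<exists>r>0. mball b r \<subseteq> U" using mdist_pos_less[OF bM(2) a bM(1)] by blast
    qed
    then show ?thesis using U(1) by (auto simp: openin_subtopology intro!: exI[of _ U])
  qed
  have clopen: "openin ?X (D b)" "closedin ?X (D b)" if b: "b \<in> M - {a}" for b
  proof -
    have bM: "b \<in> M" using b by blast
    have sub: "D b \<subseteq> M - {a}" using same_dir_neq[OF a bM] by (auto simp: D_def)
    show "openin ?X (D b)"
      by (rule open_near[OF sub]) (use same_dir_trans[OF a bM] in \<open>auto simp: D_def\<close>)
    have "openin ?X (M - {a} - D b)"
    proof (rule open_near)
      fix c e assume c: "c \<in> M - {a} - D b" and e: "e \<in> M" "same_dir a c e"
      have cM: "c \<in> M" using c by blast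
      have "e \<noteq> a" using same_dir_neq[OF a cM e] by blast
      moreover have "\<not> same_dir a b e"
        using same_dir_trans[OF a bM cM e(1) _ same_dir_sym[OF e(2)]] c by (auto simp: D_def)
      ultimately show "e \<in> M - {a} - D b" using e(1) by (auto simp: D_def)
    qed blast
    then show "closedin ?X (D b)" using sub unfolding closedin_def top by blast
  qed
  have same: "same_dir a b c" if bc: "connected_component_of ?X b c" and b: "b \<in> M - {a}" for b c
  proof -
    obtain T where T: "connectedin ?X T" "b \<in> T" "c \<in> T"
      using bc unfolding connected_component_of_def by blast
    have "b \<in> D b" using b same_dir_refl[OF a] by (auto simp: D_def)
    then have "T \<subseteq> D b" using connectedin_clopen_cases[OF T(1) clopen(2)[OF b] clopen(1)[OF b]] T(2)
      by (auto simp: disjnt_iff)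
    then show ?thesis using T(3) by (auto simp: D_def)
  qed
  define rep where "rep A = (SOME b. b \<in> M - {a} \<and> D b = A)" for A
  have rep: "rep A \<in> M - {a} \<and> D (rep A) = A" if "A \<in> D ` (M - {a})" for A
    unfolding rep_def by (rule someI_ex) (use that in blast)
  define h where "h A = Collect (connected_component_of ?X (rep A))" for A
  have "inj_on h (D ` (M - {a}))"
  proof (rule inj_onI)
    fix A B assume A: "A \<in> D ` (M - {a})" and B: "B \<in> D ` (M - {a})" and eq: "h A = h B"
    have "rep B \<in> topspace ?X" using rep[OF B] top by simp
    then have "rep B \<in> h B" by (simp add: h_def connected_component_of_refl)
    then have "rep B \<in> h A" using eq by metis
    then have "connected_component_of ?X (rep A) (rep B)" by (simp add: h_def)
    then have sd: "same_dir a (rep A) (rep B)" using same rep[OF A] by blast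
    have M: "rep A \<in> M" "rep B \<in> M" using rep[OF A] rep[OF B] by auto
    have "same_dir a (rep A) c \<longleftrightarrow> same_dir a (rep B) c" if "c \<in> M" for c
      using same_dir_trans[OF a M(1) that M(2) sd] same_dir_trans[OF a M(2) that M(1) same_dir_sym[OF sd]] by blast
    then have "D (rep A) = D (rep B)" by (auto simp: D_def)
    then show "A = B" using rep[OF A] rep[OF B] by simp
  qed
  moreover have "h ` D ` (M - {a}) \<subseteq> connected_components_of ?X"
    using rep top unfolding h_def connected_components_of_def by blast
  ultimately show ?thesis unfolding lepoll_def D_def[abs_def] by blast
qed

text \<open>
  The rays come from \<open>cone_rays\<close>. The pieces cover the cone and intersect in at most a point
  because the free group is asymptotically tree-graded, a property that is given for some finite generating
  set and carries over to the free basis by \<open>cone_bilipschitz\<close>. The rank is at least two, since the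
  group is not commutative.
\<close>

theorem marked_tree_universal:
  assumes Z: "continuum_tree Z" and \<gamma>: "\<And>e. e \<in> I \<Longrightarrow> bi_infinite_geodesic Z (\<gamma> e)" and marked: "marked_tree Z I \<gamma>"
  shows "universal_tree (mspace Z) (mdist Z) ((\<lambda>e. range (\<gamma> e)) ` I)" "inj_on (\<lambda>e. range (\<gamma> e)) I"
proof -
  obtain k n :: nat and H S \<omega> x r f where k: "k \<ge> 2" and n: "n \<ge> 1"
    and H: "\<forall>i\<in>{1..n}. infinite_cyclic_subgroup (free_group {..<k}) (H i)"
    and hyp: "relatively_hyperbolic (free_group {..<k}) n H" and basis: "free_basis (free_group {..<k}) S"
    and data: "cone_data (cayley_metric (free_group {..<k}) S) \<omega> x r"
    and f: "isometry Z (cone (cayley_metric (free_group {..<k}) S) \<omega> x r) f"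
    and pieces: "bij_betw (\<lambda>e. f ` range (\<gamma> e)) I
      (cone_pieces (cayley_metric (free_group {..<k}) S) \<omega> x r (peripheral_cosets (free_group {..<k}) n H))"
    using marked unfolding marked_tree_def Let_def by blast
  define G where "G = free_group {..<k :: nat}"
  note H = H[folded G_def] and hyp = hyp[folded G_def] and basis = basis[folded G_def] and data = data[folded G_def]
    and f = f[folded G_def] and pieces = pieces[folded G_def]
  interpret G: group G unfolding G_def by (rule group_free_group)
  interpret G: cone_group G S \<omega> x r by unfold_locales (fact basis, fact data)
  define C where "C = cone (cayley_metric G S) \<omega> x r"
  define \<Q> where "\<Q> = cone_pieces (cayley_metric G S) \<omega> x r (peripheral_cosets G n H)"
  obtain T where T: "finite T" "T \<subseteq> carrier G" "generate G T = carrier G"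
     "asymptotically_tree_graded (cayley_metric G T) (peripheral_cosets G n H)"
    using hyp unfolding relatively_hyperbolic_def by blast
  have finS: "finite S" by (rule G.finite_basis[OF T(1-3)])
  obtain D where D: "0 \<le> D" "\<And>g h. g \<in> carrier G \<Longrightarrow> h \<in> carrier G \<Longrightarrow> mdist (cayley_metric G T) g h \<le> D * mdist (cayley_metric G S) g h"
    using G.word_length_bilipschitz[OF finS G.S_closed G.generate_S T(2,3)] by blast
  obtain D' where D': "0 \<le> D'" "\<And>g h. g \<in> carrier G \<Longrightarrow> h \<in> carrier G \<Longrightarrow> mdist (cayley_metric G S) g h \<le> D' * mdist (cayley_metric G T) g h"
    using G.word_length_bilipschitz[OF T(1-3) G.S_closed G.generate_S] by blast
  have spT: "mspace (cayley_metric G T) = carrier G"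
    unfolding cayley_metric_def by (rule Metric_space.mspace_metric[OF G.Metric_space_cayley[OF T(2,3)]])
  have sp: "mspace (cayley_metric G S) = mspace (cayley_metric G T)" using spT G.cayley(1) by simp
  note D = D[folded G.cayley(1)] and D' = D'[folded G.cayley(1)]
  have coneT: "cone_data (cayley_metric G T) \<omega> x r"
    "mspace (cone (cayley_metric G T) \<omega> x r) = mspace (cone (cayley_metric G S) \<omega> x r)"
    "cone_pieces (cayley_metric G T) \<omega> x r \<A> = cone_pieces (cayley_metric G S) \<omega> x r \<A>" for \<A>
    by (rule cone_bilipschitz[OF data sp]; rule D D'; assumption)+
  have "tree_graded (cone (cayley_metric G T) \<omega> x r) (cone_pieces (cayley_metric G T) \<omega> x r (peripheral_cosets G n H))"
    using T(4) coneT(1) unfolding asymptotically_tree_graded_def by blast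
  note graded = this[unfolded tree_graded_def]
  have \<Q>: "\<Q> = cone_pieces (cayley_metric G T) \<omega> x r (peripheral_cosets G n H)"
    unfolding \<Q>_def by (rule coneT(3)[symmetric])
  have C: "mspace C = mspace (cone (cayley_metric G T) \<omega> x r)" unfolding C_def by (rule coneT(2)[symmetric])
  have "\<Union>\<Q> = mspace C" and inter: "\<forall>P\<in>\<Q>. \<forall>Q\<in>\<Q>. P \<noteq> Q \<longrightarrow> (\<forall>x\<in>P \<inter> Q. \<forall>y\<in>P \<inter> Q. x = y)"
    unfolding \<Q> C using graded by - (elim conjE, assumption)+
  have bij: "bij_betw f (mspace Z) (mspace C)" and iso: "\<And>a b. a \<in> mspace Z \<Longrightarrow> b \<in> mspace Z \<Longrightarrow> mdist C (f a) (f b) = mdist Z a b"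
    using f unfolding isometry_def C_def[symmetric] by simp_all
  have inj: "inj_on f (mspace Z)" using bij by (rule bij_betw_imp_inj_on)
  let ?\<P> = "(\<lambda>e. range (\<gamma> e)) ` I"
  have line: "range (\<gamma> e) \<subseteq> mspace Z" "mdist Z (\<gamma> e s) (\<gamma> e t) = \<bar>s - t\<bar>" if "e \<in> I" for e s t
    using \<gamma>[OF that] by (auto simp: bi_infinite_geodesic_def)
  have im: "f ` P \<in> \<Q>" if "P \<in> ?\<P>" for P using that pieces unfolding bij_betw_def \<Q>_def by blast
  have sub: "P \<subseteq> mspace Z" if "P \<in> ?\<P>" for P using that line(1) by blast
  have mem: "f a \<in> f ` P \<longleftrightarrow> a \<in> P" if "a \<in> mspace Z" "P \<in> ?\<P>" for a P
    using inj_on_image_mem_iff[OF inj that(1) sub[OF that(2)]] .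
  have pre: "\<exists>P\<in>?\<P>. Q = f ` P" if "Q \<in> \<Q>" for Q
    using that pieces unfolding bij_betw_def \<Q>_def by blast
  show "inj_on (\<lambda>e. range (\<gamma> e)) I"
  proof (rule inj_onI)
    fix e e' assume e: "e \<in> I" "e' \<in> I" "range (\<gamma> e) = range (\<gamma> e')"
    show "e = e'" by (rule inj_onD[OF bij_betw_imp_inj_on[OF pieces] _ e(1,2)]) (simp only: e(3))
  qed
  have rt: "real_tree Z" using Z by (simp add: continuum_tree_def)
  interpret Z: rtree "mspace Z" "mdist Z" by (rule rtree_real_tree[OF rt])
  interpret Z: piece_tree "mspace Z" "mdist Z" ?\<P>
  proof
    show "\<exists>g. range g = P \<and> P \<subseteq> mspace Z \<and> (\<forall>s t :: real. mdist Z (g s) (g t) = \<bar>s - t\<bar>)" if "P \<in> ?\<P>" for P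
      using that line by blast
    show "\<exists>P\<in>?\<P>. a \<in> P" if "a \<in> mspace Z" for a
    proof -
      have "f a \<in> \<Union>\<Q>" using bij_betw_apply[OF bij that] \<open>\<Union>\<Q> = mspace C\<close> by simp
      then obtain P where "P \<in> ?\<P>" "f a \<in> f ` P" using pre by blast
      then show ?thesis using mem[OF that] by blast
    qed
    fix P Q a b assume PQ: "P \<in> ?\<P>" "Q \<in> ?\<P>" "a \<in> P" "a \<in> Q" "b \<in> P" "b \<in> Q" "a \<noteq> b"
    have ab: "a \<in> mspace Z" "b \<in> mspace Z" using sub PQ by blast+
    have "f a \<noteq> f b" using inj_onD[OF inj _ ab] PQ(7) by blast
    moreover have "f a \<in> f ` P \<inter> f ` Q" "f b \<in> f ` P \<inter> f ` Q" using PQ(3-6) by simp_all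
    ultimately have "f ` P = f ` Q" using inter[rule_format, OF im[OF PQ(1)] im[OF PQ(2)]] by metis
    then show "P = Q" using inj_on_image_eq_iff[OF inj sub[OF PQ(1)] sub[OF PQ(2)]] by simp
  qed
  show "universal_tree (mspace Z) (mdist Z) ?\<P>"
  proof
    show "mspace Z \<noteq> {}" using rt by (simp add: real_tree_def)
    show "Z.mcomplete" using Z by (simp add: continuum_tree_def mcomplete_of_def)
    show "(\<lambda>b. {c \<in> mspace Z. Z.same_dir a b c}) ` (mspace Z - {a}) \<lesssim> (UNIV :: real set)" if "a \<in> mspace Z" for a
    proof -
      have "connected_components_of (subtopology Z.mtopology (mspace Z - {a})) \<approx> (UNIV :: real set)"
        using Z that unfolding continuum_tree_def mtopology_of_def by blast
      then show ?thesis by (rule lepoll_trans2[OF Z.directions_lepoll_components[OF that]])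
    qed
    fix p R assume p: "p \<in> mspace Z" and R: "pattern R"
    define A where "A = [(0 :: nat, True)]"
    define B where "B = [(1 :: nat, True)]"
    have "A \<in> carrier G" "B \<in> carrier G" "A \<otimes>\<^bsub>G\<^esub> B \<noteq> B \<otimes>\<^bsub>G\<^esub> A"
      using k by (auto simp: A_def B_def G_def free_group_def reduced_word_Cons cancel_cons_def letter_inv_def)
    then obtain s t where st: "s \<in> S" "t \<in> S" "s \<noteq> t" using G.rank_two by blast
    have fp: "f p \<in> mspace C" using bij p by (rule bij_betw_apply)
    have Hi: "infinite_cyclic_subgroup G (H i)" if "i \<in> {1..n}" for i using H that by blast
    obtain g where g: "(\<forall>w :: nat \<Rightarrow> bool. g w 0 = f p \<and> (\<forall>t\<ge>0. g w t \<in> mspace C) \<and>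
       (\<forall>s\<ge>0. \<forall>t\<ge>0. mdist C (g w s) (g w t) = \<bar>s - t\<bar>) \<and>
       (\<forall>s t. 0 \<le> s \<and> s < t \<longrightarrow> ((\<exists>Q\<in>\<Q>. g w s \<in> Q \<and> g w t \<in> Q) \<longleftrightarrow> R s t))) \<and>
     (\<forall>w w' s s'. w \<noteq> w' \<and> 0 < s \<and> 0 < s' \<longrightarrow> g w s \<noteq> g w' s')"
      using G.cone_rays[OF st n Hi fp[unfolded C_def] R] unfolding C_def \<Q>_def by (rule exE)
    note g1 = g[THEN conjunct1, THEN spec] and gne = g[THEN conjunct2, rule_format]
    note g0 = g1[THEN conjunct1] and gin = g1[THEN conjunct2, THEN conjunct1, rule_format]
      and gd = g1[THEN conjunct2, THEN conjunct2, THEN conjunct1, rule_format]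
      and gR = g1[THEN conjunct2, THEN conjunct2, THEN conjunct2, rule_format]
    define h where "h w t = inv_into (mspace Z) f (g w t)" for w t
    have h: "h w t \<in> mspace Z" "f (h w t) = g w t" if "0 \<le> t" for w t
    proof -
      have "g w t \<in> f ` mspace Z" using gin[OF that] bij_betw_imp_surj_on[OF bij] by simp
      then show "h w t \<in> mspace Z" "f (h w t) = g w t" by (simp_all add: h_def inv_into_into f_inv_into_f)
    qed
    have h0: "h w 0 = p" for w
    proof -
      have "f (h w 0) = f p" using h(2)[of 0 w] g0 by simp
      then show ?thesis using inj_onD[OF inj _ h(1) p] by simp
    qed
    have hd: "mdist Z (h w s) (h w t) = \<bar>s - t\<bar>" if "0 \<le> s" "0 \<le> t" for w s t
    proof -
      have "mdist C (g w s) (g w t) = \<bar>s - t\<bar>" using gd that by simp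
      then show ?thesis using iso[OF h(1)[OF that(1), of w] h(1)[OF that(2), of w]] h(2) that by simp
    qed
    have hR: "Z.col (h w s) (h w t) \<longleftrightarrow> R s t" if st0: "0 \<le> s" "s < t" for w s t
    proof -
      have t0: "0 \<le> t" using st0 by simp
      have "Z.col (h w s) (h w t) \<longleftrightarrow> (\<exists>Q\<in>\<Q>. g w s \<in> Q \<and> g w t \<in> Q)"
      proof
        assume "Z.col (h w s) (h w t)"
        then obtain P where "P \<in> ?\<P>" "h w s \<in> P" "h w t \<in> P" unfolding Z.col_def by blast
        then have "f ` P \<in> \<Q>" "f (h w s) \<in> f ` P" "f (h w t) \<in> f ` P" by (simp_all only: im imageI)
        then show "\<exists>Q\<in>\<Q>. g w s \<in> Q \<and> g w t \<in> Q" unfolding h(2)[OF st0(1)] h(2)[OF t0] by (intro bexI conjI)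
      next
        assume "\<exists>Q\<in>\<Q>. g w s \<in> Q \<and> g w t \<in> Q"
        then obtain P where P: "P \<in> ?\<P>" "f (h w s) \<in> f ` P" "f (h w t) \<in> f ` P"
          unfolding h(2)[OF st0(1)] h(2)[OF t0] using pre by metis
        then have "h w s \<in> P" "h w t \<in> P" using mem[OF h(1)[OF st0(1)] P(1)] mem[OF h(1)[OF t0] P(1)] by blast+
        then show "Z.col (h w s) (h w t)" unfolding Z.col_def using P(1) by blast
      qed
      also have "\<dots> \<longleftrightarrow> R s t" using gR st0 by simp
      finally show ?thesis .
    qed
    have hne: "h w s \<noteq> h w' s'" if "w \<noteq> w'" "0 < s" "0 < s'" for w w' s s'
    proof
      assume "h w s = h w' s'"
      then have "g w s = g w' s'" using h(2)[of s w] h(2)[of s' w'] that by simp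
      then show False using gne[of w w' s s'] that by simp
    qed
    show "\<exists>g :: (nat \<Rightarrow> bool) \<Rightarrow> real \<Rightarrow> 'a.
      (\<forall>f. g f 0 = p \<and> (\<forall>t\<ge>0. g f t \<in> mspace Z) \<and> (\<forall>s\<ge>0. \<forall>t\<ge>0. mdist Z (g f s) (g f t) = \<bar>s - t\<bar>) \<and>
           (\<forall>s t. 0 \<le> s \<and> s < t \<longrightarrow> (Z.col (g f s) (g f t) \<longleftrightarrow> R s t))) \<and>
      (\<forall>f f' s s'. f \<noteq> f' \<and> 0 < s \<and> 0 < s' \<longrightarrow> g f s \<noteq> g f' s')"
    proof (intro exI[of _ h] conjI allI impI)
      show "h w 0 = p" for w by (rule h0)
      show "h w t \<in> mspace Z" if "0 \<le> t" for w t by (rule h(1)[OF that])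
      show "mdist Z (h w s) (h w t) = \<bar>s - t\<bar>" if "0 \<le> s" "0 \<le> t" for w s t by (rule hd[OF that])
      show "Z.col (h w s) (h w t) \<longleftrightarrow> R s t" if "0 \<le> s \<and> s < t" for w s t
        by (rule hR[OF conjunct1[OF that] conjunct2[OF that]])
      show "h w s \<noteq> h w' s'" if "w \<noteq> w' \<and> 0 < s \<and> 0 < s'" for w w' s s'
        by (rule hne[OF conjunct1[OF that] conjunct1[OF conjunct2[OF that]] conjunct2[OF conjunct2[OF that]]])
    qed
  qed
qed

section \<open>Isometries of clusters from isometries of vertex trees\<close>

lemma metric_quotient_isometric:
  assumes S: "pseudometric_on S D" "pseudometric_on S' D'"
    and f: "\<And>x. x \<in> S \<Longrightarrow> f x \<in> S'" "\<And>x y. x \<in> S \<Longrightarrow> y \<in> S \<Longrightarrow> D' (f x) (f y) = D x y"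
    and onto: "\<And>y. y \<in> S' \<Longrightarrow> \<exists>x\<in>S. D' (f x) y = 0"
  shows "isometric (metric_quotient S D) (metric_quotient S' D')"
proof -
  note E = equiv_zero_rel[OF S(1)] and E' = equiv_zero_rel[OF S(2)]
  define c where "c x = zero_rel S D `` {x}" for x
  define c' where "c' x = zero_rel S' D' `` {x}" for x
  define F where "F p = c' (f (SOME x. x \<in> p))" for p
  have c'_eq: "c' x = c' y" if "x \<in> S'" "y \<in> S'" "D' x y = 0" for x y
    unfolding c'_def by (rule equiv_class_eq[OF E']) (use that in \<open>simp add: zero_rel_def\<close>)
  have F: "F (c x) = c' (f x)" if x: "x \<in> S" for x
  proof -
    have "c x \<in> S // zero_rel S D" using x by (auto simp: c_def intro: quotientI)
    then have "(SOME y. y \<in> c x) \<in> c x" by (rule some_in_quotient(2)[OF E])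
    then have "(SOME y. y \<in> c x) \<in> S" "D x (SOME y. y \<in> c x) = 0" by (auto simp: c_def zero_rel_def)
    then show ?thesis unfolding F_def
      using f x pseudometric_onD(2)[OF S(1)] by (intro c'_eq) auto
  qed
  have Q: "\<exists>x\<in>S. p = c x" if "p \<in> mspace (metric_quotient S D)" for p
    using that unfolding mspace_metric_quotient[OF S(1)] c_def by (auto elim: quotientE)
  have Q': "\<exists>x\<in>S'. p = c' x" if "p \<in> mspace (metric_quotient S' D')" for p
    using that unfolding mspace_metric_quotient[OF S(2)] c'_def by (auto elim: quotientE)
  have c_in: "c' x \<in> mspace (metric_quotient S' D')" if "x \<in> S'" for x
    using that unfolding mspace_metric_quotient[OF S(2)] c'_def by (auto intro: quotientI)
  have dist: "mdist (metric_quotient S' D') (F p) (F q) = mdist (metric_quotient S D) p q"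
    if pq: "p \<in> mspace (metric_quotient S D)" "q \<in> mspace (metric_quotient S D)" for p q
  proof -
    obtain x y where x: "x \<in> S" "p = c x" and y: "y \<in> S" "q = c y" using Q[OF pq(1)] Q[OF pq(2)] by blast
    have "mdist (metric_quotient S' D') (F p) (F q) = D' (f x) (f y)"
      unfolding x(2) y(2) F[OF x(1)] F[OF y(1)] unfolding c'_def
      by (rule mdist_metric_quotient[OF S(2) f(1)[OF x(1)] f(1)[OF y(1)]])
    also have "\<dots> = D x y" by (rule f(2)[OF x(1) y(1)])
    also have "\<dots> = mdist (metric_quotient S D) p q"
      unfolding x(2) y(2) c_def by (rule mdist_metric_quotient[OF S(1) x(1) y(1), symmetric])
    finally show ?thesis .
  qed
  have into: "F p \<in> mspace (metric_quotient S' D')" if "p \<in> mspace (metric_quotient S D)" for p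
    using Q[OF that] F c_in f(1) by auto
  have inj: "inj_on F (mspace (metric_quotient S D))"
  proof (rule inj_onI)
    fix p q assume pq: "p \<in> mspace (metric_quotient S D)" "q \<in> mspace (metric_quotient S D)" "F p = F q"
    have "mdist (metric_quotient S' D') (F p) (F q) = 0" using into[OF pq(2)] unfolding pq(3) by simp
    then have "mdist (metric_quotient S D) p q = 0" unfolding dist[OF pq(1,2)] .
    then show "p = q" using pq by simp
  qed
  have surj: "q \<in> F ` mspace (metric_quotient S D)" if q: "q \<in> mspace (metric_quotient S' D')" for q
  proof -
    obtain y where y: "y \<in> S'" "q = c' y" using Q'[OF q] by blast
    obtain x where x: "x \<in> S" "D' (f x) y = 0" using onto[OF y(1)] by blast
    have "q = F (c x)" using F[OF x(1)] c'_eq[OF f(1)[OF x(1)] y(1) x(2)] y(2) by simp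
    moreover have "c x \<in> mspace (metric_quotient S D)"
      using x(1) unfolding mspace_metric_quotient[OF S(1)] c_def by (auto intro: quotientI)
    ultimately show ?thesis by blast
  qed
  show ?thesis unfolding isometric_def isometry_def bij_betw_def
    using inj into surj dist by (intro exI[of _ F]) blast
qed

text \<open>
  An isometry acts on Cauchy sequences termwise.
\<close>

lemma completion_isometric:
  assumes M: "pseudometric_on M d" "pseudometric_on M' d'"
    and h: "bij_betw h M M'" "\<And>x y. x \<in> M \<Longrightarrow> y \<in> M \<Longrightarrow> d' (h x) (h y) = d x y"
  shows "isometric (completion M d) (completion M' d')"
proof -
  have hM: "h x \<in> M'" if "x \<in> M" for x using h(1) that by (rule bij_betw_apply)
  have lim: "lim (\<lambda>n. d' ((h \<circ> s) n) ((h \<circ> t) n)) = lim (\<lambda>n. d (s n) (t n))"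
    if "s \<in> cauchy_seqs M d" "t \<in> cauchy_seqs M d" for s t
  proof -
    have "s n \<in> M" "t n \<in> M" for n using that by (auto simp: cauchy_seqs_def)
    then show ?thesis using h(2) by (simp add: o_def)
  qed
  have into: "h \<circ> s \<in> cauchy_seqs M' d'" if "s \<in> cauchy_seqs M d" for s
  proof -
    have "s n \<in> M" for n using that by (auto simp: cauchy_seqs_def)
    then show ?thesis using that h(2) hM by (auto simp: cauchy_seqs_def)
  qed
  have onto: "\<exists>s\<in>cauchy_seqs M d. lim (\<lambda>n. d' ((h \<circ> s) n) (t n)) = 0" if t: "t \<in> cauchy_seqs M' d'" for t
  proof -
    have tM: "t n \<in> M'" for n using t by (auto simp: cauchy_seqs_def)
    define s where "s = (\<lambda>n. inv_into M h (t n))"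
    have s: "h (s n) = t n" "s n \<in> M" for n
      using tM h(1) by (auto simp: s_def bij_betw_def f_inv_into_f inv_into_into)
    have "d (s m) (s n) = d' (t m) (t n)" for m n using h(2)[OF s(2) s(2), of m n] s(1) by simp
    then have "s \<in> cauchy_seqs M d" using t s(2) by (auto simp: cauchy_seqs_def)
    moreover have "d' ((h \<circ> s) n) (t n) = 0" for n using s(1) pseudometric_onD(3)[OF M(2) tM] by simp
    ultimately show ?thesis by (intro bexI[of _ s]) simp_all
  qed
  show ?thesis unfolding completion_def
    by (rule metric_quotient_isometric[OF pseudometric_on_cauchy_seqs[OF M(1)] pseudometric_on_cauchy_seqs[OF M(2)], of "\<lambda>s. h \<circ> s"])
      (use into lim onto in auto)
qed

definition cluster_map :: "('v \<Rightarrow> 'w) \<Rightarrow> ('v \<Rightarrow> 'z \<Rightarrow> 'y) \<Rightarrow> ('v \<Rightarrow> real \<Rightarrow> real) \<Rightarrow> 'v \<times> 'z \<times> real \<Rightarrow> 'w \<times> 'y \<times> real" where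
  "cluster_map \<phi> f \<rho> = (\<lambda>(v, z, u). (\<phi> v, f v z, \<rho> v u))"

text \<open>
  The gluing exchanges the two coordinates of the strip along an edge. A map of clusters therefore
  has to move the real coordinate at a vertex by the same isometry by which the neighbouring vertex
  maps reparametrize the geodesics of their common edges.
\<close>

definition cluster_morphism where
  "cluster_morphism V E Z \<gamma> V' E' Z' \<gamma>' \<phi> f \<rho> \<longleftrightarrow>
     (\<forall>v\<in>V. \<phi> v \<in> V' \<and> (\<forall>a\<in>mspace (Z v). f v a \<in> mspace (Z' (\<phi> v))) \<and>
        (\<forall>a\<in>mspace (Z v). \<forall>b\<in>mspace (Z v). mdist (Z' (\<phi> v)) (f v a) (f v b) = mdist (Z v) a b) \<and>
        (\<forall>s t :: real. \<bar>\<rho> v s - \<rho> v t\<bar> = \<bar>s - t\<bar>)) \<and>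
     (\<forall>v w. {v, w} \<in> E \<longrightarrow> {\<phi> v, \<phi> w} \<in> E' \<and>
        (\<forall>t. f v (\<gamma> v {v, w} t) = \<gamma>' (\<phi> v) {\<phi> v, \<phi> w} (\<rho> w t)))"

lemma cluster_morphism_points:
  assumes "cluster_morphism V E Z \<gamma> V' E' Z' \<gamma>' \<phi> f \<rho>" "c \<in> cluster_points V Z"
  shows "cluster_map \<phi> f \<rho> c \<in> cluster_points V' Z'"
  using assms by (auto simp: cluster_morphism_def cluster_points_def vertex_space_def cluster_map_def)

lemma cluster_morphism_gluing:
  assumes "cluster_morphism V E Z \<gamma> V' E' Z' \<gamma>' \<phi> f \<rho>" "(c, c') \<in> flip_gluing E \<gamma>"
  shows "(cluster_map \<phi> f \<rho> c, cluster_map \<phi> f \<rho> c') \<in> flip_gluing E' \<gamma>'"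
proof -
  obtain v v' t u where c: "c = (v, \<gamma> v {v, v'} t, u)" "c' = (v', \<gamma> v' {v, v'} u, t)" "{v, v'} \<in> E"
    using assms(2) by (auto simp: flip_gluing_def)
  have e: "{v', v} \<in> E" "{v', v} = {v, v'}" "{\<phi> v', \<phi> v} = {\<phi> v, \<phi> v'}" using c(3) by (auto simp: insert_commute)
  have E': "{\<phi> v, \<phi> v'} \<in> E'" "f v (\<gamma> v {v, v'} t) = \<gamma>' (\<phi> v) {\<phi> v, \<phi> v'} (\<rho> v' t)"
    "f v' (\<gamma> v' {v', v} u) = \<gamma>' (\<phi> v') {\<phi> v', \<phi> v} (\<rho> v u)"
    using assms(1) c(3) e(1) unfolding cluster_morphism_def by blast+
  have "cluster_map \<phi> f \<rho> c = (\<phi> v, \<gamma>' (\<phi> v) {\<phi> v, \<phi> v'} (\<rho> v' t), \<rho> v u)"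
    "cluster_map \<phi> f \<rho> c' = (\<phi> v', \<gamma>' (\<phi> v') {\<phi> v, \<phi> v'} (\<rho> v u), \<rho> v' t)"
    using E'(2,3) e(2,3) by (simp_all add: c cluster_map_def)
  then show ?thesis using E'(1) unfolding flip_gluing_def by blast
qed

lemma cluster_morphism_equiv:
  assumes "cluster_morphism V E Z \<gamma> V' E' Z' \<gamma>' \<phi> f \<rho>" "(c, c') \<in> cluster_equiv V E Z \<gamma>"
  shows "(cluster_map \<phi> f \<rho> c, cluster_map \<phi> f \<rho> c') \<in> cluster_equiv V' E' Z' \<gamma>'"
proof -
  have rt: "(c, c') \<in> (flip_gluing E \<gamma> \<union> (flip_gluing E \<gamma>)\<inverse>)\<^sup>*" and in_P: "c \<in> cluster_points V Z" "c' \<in> cluster_points V Z"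
    using assms(2) by (auto simp: cluster_equiv_def)
  from rt have "(cluster_map \<phi> f \<rho> c, cluster_map \<phi> f \<rho> c') \<in> (flip_gluing E' \<gamma>' \<union> (flip_gluing E' \<gamma>')\<inverse>)\<^sup>*"
  proof (induction rule: rtrancl_induct)
    case (step y z)
    have "(cluster_map \<phi> f \<rho> y, cluster_map \<phi> f \<rho> z) \<in> flip_gluing E' \<gamma>' \<union> (flip_gluing E' \<gamma>')\<inverse>"
      using step(2) cluster_morphism_gluing[OF assms(1), of y z] cluster_morphism_gluing[OF assms(1), of z y] by blast
    then show ?case using step.IH by (rule rtrancl_into_rtrancl[rotated])
  qed simp
  then show ?thesis using cluster_morphism_points[OF assms(1)] in_P by (simp add: cluster_equiv_def)
qed

lemma cluster_morphism_polygonal: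
  assumes mor: "cluster_morphism V E Z \<gamma> V' E' Z' \<gamma>' \<phi> f \<rho>"
    and F: "\<And>c. c \<in> cluster_points V Z \<Longrightarrow> F (cluster_equiv V E Z \<gamma> `` {c}) = cluster_equiv V' E' Z' \<gamma>' `` {cluster_map \<phi> f \<rho> c}"
    and "polygonal_length V E Z \<gamma> p q l"
  shows "polygonal_length V' E' Z' \<gamma>' (F p) (F q) l"
  using assms(3)
proof (induction rule: polygonal_length.induct)
  case (segment v a b)
  obtain z u where a: "a = (z, u)" by (cases a)
  obtain y s where b: "b = (y, s)" by (cases b)
  have zy: "z \<in> mspace (Z v)" "y \<in> mspace (Z v)" using segment a b by (auto simp: vertex_space_def)
  have pts: "(v, a) \<in> cluster_points V Z" "(v, b) \<in> cluster_points V Z" using segment by (auto simp: cluster_points_def)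
  have m: "\<phi> v \<in> V'" "f v z \<in> mspace (Z' (\<phi> v))" "f v y \<in> mspace (Z' (\<phi> v))"
    "mdist (Z' (\<phi> v)) (f v z) (f v y) = mdist (Z v) z y" "\<bar>\<rho> v u - \<rho> v s\<bar> = \<bar>u - s\<bar>"
    using mor segment(1) zy unfolding cluster_morphism_def by blast+
  have d: "mdist (vertex_space Z' (\<phi> v)) (f v z, \<rho> v u) (f v y, \<rho> v s) = mdist (vertex_space Z v) a b"
  proof -
    have "(\<rho> v u - \<rho> v s)\<^sup>2 = (u - s)\<^sup>2" using m(5) by (metis power2_abs)
    then show ?thesis using m(4) by (simp add: vertex_space_def a b mdist_prod_metric prod_dist_def dist_real_def)
  qed
  have "polygonal_length V' E' Z' \<gamma>' (cluster_equiv V' E' Z' \<gamma>' `` {(\<phi> v, f v z, \<rho> v u)})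
     (cluster_equiv V' E' Z' \<gamma>' `` {(\<phi> v, f v y, \<rho> v s)}) (mdist (vertex_space Z' (\<phi> v)) (f v z, \<rho> v u) (f v y, \<rho> v s))"
    using m(1-3) by (intro polygonal_length.segment) (auto simp: vertex_space_def)
  then show ?case unfolding F[OF pts(1)] F[OF pts(2)] d by (simp add: cluster_map_def a b)
next
  case (concat p q l r m)
  then show ?case by (intro polygonal_length.concat)
qed

text \<open>
  Maps that respect the vertex spaces and the gluing preserve lengths of polygonal chains and hence do
  not increase distances. With such a map in the other direction, distances are preserved.
\<close>

lemma cluster_isometric:
  assumes cd: "cluster_data V E Z \<gamma>" "cluster_data V' E' Z' \<gamma>'"
    and mor: "cluster_morphism V E Z \<gamma> V' E' Z' \<gamma>' \<phi> f \<rho>"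
    and mor': "cluster_morphism V' E' Z' \<gamma>' V E Z \<gamma> \<phi>' f' \<rho>'"
    and inv: "\<And>c. c \<in> cluster_points V Z \<Longrightarrow> cluster_map \<phi>' f' \<rho>' (cluster_map \<phi> f \<rho> c) = c"
    and inv': "\<And>c. c \<in> cluster_points V' Z' \<Longrightarrow> cluster_map \<phi> f \<rho> (cluster_map \<phi>' f' \<rho>' c) = c"
  shows "isometric (cluster V E Z \<gamma>) (cluster V' E' Z' \<gamma>')"
proof -
  note eq = equiv_cluster_equiv[of V Z E \<gamma>] and eq' = equiv_cluster_equiv[of V' Z' E' \<gamma>']
  define k where "k c = cluster_equiv V E Z \<gamma> `` {c}" for c
  define k' where "k' c = cluster_equiv V' E' Z' \<gamma>' `` {c}" for c
  define m where "m = cluster_map \<phi> f \<rho>"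
  define m' where "m' = cluster_map \<phi>' f' \<rho>'"
  define F where "F p = k' (m (SOME c. c \<in> p))" for p
  define F' where "F' p = k (m' (SOME c. c \<in> p))" for p
  have F: "F (k c) = k' (m c)" if c: "c \<in> cluster_points V Z" for c
  proof -
    have "k c \<in> cluster_points V Z // cluster_equiv V E Z \<gamma>" using c by (auto simp: k_def intro: quotientI)
    then have "(SOME y. y \<in> k c) \<in> k c" by (rule some_in_quotient(2)[OF eq])
    then have "(c, SOME y. y \<in> k c) \<in> cluster_equiv V E Z \<gamma>" by (simp add: k_def)
    then have "(m c, m (SOME y. y \<in> k c)) \<in> cluster_equiv V' E' Z' \<gamma>'"
      unfolding m_def by (rule cluster_morphism_equiv[OF mor])
    then show ?thesis unfolding F_def k'_def by (rule equiv_class_eq[OF eq', symmetric])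
  qed
  have F': "F' (k' c) = k (m' c)" if c: "c \<in> cluster_points V' Z'" for c
  proof -
    have "k' c \<in> cluster_points V' Z' // cluster_equiv V' E' Z' \<gamma>'" using c by (auto simp: k'_def intro: quotientI)
    then have "(SOME y. y \<in> k' c) \<in> k' c" by (rule some_in_quotient(2)[OF eq'])
    then have "(c, SOME y. y \<in> k' c) \<in> cluster_equiv V' E' Z' \<gamma>'" by (simp add: k'_def)
    then have "(m' c, m' (SOME y. y \<in> k' c)) \<in> cluster_equiv V E Z \<gamma>"
      unfolding m'_def by (rule cluster_morphism_equiv[OF mor'])
    then show ?thesis unfolding F'_def k_def by (rule equiv_class_eq[OF eq, symmetric])
  qed
  have pt: "\<exists>c\<in>cluster_points V Z. p = k c" if "p \<in> precluster_points V E Z \<gamma>" for p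
    using that unfolding precluster_points_def k_def by (auto elim: quotientE)
  have pt': "\<exists>c\<in>cluster_points V' Z'. p = k' c" if "p \<in> precluster_points V' E' Z' \<gamma>'" for p
    using that unfolding precluster_points_def k'_def by (auto elim: quotientE)
  have k_in: "k c \<in> precluster_points V E Z \<gamma>" if "c \<in> cluster_points V Z" for c
    using that unfolding precluster_points_def k_def by (rule quotientI)
  have k'_in: "k' c \<in> precluster_points V' E' Z' \<gamma>'" if "c \<in> cluster_points V' Z'" for c
    using that unfolding precluster_points_def k'_def by (rule quotientI)
  have mC: "m c \<in> cluster_points V' Z'" if "c \<in> cluster_points V Z" for c
    unfolding m_def by (rule cluster_morphism_points[OF mor that])
  have mC': "m' c \<in> cluster_points V Z" if "c \<in> cluster_points V' Z'" for c
    unfolding m'_def by (rule cluster_morphism_points[OF mor' that])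
  have into: "F p \<in> precluster_points V' E' Z' \<gamma>'" if p: "p \<in> precluster_points V E Z \<gamma>" for p
  proof -
    obtain c where c: "c \<in> cluster_points V Z" "p = k c" using pt[OF p] by blast
    show ?thesis unfolding c(2) F[OF c(1)] by (rule k'_in[OF mC[OF c(1)]])
  qed
  have into': "F' p \<in> precluster_points V E Z \<gamma>" if p: "p \<in> precluster_points V' E' Z' \<gamma>'" for p
  proof -
    obtain c where c: "c \<in> cluster_points V' Z'" "p = k' c" using pt'[OF p] by blast
    show ?thesis unfolding c(2) F'[OF c(1)] by (rule k_in[OF mC'[OF c(1)]])
  qed
  have F'F: "F' (F p) = p" if p: "p \<in> precluster_points V E Z \<gamma>" for p
  proof -
    obtain c where c: "c \<in> cluster_points V Z" "p = k c" using pt[OF p] by blast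
    show ?thesis unfolding c(2) F[OF c(1)] F'[OF mC[OF c(1)]] using inv[OF c(1)] by (simp add: m_def m'_def)
  qed
  have FF': "F (F' p) = p" if p: "p \<in> precluster_points V' E' Z' \<gamma>'" for p
  proof -
    obtain c where c: "c \<in> cluster_points V' Z'" "p = k' c" using pt'[OF p] by blast
    show ?thesis unfolding c(2) F'[OF c(1)] F[OF mC'[OF c(1)]] using inv'[OF c(1)] by (simp add: m_def m'_def)
  qed
  have poly: "polygonal_length V' E' Z' \<gamma>' (F p) (F q) l" if "polygonal_length V E Z \<gamma> p q l" for p q l
    by (rule cluster_morphism_polygonal[OF mor _ that]) (use F in \<open>simp add: k_def k'_def m_def\<close>)
  have poly': "polygonal_length V E Z \<gamma> (F' p) (F' q) l" if "polygonal_length V' E' Z' \<gamma>' p q l" for p q l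
    by (rule cluster_morphism_polygonal[OF mor' _ that]) (use F' in \<open>simp add: k_def k'_def m'_def\<close>)
  have dist: "precluster_dist V' E' Z' \<gamma>' (F p) (F q) = precluster_dist V E Z \<gamma> p q"
    if pq: "p \<in> precluster_points V E Z \<gamma>" "q \<in> precluster_points V E Z \<gamma>" for p q
  proof -
    have "polygonal_length V' E' Z' \<gamma>' (F p) (F q) l \<longleftrightarrow> polygonal_length V E Z \<gamma> p q l" for l
      using poly[of p q l] poly'[of "F p" "F q" l] F'F pq by auto
    then show ?thesis by (simp add: precluster_dist_def)
  qed
  have "bij_betw F (precluster_points V E Z \<gamma>) (precluster_points V' E' Z' \<gamma>')"
    by (rule bij_betw_byWitness[of _ F']) (use F'F FF' into into' in auto)
  then show ?thesis unfolding cluster_def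
    by (rule completion_isometric[OF pseudometric_on_precluster[OF cd(1)] pseudometric_on_precluster[OF cd(2)] _ dist])
qed

section \<open>Isomorphisms of marked trees\<close>

definition line_isometry :: "(real \<Rightarrow> real) \<Rightarrow> bool" where
  "line_isometry \<rho> \<longleftrightarrow> (\<forall>s t. \<bar>\<rho> s - \<rho> t\<bar> = \<bar>s - t\<bar>)"

lemma line_isometry_bij:
  assumes "line_isometry \<rho>"
  shows "bij \<rho>"
proof -
  have d: "\<bar>\<rho> s - \<rho> t\<bar> = \<bar>s - t\<bar>" for s t using assms by (simp add: line_isometry_def)
  have "(\<forall>t. \<rho> t = \<rho> 0 + t) \<or> (\<forall>t. \<rho> t = \<rho> 0 - t)"
  proof (cases "\<rho> 1 = \<rho> 0 + 1")
    case True
    have "\<rho> t = \<rho> 0 + t" for t using d[of t 0] d[of t 1] True by arith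
    then show ?thesis by blast
  next
    case False
    then have "\<rho> 1 = \<rho> 0 - 1" using d[of 1 0] by arith
    then have "\<rho> t = \<rho> 0 - t" for t using d[of t 0] d[of t 1] by arith
    then show ?thesis by blast
  qed
  then have "surj \<rho>"
  proof
    assume "\<forall>t. \<rho> t = \<rho> 0 + t"
    then have "y = \<rho> (y - \<rho> 0)" for y by (metis add.commute diff_add_cancel)
    then show "surj \<rho>" by (rule surjI[OF sym])
  next
    assume "\<forall>t. \<rho> t = \<rho> 0 - t"
    then have "y = \<rho> (\<rho> 0 - y)" for y by (metis diff_diff_eq2 add_diff_cancel_left')
    then show "surj \<rho>" by (rule surjI[OF sym])
  qed
  moreover have "inj \<rho>"
  proof (rule injI)
    fix s t assume "\<rho> s = \<rho> t"
    then show "s = t" using d[of s t] by simp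
  qed
  ultimately show ?thesis by (simp add: bij_def)
qed

lemma line_isometry_inv:
  assumes "line_isometry \<rho>"
  shows "line_isometry (inv_into UNIV \<rho>)"
proof -
  have r: "\<rho> (inv_into UNIV \<rho> s) = s" for s using line_isometry_bij[OF assms] by (simp add: bij_is_surj surj_f_inv_f)
  show ?thesis unfolding line_isometry_def
  proof (intro allI)
    fix s t
    have "\<bar>\<rho> (inv_into UNIV \<rho> s) - \<rho> (inv_into UNIV \<rho> t)\<bar> = \<bar>inv_into UNIV \<rho> s - inv_into UNIV \<rho> t\<bar>" using assms unfolding line_isometry_def by blast
    then show "\<bar>inv_into UNIV \<rho> s - inv_into UNIV \<rho> t\<bar> = \<bar>s - t\<bar>" unfolding r by simp
  qed
qed

definition marked_continuum_tree :: "'z metric \<Rightarrow> 'i set \<Rightarrow> ('i \<Rightarrow> real \<Rightarrow> 'z) \<Rightarrow> bool" where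
  "marked_continuum_tree Z I \<gamma> \<longleftrightarrow> continuum_tree Z \<and> marked_tree Z I \<gamma> \<and> (\<forall>e\<in>I. bi_infinite_geodesic Z (\<gamma> e))"

lemma marked_continuum_tree_universal:
  assumes "marked_continuum_tree Z I \<gamma>"
  shows "universal_tree (mspace Z) (mdist Z) ((\<lambda>e. range (\<gamma> e)) ` I)" "inj_on (\<lambda>e. range (\<gamma> e)) I"
  using marked_tree_universal[of Z I \<gamma>] assms unfolding marked_continuum_tree_def by blast+

lemma marked_geodesic:
  assumes "marked_continuum_tree Z I \<gamma>" "e \<in> I"
  shows "\<gamma> e t \<in> mspace Z" "mdist Z (\<gamma> e s) (\<gamma> e t) = \<bar>s - t\<bar>"
  using assms unfolding marked_continuum_tree_def bi_infinite_geodesic_def by auto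

lemma marked_edge_unique:
  assumes m: "marked_continuum_tree Z I \<gamma>" and e: "e \<in> I" "e' \<in> I"
    and p: "p \<noteq> q" "p \<in> range (\<gamma> e)" "q \<in> range (\<gamma> e)" "p \<in> range (\<gamma> e')" "q \<in> range (\<gamma> e')"
  shows "e = e'"
proof -
  interpret universal_tree "mspace Z" "mdist Z" "(\<lambda>e. range (\<gamma> e)) ` I"
    by (rule marked_continuum_tree_universal(1)[OF m])
  have "range (\<gamma> e) = range (\<gamma> e')" by (rule piece_inter[OF _ _ p(2,4,3,5,1)]) (use e in blast)+
  then show ?thesis using inj_onD[OF marked_continuum_tree_universal(2)[OF m] _ e] by blast
qed

lemma marked_nonempty:
  assumes m: "marked_continuum_tree Z I \<gamma>"
  shows "I \<noteq> {}"
proof -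
  interpret universal_tree "mspace Z" "mdist Z" "(\<lambda>e. range (\<gamma> e)) ` I"
    by (rule marked_continuum_tree_universal(1)[OF m])
  show ?thesis using nonempty piece_cover by blast
qed

definition marked_isometry :: "'z metric \<Rightarrow> 'i set \<Rightarrow> ('i \<Rightarrow> real \<Rightarrow> 'z) \<Rightarrow> 'y metric \<Rightarrow> 'j set \<Rightarrow> ('j \<Rightarrow> real \<Rightarrow> 'y)
    \<Rightarrow> ('z \<Rightarrow> 'y) \<Rightarrow> ('i \<Rightarrow> 'j) \<Rightarrow> ('i \<Rightarrow> real \<Rightarrow> real) \<Rightarrow> bool" where
  "marked_isometry Z I \<gamma> Z' I' \<gamma>' f \<psi> \<sigma> \<longleftrightarrow> isometry Z Z' f \<and> bij_betw \<psi> I I' \<and>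
     (\<forall>e\<in>I. line_isometry (\<sigma> e) \<and> (\<forall>t. f (\<gamma> e t) = \<gamma>' (\<psi> e) (\<sigma> e t)))"

text \<open>
  The isometry \<open>f\<close> from \<open>line_isometry_extends\<close> preserves collinearity. Therefore it maps each
  geodesic of the family into, and by the same argument for the inverse onto, a geodesic of the other
  family. This induces the bijection of the index sets.
\<close>

theorem marked_trees_isometric:
  assumes m: "marked_continuum_tree Z I \<gamma>" and m': "marked_continuum_tree Z' I' \<gamma>'"
    and e0: "e0 \<in> I" "e0' \<in> I'" and \<rho>: "line_isometry \<rho>"
  shows "\<exists>f \<psi> \<sigma>. marked_isometry Z I \<gamma> Z' I' \<gamma>' f \<psi> \<sigma> \<and> \<psi> e0 = e0' \<and> (\<forall>t. f (\<gamma> e0 t) = \<gamma>' e0' (\<rho> t))"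
proof -
  let ?\<P> = "(\<lambda>e. range (\<gamma> e)) ` I" and ?\<P>' = "(\<lambda>e. range (\<gamma>' e)) ` I'"
  interpret A: universal_tree "mspace Z" "mdist Z" ?\<P> by (rule marked_continuum_tree_universal(1)[OF m])
  interpret B: universal_tree "mspace Z'" "mdist Z'" ?\<P>' by (rule marked_continuum_tree_universal(1)[OF m'])
  interpret two_trees "mspace Z" "mdist Z" ?\<P> "mspace Z'" "mdist Z'" ?\<P>' by unfold_locales
  have surj_\<rho>: "range (\<lambda>t. \<gamma>' e0' (\<rho> t)) = range (\<gamma>' e0')"
    using bij_is_surj[OF line_isometry_bij[OF \<rho>]] by (metis image_image)
  have \<rho>_dist: "mdist Z' (\<gamma>' e0' (\<rho> s)) (\<gamma>' e0' (\<rho> t)) = \<bar>s - t\<bar>" for s t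
    unfolding marked_geodesic(2)[OF m' e0(2)] using \<rho> by (simp add: line_isometry_def)
  have "\<exists>f. bij_betw f (mspace Z) (mspace Z') \<and> (\<forall>a\<in>mspace Z. \<forall>b\<in>mspace Z. mdist Z' (f a) (f b) = mdist Z a b) \<and>
     (\<forall>a\<in>mspace Z. \<forall>b\<in>mspace Z. B.col (f a) (f b) \<longleftrightarrow> A.col a b) \<and> (\<forall>t. f (\<gamma> e0 t) = \<gamma>' e0' (\<rho> t))"
    by (rule line_isometry_extends[OF imageI[OF e0(1)] imageI[OF e0(2)] refl marked_geodesic(2)[OF m e0(1)] surj_\<rho> \<rho>_dist])
  then obtain f where f: "bij_betw f (mspace Z) (mspace Z')"
    and iso: "\<And>a b. a \<in> mspace Z \<Longrightarrow> b \<in> mspace Z \<Longrightarrow> mdist Z' (f a) (f b) = mdist Z a b"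
    and col: "\<And>a b. a \<in> mspace Z \<Longrightarrow> b \<in> mspace Z \<Longrightarrow> B.col (f a) (f b) \<longleftrightarrow> A.col a b"
    and f0: "\<And>t. f (\<gamma> e0 t) = \<gamma>' e0' (\<rho> t)" by blast
  have fM: "f a \<in> mspace Z'" if "a \<in> mspace Z" for a using f that by (rule bij_betw_apply)
  have "\<exists>e'\<in>I'. \<exists>\<sigma>. line_isometry \<sigma> \<and> (\<forall>t. f (\<gamma> e t) = \<gamma>' e' (\<sigma> t))" if e: "e \<in> I" for e
  proof -
    define l where "l t = f (\<gamma> e t)" for t
    have lM: "l t \<in> mspace Z'" for t unfolding l_def by (rule fM[OF marked_geodesic(1)[OF m e]])
    have ld: "mdist Z' (l s) (l t) = \<bar>s - t\<bar>" for s t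
      unfolding l_def iso[OF marked_geodesic(1)[OF m e] marked_geodesic(1)[OF m e]] by (rule marked_geodesic(2)[OF m e])
    have lc: "B.col (l s) (l t)" for s t
      unfolding l_def col[OF marked_geodesic(1)[OF m e] marked_geodesic(1)[OF m e]] A.col_def using e by blast
    obtain Q where Q: "Q \<in> ?\<P>'" "l 0 \<in> Q" "l 1 \<in> Q" using lc[of 0 1] unfolding B.col_def by blast
    obtain e' where e': "e' \<in> I'" "Q = range (\<gamma>' e')" using Q(1) by blast
    have "l t \<in> Q" for t
    proof -
      define a b where "a = min 0 t" and "b = max 1 t"
      have ab: "a \<le> 0" "a \<le> t" "1 \<le> b" "t \<le> b" by (auto simp: a_def b_def)
      obtain S where S: "S \<in> ?\<P>'" "l a \<in> S" "l b \<in> S" using lc[of a b] unfolding B.col_def by blast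
      have "l x \<in> S" if "a \<le> x" "x \<le> b" for x
        by (rule B.piece_convex[OF S lM]) (use that in \<open>simp add: ld\<close>)
      then have "l 0 \<in> S" "l 1 \<in> S" "l t \<in> S" using ab by auto
      moreover have "l 0 \<noteq> l 1" using ld[of 0 1] lM[of 0] by auto
      ultimately show ?thesis using B.piece_inter[OF S(1) Q(1) _ Q(2) _ Q(3)] by blast
    qed
    then have "\<forall>t. \<exists>s. l t = \<gamma>' e' s" using e'(2) by blast
    then obtain \<sigma> where \<sigma>: "\<And>t. l t = \<gamma>' e' (\<sigma> t)" by metis
    have "line_isometry \<sigma>" unfolding line_isometry_def
    proof (intro allI)
      fix s t show "\<bar>\<sigma> s - \<sigma> t\<bar> = \<bar>s - t\<bar>"
        using ld[of s t] unfolding \<sigma> marked_geodesic(2)[OF m' e'(1)] .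
    qed
    then show ?thesis using e'(1) \<sigma> unfolding l_def by blast
  qed
  then have "\<exists>\<psi> \<sigma>. \<forall>e\<in>I. \<psi> e \<in> I' \<and> line_isometry (\<sigma> e) \<and> (\<forall>t. f (\<gamma> e t) = \<gamma>' (\<psi> e) (\<sigma> e t))" by metis
  then obtain \<psi> \<sigma> where \<psi>: "\<And>e. e \<in> I \<Longrightarrow> \<psi> e \<in> I'" and \<sigma>: "\<And>e. e \<in> I \<Longrightarrow> line_isometry (\<sigma> e)"
    and eq: "\<And>e t. e \<in> I \<Longrightarrow> f (\<gamma> e t) = \<gamma>' (\<psi> e) (\<sigma> e t)" by blast
  have inj_f: "a = b" if "f a = f b" "a \<in> mspace Z" "b \<in> mspace Z" for a b
    using inj_onD[OF bij_betw_imp_inj_on[OF f] that] .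
  have unique: "\<psi> e = e'" if e: "e \<in> I" "e' \<in> I'" and p: "p \<noteq> q" "p \<in> range (\<gamma> e)" "q \<in> range (\<gamma> e)"
    "f p \<in> range (\<gamma>' e')" "f q \<in> range (\<gamma>' e')" for e e' p q
  proof (rule marked_edge_unique[OF m' \<psi>[OF e(1)] e(2) _ _ _ p(4,5)])
    have "p \<in> mspace Z" "q \<in> mspace Z" using p(2,3) marked_geodesic(1)[OF m e(1)] by auto
    then show "f p \<noteq> f q" using inj_f p(1) by blast
    show "f p \<in> range (\<gamma>' (\<psi> e))" "f q \<in> range (\<gamma>' (\<psi> e))" using p(2,3) eq[OF e(1)] by auto
  qed
  have \<gamma>_ne: "\<gamma> e 0 \<noteq> \<gamma> e 1" if "e \<in> I" for e
    using marked_geodesic(2)[OF m that, of 0 1] marked_geodesic(1)[OF m that, of 0] by auto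
  have "\<psi> e0 = e0'"
    by (rule unique[OF e0 \<gamma>_ne[OF e0(1)]]) (use f0 in auto)
  moreover have "bij_betw \<psi> I I'"
  proof (rule bij_betw_imageI)
    show "inj_on \<psi> I"
    proof (rule inj_onI)
      fix e e' assume e: "e \<in> I" "e' \<in> I" "\<psi> e = \<psi> e'"
      have surj: "\<exists>s. \<gamma>' (\<psi> e) t = \<gamma>' (\<psi> e') (\<sigma> e' s)" for t
        using bij_is_surj[OF line_isometry_bij[OF \<sigma>[OF e(2)]]] e(3) by (metis surjD)
      have "\<gamma> e t \<in> range (\<gamma> e')" for t
      proof -
        obtain s where "\<gamma>' (\<psi> e) (\<sigma> e t) = \<gamma>' (\<psi> e') (\<sigma> e' s)" using surj by blast
        then have "f (\<gamma> e t) = f (\<gamma> e' s)" using eq[OF e(1)] eq[OF e(2)] by simp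
        then have "\<gamma> e t = \<gamma> e' s" by (rule inj_f) (intro marked_geodesic(1)[OF m] e)+
        then show ?thesis by blast
      qed
      then show "e = e'" using marked_edge_unique[OF m e(1,2) \<gamma>_ne[OF e(1)]] by blast
    qed
    show "\<psi> ` I = I'"
    proof
      show "\<psi> ` I \<subseteq> I'" using \<psi> by blast
      show "I' \<subseteq> \<psi> ` I"
      proof
        fix e' assume e': "e' \<in> I'"
        note M' = marked_geodesic(1)[OF m' e']
        obtain a where a: "a \<in> mspace Z" "f a = \<gamma>' e' 0" using f M'[of 0] unfolding bij_betw_def by (metis imageE)
        obtain b where b: "b \<in> mspace Z" "f b = \<gamma>' e' 1" using f M'[of 1] unfolding bij_betw_def by (metis imageE)
        have "B.col (f a) (f b)" unfolding a(2) b(2) B.col_def using e' by blast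
        then have "A.col a b" using col[OF a(1) b(1)] by blast
        then obtain e where e: "e \<in> I" "a \<in> range (\<gamma> e)" "b \<in> range (\<gamma> e)" unfolding A.col_def by blast
        have "\<gamma>' e' 0 \<noteq> \<gamma>' e' 1" using marked_geodesic(2)[OF m' e', of 0 1] M'[of 0] by auto
        then have "a \<noteq> b" using a(2) b(2) by metis
        then have "\<psi> e = e'" by (rule unique[OF e(1) e' _ e(2,3)]) (simp_all add: a(2) b(2))
        then show "e' \<in> \<psi> ` I" using e(1) by blast
      qed
    qed
  qed
  moreover have "isometry Z Z' f" unfolding isometry_def using f iso by blast
  ultimately show ?thesis unfolding marked_isometry_def using \<sigma> eq f0 by blast
qed

section \<open>Extension along a simplicial tree\<close>

definition graph_connected :: "'v set set \<Rightarrow> 'v set \<Rightarrow> bool" where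
  "graph_connected E A \<longleftrightarrow> (\<forall>u\<in>A. \<forall>v\<in>A. (u, v) \<in> {(a, b). {a, b} \<in> E \<and> a \<in> A \<and> b \<in> A}\<^sup>*)"

lemma graph_connected_insert:
  assumes A: "graph_connected E A" and v: "v \<in> A" "{v, w} \<in> E"
  shows "graph_connected E (insert w A)"
proof -
  let ?r = "{(a, b). {a, b} \<in> E \<and> a \<in> insert w A \<and> b \<in> insert w A}"
  have sub: "{(a, b). {a, b} \<in> E \<and> a \<in> A \<and> b \<in> A} \<subseteq> ?r" by blast
  have old: "(a, b) \<in> ?r\<^sup>*" if "a \<in> A" "b \<in> A" for a b
    using A that rtrancl_mono[OF sub] unfolding graph_connected_def by blast
  have "(v, w) \<in> ?r" "(w, v) \<in> ?r" using v by (auto simp: insert_commute)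
  then have "(a, v) \<in> ?r\<^sup>*" "(v, a) \<in> ?r\<^sup>*" if "a \<in> insert w A" for a
    using that old[OF _ v(1)] old[OF v(1)] by blast+
  then show ?thesis unfolding graph_connected_def using rtrancl_trans by meson
qed

lemma rtrancl_distinct_path:
  assumes "(u, v) \<in> r\<^sup>*"
  shows "\<exists>c. c \<noteq> [] \<and> hd c = u \<and> last c = v \<and> distinct c \<and> (\<forall>i. Suc i < length c \<longrightarrow> (c ! i, c ! Suc i) \<in> r)"
  using assms
proof (induction rule: rtrancl_induct)
  case base
  show ?case by (intro exI[of _ "[u]"]) simp
next
  case (step y z)
  then obtain c where c: "c \<noteq> []" "hd c = u" "last c = y" "distinct c" "\<forall>i. Suc i < length c \<longrightarrow> (c ! i, c ! Suc i) \<in> r" by blast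
  show ?case
  proof (cases "z \<in> set c")
    case True
    then obtain k where k: "k < length c" "c ! k = z" by (auto simp: in_set_conv_nth)
    then have l: "length (take (Suc k) c) = Suc k" by simp
    show ?thesis
    proof (intro exI[of _ "take (Suc k) c"] conjI)
      show "take (Suc k) c \<noteq> []" "hd (take (Suc k) c) = u" using c by simp_all
      show "last (take (Suc k) c) = z" using c(1) k l by (simp add: last_conv_nth del: length_take)
      show "distinct (take (Suc k) c)" using c(4) by simp
      show "\<forall>i. Suc i < length (take (Suc k) c) \<longrightarrow> (take (Suc k) c ! i, take (Suc k) c ! Suc i) \<in> r"
        unfolding l using c(5) k(1) by simp
    qed
  next
    case False
    have last: "c ! i = y" if "Suc i = length c" for i
    proof -
      have "length c - 1 = i" using that by simp
      then show ?thesis using c(1,3) by (simp add: last_conv_nth)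
    qed
    have "((c @ [z]) ! i, (c @ [z]) ! Suc i) \<in> r" if "i < length c" for i
    proof (cases "Suc i = length c")
      case True
      then show ?thesis using last[OF True] step(2) that by (simp add: nth_append)
    next
      case False
      then show ?thesis using c(5) that by (simp add: nth_append)
    qed
    then show ?thesis
      using c(1,2,4) False by (intro exI[of _ "c @ [z]"]) simp
  qed
qed

text \<open>
  Two different neighbours of \<open>w\<close> in \<open>A\<close> would be joined by a path inside \<open>A\<close>, which together with
  \<open>w\<close> is a cycle.
\<close>

lemma simplicial_tree_unique_neighbour:
  assumes T: "simplicial_tree V E" and A: "graph_connected E A" and w: "w \<notin> A"
    and uv: "u \<in> A" "v \<in> A" "{u, w} \<in> E" "{v, w} \<in> E"
  shows "u = v"
proof (rule ccontr)
  assume ne: "u \<noteq> v"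
  have "(u, v) \<in> {(a, b). {a, b} \<in> E \<and> a \<in> A \<and> b \<in> A}\<^sup>*" using A uv unfolding graph_connected_def by blast
  from rtrancl_distinct_path[OF this] obtain c where c: "c \<noteq> []" "hd c = u" "last c = v" "distinct c"
    "\<forall>i. Suc i < length c \<longrightarrow> (c ! i, c ! Suc i) \<in> {(a, b). {a, b} \<in> E \<and> a \<in> A \<and> b \<in> A}" by (elim exE conjE)
  have inA: "c ! i \<in> A" if "i < length c" for i
  proof (cases i)
    case 0
    then show ?thesis using c(1,2) uv(1) by (simp add: hd_conv_nth)
  next
    case (Suc j)
    then show ?thesis using c(5) that by auto
  qed
  then have "w \<notin> set c" using w by (auto simp: in_set_conv_nth)
  have "2 \<le> length c" using ne c(1-3) by (cases c; cases "tl c") auto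
  have "3 \<le> length (w # c) \<and> distinct (w # c) \<and> (\<forall>i. Suc i < length (w # c) \<longrightarrow> {(w # c) ! i, (w # c) ! Suc i} \<in> E) \<and> {last (w # c), hd (w # c)} \<in> E"
  proof (intro conjI allI impI)
    show "3 \<le> length (w # c)" using \<open>2 \<le> length c\<close> by simp
    show "distinct (w # c)" using c(4) \<open>w \<notin> set c\<close> by simp
    show "{last (w # c), hd (w # c)} \<in> E" using c(1,3) uv(4) by simp
    fix i assume i: "Suc i < length (w # c)"
    show "{(w # c) ! i, (w # c) ! Suc i} \<in> E"
    proof (cases i)
      case 0
      then show ?thesis using c(1,2) uv(3) by (simp add: hd_conv_nth insert_commute)
    next
      case (Suc j)
      then show ?thesis using c(5) i by auto
    qed
  qed
  then show False using T unfolding simplicial_tree_def by blast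
qed

lemma rtrancl_crossing:
  assumes "(u, v) \<in> r\<^sup>*" "u \<in> A" "v \<notin> A"
  shows "\<exists>a b. (a, b) \<in> r \<and> a \<in> A \<and> b \<notin> A"
  using assms by (induction rule: rtrancl_induct) blast+

lemma simplicial_tree_crossing:
  assumes T: "simplicial_tree V E" and A: "A \<subseteq> V" "A \<noteq> {}" "A \<noteq> V"
  shows "\<exists>v w. v \<in> A \<and> w \<in> V - A \<and> {v, w} \<in> E"
proof -
  obtain u v where uv: "u \<in> A" "v \<in> V" "v \<notin> A" using A by blast
  have "(u, v) \<in> {(a, b). {a, b} \<in> E}\<^sup>*" using T uv A(1) unfolding simplicial_tree_def by blast
  from rtrancl_crossing[OF this uv(1,3)] obtain a b where ab: "{a, b} \<in> E" "a \<in> A" "b \<notin> A" by blast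
  have "b \<in> V" using T ab(1) unfolding simplicial_tree_def by blast
  then show ?thesis using ab by blast
qed

lemma simplicial_tree_edge:
  assumes "simplicial_tree V E" "e \<in> E" "v \<in> e"
  shows "\<exists>w. e = {v, w} \<and> w \<noteq> v \<and> v \<in> V \<and> w \<in> V"
proof -
  have e: "e \<subseteq> V" "card e = 2" using assms unfolding simplicial_tree_def by blast+
  then obtain a b where "e = {a, b}" "a \<noteq> b" by (auto simp: card_2_iff)
  then show ?thesis using e(1) assms(3) by (cases "v = a") (auto simp: insert_commute)
qed

locale marked_clusters =
  fixes V :: "'v set" and E :: "'v set set" and Z :: "'v \<Rightarrow> 'z metric"
    and \<gamma> :: "'v \<Rightarrow> 'v set \<Rightarrow> real \<Rightarrow> 'z"
    and V' :: "'w set" and E' :: "'w set set" and Z' :: "'w \<Rightarrow> 'y metric"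
    and \<gamma>' :: "'w \<Rightarrow> 'w set \<Rightarrow> real \<Rightarrow> 'y"
  assumes cluster: "cluster_data V E Z \<gamma>" and cluster': "cluster_data V' E' Z' \<gamma>'"
    and marked: "v \<in> V \<Longrightarrow> marked_tree (Z v) {e \<in> E. v \<in> e} (\<gamma> v)"
    and marked': "v' \<in> V' \<Longrightarrow> marked_tree (Z' v') {e \<in> E'. v' \<in> e} (\<gamma>' v')"
begin

abbreviation "star v \<equiv> {e \<in> E. v \<in> e}"
abbreviation "star' v \<equiv> {e \<in> E'. v \<in> e}"

lemma tree: "simplicial_tree V E" "simplicial_tree V' E'"
  using cluster cluster' by (simp_all add: cluster_data_def)

lemma vertex_marked: "v \<in> V \<Longrightarrow> marked_continuum_tree (Z v) (star v) (\<gamma> v)"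
  using cluster marked unfolding cluster_data_def marked_continuum_tree_def by blast

lemma vertex_marked': "v \<in> V' \<Longrightarrow> marked_continuum_tree (Z' v) (star' v) (\<gamma>' v)"
  using cluster' marked' unfolding cluster_data_def marked_continuum_tree_def by blast

lemma no_loop: "{v, v} \<notin> E" "{v', v'} \<notin> E'"
  using tree unfolding simplicial_tree_def by fastforce+

text \<open>
  The entries \<open>(v, v', f, \<rho>)\<close> of a partial isomorphism map the factors of \<open>Q\<^sub>v\<close> to those of
  \<open>Q\<^sub>v\<^sub>'\<close> by \<open>f\<close> and \<open>\<rho>\<close>.
\<close>

definition entry :: "'v \<Rightarrow> 'w \<Rightarrow> ('z \<Rightarrow> 'y) \<Rightarrow> (real \<Rightarrow> real) \<Rightarrow> bool" where
  "entry v v' f \<rho> \<longleftrightarrow> v \<in> V \<and> v' \<in> V' \<and> line_isometry \<rho> \<and>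
     (\<exists>\<psi> \<sigma>. marked_isometry (Z v) (star v) (\<gamma> v) (Z' v') (star' v') (\<gamma>' v') f \<psi> \<sigma>)"

text \<open>
  The last condition is the compatibility with the gluing. In it, the map of the tree at one end of an
  edge is tied to the map of the line at the other end.
\<close>

definition fits :: "'v \<times> 'w \<times> ('z \<Rightarrow> 'y) \<times> (real \<Rightarrow> real) \<Rightarrow> 'v \<times> 'w \<times> ('z \<Rightarrow> 'y) \<times> (real \<Rightarrow> real) \<Rightarrow> bool" where
  "fits = (\<lambda>(v, v', f, \<rho>) (w, w', h, \<sigma>). (v = w \<longleftrightarrow> v' = w') \<and> (v = w \<longrightarrow> f = h \<and> \<rho> = \<sigma>) \<and>
     ({v, w} \<in> E \<longleftrightarrow> {v', w'} \<in> E') \<and> ({v, w} \<in> E \<longrightarrow> (\<forall>t. f (\<gamma> v {v, w} t) = \<gamma>' v' {v', w'} (\<sigma> t))))"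

definition dom :: "('v \<times> 'w \<times> ('z \<Rightarrow> 'y) \<times> (real \<Rightarrow> real)) set \<Rightarrow> 'v set" where
  "dom K = fst ` K"

definition ran :: "('v \<times> 'w \<times> ('z \<Rightarrow> 'y) \<times> (real \<Rightarrow> real)) set \<Rightarrow> 'w set" where
  "ran K = (\<lambda>x. fst (snd x)) ` K"

text \<open>
  Connectedness ensures that a new vertex has only one neighbour in the domain, and its image only one
  in the range, so that no more than one compatibility has to be met.
\<close>

definition system :: "('v \<times> 'w \<times> ('z \<Rightarrow> 'y) \<times> (real \<Rightarrow> real)) set \<Rightarrow> bool" where
  "system K \<longleftrightarrow> (\<forall>v v' f \<rho>. (v, v', f, \<rho>) \<in> K \<longrightarrow> entry v v' f \<rho>) \<and> (\<forall>x\<in>K. \<forall>y\<in>K. fits x y) \<and>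
     graph_connected E (dom K) \<and> graph_connected E' (ran K)"

text \<open>
  The geodesics of \<open>\<psi> e\<close> and \<open>e'\<close> share two points, which determine the piece.
\<close>

lemma edge_image:
  assumes v: "v \<in> V'" and iso: "marked_isometry (Z u) (star u) (\<gamma> u) (Z' v) (star' v) (\<gamma>' v) f \<psi> \<sigma>"
    and e: "e \<in> star u" "e' \<in> star' v" and eq: "\<And>t. f (\<gamma> u e t) = \<gamma>' v e' (\<tau> t)"
  shows "\<psi> e = e'"
proof -
  have \<psi>: "\<psi> e \<in> star' v" using iso e(1) unfolding marked_isometry_def by (blast dest: bij_betw_apply)
  have \<sigma>: "line_isometry (\<sigma> e)" "\<And>t. f (\<gamma> u e t) = \<gamma>' v (\<psi> e) (\<sigma> e t)" using iso e(1) unfolding marked_isometry_def by blast+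
  note m = vertex_marked'[OF v]
  have "mdist (Z' v) (f (\<gamma> u e 0)) (f (\<gamma> u e 1)) = 1"
    unfolding \<sigma>(2) marked_geodesic(2)[OF m \<psi>] using \<sigma>(1) unfolding line_isometry_def by simp
  moreover have "f (\<gamma> u e 0) \<in> mspace (Z' v)" unfolding \<sigma>(2) by (rule marked_geodesic(1)[OF m \<psi>])
  ultimately have "f (\<gamma> u e 0) \<noteq> f (\<gamma> u e 1)" using mdist_zero[of "f (\<gamma> u e 0)" "Z' v" "f (\<gamma> u e 0)"] by force
  then show ?thesis
  proof (rule marked_edge_unique[OF m \<psi> e(2)])
    show "f (\<gamma> u e 0) \<in> range (\<gamma>' v (\<psi> e))" "f (\<gamma> u e 1) \<in> range (\<gamma>' v (\<psi> e))" unfolding \<sigma>(2) by blast+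
    show "f (\<gamma> u e 0) \<in> range (\<gamma>' v e')" "f (\<gamma> u e 1) \<in> range (\<gamma>' v e')" unfolding eq by blast+
  qed
qed

text \<open>
  The new line coordinate \<open>\<tau>\<close> is read off from the way \<open>f\<close> parametrizes the image of the common edge.
  The new tree isometry \<open>h\<close> is obtained by extending the isometry that \<open>\<rho>\<close> prescribes between the
  geodesics of this edge.
\<close>

lemma system_extend:
  assumes K: "system K" and v: "(v, v', f, \<rho>) \<in> K" and w: "{v, w} \<in> E" "w \<notin> dom K"
  shows "\<exists>K'. system K' \<and> K \<subseteq> K' \<and> K' \<noteq> K"
proof -
  have ent: "\<And>v v' f \<rho>. (v, v', f, \<rho>) \<in> K \<Longrightarrow> entry v v' f \<rho>" and fit: "\<And>x y. x \<in> K \<Longrightarrow> y \<in> K \<Longrightarrow> fits x y"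
    and con: "graph_connected E (dom K)" "graph_connected E' (ran K)" using K unfolding system_def by blast+
  obtain \<psi> \<sigma> where e: "v \<in> V" "v' \<in> V'" "line_isometry \<rho>"
    "marked_isometry (Z v) (star v) (\<gamma> v) (Z' v') (star' v') (\<gamma>' v') f \<psi> \<sigma>" using ent[OF v] unfolding entry_def by blast
  have vw: "{v, w} \<in> star v" "{v, w} \<in> star w" using w(1) by auto
  have wV: "w \<in> V" using tree(1) w(1) unfolding simplicial_tree_def by blast
  have \<psi>: "\<psi> {v, w} \<in> star' v'" using e(4) vw(1) unfolding marked_isometry_def by (blast dest: bij_betw_apply)
  then obtain w' where w': "\<psi> {v, w} = {v', w'}" "w' \<noteq> v'" "w' \<in> V'" "{v', w'} \<in> E'"
    using simplicial_tree_edge[OF tree(2), of "\<psi> {v, w}" v'] by auto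
  have vw': "{v', w'} \<in> star' w'" using w'(4) by auto
  define \<tau> where "\<tau> = \<sigma> {v, w}"
  have \<tau>: "line_isometry \<tau>" "\<And>t. f (\<gamma> v {v, w} t) = \<gamma>' v' {v', w'} (\<tau> t)"
    using e(4) vw(1) w'(1) unfolding marked_isometry_def \<tau>_def by metis+
  from marked_trees_isometric[OF vertex_marked[OF wV] vertex_marked'[OF w'(3)] vw(2) vw' e(3)]
  obtain h \<psi>' \<sigma>' where h: "marked_isometry (Z w) (star w) (\<gamma> w) (Z' w') (star' w') (\<gamma>' w') h \<psi>' \<sigma>'"
    "\<forall>t. h (\<gamma> w {v, w} t) = \<gamma>' w' {v', w'} (\<rho> t)" by (elim exE conjE)
  have w'_new: "w' \<notin> ran K"
  proof
    assume "w' \<in> ran K"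
    then obtain x k \<kappa> where x: "(x, w', k, \<kappa>) \<in> K" unfolding ran_def by auto
    have ft: "fits (v, v', f, \<rho>) (x, w', k, \<kappa>)" by (rule fit[OF v x])
    then have vx: "{v, x} \<in> E" using w'(4) unfolding fits_def by simp
    have eq: "f (\<gamma> v {v, x} t) = \<gamma>' v' {v', w'} (\<kappa> t)" for t using ft vx unfolding fits_def by simp
    have "\<psi> {v, x} = {v', w'}" by (rule edge_image[OF e(2,4) _ _ eq]) (use vx w'(4) in auto)
    then have "{v, x} = {v, w}" using e(4) vx vw(1) w'(1) unfolding marked_isometry_def bij_betw_def inj_on_def by auto
    then have "x = w" by (auto simp: doubleton_eq_iff)
    then show False using w(2) x unfolding dom_def by force
  qed
  define n where "n = (w, w', h, \<tau>)"
  have en: "entry w w' h \<tau>" unfolding entry_def using wV w'(3) \<tau>(1) h(1) by blast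
  have other: "fits n y \<and> fits y n" if y: "y \<in> K" for y
  proof -
    obtain x x' k \<kappa> where yx: "y = (x, x', k, \<kappa>)" by (cases y) auto
    have x: "(x, x', k, \<kappa>) \<in> K" using y yx by simp
    have xd: "x \<in> dom K" "x' \<in> ran K" using x unfolding dom_def ran_def by force+
    have vd: "v \<in> dom K" "v' \<in> ran K" using v unfolding dom_def ran_def by force+
    have ft: "fits (v, v', f, \<rho>) (x, x', k, \<kappa>)" by (rule fit[OF v x])
    have ne: "x \<noteq> w" "x' \<noteq> w'" using xd w(2) w'_new by blast+
    have iff: "{x, w} \<in> E \<longleftrightarrow> x = v" "{x', w'} \<in> E' \<longleftrightarrow> x' = v'"
      using simplicial_tree_unique_neighbour[OF tree(1) con(1) w(2) xd(1) vd(1) _ w(1)] w(1)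
        simplicial_tree_unique_neighbour[OF tree(2) con(2) w'_new xd(2) vd(2) _ w'(4)] w'(4) by blast+
    have vv: "x = v \<longleftrightarrow> x' = v'" "x = v \<Longrightarrow> k = f \<and> \<kappa> = \<rho>" using ft unfolding fits_def by auto
    have 1: "k (\<gamma> x {x, w} t) = \<gamma>' x' {x', w'} (\<tau> t)" if "x = v" for t using \<tau>(2) vv that by simp
    have 2: "h (\<gamma> w {w, x} t) = \<gamma>' w' {w', x'} (\<kappa> t)" if "x = v" for t using h(2) vv that by (simp add: insert_commute)
    show ?thesis unfolding yx n_def fits_def using ne iff vv(1) 1 2 by (auto simp: insert_commute)
  qed
  have self: "fits n n" unfolding n_def fits_def using no_loop by simp
  have dr: "dom (insert n K) = insert w (dom K)" "ran (insert n K) = insert w' (ran K)" by (simp_all add: dom_def ran_def n_def)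
  have "v \<in> dom K" "v' \<in> ran K" using v unfolding dom_def ran_def by force+
  then have "system (insert n K)"
    unfolding system_def dr
    using graph_connected_insert[OF con(1) _ w(1)] graph_connected_insert[OF con(2) _ w'(4)] other self fit ent en
    by (auto simp: n_def)
  moreover have "n \<notin> K" using w(2) unfolding n_def dom_def by force
  ultimately show ?thesis by blast
qed

text \<open>
  A maximal system is defined at all vertices of \<open>T\<close> by \<open>system_extend\<close>. If its range were not all
  of \<open>T'\<close>, an edge would lead out of the range. This edge is the image of an edge of \<open>T\<close>, since the
  isometry of the vertex trees is bijective on edges, and then its end is the image of a vertex.
\<close>

lemma system_exists: "\<exists>K. system K \<and> dom K = V \<and> ran K = V'"
proof -
  obtain v0 where v0: "v0 \<in> V" using tree(1) unfolding simplicial_tree_def by blast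
  obtain v0' where v0': "v0' \<in> V'" using tree(2) unfolding simplicial_tree_def by blast
  obtain e0 where e0: "e0 \<in> star v0" using marked_nonempty[OF vertex_marked[OF v0]] by blast
  obtain e0' where e0': "e0' \<in> star' v0'" using marked_nonempty[OF vertex_marked'[OF v0']] by blast
  have id: "line_isometry (\<lambda>t. t)" by (simp add: line_isometry_def)
  from marked_trees_isometric[OF vertex_marked[OF v0] vertex_marked'[OF v0'] e0 e0' id]
  obtain f0 \<psi>0 \<sigma>0 where f0: "marked_isometry (Z v0) (star v0) (\<gamma> v0) (Z' v0') (star' v0') (\<gamma>' v0') f0 \<psi>0 \<sigma>0" by (elim exE conjE)
  define K0 where "K0 = {(v0, v0', f0, \<lambda>t :: real. t)}"
  have K0: "system K0" "K0 \<noteq> {}"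
    unfolding system_def K0_def dom_def ran_def graph_connected_def fits_def entry_def
    using v0 v0' f0 id no_loop by auto
  define \<A> where "\<A> = {K. system K \<and> K \<noteq> {}}"
  have "\<exists>K\<in>\<A>. \<forall>X\<in>\<A>. K \<subseteq> X \<longrightarrow> X = K"
  proof (rule subset_Zorn_nonempty)
    show "\<A> \<noteq> {}" using K0 by (auto simp: \<A>_def)
    fix \<C> assume C: "\<C> \<noteq> {}" "subset.chain \<A> \<C>"
    have s: "system K" if "K \<in> \<C>" for K using C that by (auto simp: subset.chain_def \<A>_def)
    have two: "\<exists>K\<in>\<C>. x \<in> K \<and> y \<in> K" if xy: "x \<in> \<Union>\<C>" "y \<in> \<Union>\<C>" for x y
    proof -
      obtain K L where KL: "K \<in> \<C>" "x \<in> K" "L \<in> \<C>" "y \<in> L" using xy by blast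
      then have "K \<subseteq> L \<or> L \<subseteq> K" using C(2) unfolding subset.chain_def by blast
      then show ?thesis using KL by blast
    qed
    have "system (\<Union>\<C>)" unfolding system_def
    proof (intro conjI allI impI ballI)
      show "entry v v' f \<rho>" if "(v, v', f, \<rho>) \<in> \<Union>\<C>" for v v' f \<rho> using s that unfolding system_def by blast
      show "fits x y" if "x \<in> \<Union>\<C>" "y \<in> \<Union>\<C>" for x y using two[OF that] s unfolding system_def by blast
      show "graph_connected E (dom (\<Union>\<C>))" unfolding graph_connected_def
      proof (intro ballI)
        fix a b assume "a \<in> dom (\<Union>\<C>)" "b \<in> dom (\<Union>\<C>)"
        then obtain x y where "x \<in> \<Union>\<C>" "y \<in> \<Union>\<C>" "a = fst x" "b = fst y" unfolding dom_def by blast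
        then obtain K where K: "K \<in> \<C>" "a \<in> dom K" "b \<in> dom K" using two unfolding dom_def by blast
        have "(a, b) \<in> {(a, b). {a, b} \<in> E \<and> a \<in> dom K \<and> b \<in> dom K}\<^sup>*"
          using s[OF K(1)] K(2,3) unfolding system_def graph_connected_def by blast
        moreover have "dom K \<subseteq> dom (\<Union>\<C>)" using K(1) unfolding dom_def by blast
        then have "{(a, b). {a, b} \<in> E \<and> a \<in> dom K \<and> b \<in> dom K} \<subseteq> {(a, b). {a, b} \<in> E \<and> a \<in> dom (\<Union>\<C>) \<and> b \<in> dom (\<Union>\<C>)}" by blast
        ultimately show "(a, b) \<in> {(a, b). {a, b} \<in> E \<and> a \<in> dom (\<Union>\<C>) \<and> b \<in> dom (\<Union>\<C>)}\<^sup>*" using rtrancl_mono by blast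
      qed
      show "graph_connected E' (ran (\<Union>\<C>))" unfolding graph_connected_def
      proof (intro ballI)
        fix a b assume "a \<in> ran (\<Union>\<C>)" "b \<in> ran (\<Union>\<C>)"
        then obtain x y where "x \<in> \<Union>\<C>" "y \<in> \<Union>\<C>" "a = fst (snd x)" "b = fst (snd y)" unfolding ran_def by blast
        then obtain K where K: "K \<in> \<C>" "a \<in> ran K" "b \<in> ran K" using two unfolding ran_def by blast
        have "(a, b) \<in> {(a, b). {a, b} \<in> E' \<and> a \<in> ran K \<and> b \<in> ran K}\<^sup>*"
          using s[OF K(1)] K(2,3) unfolding system_def graph_connected_def by blast
        moreover have "ran K \<subseteq> ran (\<Union>\<C>)" using K(1) unfolding ran_def by blast
        then have "{(a, b). {a, b} \<in> E' \<and> a \<in> ran K \<and> b \<in> ran K} \<subseteq> {(a, b). {a, b} \<in> E' \<and> a \<in> ran (\<Union>\<C>) \<and> b \<in> ran (\<Union>\<C>)}" by blast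
        ultimately show "(a, b) \<in> {(a, b). {a, b} \<in> E' \<and> a \<in> ran (\<Union>\<C>) \<and> b \<in> ran (\<Union>\<C>)}\<^sup>*" using rtrancl_mono by blast
      qed
    qed
    moreover have "\<Union>\<C> \<noteq> {}"
    proof -
      obtain K where K: "K \<in> \<C>" using C(1) by blast
      then have "K \<noteq> {}" using C(2) by (auto simp: subset.chain_def \<A>_def)
      then show ?thesis using K by blast
    qed
    ultimately show "\<Union>\<C> \<in> \<A>" by (simp add: \<A>_def)
  qed
  then obtain K where K: "system K" "K \<noteq> {}" and max: "\<And>X. X \<in> \<A> \<Longrightarrow> K \<subseteq> X \<Longrightarrow> X = K" by (auto simp: \<A>_def)
  have ent: "\<And>v v' f \<rho>. (v, v', f, \<rho>) \<in> K \<Longrightarrow> entry v v' f \<rho>" and fit: "\<And>x y. x \<in> K \<Longrightarrow> y \<in> K \<Longrightarrow> fits x y"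
    using K unfolding system_def by blast+
  have domE: "\<exists>v' f \<rho>. (v, v', f, \<rho>) \<in> K" if "v \<in> dom K" for v
    using that unfolding dom_def by (elim imageE) (metis prod.collapse)
  have ranE: "\<exists>v f \<rho>. (v, v', f, \<rho>) \<in> K" if "v' \<in> ran K" for v'
    using that unfolding ran_def by (elim imageE) (metis prod.collapse)
  have sub: "dom K \<subseteq> V" "ran K \<subseteq> V'"
    using domE ranE ent unfolding entry_def by blast+
  have ne: "dom K \<noteq> {}" "ran K \<noteq> {}" using K(2) by (auto simp: dom_def ran_def)
  have dom: "dom K = V"
  proof (rule ccontr)
    assume "dom K \<noteq> V"
    then obtain v w where vw: "v \<in> dom K" "w \<in> V - dom K" "{v, w} \<in> E"
      using simplicial_tree_crossing[OF tree(1) sub(1) ne(1)] by blast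
    obtain v' f \<rho> where v: "(v, v', f, \<rho>) \<in> K" using domE[OF vw(1)] by blast
    obtain K' where "system K'" "K \<subseteq> K'" "K' \<noteq> K" using system_extend[OF K(1) v vw(3)] vw(2) by blast
    then show False using max[of K'] K(2) by (auto simp: \<A>_def)
  qed
  moreover have "ran K = V'"
  proof (rule ccontr)
    assume "ran K \<noteq> V'"
    then obtain v' w' where vw': "v' \<in> ran K" "w' \<in> V' - ran K" "{v', w'} \<in> E'"
      using simplicial_tree_crossing[OF tree(2) sub(2) ne(2)] by blast
    obtain v f \<rho> where v: "(v, v', f, \<rho>) \<in> K" using ranE[OF vw'(1)] by blast
    obtain \<psi> \<sigma> where e: "v \<in> V" "v' \<in> V'"
      "marked_isometry (Z v) (star v) (\<gamma> v) (Z' v') (star' v') (\<gamma>' v') f \<psi> \<sigma>" using ent[OF v] unfolding entry_def by blast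
    have "{v', w'} \<in> star' v'" using vw'(3) by auto
    then obtain a where a: "a \<in> star v" "\<psi> a = {v', w'}"
    proof -
      have "\<psi> ` star v = star' v'" using e(3) unfolding marked_isometry_def bij_betw_def by blast
      then have "{v', w'} \<in> \<psi> ` star v" using \<open>{v', w'} \<in> star' v'\<close> by (simp only:)
      then show thesis using that[OF _ sym] by (elim imageE)
    qed
    then obtain w where w: "a = {v, w}" "w \<in> V" using simplicial_tree_edge[OF tree(1), of a v] by auto
    then obtain x' k \<kappa> where x: "(w, x', k, \<kappa>) \<in> K" using domE[of w] dom by blast
    have ft: "fits (v, v', f, \<rho>) (w, x', k, \<kappa>)" by (rule fit[OF v x])
    have vw: "{v, w} \<in> E" using a(1) w(1) by simp
    then have vx': "{v', x'} \<in> E'" using ft unfolding fits_def by simp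
    have eq: "f (\<gamma> v a t) = \<gamma>' v' {v', x'} (\<kappa> t)" for t using ft vw w(1) unfolding fits_def by simp
    have "\<psi> a = {v', x'}" by (rule edge_image[OF e(2,3) a(1) _ eq]) (use vx' in auto)
    then have "w' = x'" using a(2) by (auto simp: doubleton_eq_iff)
    then show False using vw'(2) x unfolding ran_def by force
  qed
  ultimately show ?thesis using K(1) by blast
qed

theorem clusters_isometric: "isometric (cluster V E Z \<gamma>) (cluster V' E' Z' \<gamma>')"
proof -
  obtain K where K: "system K" "dom K = V" "ran K = V'" using system_exists by blast
  have ent: "\<And>v v' f \<rho>. (v, v', f, \<rho>) \<in> K \<Longrightarrow> entry v v' f \<rho>" and fit: "\<And>x y. x \<in> K \<Longrightarrow> y \<in> K \<Longrightarrow> fits x y"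
    using K unfolding system_def by blast+
  have "\<exists>v' f \<rho>. (v, v', f, \<rho>) \<in> K" if "v \<in> V" for v
  proof -
    have "v \<in> dom K" using that K(2) by simp
    then show ?thesis unfolding dom_def by (elim imageE) (metis prod.collapse)
  qed
  then have "\<exists>\<phi> f \<rho>. \<forall>v\<in>V. (v, \<phi> v, f v, \<rho> v) \<in> K" by metis
  then obtain \<phi> f \<rho> where \<phi>: "\<And>v. v \<in> V \<Longrightarrow> (v, \<phi> v, f v, \<rho> v) \<in> K" by blast
  have fitV: "fits (v, \<phi> v, f v, \<rho> v) (w, \<phi> w, f w, \<rho> w)" if "v \<in> V" "w \<in> V" for v w by (rule fit[OF \<phi>[OF that(1)] \<phi>[OF that(2)]])
  have inj: "v = w" if "v \<in> V" "w \<in> V" "\<phi> v = \<phi> w" for v w using fitV[OF that(1,2)] that(3) unfolding fits_def by simp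
  have surj: "\<exists>v\<in>V. \<phi> v = v'" if v': "v' \<in> V'" for v'
  proof -
    obtain v k \<kappa> where v: "(v, v', k, \<kappa>) \<in> K" using v' K(3) unfolding ran_def by auto
    have "v \<in> V" using ent[OF v] unfolding entry_def by blast
    moreover have "fits (v, v', k, \<kappa>) (v, \<phi> v, f v, \<rho> v)" by (rule fit[OF v \<phi>[OF calculation]])
    ultimately show ?thesis unfolding fits_def by auto
  qed
  have en: "\<phi> v \<in> V'" "line_isometry (\<rho> v)" "isometry (Z v) (Z' (\<phi> v)) (f v)" if "v \<in> V" for v
    using ent[OF \<phi>[OF that]] unfolding entry_def marked_isometry_def by blast+
  have edge: "{\<phi> v, \<phi> w} \<in> E'" "f v (\<gamma> v {v, w} t) = \<gamma>' (\<phi> v) {\<phi> v, \<phi> w} (\<rho> w t)" if "{v, w} \<in> E" "v \<in> V" "w \<in> V" for v w t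
    using fitV[OF that(2,3)] that(1) unfolding fits_def by auto
  have edge': "{v, w} \<in> E" if "{\<phi> v, \<phi> w} \<in> E'" "v \<in> V" "w \<in> V" for v w
    using fitV[OF that(2,3)] that(1) unfolding fits_def by auto
  have ends: "v \<in> V" "w \<in> V" if "{v, w} \<in> E" for v w using tree(1) that unfolding simplicial_tree_def by blast+
  have ends': "v \<in> V'" "w \<in> V'" if "{v, w} \<in> E'" for v w using tree(2) that unfolding simplicial_tree_def by blast+
  have f: "f v a \<in> mspace (Z' (\<phi> v))" "mdist (Z' (\<phi> v)) (f v a) (f v b) = mdist (Z v) a b"
    if "v \<in> V" "a \<in> mspace (Z v)" "b \<in> mspace (Z v)" for v a b
    using en(3)[OF that(1)] that unfolding isometry_def by (blast dest: bij_betw_apply)+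
  have mor: "cluster_morphism V E Z \<gamma> V' E' Z' \<gamma>' \<phi> f \<rho>"
    unfolding cluster_morphism_def
  proof (intro conjI allI ballI impI)
    show "\<bar>\<rho> v s - \<rho> v t\<bar> = \<bar>s - t\<bar>" if "v \<in> V" for v s t using en(2)[OF that] unfolding line_isometry_def by blast
    show "\<phi> v \<in> V'" if "v \<in> V" for v by (rule en(1)[OF that])
    show "f v a \<in> mspace (Z' (\<phi> v))" if "v \<in> V" "a \<in> mspace (Z v)" for v a by (rule f(1)[OF that that(2)])
    show "mdist (Z' (\<phi> v)) (f v a) (f v b) = mdist (Z v) a b" if "v \<in> V" "a \<in> mspace (Z v)" "b \<in> mspace (Z v)" for v a b
      by (rule f(2)[OF that])
    show "{\<phi> v, \<phi> w} \<in> E'" if "{v, w} \<in> E" for v w by (rule edge(1)[OF that ends[OF that]])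
    show "f v (\<gamma> v {v, w} t) = \<gamma>' (\<phi> v) {\<phi> v, \<phi> w} (\<rho> w t)" if "{v, w} \<in> E" for v w t
      by (rule edge(2)[OF that ends[OF that]])
  qed
  define \<phi>' where "\<phi>' v' = (SOME v. v \<in> V \<and> \<phi> v = v')" for v'
  have \<phi>': "\<phi>' v' \<in> V" "\<phi> (\<phi>' v') = v'" if "v' \<in> V'" for v'
  proof -
    have "\<phi>' v' \<in> V \<and> \<phi> (\<phi>' v') = v'" unfolding \<phi>'_def using surj[OF that, unfolded Bex_def] by (rule someI_ex)
    then show "\<phi>' v' \<in> V" "\<phi> (\<phi>' v') = v'" by auto
  qed
  have \<phi>'\<phi>: "\<phi>' (\<phi> v) = v" if "v \<in> V" for v
    using inj[OF \<phi>'(1)[OF en(1)[OF that]] that \<phi>'(2)[OF en(1)[OF that]]] .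
  define f' where "f' v' = inv_into (mspace (Z (\<phi>' v'))) (f (\<phi>' v'))" for v'
  define \<rho>' where "\<rho>' v' = inv_into UNIV (\<rho> (\<phi>' v'))" for v'
  have f': "f' v' a \<in> mspace (Z (\<phi>' v'))" "f (\<phi>' v') (f' v' a) = a" if "v' \<in> V'" "a \<in> mspace (Z' v')" for v' a
  proof -
    have "bij_betw (f (\<phi>' v')) (mspace (Z (\<phi>' v'))) (mspace (Z' v'))"
      using en(3)[OF \<phi>'(1)[OF that(1)]] unfolding \<phi>'(2)[OF that(1)] isometry_def by blast
    then have "a \<in> f (\<phi>' v') ` mspace (Z (\<phi>' v'))" using that(2) by (simp add: bij_betw_def)
    then show "f' v' a \<in> mspace (Z (\<phi>' v'))" "f (\<phi>' v') (f' v' a) = a"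
      unfolding f'_def by (rule inv_into_into, rule f_inv_into_f)
  qed
  have f'f: "f' v' (f (\<phi>' v') a) = a" if "v' \<in> V'" "a \<in> mspace (Z (\<phi>' v'))" for v' a
  proof -
    have "bij_betw (f (\<phi>' v')) (mspace (Z (\<phi>' v'))) (mspace (Z' v'))"
      using en(3)[OF \<phi>'(1)[OF that(1)]] unfolding \<phi>'(2)[OF that(1)] isometry_def by blast
    then show ?thesis unfolding f'_def using that(2) by (intro inv_into_f_f) (auto simp: bij_betw_def)
  qed
  have r: "\<rho> (\<phi>' v') (\<rho>' v' t) = t" "\<rho>' v' (\<rho> (\<phi>' v') t) = t" if "v' \<in> V'" for v' t
    using line_isometry_bij[OF en(2)[OF \<phi>'(1)[OF that]]]
    by (simp_all add: \<rho>'_def surj_f_inv_f bij_is_surj inv_f_f bij_is_inj)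
  have mor': "cluster_morphism V' E' Z' \<gamma>' V E Z \<gamma> \<phi>' f' \<rho>'"
    unfolding cluster_morphism_def
  proof (intro conjI allI ballI impI)
    fix v' assume v': "v' \<in> V'"
    show "\<phi>' v' \<in> V" by (rule \<phi>'(1)[OF v'])
    show "\<bar>\<rho>' v' s - \<rho>' v' t\<bar> = \<bar>s - t\<bar>" for s t
      using line_isometry_inv[OF en(2)[OF \<phi>'(1)[OF v']]] unfolding line_isometry_def \<rho>'_def by blast
    fix a assume a: "a \<in> mspace (Z' v')"
    show "f' v' a \<in> mspace (Z (\<phi>' v'))" by (rule f'(1)[OF v' a])
    fix b assume b: "b \<in> mspace (Z' v')"
    show "mdist (Z (\<phi>' v')) (f' v' a) (f' v' b) = mdist (Z' v') a b"
      using f(2)[OF \<phi>'(1)[OF v'] f'(1)[OF v' a] f'(1)[OF v' b]] unfolding \<phi>'(2)[OF v'] f'(2)[OF v' a] f'(2)[OF v' b] by simp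
  next
    fix v' w' assume e: "{v', w'} \<in> E'"
    note v' = ends'(1)[OF e] and w' = ends'(2)[OF e]
    show E: "{\<phi>' v', \<phi>' w'} \<in> E" by (rule edge') (use e \<phi>' v' w' in simp_all)
    fix t
    have "f (\<phi>' v') (\<gamma> (\<phi>' v') {\<phi>' v', \<phi>' w'} (\<rho>' w' t)) = \<gamma>' v' {v', w'} t"
      using edge(2)[OF E \<phi>'(1)[OF v'] \<phi>'(1)[OF w'], of "\<rho>' w' t"] \<phi>'(2)[OF v'] \<phi>'(2)[OF w'] r(1)[OF w'] by simp
    then have "f' v' (\<gamma>' v' {v', w'} t) = f' v' (f (\<phi>' v') (\<gamma> (\<phi>' v') {\<phi>' v', \<phi>' w'} (\<rho>' w' t)))" by simp
    also have "\<dots> = \<gamma> (\<phi>' v') {\<phi>' v', \<phi>' w'} (\<rho>' w' t)"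
      by (rule f'f[OF v' marked_geodesic(1)[OF vertex_marked[OF \<phi>'(1)[OF v']]]]) (use E in auto)
    finally show "f' v' (\<gamma>' v' {v', w'} t) = \<gamma> (\<phi>' v') {\<phi>' v', \<phi>' w'} (\<rho>' w' t)" .
  qed
  show ?thesis
  proof (rule cluster_isometric[OF cluster cluster' mor mor'])
    fix c assume c: "c \<in> cluster_points V Z"
    obtain v z u where vzu: "c = (v, z, u)" by (cases c) auto
    have v: "v \<in> V" "z \<in> mspace (Z v)" using c vzu by (auto simp: cluster_points_def vertex_space_def)
    note v' = en(1)[OF v(1)]
    have "f' (\<phi> v) (f v z) = z" using f'f[OF v', of z] v(2) unfolding \<phi>'\<phi>[OF v(1)] by blast
    moreover have "\<rho>' (\<phi> v) (\<rho> v u) = u" using r(2)[OF v', of u] unfolding \<phi>'\<phi>[OF v(1)] .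
    ultimately show "cluster_map \<phi>' f' \<rho>' (cluster_map \<phi> f \<rho> c) = c" using \<phi>'\<phi>[OF v(1)] by (simp add: vzu cluster_map_def)
  next
    fix c assume c: "c \<in> cluster_points V' Z'"
    obtain v z u where vzu: "c = (v, z, u)" by (cases c) auto
    have v: "v \<in> V'" "z \<in> mspace (Z' v)" using c vzu by (auto simp: cluster_points_def vertex_space_def)
    show "cluster_map \<phi> f \<rho> (cluster_map \<phi>' f' \<rho>' c) = c"
      using \<phi>'(2)[OF v(1)] f'(2)[OF v] r(1)[OF v(1)] by (simp add: vzu cluster_map_def)
  qed
qed

end

theorem proposition3p11:
  fixes V :: "'v set" and E :: "'v set set" and Z :: "'v \<Rightarrow> 'z metric"
    and \<gamma> :: "'v \<Rightarrow> 'v set \<Rightarrow> real \<Rightarrow> 'z"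
    and V' :: "'w set" and E' :: "'w set set" and Z' :: "'w \<Rightarrow> 'y metric"
    and \<gamma>' :: "'w \<Rightarrow> 'w set \<Rightarrow> real \<Rightarrow> 'y"
  assumes "cluster_data V E Z \<gamma>" and "cluster_data V' E' Z' \<gamma>'"
    and "\<forall>v\<in>V. marked_tree (Z v) {e \<in> E. v \<in> e} (\<gamma> v)"
    and "\<forall>v\<in>V'. marked_tree (Z' v) {e \<in> E'. v \<in> e} (\<gamma>' v)"
  shows "isometric (cluster V E Z \<gamma>) (cluster V' E' Z' \<gamma>')"
proof -
  interpret marked_clusters V E Z \<gamma> V' E' Z' \<gamma>' by unfold_locales (use assms in blast)+
  show ?thesis by (rule clusters_isometric)
qed

end
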